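(* Let $\Omega\subset\mathbb{R}^3$ be a bounded open set with smooth boundary and let $D\subset\Omega$ be an open set with smooth boundary. Suppose $H=H(\kappa)$ satisfies $\ln\kappa\ll\kappa H\ll\kappa^2$ as $\kappa\to\infty$. If, for each $\kappa$, $(\psi,\mathbf A)\in H^1(\Omega;\mathbb{C})\times\dot H^1_{\mathrm{div},\mathbf F}(\mathbb{R}^3)$ is a minimizer of $\mathcal E^{3D}_{\kappa,H}$, then $$\int_D\Big(|(\nabla-i\kappa H\mathbf A)\psi|^2+\frac{\kappa^2}{2}(1-|\psi|^2)^2\Big)dx\ \ge\ |D|\,\kappa H\ln\sqrt{\frac{\kappa}{H}}+o\bigg(\kappa H\ln\sqrt{\frac{\kappa}{H}}\bigg)\quad\text{as }\kappa\to\infty.$$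
   Context: Notation: $a(\kappa)\ll b(\kappa)$ means $a(\kappa)/b(\kappa)\to0$ as $\kappa\to\infty$; $|D|$ is the Lebesgue measure of $D$. Let $\beta=(0,0,1)$, $\mathbf F(x)=(-x_2/2,x_1/2,0)$. Let $\dot H^1(\mathbb{R}^3)$ be the closure of $C_c^\infty(\mathbb{R}^3)$ under $u\mapsto\|\nabla u\|_{L^2(\mathbb{R}^3)}$ and $\dot H^1_{\mathrm{div},\mathbf F}(\mathbb{R}^3)=\{\mathbf A:\ \operatorname{div}\mathbf A=0,\ \mathbf A-\mathbf F\in\dot H^1(\mathbb{R}^3)\}$. For $\kappa,H>0$, $$\mathcal E^{3D}_{\kappa,H}(\psi,\mathbf A)=\int_\Omega\Big(|(\nabla-i\kappa H\mathbf A)\psi|^2+\frac{\kappa^2}{2}(1-|\psi|^2)^2\Big)dx+\kappa^2H^2\int_{\mathbb{R}^3}|\operatorname{curl}\mathbf A-\beta|^2dx;$$ a minimizer is a pair attaining the infimum of this functional over $H^1(\Omega;\mathbb{C})\times\dot H^1_{\mathrm{div},\mathbf F}(\mathbb{R}^3)$. *)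

theory Defs
  imports "HOL-Analysis.Analysis"
begin

type_synonym R3 = "real ^ 3"

definition pd :: "3 \<Rightarrow> (R3 \<Rightarrow> real) \<Rightarrow> R3 \<Rightarrow> real" where
  "pd j f x = frechet_derivative f (at x) (axis j 1)"

fun iter_pd :: "3 list \<Rightarrow> (R3 \<Rightarrow> real) \<Rightarrow> R3 \<Rightarrow> real" where
  "iter_pd [] f = f"
| "iter_pd (j # js) f = pd j (iter_pd js f)"

definition smooth_on :: "R3 set \<Rightarrow> (R3 \<Rightarrow> real) \<Rightarrow> bool" where
  "smooth_on S f \<longleftrightarrow> (\<forall>js. \<forall>x\<in>S. iter_pd js f differentiable (at x))"

definition tsupp :: "(R3 \<Rightarrow> real) \<Rightarrow> R3 set" where
  "tsupp f = closure {x. f x \<noteq> 0}"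

definition test_fun :: "R3 set \<Rightarrow> (R3 \<Rightarrow> real) \<Rightarrow> bool" where
  "test_fun U \<phi> \<longleftrightarrow> smooth_on UNIV \<phi> \<and> compact (tsupp \<phi>) \<and> tsupp \<phi> \<subseteq> U"

definition smooth_bdry_open :: "R3 set \<Rightarrow> bool" where
  "smooth_bdry_open U \<longleftrightarrow> open U \<and>
     (\<forall>x\<in>frontier U. \<exists>V \<rho>. open V \<and> x \<in> V \<and> smooth_on UNIV \<rho> \<and>
        (\<forall>y\<in>V. (\<exists>j. pd j \<rho> y \<noteq> 0)) \<and> U \<inter> V = {y\<in>V. \<rho> y < 0})"

definition loc_int :: "R3 set \<Rightarrow> (R3 \<Rightarrow> 'b::{banach,second_countable_topology}) \<Rightarrow> bool" where
  "loc_int U u \<longleftrightarrow> (\<forall>K. compact K \<and> K \<subseteq> U \<longrightarrow> set_integrable lebesgue K u)"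

definition weak_pd :: "R3 set \<Rightarrow> 3 \<Rightarrow> (R3 \<Rightarrow> 'b::{real_normed_field,banach,second_countable_topology})
                       \<Rightarrow> (R3 \<Rightarrow> 'b) \<Rightarrow> bool" where
  "weak_pd U j u g \<longleftrightarrow> loc_int U u \<and> loc_int U g \<and>
     (\<forall>\<phi>. test_fun U \<phi> \<longrightarrow>
        (\<integral>x. indicator U x *\<^sub>R (of_real (pd j \<phi> x) * u x) \<partial>lebesgue)
          = - (\<integral>x. indicator U x *\<^sub>R (of_real (\<phi> x) * g x) \<partial>lebesgue))"

definition wpd :: "R3 set \<Rightarrow> 3 \<Rightarrow> (R3 \<Rightarrow> 'b::{real_normed_field,banach,second_countable_topology})
                   \<Rightarrow> R3 \<Rightarrow> 'b" where
  "wpd U j u = (SOME g. weak_pd U j u g)"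

definition L2_on :: "R3 set \<Rightarrow> (R3 \<Rightarrow> 'b::{real_normed_vector,second_countable_topology}) \<Rightarrow> bool" where
  "L2_on U u \<longleftrightarrow> u \<in> borel_measurable (lebesgue_on U) \<and>
     (\<integral>\<^sup>+x\<in>U. ennreal ((norm (u x))\<^sup>2) \<partial>lebesgue) < \<infinity>"

definition H1 :: "R3 set \<Rightarrow> (R3 \<Rightarrow> complex) \<Rightarrow> bool" where
  "H1 U u \<longleftrightarrow> L2_on U u \<and> (\<forall>j. \<exists>g. weak_pd U j u g \<and> L2_on U g)"

text \<open>Homogeneous space \<open>\<dot>H\<^sup>1(R^3)\<close>: closure of C_c^infinity under the norm
  \<open>\<parallel>\<nabla>u\<parallel>_L2\<close>, realised as functions with L2 weak gradient which are limits of test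
  functions both in the gradient seminorm and in L2 on every ball (the latter fixes the
  representative of the limit).\<close>
definition Hdot1 :: "(R3 \<Rightarrow> real) \<Rightarrow> bool" where
  "Hdot1 w \<longleftrightarrow> (\<forall>j. \<exists>g. weak_pd UNIV j w g \<and> L2_on UNIV g) \<and>
     (\<exists>\<phi>::nat \<Rightarrow> R3 \<Rightarrow> real. (\<forall>n. test_fun UNIV (\<phi> n)) \<and>
        ((\<lambda>n. \<integral>\<^sup>+x. ennreal (\<Sum>j\<in>UNIV. (pd j (\<phi> n) x - wpd UNIV j w x)\<^sup>2) \<partial>lebesgue)
            \<longlonglongrightarrow> 0) \<and>
        (\<forall>r. ((\<lambda>n. \<integral>\<^sup>+x\<in>ball 0 r. ennreal ((\<phi> n x - w x)\<^sup>2) \<partial>lebesgue) \<longlonglongrightarrow> 0)))"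

definition Fpot :: "R3 \<Rightarrow> R3" where
  "Fpot x = vector [- (x $ 2) / 2, x $ 1 / 2, 0]"

definition beta :: R3 where
  "beta = vector [0, 0, 1]"

definition comp :: "(R3 \<Rightarrow> R3) \<Rightarrow> 3 \<Rightarrow> R3 \<Rightarrow> real" where
  "comp A j x = A x $ j"

definition weak_curl :: "(R3 \<Rightarrow> R3) \<Rightarrow> R3 \<Rightarrow> R3" where
  "weak_curl A x = vector
     [wpd UNIV 2 (comp A 3) x - wpd UNIV 3 (comp A 2) x,
      wpd UNIV 3 (comp A 1) x - wpd UNIV 1 (comp A 3) x,
      wpd UNIV 1 (comp A 2) x - wpd UNIV 2 (comp A 1) x]"

definition Hdiv_F :: "(R3 \<Rightarrow> R3) \<Rightarrow> bool" where
  "Hdiv_F A \<longleftrightarrow> (\<forall>j. Hdot1 (\<lambda>x. A x $ j - Fpot x $ j)) \<and>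
     (\<forall>j. \<exists>g. weak_pd UNIV j (comp A j) g) \<and>
     (AE x in lebesgue. (\<Sum>j\<in>UNIV. wpd UNIV j (comp A j) x) = 0)"

definition GL_density :: "R3 set \<Rightarrow> real \<Rightarrow> real \<Rightarrow> (R3 \<Rightarrow> complex) \<Rightarrow> (R3 \<Rightarrow> R3) \<Rightarrow> R3 \<Rightarrow> real" where
  "GL_density \<Omega> \<kappa> H \<psi> A x =
     (\<Sum>j\<in>UNIV. (cmod (wpd \<Omega> j \<psi> x - \<i> * complex_of_real (\<kappa> * H * (A x $ j)) * \<psi> x))\<^sup>2)
     + \<kappa>\<^sup>2 / 2 * (1 - (cmod (\<psi> x))\<^sup>2)\<^sup>2"

definition GL_energy :: "R3 set \<Rightarrow> real \<Rightarrow> real \<Rightarrow> (R3 \<Rightarrow> complex) \<Rightarrow> (R3 \<Rightarrow> R3) \<Rightarrow> ennreal" where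
  "GL_energy \<Omega> \<kappa> H \<psi> A =
     (\<integral>\<^sup>+x\<in>\<Omega>. ennreal (GL_density \<Omega> \<kappa> H \<psi> A x) \<partial>lebesgue)
     + ennreal (\<kappa>\<^sup>2 * H\<^sup>2) * (\<integral>\<^sup>+x. ennreal ((norm (weak_curl A x - beta))\<^sup>2) \<partial>lebesgue)"

definition GL_minimizer :: "R3 set \<Rightarrow> real \<Rightarrow> real \<Rightarrow> (R3 \<Rightarrow> complex) \<Rightarrow> (R3 \<Rightarrow> R3) \<Rightarrow> bool" where
  "GL_minimizer \<Omega> \<kappa> H \<psi> A \<longleftrightarrow> H1 \<Omega> \<psi> \<and> Hdiv_F A \<and>
     (\<forall>\<phi> B. H1 \<Omega> \<phi> \<and> Hdiv_F B \<longrightarrow> GL_energy \<Omega> \<kappa> H \<psi> A \<le> GL_energy \<Omega> \<kappa> H \<phi> B)"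

end

theory Submission
  imports Defs "HOL-Real_Asymp.Real_Asymp"
begin

text \<open>Write \<open>B = \<kappa> H\<close>, \<open>b = H / \<kappa>\<close> and \<open>L = ln (1 / sqrt b)\<close>. A periodic array of vortices
  parallel to the field, with the potential \<open>F\<close> itself, has energy \<open>O(B L)\<close>. Hence a minimizer
  satisfies \<open>\<integral> \<bar>curl A - \<beta>\<bar>\<^sup>2 = O(L / B) = o(1)\<close>.

  For the lower bound only the derivatives in the two directions orthogonal to the field are used.
  Restricting \<open>\<psi>\<close> and the line integrals of \<open>A\<close> to a horizontal square grid of spacing
  \<open>1 / \<kappa>\<close> with \<open>N\<^sup>2\<close> points gives a lattice gauge energy. By Cauchy--Schwarz along the edges, its
  average over all translates of the grid is at most the continuum energy, and since
  \<open>curl A - \<beta>\<close> is small in the mean square, for most translates the flux through the plaquettes is close to \<open>b\<close>.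
  Weak derivatives enter only through the fundamental theorem of calculus on almost every segment.

  On the lattice the ball construction works without any regularity theory. Sites next to a
  bad edge are covered by discs, which are grown and merged; the energy in an annulus controls the
  enclosed degree by duality with a logarithmic cutoff. The degree of almost the whole square equals
  its flux \<open>b N\<^sup>2 / 2 \<pi>\<close> up to a boundary circulation, which is small because the square carries
  many flux quanta, so the energy is at least \<open>(1 - o(1)) N\<^sup>2 b L\<close>.\<close>

section \<open>Growing and merging discs\<close>

text \<open>The difficulty is scale separation: covering the bad sites costs a logarithm of their
  number, which must stay small against \<open>L\<close>. In lattice units the square has side about
  \<open>sqrt (1000 L / \<eta>^3) / sqrt b\<close>. Its flux is then at least
  \<open>1000 L / \<eta>^3\<close>, so the circulation along a well chosen contour, at most the
  square root of \<open>1000 L / \<eta>\<close> times the flux, is an \<open>\<eta>\<close> fraction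
  of it. The flux is also at most \<open>4 L^2\<close>; so unless the energy already exceeds the
  target it is at most \<open>4 L^3\<close>, and since every bad edge costs a fixed amount, the
  number of bad sites is polynomial in \<open>L\<close>. Discs can grow until the flux through one
  of them becomes noticeable, at a radius of order \<open>\<eta> * exp L / L\<close>, while the
  starting radii are polynomial in \<open>L\<close>. The condition
  \<open>ln \<kappa> << \<kappa> H\<close> enters twice: for the field energy, and to make the
  physical side \<open>N / \<kappa>\<close> of the square shrink, so that its translates fit into
  \<open>D\<close>. The parameter \<open>\<eta>\<close> is fixed throughout and sent to 0 at the
  very end.\<close>

type_synonym cdisc = "complex \<times> real"

abbreviation cb :: "cdisc \<Rightarrow> complex set" where
  "cb p \<equiv> cball (fst p) (snd p)"

definition disc_family :: "real \<Rightarrow> cdisc set \<Rightarrow> bool" where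
  "disc_family T F \<longleftrightarrow> finite F \<and> (\<forall>p\<in>F. T \<le> snd p) \<and>
     (\<forall>p\<in>F. \<forall>q\<in>F. p \<noteq> q \<longrightarrow> snd p + snd q < dist (fst p) (fst q))"

text \<open>The centre divides the segment from \<open>a\<close> to \<open>b\<close> in the ratio
  \<open>s : r\<close>, so it lies within \<open>s\<close> of \<open>a\<close> and within
  \<open>r\<close> of \<open>b\<close>. The radius of the merged disc is the sum of the radii, hence
  merging never increases the total radius, the quantity that growth controls.\<close>

lemma merge_two_discs:
  fixes a b :: complex
  assumes "r > 0" "s > 0" "dist a b \<le> r + s"
  shows "\<exists>c. cball a r \<subseteq> cball c (r + s) \<and> cball b s \<subseteq> cball c (r + s)"
proof -
  define c where "c = a + (s / (r + s)) *\<^sub>R (b - a)"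
  have "dist c a = s / (r + s) * dist a b"
    using assms by (simp add: c_def dist_norm norm_minus_commute)
  also have "\<dots> \<le> s / (r + s) * (r + s)"
    using assms by (intro mult_left_mono) auto
  finally have 1: "dist c a \<le> s" using assms by simp
  have "c - b = (r / (r + s)) *\<^sub>R (a - b)"
  proof -
    have eq: "r / (r + s) = 1 - s / (r + s)" using assms by (simp add: field_simps)
    show ?thesis unfolding c_def eq by (simp add: scaleR_left_diff_distrib scaleR_right_diff_distrib)
  qed
  then have "dist c b = r / (r + s) * dist a b"
    using assms by (simp add: dist_norm)
  also have "\<dots> \<le> r / (r + s) * (r + s)"
    using assms by (intro mult_left_mono) auto
  finally have 2: "dist c b \<le> r" using assms by simp
  have "cball a r \<subseteq> cball c (r + s)"
  proof
    fix x assume "x \<in> cball a r"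
    then show "x \<in> cball c (r + s)" using 1 dist_triangle[of c x a] by auto
  qed
  moreover have "cball b s \<subseteq> cball c (r + s)"
  proof
    fix x assume "x \<in> cball b s"
    then show "x \<in> cball c (r + s)" using 2 dist_triangle[of c x b] by auto
  qed
  ultimately show ?thesis by blast
qed

text \<open>Touching discs are merged in pairs until none touch. The last alternative records that
  the cardinality drops strictly unless nothing was merged, which bounds the number of stages in
  \<open>growth\<close> and hence the total loss there.\<close>

lemma merge_discs:
  assumes "finite F" "\<forall>p\<in>F. T \<le> snd p" "T > 0"
  shows "\<exists>F'. disc_family T F' \<and> (\<Sum>p\<in>F'. snd p) \<le> (\<Sum>p\<in>F. snd p) \<and> card F' \<le> card F \<and>
           (\<forall>p\<in>F. \<exists>p'\<in>F'. cb p \<subseteq> cb p') \<and> (disc_family T F \<or> card F' < card F)"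
  using assms
proof (induction "card F" arbitrary: F rule: less_induct)
  case less
  show ?case
  proof (cases "disc_family T F")
    case True
    then show ?thesis by (intro exI[of _ F]) auto
  next
    case False
    then obtain p q where pq: "p \<in> F" "q \<in> F" "p \<noteq> q" "dist (fst p) (fst q) \<le> snd p + snd q"
      using less.prems by (auto simp: disc_family_def not_less)
    have pos: "snd p > 0" "snd q > 0" using pq less.prems by force+
    obtain c where c: "cb p \<subseteq> cball c (snd p + snd q)" "cb q \<subseteq> cball c (snd p + snd q)"
      using merge_two_discs[OF pos pq(4)] by auto
    have Tpq: "T \<le> snd p + snd q" using pq(1) less.prems(2) pos by force
    define m where "m = (c, snd p + snd q)"
    define G where "G = F - {p, q}"
    have finG: "finite G" using less.prems by (simp add: G_def)
    have F: "F = insert p (insert q G)" using pq by (auto simp: G_def)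
    have pG: "p \<notin> insert q G" "q \<notin> G" using pq by (auto simp: G_def)
    have cardF: "card F = card G + 2" using F pG finG by simp
    have c1: "card (insert m G) < card F" using cardF finG by (simp add: card_insert_if)
    have sF: "(\<Sum>p\<in>F. snd p) = snd p + snd q + (\<Sum>p\<in>G. snd p)"
      unfolding F using pG finG by simp
    \<comment> \<open>The merged disc may already belong to \<open>G\<close>; inserting it then
      changes nothing and the sum only drops.\<close>
    have sG: "(\<Sum>p\<in>insert m G. snd p) \<le> (\<Sum>p\<in>F. snd p)"
      unfolding sF using finG pos by (cases "m \<in> G") (auto simp: insert_absorb m_def)
    obtain F' where F': "disc_family T F'" "(\<Sum>p\<in>F'. snd p) \<le> (\<Sum>p\<in>insert m G. snd p)"
      "card F' \<le> card (insert m G)" "\<forall>p\<in>insert m G. \<exists>p'\<in>F'. cb p \<subseteq> cb p'"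
      using less.hyps[OF c1] finG less.prems Tpq by (auto simp: m_def G_def)
    have cov: "\<forall>x\<in>F. \<exists>p'\<in>F'. cb x \<subseteq> cb p'"
    proof
      fix x assume "x \<in> F"
      obtain m' where m': "m' \<in> F'" "cb m \<subseteq> cb m'" using F' by blast
      have "cb p \<subseteq> cb m'" "cb q \<subseteq> cb m'" using c m' by (auto simp: m_def)
      then show "\<exists>p'\<in>F'. cb x \<subseteq> cb p'" using F' \<open>x \<in> F\<close> m' by (auto simp: F)
    qed
    have l: "card F' < card F" using F'(3) c1 by linarith
    show ?thesis
      by (rule exI[of _ F']) (use F' sG cov l in auto)
  qed
qed

text \<open>In the application \<open>X\<close> consists of the sites next to a bad edge, \<open>\<mu>\<close> is the lattice Dirichlet
  energy and \<open>q S\<close> is the modulus of the degree of \<open>S\<close>.\<close>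

locale disc_growth =
  fixes \<mu> q :: "complex set \<Rightarrow> real" and X :: "complex set" and T c \<theta> :: real
  assumes \<mu>_nonneg: "0 \<le> \<mu> S"
    and \<mu>_add: "A \<inter> B = {} \<Longrightarrow> \<mu> (A \<union> B) = \<mu> A + \<mu> B"
    and q_nonneg: "0 \<le> q S"
    and q_sub: "\<lbrakk>finite G; \<And>p p'. \<lbrakk>p \<in> G; p' \<in> G; p \<noteq> p'\<rbrakk> \<Longrightarrow> X \<inter> cb p \<inter> cb p' = {};
          \<And>p. p \<in> G \<Longrightarrow> cb p \<subseteq> C; X \<inter> C \<subseteq> (\<Union>p\<in>G. cb p)\<rbrakk> \<Longrightarrow> q C \<le> (\<Sum>p\<in>G. q (cb p))"
    and annulus: "\<lbrakk>T \<le> s; s < t; X \<inter> cball a t \<subseteq> cball a s\<rbrakk> \<Longrightarrow>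
          c * q (cball a t) * (ln (t / s) - \<theta>) \<le> \<mu> (ball a t - cball a s)"
    and T_pos: "T > 0" and c_nonneg: "c \<ge> 0" and \<theta>_nonneg: "\<theta> \<ge> 0"
begin

lemma \<mu>_empty: "\<mu> {} = 0"
  using \<mu>_add[of "{}" "{}"] by simp

lemma \<mu>_mono: "A \<subseteq> B \<Longrightarrow> \<mu> A \<le> \<mu> B"
  using \<mu>_add[of A "B - A"] \<mu>_nonneg[of "B - A"] by (simp add: Un_absorb1 Diff_partition)

lemma \<mu>_UN: "\<lbrakk>finite I; \<And>i j. \<lbrakk>i \<in> I; j \<in> I; i \<noteq> j\<rbrakk> \<Longrightarrow> S i \<inter> S j = {}\<rbrakk> \<Longrightarrow> (\<Sum>i\<in>I. \<mu> (S i)) = \<mu> (\<Union>i\<in>I. S i)"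
proof (induction I rule: finite_induct)
  case (insert x I)
  have "S x \<inter> (\<Union>i\<in>I. S i) = {}" using insert by fastforce
  then show ?case using insert by (simp add: \<mu>_add)
qed (simp add: \<mu>_empty)

definition scaled :: "real \<Rightarrow> cdisc \<Rightarrow> cdisc" where
  "scaled l p = (fst p, l * snd p)"

text \<open>Dilation stops at first contact (\<open>sep\<close> permits equality), so the open
  annuli \<open>N p\<close> are pairwise disjoint and their energies add up. The closed dilated
  discs may touch, but \<open>X\<close> inside a dilated disc lies in the original disc, which no
  other dilated disc meets; this is why the overlap condition in \<open>q_sub\<close> only concerns
  \<open>X\<close>.\<close>

lemma grow_once:
  assumes F: "disc_family T F" and X: "X \<subseteq> (\<Union>p\<in>F. cb p)" and l: "1 < l"
    and sep: "\<And>p q. \<lbrakk>p \<in> F; q \<in> F; p \<noteq> q\<rbrakk> \<Longrightarrow> l * (snd p + snd q) \<le> dist (fst p) (fst q)"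
  shows "c * (ln l - \<theta>) * (\<Sum>p\<in>F. q (cb (scaled l p)))
           \<le> \<mu> ((\<Union>p\<in>F. cb (scaled l p)) - (\<Union>p\<in>F. cb p))"
    and "\<And>p p'. \<lbrakk>p \<in> F; p' \<in> F; p \<noteq> p'\<rbrakk> \<Longrightarrow> X \<inter> cb (scaled l p) \<inter> cb (scaled l p') = {}"
proof -
  have pos: "snd p > 0" "T \<le> snd p" if "p \<in> F" for p
    using that F T_pos by (force simp: disc_family_def)+
  have disj: "cb (scaled l p) \<inter> cb p' = {}" if "p \<in> F" "p' \<in> F" "p \<noteq> p'" for p p'
  proof (rule ccontr)
    assume "cb (scaled l p) \<inter> cb p' \<noteq> {}"
    then obtain x where x: "dist (fst p) x \<le> l * snd p" "dist (fst p') x \<le> snd p'"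
      by (auto simp: scaled_def)
    have "dist (fst p) (fst p') \<le> l * snd p + snd p'"
      using x dist_triangle[of "fst p" "fst p'" x] by (simp add: dist_commute)
    also have "\<dots> < l * (snd p + snd p')" using l pos[OF that(2)] by (simp add: algebra_simps)
    finally show False using sep[OF that] by simp
  qed
  have Xp: "X \<inter> cb (scaled l p) \<subseteq> cb p" if "p \<in> F" for p
    using X disj[OF that] by blast
  show "X \<inter> cb (scaled l p) \<inter> cb (scaled l p') = {}" if "p \<in> F" "p' \<in> F" "p \<noteq> p'" for p p'
    using Xp[OF that(2)] disj[OF that] by blast
  define N where "N p = ball (fst p) (l * snd p) - cb p" for p :: cdisc
  have N: "N p \<inter> N p' = {}" if "p \<in> F" "p' \<in> F" "p \<noteq> p'" for p p'
  proof (rule ccontr)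
    assume "N p \<inter> N p' \<noteq> {}"
    then obtain x where x: "dist (fst p) x < l * snd p" "dist (fst p') x < l * snd p'"
      by (auto simp: N_def)
    have "dist (fst p) (fst p') < l * snd p + l * snd p'"
      using x dist_triangle[of "fst p" "fst p'" x] by (simp add: dist_commute)
    then show False using sep[OF that] by (simp add: algebra_simps)
  qed
  have "c * (ln l - \<theta>) * (\<Sum>p\<in>F. q (cb (scaled l p))) = (\<Sum>p\<in>F. c * q (cb (scaled l p)) * (ln l - \<theta>))"
    by (simp add: sum_distrib_left mult_ac)
  also have "\<dots> \<le> (\<Sum>p\<in>F. \<mu> (N p))"
  proof (rule sum_mono)
    fix p assume p: "p \<in> F"
    show "c * q (cb (scaled l p)) * (ln l - \<theta>) \<le> \<mu> (N p)"
      using annulus[of "snd p" "l * snd p" "fst p"] Xp[OF p] pos[OF p] l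
      by (simp add: scaled_def N_def)
  qed
  also have "\<dots> = \<mu> (\<Union>p\<in>F. N p)"
    using F N by (intro \<mu>_UN) (auto simp: disc_family_def)
  also have "\<dots> \<le> \<mu> ((\<Union>p\<in>F. cb (scaled l p)) - (\<Union>p\<in>F. cb p))"
  proof (rule \<mu>_mono, rule subsetI)
    fix x assume "x \<in> (\<Union>p\<in>F. N p)"
    then obtain p where p: "p \<in> F" "x \<in> N p" by blast
    have "x \<in> cb (scaled l p)" "x \<notin> cb p" using p by (auto simp: N_def scaled_def)
    moreover have "x \<notin> cb p'" if "p' \<in> F" "p' \<noteq> p" for p'
      using disj[OF p(1) that(1)] that \<open>x \<in> cb (scaled l p)\<close> by blast
    ultimately show "x \<in> (\<Union>p\<in>F. cb (scaled l p)) - (\<Union>p\<in>F. cb p)" using p by blast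
  qed
  finally show "c * (ln l - \<theta>) * (\<Sum>p\<in>F. q (cb (scaled l p)))
           \<le> \<mu> ((\<Union>p\<in>F. cb (scaled l p)) - (\<Union>p\<in>F. cb p))" .
qed

text \<open>Each disc of \<open>G\<close> is assigned to a disc of \<open>F\<close> that contains
  it. Disjointness of \<open>F\<close> ensures that the discs assigned to \<open>C\<close> catch all
  of \<open>X\<close> inside \<open>C\<close>, so \<open>q_sub\<close> applies fibre by fibre. The
  total degree can therefore only decrease when discs are merged.\<close>

lemma sum_q_le:
  assumes G: "finite G" "\<And>p p'. \<lbrakk>p \<in> G; p' \<in> G; p \<noteq> p'\<rbrakk> \<Longrightarrow> X \<inter> cb p \<inter> cb p' = {}"
    and X: "X \<subseteq> (\<Union>p\<in>G. cb p)" and F: "disc_family T F"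
    and cov: "\<And>p. p \<in> G \<Longrightarrow> \<exists>p'\<in>F. cb p \<subseteq> cb p'"
    and ne: "\<And>p. p \<in> G \<Longrightarrow> cb p \<noteq> {}"
  shows "(\<Sum>p\<in>F. q (cb p)) \<le> (\<Sum>p\<in>G. q (cb p))"
proof -
  obtain h where h: "\<And>p. p \<in> G \<Longrightarrow> h p \<in> F" "\<And>p. p \<in> G \<Longrightarrow> cb p \<subseteq> cb (h p)"
    using cov by metis
  have disjF: "cb p \<inter> cb p' = {}" if "p \<in> F" "p' \<in> F" "p \<noteq> p'" for p p'
  proof (rule ccontr)
    assume "cb p \<inter> cb p' \<noteq> {}"
    then obtain x where x: "dist (fst p) x \<le> snd p" "dist (fst p') x \<le> snd p'" by auto
    have "dist (fst p) (fst p') \<le> snd p + snd p'"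
      using x dist_triangle[of "fst p" "fst p'" x] by (simp add: dist_commute)
    moreover have "snd p + snd p' < dist (fst p) (fst p')" using F that unfolding disc_family_def by blast
    ultimately show False by simp
  qed
  have "(\<Sum>C\<in>F. q (cb C)) \<le> (\<Sum>C\<in>F. \<Sum>p\<in>{p\<in>G. h p = C}. q (cb p))"
  proof (rule sum_mono)
    fix C assume C: "C \<in> F"
    show "q (cb C) \<le> (\<Sum>p\<in>{p\<in>G. h p = C}. q (cb p))"
    proof (rule q_sub)
      show "X \<inter> cb C \<subseteq> (\<Union>p\<in>{p\<in>G. h p = C}. cb p)"
      proof
        fix x assume x: "x \<in> X \<inter> cb C"
        then obtain p where p: "p \<in> G" "x \<in> cb p" using X by blast
        then have "x \<in> cb (h p) \<inter> cb C" using h x by blast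
        then have "h p = C" using disjF[OF h(1)[OF p(1)] C] by blast
        then show "x \<in> (\<Union>p\<in>{p\<in>G. h p = C}. cb p)" using p by blast
      qed
      show "cb p \<subseteq> cb C" if "p \<in> {p\<in>G. h p = C}" for p using that h(2) by blast
    qed (use G in auto)
  qed
  also have "\<dots> = (\<Sum>p\<in>G. q (cb p))"
    using F G h by (intro sum.group) (auto simp: disc_family_def)
  finally show ?thesis .
qed

text \<open>All discs are dilated by a common factor until two of them touch or the budget
  \<open>R\<close> is reached; touching discs are merged and the process restarts. The final degree
  sum is at most that of every stage, so the logarithms of the stages add up to
  \<open>ln (R / \<rho>)\<close>. Every stage before the last one reduces the number of discs, so
  there are at most \<open>card F\<close> stages, each losing \<open>\<theta>\<close>.\<close>

theorem growth:
  assumes "disc_family T F" "X \<subseteq> (\<Union>p\<in>F. cb p)" "(\<Sum>p\<in>F. snd p) \<le> \<rho>" "0 < \<rho>" "\<rho> \<le> R"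
  shows "\<exists>F'. disc_family T F' \<and> (\<Sum>p\<in>F'. snd p) \<le> R \<and> (\<forall>p\<in>F. \<exists>p'\<in>F'. cb p \<subseteq> cb p') \<and>
     c * (ln (R / \<rho>) - card F * \<theta>) * (\<Sum>p\<in>F'. q (cb p)) \<le> \<mu> ((\<Union>p\<in>F'. cb p) - (\<Union>p\<in>F. cb p))"
  using assms
proof (induction "card F" arbitrary: F \<rho> rule: less_induct)
  case less
  note F = less.prems(1)
  have fin: "finite F" and posF: "\<And>p. p \<in> F \<Longrightarrow> snd p > 0"
    using F T_pos by (force simp: disc_family_def)+
  consider "F = {}" | "F \<noteq> {}" "R = \<rho>" | "F \<noteq> {}" "\<rho> < R" using less.prems by linarith
  then show ?case
  proof cases
    case 1
    then show ?thesis using less.prems by (intro exI[of _ F]) (auto simp: \<mu>_empty)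
  next
    case 2
    have "c * (ln (R / \<rho>) - card F * \<theta>) * (\<Sum>p\<in>F. q (cb p)) \<le> 0"
      using 2 less.prems c_nonneg \<theta>_nonneg q_nonneg
      by (simp add: mult_nonneg_nonneg sum_nonneg)
    then show ?thesis using less.prems 2 by (intro exI[of _ F]) (auto simp: \<mu>_empty)
  next
    case 3
    define pairs where "pairs = {pq \<in> F \<times> F. fst pq \<noteq> snd pq}"
    \<comment> \<open>\<open>rat\<close> is the dilation factor at which a pair touches;
      \<open>l\<close> is the first such factor, capped by the factor that exhausts the
      budget.\<close>
    define rat where "rat pq = dist (fst (fst pq)) (fst (snd pq)) / (snd (fst pq) + snd (snd pq))" for pq :: "cdisc \<times> cdisc"
    define l where "l = Min (insert (R / \<rho>) (rat ` pairs))"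
    have finp: "finite pairs" using fin by (simp add: pairs_def)
    have rat1: "1 < rat pq" if "pq \<in> pairs" for pq
    proof -
      have "snd (fst pq) + snd (snd pq) < dist (fst (fst pq)) (fst (snd pq))"
        "0 < snd (fst pq) + snd (snd pq)"
      proof -
        have m: "fst pq \<in> F" "snd pq \<in> F" "fst pq \<noteq> snd pq" using that by (auto simp: pairs_def)
        show "snd (fst pq) + snd (snd pq) < dist (fst (fst pq)) (fst (snd pq))"
          using F m unfolding disc_family_def by blast
        show "0 < snd (fst pq) + snd (snd pq)" using posF[OF m(1)] posF[OF m(2)] by simp
      qed
      then show ?thesis by (simp add: rat_def)
    qed
    have l1: "1 < l"
      using 3 less.prems finp rat1 by (auto simp: l_def)
    have lR: "l \<le> R / \<rho>" using finp by (simp add: l_def)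
    have sep: "l * (snd p + snd q) \<le> dist (fst p) (fst q)" if "p \<in> F" "q \<in> F" "p \<noteq> q" for p q
    proof -
      have "(p, q) \<in> pairs" using that by (simp add: pairs_def)
      then have "l \<le> rat (p, q)" using finp by (simp add: l_def)
      then show ?thesis using posF[OF that(1)] posF[OF that(2)] by (simp add: rat_def field_simps)
    qed
    note grow = grow_once[OF F less.prems(2) l1 sep]
    define G where "G = scaled l ` F"
    have inj: "inj_on (scaled l) F" using l1 by (auto simp: inj_on_def scaled_def prod_eq_iff)
    have finG: "finite G" using fin by (simp add: G_def)
    have cardG: "card G = card F" using inj by (simp add: G_def card_image)
    have TG: "\<forall>p\<in>G. T \<le> snd p"
    proof
      fix p assume "p \<in> G"
      then obtain p0 where "p0 \<in> F" "p = scaled l p0" by (auto simp: G_def)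
      then have "T \<le> snd p0" "snd p = l * snd p0" "0 < snd p0"
        using F posF by (auto simp: disc_family_def scaled_def)
      moreover have "1 * snd p0 \<le> l * snd p0" using l1 \<open>0 < snd p0\<close> by (intro mult_right_mono) auto
      ultimately show "T \<le> snd p" by linarith
    qed
    have sumG: "(\<Sum>p\<in>G. snd p) \<le> l * \<rho>"
    proof -
      have "(\<Sum>p\<in>G. snd p) = l * (\<Sum>p\<in>F. snd p)"
        unfolding G_def sum.reindex[OF inj] by (simp add: scaled_def sum_distrib_left)
      then show ?thesis using less.prems l1 by simp
    qed
    have sub: "cb p \<subseteq> cb (scaled l p)" if "p \<in> F" for p
      using l1 posF[OF that] by (auto simp: scaled_def intro!: subset_cball)
    have UG: "(\<Union>p\<in>G. cb p) = (\<Union>p\<in>F. cb (scaled l p))" by (auto simp: G_def)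
    have XG: "X \<subseteq> (\<Union>p\<in>G. cb p)" unfolding UG using less.prems(2) sub by blast
    have sumqG: "(\<Sum>p\<in>F. q (cb (scaled l p))) = (\<Sum>p\<in>G. q (cb p))"
      unfolding G_def using inj by (simp add: sum.reindex)
    have disjG: "X \<inter> cb p \<inter> cb p' = {}" if "p \<in> G" "p' \<in> G" "p \<noteq> p'" for p p'
    proof -
      have m: "p \<in> G" "p' \<in> G" "p \<noteq> p'" by fact+
      obtain p0 where "p = scaled l p0" "p0 \<in> F" using m(1) unfolding G_def by blast
      moreover obtain p0' where "p' = scaled l p0'" "p0' \<in> F" using m(2) unfolding G_def by blast
      ultimately
      show ?thesis using m(3) grow(2)[of p0 p0'] by auto
    qed
    have neG: "cb p \<noteq> {}" if "p \<in> G" for p using TG T_pos that by (auto simp: not_less)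
    obtain K where K: "disc_family T K" "(\<Sum>p\<in>K. snd p) \<le> (\<Sum>p\<in>G. snd p)" "card K \<le> card G"
        "\<forall>p\<in>G. \<exists>p'\<in>K. cb p \<subseteq> cb p'" "disc_family T G \<or> card K < card G"
      using merge_discs[OF finG TG T_pos] by blast
    have FK: "\<forall>p\<in>F. \<exists>p'\<in>K. cb p \<subseteq> cb p'"
    proof
      fix p assume p: "p \<in> F"
      then obtain p' where "p' \<in> K" "cb (scaled l p) \<subseteq> cb p'" using K(4) by (auto simp: G_def)
      then show "\<exists>p'\<in>K. cb p \<subseteq> cb p'" using sub[OF p] by blast
    qed
    have XK: "X \<subseteq> (\<Union>p\<in>K. cb p)" using XG K(4) by blast
    have GK: "(\<Union>p\<in>G. cb p) \<subseteq> (\<Union>p\<in>K. cb p)" using K(4) by blast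
    show ?thesis
    proof (cases "l = R / \<rho>")
      case True
      have qK: "(\<Sum>p\<in>K. q (cb p)) \<le> (\<Sum>p\<in>G. q (cb p))"
        using sum_q_le[OF finG disjG XG K(1) _ neG] K(4) by blast
      have cF: "1 \<le> card F" using 3 fin by (simp add: Suc_leI card_gt_0_iff)
      have "c * (ln (R / \<rho>) - card F * \<theta>) * (\<Sum>p\<in>K. q (cb p)) \<le> \<mu> ((\<Union>p\<in>K. cb p) - (\<Union>p\<in>F. cb p))"
      \<comment> \<open>Passing from \<open>G\<close> to the smaller degree sum of \<open>K\<close>
        needs a nonnegative factor; for a negative factor the claim is trivial because
        \<open>\<mu>\<close> is nonnegative.\<close>
      proof (cases "ln l - \<theta> \<ge> 0")
        case True': True
        have "c * (ln (R / \<rho>) - card F * \<theta>) * (\<Sum>p\<in>K. q (cb p)) \<le> c * (ln l - \<theta>) * (\<Sum>p\<in>K. q (cb p))"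
          using True cF \<theta>_nonneg c_nonneg q_nonneg
          by (intro mult_right_mono mult_left_mono sum_nonneg) (auto simp: mult_le_cancel_right1)
        also have "\<dots> \<le> c * (ln l - \<theta>) * (\<Sum>p\<in>G. q (cb p))"
          using qK c_nonneg True' by (intro mult_left_mono) auto
        also have "\<dots> \<le> \<mu> ((\<Union>p\<in>G. cb p) - (\<Union>p\<in>F. cb p))"
          using grow(1) unfolding UG sumqG by simp
        also have "\<dots> \<le> \<mu> ((\<Union>p\<in>K. cb p) - (\<Union>p\<in>F. cb p))"
          using GK by (intro \<mu>_mono) blast
        finally show ?thesis .
      next
        case False
        have "ln (R / \<rho>) - card F * \<theta> \<le> ln l - \<theta>"
          using True cF \<theta>_nonneg by (auto simp: mult_le_cancel_right1)
        then have "ln (R / \<rho>) - card F * \<theta> \<le> 0" using False by linarith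
        then have "c * (ln (R / \<rho>) - card F * \<theta>) * (\<Sum>p\<in>K. q (cb p)) \<le> 0"
          using c_nonneg q_nonneg by (simp add: mult_nonneg_nonpos mult_nonpos_nonneg sum_nonneg)
        then show ?thesis using \<mu>_nonneg by (meson order_trans)
      qed
      moreover have "(\<Sum>p\<in>K. snd p) \<le> R" using K(2) sumG True less.prems by simp
      ultimately show ?thesis using K(1) FK by blast
    next
      case False
      then have lR': "l < R / \<rho>" using lR by simp
      have "l \<in> insert (R / \<rho>) (rat ` pairs)" unfolding l_def using finp by (intro Min_in) auto
      then obtain pq where pq: "pq \<in> pairs" "l = rat pq" using False by auto
      \<comment> \<open>The minimum is attained by a pair of discs, which touch exactly at the
        factor \<open>l\<close>. So merging really reduces the number of discs, and the induction
        hypothesis applies with the new total radius \<open>l * \<rho>\<close>.\<close>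
      have "\<not> disc_family T G"
      proof -
        obtain p q where [simp]: "pq = (p, q)" by (cases pq)
        have m: "p \<in> F" "q \<in> F" "p \<noteq> q" using pq by (auto simp: pairs_def)
        have "dist (fst p) (fst q) = l * snd p + l * snd q"
          using posF[OF m(1)] posF[OF m(2)] pq(2) by (simp add: rat_def field_simps)
        moreover have "scaled l p \<noteq> scaled l q" using m inj by (auto simp: inj_on_def)
        ultimately show ?thesis using m by (force simp: disc_family_def G_def scaled_def)
      qed
      then have cK: "card K < card F" using K(5) cardG by simp
      have lr: "0 < l * \<rho>" "l * \<rho> \<le> R" using l1 lR less.prems by (auto simp: field_simps)
      have sK: "(\<Sum>p\<in>K. snd p) \<le> l * \<rho>" using K(2) sumG by linarith
      obtain F' where F': "disc_family T F'" "(\<Sum>p\<in>F'. snd p) \<le> R" "\<forall>p\<in>K. \<exists>p'\<in>F'. cb p \<subseteq> cb p'"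
         "c * (ln (R / (l * \<rho>)) - card K * \<theta>) * (\<Sum>p\<in>F'. q (cb p)) \<le> \<mu> ((\<Union>p\<in>F'. cb p) - (\<Union>p\<in>K. cb p))"
        using less.hyps[OF cK K(1) XK sK lr] by blast
      have qF': "(\<Sum>p\<in>F'. q (cb p)) \<le> (\<Sum>p\<in>G. q (cb p))"
      proof (rule sum_q_le[OF finG disjG XG F'(1) _ neG])
        show "\<exists>p'\<in>F'. cb p \<subseteq> cb p'" if "p \<in> G" for p using that K(4) F'(3) by (meson subset_trans)
      qed
      let ?Q = "\<Sum>p\<in>F'. q (cb p)"
      have Q0: "0 \<le> ?Q" using q_nonneg by (intro sum_nonneg) auto
      have a: "c * (ln l - \<theta>) * ?Q \<le> \<mu> ((\<Union>p\<in>G. cb p) - (\<Union>p\<in>F. cb p))"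
      proof (cases "ln l - \<theta> \<ge> 0")
        case True
        have "c * (ln l - \<theta>) * ?Q \<le> c * (ln l - \<theta>) * (\<Sum>p\<in>G. q (cb p))"
          using qF' c_nonneg True by (intro mult_left_mono) auto
        also have "\<dots> \<le> \<mu> ((\<Union>p\<in>G. cb p) - (\<Union>p\<in>F. cb p))"
          using grow(1) unfolding UG sumqG by simp
        finally show ?thesis .
      next
        case False
        then have "c * (ln l - \<theta>) * ?Q \<le> 0"
          using c_nonneg Q0 by (simp add: mult_nonneg_nonpos mult_nonpos_nonneg)
        then show ?thesis using \<mu>_nonneg by (meson order_trans)
      qed
      have lnsum: "ln (R / \<rho>) = ln l + ln (R / (l * \<rho>))"
        using l1 less.prems lr by (simp add: ln_div ln_mult)
      \<comment> \<open>The disc lost in this stage pays for its \<open>\<theta>\<close>.\<close>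
      have kk: "real (card K) + 1 \<le> real (card F)" using cK by linarith
      have "c * (ln (R / \<rho>) - card F * \<theta>) * ?Q \<le> c * (ln (R / \<rho>) - (card K + 1) * \<theta>) * ?Q"
        using mult_right_mono[OF kk \<theta>_nonneg] c_nonneg Q0
        by (intro mult_right_mono mult_left_mono) (auto simp: add.commute)
      also have "\<dots> = c * (ln l - \<theta>) * ?Q + c * (ln (R / (l * \<rho>)) - card K * \<theta>) * ?Q"
        unfolding lnsum by (simp add: algebra_simps)
      also have "\<dots> \<le> \<mu> ((\<Union>p\<in>G. cb p) - (\<Union>p\<in>F. cb p)) + \<mu> ((\<Union>p\<in>F'. cb p) - (\<Union>p\<in>K. cb p))"
        using a F'(4) by linarith
      also have "\<dots> = \<mu> (((\<Union>p\<in>G. cb p) - (\<Union>p\<in>F. cb p)) \<union> ((\<Union>p\<in>F'. cb p) - (\<Union>p\<in>K. cb p)))"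
        using GK by (intro \<mu>_add[symmetric]) blast
      also have "\<dots> \<le> \<mu> ((\<Union>p\<in>F'. cb p) - (\<Union>p\<in>F. cb p))"
      proof (rule \<mu>_mono)
        have 1: "(\<Union>p\<in>K. cb p) \<subseteq> (\<Union>p\<in>F'. cb p)" using F'(3) by blast
        have 2: "(\<Union>p\<in>F. cb p) \<subseteq> (\<Union>p\<in>K. cb p)" using FK by blast
        show "((\<Union>p\<in>G. cb p) - (\<Union>p\<in>F. cb p)) \<union> ((\<Union>p\<in>F'. cb p) - (\<Union>p\<in>K. cb p))
            \<subseteq> (\<Union>p\<in>F'. cb p) - (\<Union>p\<in>F. cb p)"
          by (intro Un_least Diff_mono order_refl subset_trans[OF GK 1] 1 2)
      qed
      finally have "c * (ln (R / \<rho>) - card F * \<theta>) * ?Q \<le> \<mu> ((\<Union>p\<in>F'. cb p) - (\<Union>p\<in>F. cb p))" .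
      moreover have "\<forall>p\<in>F. \<exists>p'\<in>F'. cb p \<subseteq> cb p'" using FK F'(3) by (meson subset_trans)
      ultimately show ?thesis using F' by blast
    qed
  qed
qed

end

section \<open>The square lattice\<close>

definition site :: "int \<times> int \<Rightarrow> complex" where
  "site g = Complex (of_int (fst g)) (of_int (snd g))"

definition site_cell :: "int \<times> int \<Rightarrow> complex set" where
  "site_cell g = box (site g - Complex (1/2) (1/2)) (site g + Complex (1/2) (1/2))"

lemma inj_site: "inj site"
  by (auto simp: inj_def site_def prod_eq_iff)

lemma measure_site_cell: "measure lborel (site_cell g) = 1"
  unfolding site_cell_def
  by (subst measure_lborel_box) (auto simp: Basis_complex_def)

lemma site_cell_coords:
  assumes "x \<in> site_cell g"
  shows "\<bar>Re x - of_int (fst g)\<bar> < 1/2" "\<bar>Im x - of_int (snd g)\<bar> < 1/2"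
proof -
  have "of_int (fst g) - 1/2 < Re x" "Re x < of_int (fst g) + 1/2"
       "of_int (snd g) - 1/2 < Im x" "Im x < of_int (snd g) + 1/2"
    using assms by (auto simp: site_cell_def site_def in_box_complex_iff)
  then show "\<bar>Re x - of_int (fst g)\<bar> < 1/2" "\<bar>Im x - of_int (snd g)\<bar> < 1/2" by linarith+
qed

lemma site_cell_disjoint: "g \<noteq> g' \<Longrightarrow> site_cell g \<inter> site_cell g' = {}"
proof (rule ccontr)
  assume ne: "g \<noteq> g'" and "site_cell g \<inter> site_cell g' \<noteq> {}"
  then obtain x where x: "x \<in> site_cell g" "x \<in> site_cell g'" by blast
  note site_cell_coords[OF x(1)] site_cell_coords[OF x(2)]
  then have "\<bar>of_int (fst g) - of_int (fst g') :: real\<bar> < 1" "\<bar>of_int (snd g) - of_int (snd g') :: real\<bar> < 1"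
    by linarith+
  then have "fst g = fst g'" "snd g = snd g'" by linarith+
  then show False using ne by (simp add: prod_eq_iff)
qed

lemma site_cell_near: assumes "x \<in> site_cell g" shows "dist x (site g) < 1"
proof -
  note site_cell_coords[OF assms]
  moreover have "dist x (site g) \<le> \<bar>Re (x - site g)\<bar> + \<bar>Im (x - site g)\<bar>"
    unfolding dist_norm by (rule cmod_le)
  ultimately show ?thesis by (simp add: site_def)
qed

text \<open>The unit cells around the counted sites are disjoint and lie in the annulus enlarged by
  1 on both sides, because a cell has radius below 1. The leading constant \<open>pi\<close> must be
  exact, since it ends up in the constant of the main term.\<close>

lemma lattice_count:
  assumes S: "finite S" "\<And>g. g \<in> S \<Longrightarrow> \<sigma> \<le> dist a (site g) \<and> dist a (site g) < \<tau>"
    and "1 \<le> \<sigma>" "\<sigma> \<le> \<tau>"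
  shows "real (card S) \<le> pi * ((\<tau> + 1)\<^sup>2 - (\<sigma> - 1)\<^sup>2)"
proof -
  have "real (card S) = (\<Sum>g\<in>S. measure lborel (site_cell g))"
    by (simp add: measure_site_cell)
  also have "\<dots> = measure lborel (\<Union>g\<in>S. site_cell g)"
    using S(1) site_cell_disjoint
    by (intro measure_finite_Union[symmetric])
       (auto simp: site_cell_def disjoint_family_on_def emeasure_lborel_box_eq)
  also have "\<dots> \<le> measure lborel (ball a (\<tau> + 1) - ball a (\<sigma> - 1))"
  proof (rule measure_mono_fmeasurable)
    show "(\<Union>g\<in>S. site_cell g) \<subseteq> ball a (\<tau> + 1) - ball a (\<sigma> - 1)"
    proof
      fix x assume "x \<in> (\<Union>g\<in>S. site_cell g)"
      then obtain g where g: "g \<in> S" "dist x (site g) < 1" using site_cell_near by blast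
      then show "x \<in> ball a (\<tau> + 1) - ball a (\<sigma> - 1)"
        using S(2)[OF g(1)] dist_triangle[of a x "site g"] dist_triangle[of a "site g" x]
        by (auto simp: dist_commute)
    qed
    show "(\<Union>g\<in>S. site_cell g) \<in> sets lborel" by (auto simp: site_cell_def)
    show "ball a (\<tau> + 1) - ball a (\<sigma> - 1) \<in> fmeasurable lborel"
      using emeasure_lborel_ball_finite[of a "\<tau> + 1"]
      by (intro fmeasurable_Diff) (auto simp: fmeasurable_def)
  qed
  also have "\<dots> = measure lborel (ball a (\<tau> + 1)) - measure lborel (ball a (\<sigma> - 1))"
  proof (rule measure_Diff)
    show "emeasure lborel (ball a (\<tau> + 1)) \<noteq> \<infinity>"
      using emeasure_lborel_ball_finite[of a "\<tau> + 1"] by (metis less_irrefl)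
    show "ball a (\<sigma> - 1) \<subseteq> ball a (\<tau> + 1)" using assms by (intro subset_ball) auto
  qed auto
  also have "\<dots> = pi * (\<tau> + 1)\<^sup>2 - pi * (\<sigma> - 1)\<^sup>2"
  proof -
    have "measure lborel (ball a r) = pi * r\<^sup>2" if "r \<ge> 0" for r
      using content_ball[OF that, of a] by (simp add: unit_ball_vol_2)
    then show ?thesis using assms by simp
  qed
  finally show ?thesis by (simp add: algebra_simps)
qed

text \<open>Riemann sum for the integral of 1 / r^2 over an annulus, cut into geometric shells of
  ratio \<open>1 + th\<close>. Each shell contributes at most 2 pi th (1 + th), and there are about
  \<open>ln (\<tau> / \<sigma>) / ln (1 + th)\<close> of them. The bound \<open>6 / th^2\<close> on
  the inner radius makes the relative counting error of a shell, at most
  \<open>6 / \<sigma>\<close>, smaller than \<open>th^2\<close>.\<close>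

lemma lattice_sum:
  assumes S: "finite S" "\<And>g. g \<in> S \<Longrightarrow> \<sigma> \<le> dist a (site g) \<and> dist a (site g) < \<tau>"
    and th: "0 < th" "th \<le> 1" and \<sigma>: "6 / th\<^sup>2 \<le> \<sigma>" and \<tau>: "\<sigma> \<le> \<tau>"
  shows "(\<Sum>g\<in>S. 1 / (dist a (site g))\<^sup>2) \<le> 2 * pi * (1 + th)\<^sup>2 * (ln (\<tau> / \<sigma>) + th)"
proof -
  have "6 / 1 \<le> 6 / th\<^sup>2"
    using th by (intro divide_left_mono) (auto simp: power_le_one)
  then have \<sigma>6: "6 \<le> \<sigma>" using \<sigma> by simp
  define q where "q = 1 + th"
  have q1: "1 < q" "0 < ln q" using th by (auto simp: q_def)
  define k where "k g = nat \<lfloor>ln (dist a (site g) / \<sigma>) / ln q\<rfloor>" for g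
  define K where "K = nat \<lfloor>ln (\<tau> / \<sigma>) / ln q\<rfloor>"
  have kK: "k g \<in> {..K}" if "g \<in> S" for g
  proof -
    have "ln (dist a (site g) / \<sigma>) \<le> ln (\<tau> / \<sigma>)"
    proof -
      have "0 < dist a (site g) / \<sigma>" using S(2)[OF that] \<sigma>6 by (intro divide_pos_pos; linarith)
      moreover have "dist a (site g) / \<sigma> \<le> \<tau> / \<sigma>" using S(2)[OF that] \<sigma>6 by (intro divide_right_mono) auto
      ultimately show ?thesis by simp
    qed
    then have "ln (dist a (site g) / \<sigma>) / ln q \<le> ln (\<tau> / \<sigma>) / ln q"
      using q1 by (intro divide_right_mono) auto
    then show ?thesis unfolding k_def K_def by (auto intro: nat_mono floor_mono)
  qed
  have shell: "\<sigma> * q ^ k g \<le> dist a (site g) \<and> dist a (site g) < \<sigma> * q ^ (k g + 1)" if "g \<in> S" for g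
  proof -
    let ?r = "dist a (site g)" let ?x = "ln (?r / \<sigma>) / ln q"
    have r: "\<sigma> \<le> ?r" "0 < ?r" using S(2)[OF that] \<sigma>6 by linarith+
    then have r': "0 < ?r / \<sigma>" using \<sigma>6 by (intro divide_pos_pos) linarith+
    have "0 \<le> ?x" using r \<sigma>6 q1 by simp
    then have "real (k g) \<le> ?x" "?x < real (k g) + 1" unfolding k_def by linarith+
    then have "real (k g) * ln q \<le> ln (?r / \<sigma>)" "ln (?r / \<sigma>) < (real (k g) + 1) * ln q"
      using q1 by (auto simp: field_simps)
    then have "ln (q ^ k g) \<le> ln (?r / \<sigma>)" "ln (?r / \<sigma>) < ln (q ^ (k g + 1))"
      using q1 by (auto simp: ln_realpow ln_mult algebra_simps)
    then have "q ^ k g \<le> ?r / \<sigma>" "?r / \<sigma> < q ^ (k g + 1)"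
      using q1 r' by (auto simp del: power_Suc)
    then show ?thesis using \<sigma>6 by (simp add: field_simps)
  qed
  have each: "(\<Sum>g\<in>{g\<in>S. k g = m}. 1 / (dist a (site g))\<^sup>2) \<le> 2 * pi * th * (1 + th)" for m
  proof -
    let ?S = "{g\<in>S. k g = m}" let ?s = "\<sigma> * q ^ m"
    have qm: "1 \<le> q ^ m" using q1 by (simp add: one_le_power)
    have s6: "\<sigma> \<le> ?s" using qm \<sigma>6 by (simp add: mult_le_cancel_left1)
    then have s1: "1 \<le> ?s" "0 < ?s" using \<sigma>6 by linarith+
    have c: "real (card ?S) \<le> pi * ((?s * q + 1)\<^sup>2 - (?s - 1)\<^sup>2)"
    proof (rule lattice_count[of _ _ a])
      have "?s * 1 \<le> ?s * q" using s1 q1 by (intro mult_left_mono) auto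
      then show "?s \<le> ?s * q" by simp
      show "?s \<le> dist a (site g) \<and> dist a (site g) < ?s * q" if "g \<in> ?S" for g
        using shell[of g] that by (auto simp: mult_ac)
    qed (use S(1) s1 in auto)
    have "(\<Sum>g\<in>?S. 1 / (dist a (site g))\<^sup>2) \<le> (\<Sum>g\<in>?S. 1 / ?s\<^sup>2)"
    proof (rule sum_mono)
      fix g assume "g \<in> ?S"
      then have "?s \<le> dist a (site g)" using shell[of g] by auto
      then show "1 / (dist a (site g))\<^sup>2 \<le> 1 / ?s\<^sup>2"
        using s1 \<sigma>6 q1 by (intro divide_left_mono power_mono mult_pos_pos zero_less_power) auto
    qed
    also have "\<dots> = real (card ?S) / ?s\<^sup>2" by simp
    also have "\<dots> \<le> pi * ((?s * q + 1)\<^sup>2 - (?s - 1)\<^sup>2) / ?s\<^sup>2"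
      using c by (intro divide_right_mono) auto
    also have "\<dots> = pi * ((2 * th + th\<^sup>2) + (4 + 2 * th) / ?s)"
    proof -
      have "pi * ((s * q + 1)\<^sup>2 - (s - 1)\<^sup>2) / s\<^sup>2 = pi * ((2 * th + th\<^sup>2) + (4 + 2 * th) / s)"
        if "s > 0" for s
        using that by (simp add: q_def power2_eq_square field_simps)
      then show ?thesis using s1(2) by blast
    qed
    also have "\<dots> \<le> pi * ((2 * th + th\<^sup>2) + th\<^sup>2)"
    proof -
      have "(4 + 2 * th) / ?s \<le> 6 / \<sigma>"
        using th s6 \<sigma>6 by (intro frac_le) auto
      also have "\<dots> \<le> th\<^sup>2" using \<sigma> th \<sigma>6 by (simp add: field_simps)
      finally show ?thesis by (intro mult_left_mono add_left_mono) auto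
    qed
    also have "\<dots> = 2 * pi * th * (1 + th)" by (simp add: power2_eq_square algebra_simps)
    finally show ?thesis .
  qed
  have "(\<Sum>g\<in>S. 1 / (dist a (site g))\<^sup>2) = (\<Sum>m\<le>K. \<Sum>g\<in>{g\<in>S. k g = m}. 1 / (dist a (site g))\<^sup>2)"
    using S(1) kK by (intro sum.group[symmetric]) auto
  also have "\<dots> \<le> (\<Sum>m\<le>K. 2 * pi * th * (1 + th))" by (intro sum_mono each)
  also have "\<dots> = 2 * pi * (1 + th) * (th * (real K + 1))" by simp
  also have "\<dots> \<le> 2 * pi * (1 + th) * ((1 + th) * (ln (\<tau> / \<sigma>) + th))"
  proof (intro mult_left_mono)
    have "0 \<le> ln (\<tau> / \<sigma>)" using \<tau> \<sigma>6 by simp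
    then have "real K \<le> ln (\<tau> / \<sigma>) / ln q" unfolding K_def using q1 by simp
    then have 1: "real K * ln q \<le> ln (\<tau> / \<sigma>)" using q1 by (simp add: field_simps)
    have 2: "ln q \<le> th" using th unfolding q_def by (intro ln_add_one_self_le_self) auto
    \<comment> \<open>It turns the shell count, which divides by \<open>ln (1 + th)\<close>, into
      the factor \<open>1 + th\<close> of the claim.\<close>
    have 3: "th \<le> (1 + th) * ln q"
    proof -
      have "ln (1 / q) \<le> 1 / q - 1" using q1 by (intro ln_le_minus_one) auto
      then have "1 - 1 / q \<le> ln q" using q1 by (simp add: ln_div)
      then have "(1 + th) * (1 - 1 / q) \<le> (1 + th) * ln q" using th by (intro mult_left_mono) auto
      moreover have "q * (1 - 1 / q) = q - 1" using q1 by (simp add: right_diff_distrib)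
      then have "(1 + th) * (1 - 1 / q) = th" by (simp add: q_def)
      ultimately show ?thesis by simp
    qed
    have "th * (real K + 1) \<le> (1 + th) * ln q * (real K + 1)"
      using 3 by (intro mult_right_mono) auto
    also have "\<dots> = (1 + th) * (real K * ln q + ln q)" by (simp add: algebra_simps)
    also have "\<dots> \<le> (1 + th) * (ln (\<tau> / \<sigma>) + th)" using 1 2 th by (intro mult_left_mono) auto
    finally show "th * (real K + 1) \<le> (1 + th) * (ln (\<tau> / \<sigma>) + th)" .
  qed (use th in auto)
  also have "\<dots> = 2 * pi * (1 + th)\<^sup>2 * (ln (\<tau> / \<sigma>) + th)" by (simp add: power2_eq_square)
  finally show ?thesis .
qed

section \<open>Edges, discrete curl and summation by parts\<close>

type_synonym site = "int \<times> int"

text \<open>The edge \<open>(True, i, j)\<close> separates the plaquettes \<open>(i, j)\<close> and \<open>(i, j - 1)\<close>, the edge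
  \<open>(False, i, j)\<close> separates \<open>(i - 1, j)\<close> and \<open>(i, j)\<close>; plaquette \<open>(i, j)\<close> has its centre at
  \<open>site (i, j)\<close>.\<close>
type_synonym edge = "bool \<times> int \<times> int"

fun emid :: "edge \<Rightarrow> complex" where
  "emid (True, i, j) = Complex (of_int i) (of_int j - 1/2)"
| "emid (False, i, j) = Complex (of_int i - 1/2) (of_int j)"

fun side1 :: "edge \<Rightarrow> site" where
  "side1 (True, i, j) = (i, j)"
| "side1 (False, i, j) = (i - 1, j)"

fun side2 :: "edge \<Rightarrow> site" where
  "side2 (True, i, j) = (i, j - 1)"
| "side2 (False, i, j) = (i, j)"

text \<open>Counterclockwise circulation around plaquette \<open>g\<close>, with horizontal bonds
  marked \<open>True\<close>: bottom plus right minus top minus left.\<close>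

definition ecurl :: "(edge \<Rightarrow> real) \<Rightarrow> site \<Rightarrow> real" where
  "ecurl p g = p (True, g) + p (False, fst g + 1, snd g) - p (True, fst g, snd g + 1) - p (False, g)"

definition cograd :: "(site \<Rightarrow> real) \<Rightarrow> edge \<Rightarrow> real" where
  "cograd \<xi> e = \<xi> (side1 e) - \<xi> (side2 e)"

lemma side1_iff: "side1 e = g \<longleftrightarrow> e = (True, g) \<or> e = (False, fst g + 1, snd g)"
  by (cases e rule: side1.cases; cases g) auto

lemma side2_iff: "side2 e = g \<longleftrightarrow> e = (True, fst g, snd g + 1) \<or> e = (False, g)"
  by (cases e rule: side2.cases; cases g) auto

lemma dist_emid_side: "dist (emid e) (site (side1 e)) = 1/2" "dist (emid e) (site (side2 e)) = 1/2"
  by (cases e rule: emid.cases; simp add: site_def dist_norm cmod_def)+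

text \<open>Every edge borders two plaquettes and enters \<open>ecurl\<close> with sign plus at
  \<open>side1\<close> and minus at \<open>side2\<close>, so collecting the coefficients of
  \<open>p e\<close> yields \<open>cograd\<close>. The set \<open>E\<close> only has to carry the
  cogradient; it will be the edges of an annulus or of the boundary of a square.\<close>

lemma summation_by_parts:
  assumes Z: "finite Z" "\<And>g. g \<notin> Z \<Longrightarrow> \<xi> g = 0"
    and E: "finite E" "\<And>e. e \<notin> E \<Longrightarrow> cograd \<xi> e = 0"
  shows "(\<Sum>g\<in>Z. \<xi> g * ecurl p g) = (\<Sum>e\<in>E. p e * cograd \<xi> e)"
proof -
  define E1 where "E1 = (\<Union>g\<in>Z. {(True, g), (False, fst g + 1, snd g)})"
  define E2 where "E2 = (\<Union>g\<in>Z. {(True, fst g, snd g + 1), (False, g)})"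
  have fin: "finite E1" "finite E2" using Z by (auto simp: E1_def E2_def)
  have e1: "{e\<in>E1. side1 e = g} = {(True, g), (False, fst g + 1, snd g)}" if "g \<in> Z" for g
    using that by (auto simp: E1_def side1_iff)
  have e2: "{e\<in>E2. side2 e = g} = {(True, fst g, snd g + 1), (False, g)}" if "g \<in> Z" for g
    using that by (auto simp: E2_def side2_iff)
  have 1: "(\<Sum>e\<in>E1. p e * \<xi> (side1 e)) = (\<Sum>g\<in>Z. \<xi> g * (p (True, g) + p (False, fst g + 1, snd g)))"
  proof -
    have "(\<Sum>e\<in>E1. p e * \<xi> (side1 e)) = (\<Sum>g\<in>Z. \<Sum>e\<in>{e\<in>E1. side1 e = g}. p e * \<xi> (side1 e))"
      using fin Z by (intro sum.group[symmetric]) (auto simp: E1_def side1_iff)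
    also have "\<dots> = (\<Sum>g\<in>Z. \<xi> g * (p (True, g) + p (False, fst g + 1, snd g)))"
    proof (intro sum.cong refl)
      fix g assume g: "g \<in> Z"
      have "side1 (True, g) = g" "side1 (False, fst g + 1, snd g) = g" by (simp_all add: side1_iff)
      then show "(\<Sum>e\<in>{e\<in>E1. side1 e = g}. p e * \<xi> (side1 e)) = \<xi> g * (p (True, g) + p (False, fst g + 1, snd g))"
        unfolding e1[OF g] by (simp add: algebra_simps)
    qed
    finally show ?thesis .
  qed
  have 2: "(\<Sum>e\<in>E2. p e * \<xi> (side2 e)) = (\<Sum>g\<in>Z. \<xi> g * (p (True, fst g, snd g + 1) + p (False, g)))"
  proof -
    have "(\<Sum>e\<in>E2. p e * \<xi> (side2 e)) = (\<Sum>g\<in>Z. \<Sum>e\<in>{e\<in>E2. side2 e = g}. p e * \<xi> (side2 e))"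
      using fin Z by (intro sum.group[symmetric]) (auto simp: E2_def side2_iff)
    also have "\<dots> = (\<Sum>g\<in>Z. \<xi> g * (p (True, fst g, snd g + 1) + p (False, g)))"
    proof (intro sum.cong refl)
      fix g assume g: "g \<in> Z"
      have "side2 (True, fst g, snd g + 1) = g" "side2 (False, g) = g" by (simp_all add: side2_iff)
      then show "(\<Sum>e\<in>{e\<in>E2. side2 e = g}. p e * \<xi> (side2 e)) = \<xi> g * (p (True, fst g, snd g + 1) + p (False, g))"
        unfolding e2[OF g] by (simp add: algebra_simps)
    qed
    finally show ?thesis .
  qed
  have n1: "\<xi> (side1 e) = 0" if "e \<notin> E1" for e
  proof -
    have "side1 e \<notin> Z" using that side1_iff[of e "side1 e"] by (auto simp: E1_def)
    then show ?thesis by (rule Z(2))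
  qed
  have n2: "\<xi> (side2 e) = 0" if "e \<notin> E2" for e
  proof -
    have "side2 e \<notin> Z" using that side2_iff[of e "side2 e"] by (auto simp: E2_def)
    then show ?thesis by (rule Z(2))
  qed
  have "(\<Sum>e\<in>E. p e * cograd \<xi> e) = (\<Sum>e\<in>E \<union> E1 \<union> E2. p e * cograd \<xi> e)"
    using E fin by (intro sum.mono_neutral_left) auto
  also have "\<dots> = (\<Sum>e\<in>E \<union> E1 \<union> E2. p e * \<xi> (side1 e)) - (\<Sum>e\<in>E \<union> E1 \<union> E2. p e * \<xi> (side2 e))"
    by (simp add: cograd_def algebra_simps sum_subtractf)
  also have "(\<Sum>e\<in>E \<union> E1 \<union> E2. p e * \<xi> (side1 e)) = (\<Sum>e\<in>E1. p e * \<xi> (side1 e))"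
    using E fin n1 by (intro sum.mono_neutral_right) auto
  also have "(\<Sum>e\<in>E \<union> E1 \<union> E2. p e * \<xi> (side2 e)) = (\<Sum>e\<in>E2. p e * \<xi> (side2 e))"
    using E fin n2 by (intro sum.mono_neutral_right) auto
  finally show ?thesis
    unfolding 1 2 by (simp add: ecurl_def algebra_simps sum_subtractf sum.distrib)
qed

section \<open>Dirichlet energy of the logarithmic cutoff\<close>

lemma ln_one_plus_sq_le:
  fixes y :: real
  assumes "\<bar>y\<bar> \<le> 1/2"
  shows "(ln (1 + y))\<^sup>2 \<le> y\<^sup>2 * (1 + 2 * \<bar>y\<bar>)\<^sup>2"
proof -
  have "\<bar>ln (1 + y) - y\<bar> \<le> 2 * y\<^sup>2" using assms by (intro abs_ln_one_plus_x_minus_x_bound) auto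
  then have "\<bar>ln (1 + y)\<bar> \<le> \<bar>y\<bar> * (1 + 2 * \<bar>y\<bar>)"
    by (auto simp: algebra_simps power2_eq_square abs_if split: if_splits)
  then have "\<bar>ln (1 + y)\<bar>\<^sup>2 \<le> (\<bar>y\<bar> * (1 + 2 * \<bar>y\<bar>))\<^sup>2" by (intro power_mono) auto
  then show ?thesis by (simp add: power_mult_distrib)
qed

text \<open>Discrete form of the identity that the squared gradient of \<open>ln (norm z)\<close> is
  \<open>1 / (norm z)^2\<close>. A unit step multiplies the squared norm by \<open>1 + y\<close>
  with \<open>y = (2 * t + 1) / r^2\<close>, where \<open>t\<close> is the coordinate in that
  direction. The squares of the two numerators add up to \<open>4 * r^2\<close> plus lower order
  terms; these and the squared Taylor error together cost \<open>(1 + 6 / r)^3\<close>.\<close>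

lemma log_gradient_bound:
  fixes z :: complex and th :: real
  assumes r: "6 / th \<le> norm z" and th: "0 < th" "th \<le> 1"
  shows "(ln (norm (z + 1)) - ln (norm z))\<^sup>2 + (ln (norm (z + \<i>)) - ln (norm z))\<^sup>2
           \<le> (1 + th) ^ 3 / (norm z)\<^sup>2"
proof -
  define r where "r = norm z"
  define a where "a = Re z" define b where "b = Im z"
  have "6 / 1 \<le> 6 / th" using th by (intro divide_left_mono) auto
  then have r6: "6 \<le> r" using r by (simp add: r_def)
  have rth: "6 / r \<le> th" using r th r6 by (simp add: r_def divide_le_eq mult.commute)
  have r2: "r\<^sup>2 = a\<^sup>2 + b\<^sup>2" unfolding r_def a_def b_def by (rule cmod_power2)
  have ab: "\<bar>a\<bar> \<le> r" "\<bar>b\<bar> \<le> r" unfolding r_def a_def b_def by (auto intro: abs_Re_le_cmod abs_Im_le_cmod)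
  have step: "(ln (norm w) - ln r)\<^sup>2 \<le> (2 * t + 1)\<^sup>2 / (4 * r ^ 4) * (1 + 6 / r)\<^sup>2"
    if w: "(norm w)\<^sup>2 = r\<^sup>2 + 2 * t + 1" and t: "\<bar>t\<bar> \<le> r" for w :: complex and t
  proof -
    define y where "y = (2 * t + 1) / r\<^sup>2"
    have "\<bar>2 * t + 1\<bar> \<le> 3 * r" using t r6 by linarith
    then have y3: "\<bar>y\<bar> \<le> 3 / r" using r6 by (simp add: y_def abs_divide field_simps power2_eq_square)
    have "3 / r \<le> 1/2" using r6 by (simp add: field_simps)
    then have y2: "\<bar>y\<bar> \<le> 1/2" using y3 by linarith
    have nw: "(norm w)\<^sup>2 = r\<^sup>2 * (1 + y)" using r6 w by (simp add: y_def field_simps)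
    have "norm w \<noteq> 0" using nw y2 r6 by auto
    then have "2 * ln (norm w) = ln ((norm w)\<^sup>2)" by (simp add: ln_realpow)
    also have "\<dots> = 2 * ln r + ln (1 + y)" unfolding nw using r6 y2 by (simp add: ln_mult ln_realpow abs_le_iff)
    finally have eq: "ln (norm w) - ln r = ln (1 + y) / 2" by simp
    have "(ln (norm w) - ln r)\<^sup>2 = (ln (1 + y))\<^sup>2 / 4" unfolding eq by (simp add: power_divide)
    also have "\<dots> \<le> y\<^sup>2 * (1 + 2 * \<bar>y\<bar>)\<^sup>2 / 4" using ln_one_plus_sq_le[OF y2] by simp
    also have "\<dots> \<le> y\<^sup>2 * (1 + 6 / r)\<^sup>2 / 4"
      using y3 by (intro divide_right_mono mult_left_mono power_mono) auto
    also have "\<dots> = (2 * t + 1)\<^sup>2 / (4 * r ^ 4) * (1 + 6 / r)\<^sup>2"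
      by (simp add: y_def power_divide flip: power_mult)
    finally show ?thesis .
  qed
  have n1: "(norm (z + 1))\<^sup>2 = r\<^sup>2 + 2 * a + 1" "(norm (z + \<i>))\<^sup>2 = r\<^sup>2 + 2 * b + 1"
    unfolding r2 cmod_power2 by (simp_all add: a_def b_def power2_eq_square algebra_simps)
  have "(ln (norm (z + 1)) - ln r)\<^sup>2 + (ln (norm (z + \<i>)) - ln r)\<^sup>2
     \<le> (2 * a + 1)\<^sup>2 / (4 * r ^ 4) * (1 + 6 / r)\<^sup>2 + (2 * b + 1)\<^sup>2 / (4 * r ^ 4) * (1 + 6 / r)\<^sup>2"
    using step[OF n1(1) ab(1)] step[OF n1(2) ab(2)] by linarith
  also have "\<dots> = (4 * r\<^sup>2 + 4 * (a + b) + 2) / (4 * r ^ 4) * (1 + 6 / r)\<^sup>2"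
  proof -
    have "(2 * a + 1)\<^sup>2 + (2 * b + 1)\<^sup>2 = 4 * r\<^sup>2 + 4 * (a + b) + 2"
      unfolding r2 by (simp add: power2_eq_square algebra_simps)
    then show ?thesis by (metis add_divide_distrib distrib_right)
  qed
  also have "\<dots> \<le> (4 * r\<^sup>2 + 24 * r) / (4 * r ^ 4) * (1 + 6 / r)\<^sup>2"
    using ab r6 by (intro mult_right_mono divide_right_mono) auto
  also have "\<dots> = (1 + 6 / r) ^ 3 / r\<^sup>2"
  proof -
    have "(4 * r\<^sup>2 + 24 * r) / (4 * r ^ 4) = (1 + 6 / r) / r\<^sup>2"
      using r6 by (simp add: divide_simps) (simp add: power2_eq_square power4_eq_xxxx algebra_simps)
    then show ?thesis by (simp add: power3_eq_cube power2_eq_square)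
  qed
  also have "\<dots> \<le> (1 + th) ^ 3 / r\<^sup>2"
    using rth r6 by (intro divide_right_mono power_mono) auto
  finally show ?thesis by (simp add: r_def)
qed

lemma finite_sites: "finite {g. dist a (site g) \<le> t}"
proof (rule finite_subset)
  show "{g. dist a (site g) \<le> t} \<subseteq> {\<lfloor>Re a - t\<rfloor>..\<lceil>Re a + t\<rceil>} \<times> {\<lfloor>Im a - t\<rfloor>..\<lceil>Im a + t\<rceil>}"
  proof
    fix g assume "g \<in> {g. dist a (site g) \<le> t}"
    then have "norm (site g - a) \<le> t" by (simp add: dist_norm norm_minus_commute)
    then have "\<bar>of_int (fst g) - Re a\<bar> \<le> t" "\<bar>of_int (snd g) - Im a\<bar> \<le> t"
      using abs_Re_le_cmod[of "site g - a"] abs_Im_le_cmod[of "site g - a"] by (auto simp: site_def)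
    then have "Re a - t \<le> of_int (fst g)" "of_int (fst g) \<le> Re a + t"
        "Im a - t \<le> of_int (snd g)" "of_int (snd g) \<le> Im a + t" by linarith+
    then show "g \<in> {\<lfloor>Re a - t\<rfloor>..\<lceil>Re a + t\<rceil>} \<times> {\<lfloor>Im a - t\<rfloor>..\<lceil>Im a + t\<rceil>}"
      by (cases g) (auto simp: floor_le_iff le_ceiling_iff; linarith)
  qed
qed auto

lemma finite_edges: "finite {e. emid e \<in> ball a t}"
proof (rule finite_subset)
  let ?S = "{g. dist a (site g) \<le> t + 1}"
  show "{e. emid e \<in> ball a t} \<subseteq> (\<Union>g\<in>?S. {(True, g), (False, fst g + 1, snd g)})"
  proof
    fix e assume "e \<in> {e. emid e \<in> ball a t}"
    then have "side1 e \<in> ?S"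
      using dist_emid_side(1)[of e] dist_triangle[of a "site (side1 e)" "emid e"] by auto
    then show "e \<in> (\<Union>g\<in>?S. {(True, g), (False, fst g + 1, snd g)})"
      using side1_iff[of e "side1 e"] by blast
  qed
qed (auto simp: finite_sites)

text \<open>Equilibrium potential of the annulus: 1 on the inner disc, 0 outside the outer one,
  harmonic in between. In the continuum its Dirichlet energy 2 pi / ln (t / s) is the least
  possible, so Cauchy--Schwarz against it loses nothing for a single vortex.\<close>

definition log_cut :: "complex \<Rightarrow> real \<Rightarrow> real \<Rightarrow> site \<Rightarrow> real" where
  "log_cut a s t g = (ln t - ln (max s (min t (dist a (site g))))) / ln (t / s)"

lemma log_cut_bounds:
  assumes "0 < s" "s < t"
  shows "0 \<le> log_cut a s t g" "log_cut a s t g \<le> 1"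
    and "dist a (site g) \<le> s \<Longrightarrow> log_cut a s t g = 1"
    and "t \<le> dist a (site g) \<Longrightarrow> log_cut a s t g = 0"
proof -
  let ?m = "max s (min t (dist a (site g)))"
  have m: "s \<le> ?m" "?m \<le> t" using assms by auto
  have L: "0 < ln (t / s)" using assms by simp
  have "ln s \<le> ln ?m" "ln ?m \<le> ln t" using m assms by auto
  moreover have lts: "ln (t / s) = ln t - ln s" using assms by (simp add: ln_div)
  ultimately show "0 \<le> log_cut a s t g" "log_cut a s t g \<le> 1" using L
    by (auto simp: log_cut_def divide_le_eq)
  show "log_cut a s t g = 1" if "dist a (site g) \<le> s"
  proof -
    have "?m = s" using that assms by auto
    then show ?thesis using L lts by (simp add: log_cut_def)
  qed
  show "log_cut a s t g = 0" if "t \<le> dist a (site g)"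
  proof -
    have "?m = t" using that assms by auto
    then show ?thesis by (simp add: log_cut_def)
  qed
qed

lemma abs_ln_clamp_diff:
  assumes "0 < s" "s < t" "0 < x" "0 < y"
  shows "\<bar>ln (max s (min t x)) - ln (max s (min t y))\<bar> \<le> \<bar>ln x - ln (y::real)\<bar>"
proof -
  have *: "ln (max s (min t x)) = max (ln s) (min (ln t) (ln x))" if "0 < x" for x
    using assms that by (auto simp: max_def min_def)
  show ?thesis unfolding *[OF assms(3)] *[OF assms(4)] by (auto simp: max_def min_def)
qed

text \<open>Edges are read as bonds between neighbouring plaquette centres, and \<open>base\<close>
  is the lower or left end. Every edge thus becomes \<open>up g\<close> or \<open>right g\<close> of
  one centre, so a sum over edges becomes a sum over sites of the two forward differences in
  \<open>log_gradient_bound\<close>.\<close>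

fun base :: "edge \<Rightarrow> site" where
  "base (True, i, j) = (i, j - 1)"
| "base (False, i, j) = (i - 1, j)"

definition up :: "site \<Rightarrow> edge" where "up g = (True, fst g, snd g + 1)"
definition right :: "site \<Rightarrow> edge" where "right g = (False, fst g + 1, snd g)"

lemma base_cases: "e = up (base e) \<or> e = right (base e)"
  by (cases e rule: base.cases) (auto simp: up_def right_def)

lemma site_up: "site (side1 (up g)) = site g + \<i>" "side2 (up g) = g"
  by (auto simp: up_def site_def complex_eq_iff side2_iff)

lemma site_right: "site (side2 (right g)) = site g + 1" "side1 (right g) = g"
  by (auto simp: right_def site_def complex_eq_iff side1_iff)

text \<open>Clamping only shrinks differences of logarithms, so each site contributes at most its
  two forward differences of \<open>ln\<close>, and only sites within one unit of the annulus
  contribute; hence \<open>s - 1\<close> and \<open>t + 1\<close>. The power 5 combines the cube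
  from \<open>log_gradient_bound\<close> with the square from \<open>lattice_sum\<close>.\<close>

lemma log_cut_energy:
  assumes th: "0 < th" "th \<le> 1" and s: "6 / th\<^sup>2 + 1 \<le> s" and st: "s < t" and E: "finite E"
  shows "(\<Sum>e\<in>E. (cograd (log_cut a s t) e)\<^sup>2)
     \<le> 2 * pi * (1 + th) ^ 5 * (ln ((t + 1) / (s - 1)) + th) / (ln (t / s))\<^sup>2"
proof -
  let ?r = "\<lambda>g. dist a (site g)"
  let ?F = "\<lambda>e. (cograd (log_cut a s t) e)\<^sup>2"
  define L where "L = ln (t / s)"
  have "th\<^sup>2 \<le> 1" using th by (simp add: power_le_one)
  then have "6 / 1 \<le> 6 / th\<^sup>2" using th by (intro divide_left_mono) auto
  moreover have "th\<^sup>2 \<le> th" using th by (simp add: power2_eq_square mult_le_cancel_left1)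
  then have "6 / th \<le> 6 / th\<^sup>2" using th by (intro divide_left_mono) auto
  ultimately  have s7: "7 \<le> s" "6 / th \<le> s - 1" using s by linarith+
  have Lpos: "0 < L" using st s7 by (simp add: L_def)
  define S where "S = {g \<in> base ` E. s - 1 \<le> ?r g \<and> ?r g < t + 1}"
  have finS: "finite S" using E by (simp add: S_def)
  have near: "\<bar>?r (side1 e) - ?r (base e)\<bar> \<le> 1 \<and> \<bar>?r (side2 e) - ?r (base e)\<bar> \<le> 1" for e
  proof -
    have "dist (site (side1 e)) (site (base e)) \<le> 1 \<and> dist (site (side2 e)) (site (base e)) \<le> 1"
      using base_cases[of e]
    proof
      assume e: "e = up (base e)"
      show ?thesis by (subst (1 3) e, unfold site_up) (simp add: dist_norm)
    next
      assume e: "e = right (base e)"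
      show ?thesis by (subst (1 3) e, unfold site_right) (simp add: dist_norm)
    qed
    then show ?thesis
      using dist_triangle[of a "site (side1 e)" "site (base e)"] dist_triangle[of a "site (base e)" "site (side1 e)"]
        dist_triangle[of a "site (side2 e)" "site (base e)"] dist_triangle[of a "site (base e)" "site (side2 e)"]
      by (auto simp: dist_commute)
  qed
  have supp: "base e \<in> S" if "e \<in> E" "cograd (log_cut a s t) e \<noteq> 0" for e
  proof -
    have "\<not> (?r (side1 e) \<le> s \<and> ?r (side2 e) \<le> s)" "\<not> (t \<le> ?r (side1 e) \<and> t \<le> ?r (side2 e))"
      using that(2) s7 st by (auto simp: cograd_def log_cut_bounds)
    then have "s - 1 \<le> ?r (base e) \<and> ?r (base e) < t + 1" using near[of e] by linarith
    then show ?thesis using that by (simp add: S_def)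
  qed
  have site_bound: "?F (up g) + ?F (right g) \<le> (1 + th) ^ 3 / (?r g)\<^sup>2 / L\<^sup>2" if g: "g \<in> S" for g
  proof -
    define z where "z = site g - a"
    have rz: "?r g = norm z" "?r (side1 (up g)) = norm (z + \<i>)" "?r (side2 (right g)) = norm (z + 1)"
      unfolding site_up site_right z_def by (simp_all add: dist_norm norm_minus_commute algebra_simps)
    have zs: "s - 1 \<le> norm z" using g unfolding S_def rz(1)[symmetric] by simp
    have n: "norm (z + \<i>) \<ge> norm z - 1" "norm (z + 1) \<ge> norm z - 1"
      using norm_triangle_ineq4[of "z + \<i>" \<i>] norm_triangle_ineq4[of "z + 1" 1] by auto
    have pos: "0 < norm z" "0 < norm (z + \<i>)" "0 < norm (z + 1)" using zs s7 n by linarith+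
    have "\<bar>cograd (log_cut a s t) (up g)\<bar> \<le> \<bar>ln (norm (z + \<i>)) - ln (norm z)\<bar> / L"
    proof -
      have "cograd (log_cut a s t) (up g)
         = (ln (max s (min t (norm z))) - ln (max s (min t (norm (z + \<i>))))) / L"
        by (simp add: cograd_def log_cut_def site_up(2) rz L_def diff_divide_distrib)
      then have "\<bar>cograd (log_cut a s t) (up g)\<bar>
         = \<bar>ln (max s (min t (norm (z + \<i>)))) - ln (max s (min t (norm z)))\<bar> / L"
        using Lpos by (simp only: abs_divide abs_of_pos abs_minus_commute)
      also have "\<dots> \<le> \<bar>ln (norm (z + \<i>)) - ln (norm z)\<bar> / L"
        using s7 st pos Lpos by (intro divide_right_mono abs_ln_clamp_diff) auto
      finally show ?thesis .
    qed
    then have "\<bar>cograd (log_cut a s t) (up g)\<bar>\<^sup>2 \<le> (\<bar>ln (norm (z + \<i>)) - ln (norm z)\<bar> / L)\<^sup>2"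
      by (intro power_mono) auto
    then have 1: "?F (up g) \<le> (ln (norm (z + \<i>)) - ln (norm z))\<^sup>2 / L\<^sup>2" by (simp add: power_divide)
    have "\<bar>cograd (log_cut a s t) (right g)\<bar> \<le> \<bar>ln (norm (z + 1)) - ln (norm z)\<bar> / L"
    proof -
      have "cograd (log_cut a s t) (right g)
         = (ln (max s (min t (norm (z + 1)))) - ln (max s (min t (norm z)))) / L"
        by (simp add: cograd_def log_cut_def site_right(2) rz L_def diff_divide_distrib)
      then have "\<bar>cograd (log_cut a s t) (right g)\<bar>
         = \<bar>ln (max s (min t (norm (z + 1)))) - ln (max s (min t (norm z)))\<bar> / L"
        using Lpos by (simp only: abs_divide abs_of_pos)
      also have "\<dots> \<le> \<bar>ln (norm (z + 1)) - ln (norm z)\<bar> / L"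
        using s7 st pos Lpos by (intro divide_right_mono abs_ln_clamp_diff) auto
      finally show ?thesis .
    qed
    then have "\<bar>cograd (log_cut a s t) (right g)\<bar>\<^sup>2 \<le> (\<bar>ln (norm (z + 1)) - ln (norm z)\<bar> / L)\<^sup>2"
      by (intro power_mono) auto
    then have 2: "?F (right g) \<le> (ln (norm (z + 1)) - ln (norm z))\<^sup>2 / L\<^sup>2" by (simp add: power_divide)
    have "6 / th \<le> norm z" using s7 zs by linarith
    from log_gradient_bound[OF this th]
    have "((ln (norm (z + 1)) - ln (norm z))\<^sup>2 + (ln (norm (z + \<i>)) - ln (norm z))\<^sup>2) / L\<^sup>2
       \<le> (1 + th) ^ 3 / (norm z)\<^sup>2 / L\<^sup>2"
      by (intro divide_right_mono) auto
    then show ?thesis unfolding rz(1) using 1 2 by (simp add: add_divide_distrib)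
  qed
  have injs: "inj_on up S" "inj_on right S" by (auto simp: inj_on_def up_def right_def prod_eq_iff)
  have "(\<Sum>e\<in>E. ?F e) = (\<Sum>e\<in>{e\<in>E. cograd (log_cut a s t) e \<noteq> 0}. ?F e)"
    using E by (intro sum.mono_neutral_right) auto
  also have "\<dots> \<le> (\<Sum>e\<in>up ` S \<union> right ` S. ?F e)"
  proof (rule sum_mono2)
    show "{e\<in>E. cograd (log_cut a s t) e \<noteq> 0} \<subseteq> up ` S \<union> right ` S"
    proof
      fix e assume "e \<in> {e\<in>E. cograd (log_cut a s t) e \<noteq> 0}"
      then have "base e \<in> S" using supp by blast
      then show "e \<in> up ` S \<union> right ` S" using base_cases[of e] by blast
    qed
  qed (use finS in auto)
  also have "\<dots> = (\<Sum>e\<in>up ` S. ?F e) + (\<Sum>e\<in>right ` S. ?F e)"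
    using finS by (intro sum.union_disjoint) (auto simp: up_def right_def)
  also have "\<dots> = (\<Sum>g\<in>S. ?F (up g) + ?F (right g))"
    by (simp add: sum.reindex[OF injs(1)] sum.reindex[OF injs(2)] sum.distrib)
  also have "\<dots> \<le> (\<Sum>g\<in>S. (1 + th) ^ 3 / (?r g)\<^sup>2 / L\<^sup>2)" by (intro sum_mono site_bound)
  also have "\<dots> = (1 + th) ^ 3 / L\<^sup>2 * (\<Sum>g\<in>S. 1 / (?r g)\<^sup>2)"
    unfolding sum_distrib_left by (intro sum.cong refl) simp
  also have "\<dots> \<le> (1 + th) ^ 3 / L\<^sup>2 * (2 * pi * (1 + th)\<^sup>2 * (ln ((t + 1) / (s - 1)) + th))"
    using th s st by (intro mult_left_mono lattice_sum finS) (auto simp: S_def)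
  also have "\<dots> = 2 * pi * (1 + th) ^ 5 * (ln ((t + 1) / (s - 1)) + th) / L\<^sup>2"
  proof -
    have "(1 + th) ^ 5 = (1 + th) ^ 3 * (1 + th)\<^sup>2" by (simp flip: power_add)
    then show ?thesis by simp
  qed
  finally show ?thesis unfolding L_def .
qed

text \<open>Summation by parts against the cutoff \<open>log_cut\<close> turns the enclosed degree into a sum over
  edges of the annulus, and Cauchy--Schwarz brings in the energy of the cutoff.\<close>

theorem annulus_energy:
  fixes p :: "edge \<Rightarrow> real" and d :: "site \<Rightarrow> int" and f :: "site \<Rightarrow> real"
  assumes curl: "\<And>g. dist a (site g) \<le> t \<Longrightarrow> ecurl p g = 2 * pi * of_int (d g) - f g"
    and d0: "\<And>g. \<lbrakk>s < dist a (site g); dist a (site g) \<le> t\<rbrakk> \<Longrightarrow> d g = 0"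
    and \<theta>: "0 < \<theta>" "\<theta> \<le> 1" and \<eta>: "0 < \<eta>" "\<eta> \<le> 1/2"
    and s: "6 / (\<eta> * \<theta>)\<^sup>2 + 1 \<le> s" and st: "\<theta> \<le> ln (t / s)" "s < t"
    and f: "(\<Sum>g\<in>{g. dist a (site g) \<le> t}. \<bar>f g\<bar>) \<le> \<eta>"
  shows "2 * pi * (1 - \<eta>) ^ 10 * \<bar>\<Sum>g\<in>{g. dist a (site g) \<le> s}. of_int (d g)\<bar> * ln (t / s)
     \<le> (\<Sum>e\<in>{e. emid e \<in> ball a t - cball a s}. (p e)\<^sup>2)"
proof -
  \<comment> \<open>The additive error \<open>th\<close> of the cutoff energy is at most
    \<open>\<eta> * l\<close> because \<open>\<theta> \<le> l\<close>, so it can be absorbed into a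
    factor \<open>1 + \<eta>\<close>.\<close>
  define th where "th = \<eta> * \<theta>"
  define l where "l = ln (t / s)"
  define D where "D = \<bar>\<Sum>g\<in>{g. dist a (site g) \<le> s}. real_of_int (d g)\<bar>"
  define E where "E = {e. emid e \<in> ball a t - cball a s}"
  define P where "P = (\<Sum>e\<in>E. (p e)\<^sup>2)"
  have P0: "0 \<le> P" by (simp add: P_def sum_nonneg)
  have finE: "finite E" using finite_subset[OF _ finite_edges[of a t], of E] by (auto simp: E_def)
  have th: "0 < th" "th \<le> 1/2" "th \<le> \<eta>" "th \<le> \<eta> * l"
    using \<theta> \<eta> st mult_mono[of \<eta> "1/2" \<theta> 1] mult_left_mono[of \<theta> 1 \<eta>] by (auto simp: th_def l_def)
  have "12 / th \<le> 6 / th\<^sup>2" using th(1,2) by (simp add: power2_eq_square field_simps)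
  then have s12: "12 / th \<le> s - 1" using s by (simp add: th_def)
  have "12 / (1/2) \<le> 12 / th" using th by (intro divide_left_mono) auto
  then have s24: "24 \<le> s" using s12 by simp
  have thetas: "12 \<le> \<theta> * s"
  proof -
    have "12 / th \<le> s" using s12 by linarith
    then have "12 \<le> th * s" using th(1) by (simp add: field_simps)
    also have "\<dots> \<le> \<theta> * s" using \<eta> \<theta> s24 unfolding th_def by (intro mult_right_mono) (auto simp: mult_le_cancel_right1)
    finally show ?thesis .
  qed
  have lpos: "0 < l" using st \<theta> by (simp add: l_def)
  have big: "s + 12 \<le> t"
  proof -
    \<comment> \<open>A ratio with logarithm at least \<open>\<theta>\<close> is at least
      \<open>1 + \<theta>\<close>, and \<open>12 \<le> \<theta> * s\<close>; so the annulus is wide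
      enough for a margin at both ends.\<close>
    have "\<theta> + 1 \<le> exp \<theta>" using exp_ge_add_one_self[of \<theta>] by linarith
    also have "exp \<theta> \<le> exp (ln (t / s))" using st by simp
    also have "\<dots> = t / s" using st s24 by simp
    finally have "(\<theta> + 1) * s \<le> t" using s24 by (subst (asm) pos_le_divide_eq) auto
    then show ?thesis using thetas by (simp add: algebra_simps)
  qed
  \<comment> \<open>The margin 3 puts every edge on which the cutoff varies inside the open annulus
    and makes \<open>(t' + 1) / (s' - 1) \<le> t / s\<close>.\<close>
  define s' t' where "s' = s + 3" and "t' = t - 3"
  have st': "0 < s'" "s' < t'" using big s24 by (auto simp: s'_def t'_def)
  define \<xi> where "\<xi> = log_cut a s' t'"
  define Z where "Z = {g. dist a (site g) \<le> t}"
  have finZ: "finite Z" unfolding Z_def by (rule finite_sites)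
  have \<xi>Z: "\<xi> g = 0" if "g \<notin> Z" for g
    using that st' by (auto simp: \<xi>_def Z_def t'_def intro: log_cut_bounds(4))
  have suppE: "cograd \<xi> e = 0" if "e \<notin> E" for e
  proof -
    have "dist a (emid e) \<le> s \<or> t \<le> dist a (emid e)" using that by (auto simp: E_def)
    then have "(dist a (site (side1 e)) \<le> s' \<and> dist a (site (side2 e)) \<le> s') \<or>
               (t' \<le> dist a (site (side1 e)) \<and> t' \<le> dist a (site (side2 e)))"
      using dist_emid_side[of e] dist_triangle[of a "site (side1 e)" "emid e"]
        dist_triangle[of a "site (side2 e)" "emid e"]
        dist_triangle[of a "emid e" "site (side1 e)"] dist_triangle[of a "emid e" "site (side2 e)"]
      by (auto simp: s'_def t'_def dist_commute)
    then show ?thesis using st' by (auto simp: cograd_def \<xi>_def log_cut_bounds(3,4))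
  qed
  show ?thesis
  proof (cases "D = 0")
    case True
    then show ?thesis using P0 by (simp add: P_def D_def E_def)
  next
    case False
    \<comment> \<open>A nonzero degree sum is an integer, of modulus at least 1. This lets the flux
      error \<open>\<eta>\<close> be absorbed into \<open>2 * pi * D * \<eta>\<close>, and finally
      \<open>D^2\<close> be replaced by \<open>D\<close>.\<close>
    have D1: "1 \<le> D"
    proof -
      have "D = real_of_int \<bar>\<Sum>g\<in>{g. dist a (site g) \<le> s}. d g\<bar>" by (simp add: D_def)
      then show ?thesis using False by (metis int_one_le_iff_zero_less of_int_0 of_int_1_le_iff zero_less_abs_iff of_int_0_eq_iff abs_zero)
    qed
    have sumd: "(\<Sum>g\<in>Z. \<xi> g * of_int (d g)) = (\<Sum>g\<in>{g. dist a (site g) \<le> s}. real_of_int (d g))"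
    proof -
      have "(\<Sum>g\<in>Z. \<xi> g * of_int (d g)) = (\<Sum>g\<in>{g. dist a (site g) \<le> s}. \<xi> g * real_of_int (d g))"
        using finZ d0 st by (intro sum.mono_neutral_right) (auto simp: Z_def)
      also have "\<dots> = (\<Sum>g\<in>{g. dist a (site g) \<le> s}. real_of_int (d g))"
        using st' by (intro sum.cong refl) (simp add: \<xi>_def log_cut_bounds(3) s'_def)
      finally show ?thesis .
    qed
    have sumf: "\<bar>\<Sum>g\<in>Z. \<xi> g * f g\<bar> \<le> \<eta>"
    proof -
      have "\<bar>\<Sum>g\<in>Z. \<xi> g * f g\<bar> \<le> (\<Sum>g\<in>Z. \<bar>\<xi> g * f g\<bar>)" by (rule sum_abs)
      also have "\<dots> \<le> (\<Sum>g\<in>Z. \<bar>f g\<bar>)"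
        using log_cut_bounds(1,2)[OF st']
        by (intro sum_mono) (simp add: \<xi>_def abs_mult mult_left_le_one_le)
      finally show ?thesis using f by (simp add: Z_def)
    qed
    have "(\<Sum>e\<in>E. p e * cograd \<xi> e) = (\<Sum>g\<in>Z. \<xi> g * ecurl p g)"
      by (rule summation_by_parts[symmetric, OF finZ \<xi>Z finE suppE])
    also have "\<dots> = (\<Sum>g\<in>Z. 2 * pi * (\<xi> g * of_int (d g)) - \<xi> g * f g)"
      by (intro sum.cong refl) (simp add: curl Z_def algebra_simps)
    also have "\<dots> = 2 * pi * (\<Sum>g\<in>Z. \<xi> g * of_int (d g)) - (\<Sum>g\<in>Z. \<xi> g * f g)"
      by (simp add: sum_subtractf sum_distrib_left)
    finally have id: "(\<Sum>e\<in>E. p e * cograd \<xi> e) = 2 * pi * (\<Sum>g\<in>Z. \<xi> g * of_int (d g)) - (\<Sum>g\<in>Z. \<xi> g * f g)" .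
    have low: "2 * pi * D * (1 - \<eta>) \<le> \<bar>\<Sum>e\<in>E. p e * cograd \<xi> e\<bar>"
    proof -
      have "2 * pi * D - \<eta> \<le> \<bar>\<Sum>e\<in>E. p e * cograd \<xi> e\<bar>"
        unfolding id sumd using sumf by (auto simp: D_def abs_if split: if_splits)
      moreover have "1 * \<eta> \<le> (2 * pi * D) * \<eta>"
        using D1 pi_gt3 \<eta> mult_mono[of 1 "2 * pi" 1 D] by (intro mult_right_mono) auto
      ultimately show ?thesis by (simp add: algebra_simps)
    qed
    define G where "G = (\<Sum>e\<in>E. (cograd \<xi> e)\<^sup>2)"
    have "(2 * pi * D * (1 - \<eta>))\<^sup>2 \<le> \<bar>\<Sum>e\<in>E. p e * cograd \<xi> e\<bar>\<^sup>2"
      using low D1 \<eta> by (intro power_mono) auto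
    also have "\<dots> \<le> P * G"
      unfolding P_def G_def power2_abs by (rule Cauchy_Schwarz_ineq_sum)
    finally have CS: "(2 * pi * D * (1 - \<eta>))\<^sup>2 \<le> P * G" .
    have Gle: "G \<le> 2 * pi * (1 + \<eta>) ^ 6 * l / (l * (1 - \<eta>))\<^sup>2"
    proof -
      have "G \<le> 2 * pi * (1 + th) ^ 5 * (ln ((t' + 1) / (s' - 1)) + th) / (ln (t' / s'))\<^sup>2"
        unfolding G_def \<xi>_def using th s st' finE
        by (intro log_cut_energy) (auto simp: th_def s'_def)
      also have "\<dots> \<le> 2 * pi * (1 + \<eta>) ^ 5 * (l * (1 + \<eta>)) / (l * (1 - \<eta>))\<^sup>2"
      proof (rule frac_le)
        have "ln ((t' + 1) / (s' - 1)) \<le> l"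
        proof -
          have "(t' + 1) / (s' - 1) \<le> t / s" using s24 big by (intro frac_le) (auto simp: s'_def t'_def)
          moreover have "0 < (t' + 1) / (s' - 1)" using s24 big by (intro divide_pos_pos) (auto simp: s'_def t'_def)
          ultimately show ?thesis by (simp add: l_def)
        qed
        moreover have "0 \<le> ln ((t' + 1) / (s' - 1))"
          using s24 big by (simp add: s'_def t'_def)
        ultimately show "2 * pi * (1 + th) ^ 5 * (ln ((t' + 1) / (s' - 1)) + th) \<le> 2 * pi * (1 + \<eta>) ^ 5 * (l * (1 + \<eta>))"
          using th by (intro mult_mono power_mono) (auto simp: algebra_simps)
        have "l - th \<le> ln (t' / s')"
        proof -
          have e: "ln (t' / s') = l + ln (1 - 3 / t) - ln (1 + 3 / s)"
          proof -
            have "t' = t * (1 - 3 / t)" "s' = s * (1 + 3 / s)" using s24 big by (auto simp: s'_def t'_def field_simps)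
            moreover have "0 < 1 - 3 / t" "0 < 1 + 3 / s" using s24 big by (auto simp: field_simps)
            ultimately show ?thesis using s24 big by (simp add: l_def ln_div ln_mult)
          qed
          have "- (3 / t) - 2 * (3 / t)\<^sup>2 \<le> ln (1 - 3 / t)"
            using s24 big by (intro ln_one_minus_pos_lower_bound) (auto simp: field_simps)
          moreover have "2 * (3 / t)\<^sup>2 \<le> 3 / t" using s24 big by (simp add: power2_eq_square field_simps)
          moreover have "ln (1 + 3 / s) \<le> 3 / s" using s24 by (intro ln_add_one_self_le_self) auto
          moreover have "3 / t \<le> 3 / s" using s24 big by (intro divide_left_mono) auto
          moreover have "9 / s \<le> th"
          proof -
            have "12 / th \<le> s" using s12 by linarith
            then have "12 \<le> th * s" using th(1) by (simp add: field_simps)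
            then show ?thesis using s24 by (simp add: field_simps)
          qed
          ultimately show ?thesis unfolding e by simp
        qed
        then have "l * (1 - \<eta>) \<le> ln (t' / s')" using th by (simp add: algebra_simps)
        then show "(l * (1 - \<eta>))\<^sup>2 \<le> (ln (t' / s'))\<^sup>2" using lpos \<eta> by (intro power_mono) auto
        show "0 < (l * (1 - \<eta>))\<^sup>2" using lpos \<eta> by simp
        show "0 \<le> 2 * pi * (1 + \<eta>) ^ 5 * (l * (1 + \<eta>))" using lpos \<eta> by simp
      qed
      also have "\<dots> = 2 * pi * (1 + \<eta>) ^ 6 * l / (l * (1 - \<eta>))\<^sup>2"
      proof -
        have "(1 + \<eta>) ^ 6 = (1 + \<eta>) ^ 5 * (1 + \<eta>)" by (simp flip: power_Suc2)
        then show ?thesis by simp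
      qed
      finally show ?thesis .
    qed
    have "(2 * pi * D * (1 - \<eta>))\<^sup>2 \<le> P * (2 * pi * (1 + \<eta>) ^ 6 * l / (l * (1 - \<eta>))\<^sup>2)"
      using CS mult_left_mono[OF Gle P0] by linarith
    then have "(2 * pi * D * (1 - \<eta>))\<^sup>2 * (l * (1 - \<eta>))\<^sup>2 \<le> P * (2 * pi * (1 + \<eta>) ^ 6 * l)"
      using lpos \<eta> by (simp add: field_simps)
    moreover have "(2 * pi * D * (1 - \<eta>))\<^sup>2 * (l * (1 - \<eta>))\<^sup>2 = (2 * pi * l) * (2 * pi * D\<^sup>2 * (1 - \<eta>) ^ 4 * l)"
      by (simp add: power_mult_distrib power2_eq_square power4_eq_xxxx)
    ultimately have "(2 * pi * l) * (2 * pi * D\<^sup>2 * (1 - \<eta>) ^ 4 * l) \<le> (2 * pi * l) * (P * (1 + \<eta>) ^ 6)"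
      by (simp add: mult_ac)
    then have A: "2 * pi * D\<^sup>2 * (1 - \<eta>) ^ 4 * l \<le> P * (1 + \<eta>) ^ 6"
      using lpos by (subst (asm) mult_le_cancel_left_pos) auto
    \<comment> \<open>The six factors \<open>1 + \<eta>\<close> are traded for factors
      \<open>1 - \<eta>\<close> on the other side; with the four already present this is the origin
      of the power 10.\<close>
    have one: "(1 + \<eta>) ^ 6 * (1 - \<eta>) ^ 6 \<le> 1"
    proof -
      have "(1 + \<eta>) * (1 - \<eta>) \<le> 1" "0 \<le> (1 + \<eta>) * (1 - \<eta>)" using \<eta> mult_mono[of \<eta> "1/2" \<eta> "1/2"] by (auto simp: algebra_simps)
      then show ?thesis by (metis power_mult_distrib power_le_one)
    qed
    have "2 * pi * (1 - \<eta>) ^ 10 * D * l \<le> 2 * pi * (1 - \<eta>) ^ 10 * D\<^sup>2 * l"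
      using D1 \<eta> lpos by (intro mult_right_mono mult_left_mono) (auto simp: power2_eq_square)
    also have "\<dots> = (2 * pi * D\<^sup>2 * (1 - \<eta>) ^ 4 * l) * (1 - \<eta>) ^ 6"
    proof -
      have "(1 - \<eta>) ^ 10 = (1 - \<eta>) ^ 4 * (1 - \<eta>) ^ 6" by (simp flip: power_add)
      then show ?thesis by simp
    qed
    also have "\<dots> \<le> P * (1 + \<eta>) ^ 6 * (1 - \<eta>) ^ 6" using A \<eta> by (intro mult_right_mono) auto
    also have "\<dots> \<le> P" using mult_left_mono[OF one P0] by (simp add: mult.assoc)
    finally show ?thesis by (simp add: D_def l_def P_def E_def)
  qed
qed

section \<open>The lattice gauge energy of a square\<close>

text \<open>An edge \<open>e\<close> also denotes the bond from \<open>snd e\<close> to \<open>tgt e\<close>, that is, the side shared by the two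
  plaquettes \<open>side1 e\<close> and \<open>side2 e\<close>, once site \<open>(i, j)\<close> is regarded as the lower left corner of
  plaquette \<open>(i, j)\<close>.\<close>

definition tgt :: "edge \<Rightarrow> site" where
  "tgt e = (if fst e then (fst (snd e) + 1, snd (snd e)) else (fst (snd e), snd (snd e) + 1))"

text \<open>The squared difference equals \<open>(r - s)^2 + r * s * (cmod (a - b))^2\<close>, so
  amplitudes bounded below by \<open>c\<close> reduce the energy of a bond to its phase
  difference.\<close>

lemma cmod_scaled_diff:
  fixes a b :: complex
  assumes "cmod a = 1" "cmod b = 1" "0 \<le> c" "c \<le> r" "c \<le> s"
  shows "c\<^sup>2 * (cmod (a - b))\<^sup>2 \<le> (cmod (of_real r * a - of_real s * b))\<^sup>2"
proof -
  have ab: "(Re a)\<^sup>2 + (Im a)\<^sup>2 = 1" "(Re b)\<^sup>2 + (Im b)\<^sup>2 = 1"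
    using assms(1,2) by (auto simp: cmod_power2[symmetric])
  have "(cmod (of_real r * a - of_real s * b))\<^sup>2
      = r\<^sup>2 * ((Re a)\<^sup>2 + (Im a)\<^sup>2) + s\<^sup>2 * ((Re b)\<^sup>2 + (Im b)\<^sup>2) - 2 * r * s * (Re a * Re b + Im a * Im b)"
    unfolding cmod_power2 by (simp add: power2_eq_square algebra_simps)
  also have "\<dots> = (r - s)\<^sup>2 + r * s * (2 - 2 * (Re a * Re b + Im a * Im b))"
    unfolding ab by (simp add: power2_eq_square algebra_simps)
  also have "2 - 2 * (Re a * Re b + Im a * Im b) = (cmod (a - b))\<^sup>2"
  proof -
    have "(cmod (a - b))\<^sup>2 = ((Re a)\<^sup>2 + (Im a)\<^sup>2) + ((Re b)\<^sup>2 + (Im b)\<^sup>2) - 2 * (Re a * Re b + Im a * Im b)"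
      unfolding cmod_power2 by (simp add: power2_eq_square algebra_simps)
    then show ?thesis unfolding ab by simp
  qed
  finally have "(cmod (of_real r * a - of_real s * b))\<^sup>2 = (r - s)\<^sup>2 + r * s * (cmod (a - b))\<^sup>2" .
  moreover have "c\<^sup>2 \<le> r * s" unfolding power2_eq_square using assms by (intro mult_mono) auto
  then have "c\<^sup>2 * (cmod (a - b))\<^sup>2 \<le> r * s * (cmod (a - b))\<^sup>2" by (intro mult_right_mono) auto
  ultimately show ?thesis by (metis add_increasing zero_le_power2)
qed

lemma cos_le_quartic: "cos x \<le> 1 - x\<^sup>2 / 2 + x ^ 4 / (24::real)"
proof -
  obtain t where t: "cos x = (\<Sum>m<4. cos_coeff m * x ^ m) + cos (t + 1/2 * real 4 * pi) / fact 4 * x ^ 4"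
    using Maclaurin_cos_expansion[of x 4] by blast
  have "(\<Sum>m<4. cos_coeff m * x ^ m) = 1 - x\<^sup>2 / 2"
  proof -
    have "{..<4::nat} = {0, 1, 2, 3}" by auto
    then show ?thesis by (simp add: cos_coeff_def fact_numeral)
  qed
  moreover have "cos (t + 1/2 * real 4 * pi) / fact 4 * x ^ 4 \<le> 1 / fact 4 * x ^ 4"
    by (intro mult_right_mono divide_right_mono) auto
  ultimately show ?thesis using t by (simp add: fact_numeral)
qed

lemma cmod_cis_minus_1: "(cmod (cis x - 1))\<^sup>2 = 2 - 2 * cos x"
proof -
  have "(cmod (cis x - 1))\<^sup>2 = ((cos x)\<^sup>2 + (sin x)\<^sup>2) + 1 - 2 * cos x"
    unfolding cmod_power2 by (simp add: power2_eq_square algebra_simps)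
  then show ?thesis by simp
qed

text \<open>\<open>p\<close> is the phase increment along a bond corrected by \<open>\<alpha>\<close> and \<open>d\<close> is the degree around a
  plaquette; \<open>d_curl\<close> shows that the choice defining \<open>d\<close> succeeds.\<close>

locale lattice_gl =
  fixes u :: "site \<Rightarrow> complex" and \<alpha> :: "edge \<Rightarrow> real" and N :: nat and \<eta> :: real
  assumes \<eta>: "0 < \<eta>" "\<eta> \<le> 1/4"
begin

definition V :: "site set" where "V = {0..<int N} \<times> {0..<int N}"
text \<open>Plaquettes whose four corners all lie in \<open>V\<close>; hence the upper limit
  \<open>N - 2\<close>.\<close>

definition V1 :: "site set" where "V1 = {0..int N - 2} \<times> {0..int N - 2}"
definition w :: "edge \<Rightarrow> real" where
  "w e = (cmod (u (tgt e) - cis (\<alpha> e) * u (snd e)))\<^sup>2"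
definition pot :: "site \<Rightarrow> real" where
  "pot g = (1 - (cmod (u g))\<^sup>2)\<^sup>2 / 2"
definition energy :: real where
  "energy = (\<Sum>g\<in>V. w (True, g) + w (False, g) + pot g)"
text \<open>The value 1 at zeros of \<open>u\<close> keeps every phase unimodular, so that
  \<open>cis_p\<close> and the integrality of the degree hold on all edges without
  exception.\<close>

definition dir :: "site \<Rightarrow> complex" where
  "dir g = (if u g = 0 then 1 else sgn (u g))"
definition p :: "edge \<Rightarrow> real" where
  "p e = Arg (dir (tgt e) / (dir (snd e) * cis (\<alpha> e)))"
definition good :: "edge \<Rightarrow> bool" where
  "good e \<longleftrightarrow> 1 - \<eta> \<le> cmod (u (snd e)) \<and> 1 - \<eta> \<le> cmod (u (tgt e)) \<and> \<bar>p e\<bar> \<le> \<eta>"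
definition edges_of :: "site \<Rightarrow> edge set" where
  "edges_of g = {(True, g), (False, fst g + 1, snd g), (True, fst g, snd g + 1), (False, g)}"
definition X0 :: "site set" where
  "X0 = {g\<in>V1. \<exists>e\<in>edges_of g. \<not> good e}"
definition d :: "site \<Rightarrow> int" where
  "d g = (SOME k. ecurl p g + ecurl \<alpha> g = 2 * pi * of_int k)"

lemma finite_V: "finite V" "finite V1" "finite X0"
  by (auto simp: V_def V1_def X0_def)

lemma w_nonneg: "0 \<le> w e" and pot_nonneg: "0 \<le> pot g"
  by (simp_all add: w_def pot_def)

lemma norm_dir [simp]: "cmod (dir g) = 1" "dir g \<noteq> 0"
proof -
  show "cmod (dir g) = 1" by (simp add: dir_def norm_sgn)
  then show "dir g \<noteq> 0" by auto
qed

lemma cis_p: "cis (p e + \<alpha> e) = dir (tgt e) / dir (snd e)"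
proof -
  let ?z = "dir (tgt e) / (dir (snd e) * cis (\<alpha> e))"
  have "cmod ?z = 1" by (simp add: norm_divide norm_mult)
  then have "?z \<noteq> 0" "sgn ?z = ?z" by (auto simp: sgn_div_norm)
  then have "cis (p e) = ?z" unfolding p_def by (simp add: cis_Arg)
  then show ?thesis by (simp add: cis_mult[symmetric] cis_neq_zero)
qed

text \<open>Around a plaquette the ratios of \<open>dir\<close> along the four bonds cancel, so
  exponentiating the total increment gives 1.\<close>

lemma d_curl: "ecurl p g = 2 * pi * of_int (d g) - ecurl \<alpha> g"
proof -
  obtain i j where g: "g = (i, j)" by (cases g)
  define P where "P e = p e + \<alpha> e" for e
  have tot: "ecurl p g + ecurl \<alpha> g = P (True, i, j) + P (False, i + 1, j) - P (True, i, j + 1) - P (False, i, j)"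
    by (simp add: ecurl_def P_def g)
  have "cis (ecurl p g + ecurl \<alpha> g)
      = cis (P (True, i, j)) * cis (P (False, i + 1, j)) / cis (P (True, i, j + 1)) / cis (P (False, i, j))"
    unfolding tot by (simp add: cis_mult cis_divide)
  also have "\<dots> = 1" unfolding P_def cis_p by (simp add: tgt_def)
  finally have "exp (\<i> * of_real (ecurl p g + ecurl \<alpha> g)) = 1" by (simp add: cis_conv_exp)
  then obtain n :: int where "ecurl p g + ecurl \<alpha> g = of_int (2 * n) * pi"
    unfolding exp_eq_1 by auto
  then have "ecurl p g + ecurl \<alpha> g = 2 * pi * of_int n" by simp
  then have "ecurl p g + ecurl \<alpha> g = 2 * pi * of_int (d g)" unfolding d_def by (rule someI)
  then show ?thesis by simp
qed

lemma w_ge_cos: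
  assumes "1 - \<eta> \<le> cmod (u (snd e))" "1 - \<eta> \<le> cmod (u (tgt e))"
  shows "(1 - \<eta>)\<^sup>2 * (2 - 2 * cos (p e)) \<le> w e"
proof -
  have ne: "u (snd e) \<noteq> 0" "u (tgt e) \<noteq> 0" using assms \<eta> by auto
  let ?a = "dir (tgt e)" and ?b = "cis (\<alpha> e) * dir (snd e)"
  have eq: "u (tgt e) = of_real (cmod (u (tgt e))) * ?a" "u (snd e) = of_real (cmod (u (snd e))) * dir (snd e)"
    using ne by (auto simp: dir_def sgn_div_norm scaleR_conv_of_real)
  have "w e = (cmod (of_real (cmod (u (tgt e))) * ?a - of_real (cmod (u (snd e))) * ?b))\<^sup>2"
    unfolding w_def by (subst eq(1), subst eq(2)) (simp add: mult_ac)
  moreover have "(1 - \<eta>)\<^sup>2 * (cmod (?a - ?b))\<^sup>2 \<le> \<dots>"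
    using assms \<eta> by (intro cmod_scaled_diff) (auto simp: norm_mult)
  moreover have "cmod (?a - ?b) = cmod (cis (p e) - 1)"
  proof -
    have "cis (p e) * cis (\<alpha> e) = ?a / dir (snd e)" using cis_p[of e] by (simp add: cis_mult)
    then have "?a = cis (p e) * ?b" by (simp add: field_simps)
    then have "?a - ?b = (cis (p e) - 1) * ?b" by (simp add: algebra_simps)
    then show ?thesis by (simp add: norm_mult)
  qed
  ultimately show ?thesis by (simp add: cmod_cis_minus_1)
qed

text \<open>By the quartic bound for the cosine, \<open>2 - 2 * cos (p e)\<close> is at least
  \<open>(1 - \<eta>)^2 * (p e)^2\<close> for increments up to \<open>\<eta>\<close>; the other two
  factors \<open>1 - \<eta>\<close> come from the amplitudes.\<close>

lemma good_w: "good e \<Longrightarrow> (1 - \<eta>) ^ 4 * (p e)\<^sup>2 \<le> w e"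
proof -
  assume g: "good e"
  have p2: "(p e)\<^sup>2 \<le> \<eta>"
  proof -
    have "\<bar>p e\<bar>\<^sup>2 \<le> \<eta>\<^sup>2" using g by (intro power_mono) (auto simp: good_def)
    also have "\<dots> \<le> \<eta>" using \<eta> by (simp add: power2_eq_square mult_le_cancel_left1)
    finally show ?thesis by simp
  qed
  have "(1 - \<eta>)\<^sup>2 * (p e)\<^sup>2 \<le> (1 - \<eta>) * (p e)\<^sup>2"
    using \<eta> by (intro mult_right_mono) (auto simp: power2_eq_square mult_le_cancel_left2)
  also have "\<dots> \<le> (1 - (p e)\<^sup>2 / 12) * (p e)\<^sup>2"
    using p2 \<eta> by (intro mult_right_mono) auto
  also have "\<dots> \<le> 2 - 2 * cos (p e)"
    using cos_le_quartic[of "p e"] by (simp add: algebra_simps power2_eq_square power4_eq_xxxx)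
  finally have "(1 - \<eta>)\<^sup>2 * ((1 - \<eta>)\<^sup>2 * (p e)\<^sup>2) \<le> (1 - \<eta>)\<^sup>2 * (2 - 2 * cos (p e))"
    by (intro mult_left_mono) auto
  also have "\<dots> \<le> w e" using g by (intro w_ge_cos) (auto simp: good_def)
  finally show ?thesis by (simp add: power4_eq_xxxx power2_eq_square mult.assoc)
qed

text \<open>Either an amplitude drops below \<open>1 - \<eta>\<close> and the potential at that end
  pays, or both amplitudes are large and the phase increment exceeds \<open>\<eta>\<close>, so the
  bond energy pays.\<close>

lemma bad_cost: "\<not> good e \<Longrightarrow> \<eta>\<^sup>2 / 8 \<le> w e + pot (snd e) + pot (tgt e)"
proof -
  assume b: "\<not> good e"
  have vert: "\<eta>\<^sup>2 / 8 \<le> pot g" if "\<not> 1 - \<eta> \<le> cmod (u g)" for g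
  proof -
    have "(cmod (u g))\<^sup>2 \<le> (1 - \<eta>)\<^sup>2" using that by (intro power_mono) auto
    also have "\<dots> \<le> 1 - \<eta>" using \<eta> by (simp add: power2_eq_square mult_le_cancel_left2)
    finally have "\<eta>\<^sup>2 \<le> (1 - (cmod (u g))\<^sup>2)\<^sup>2" using \<eta> by (intro power_mono) auto
    then show ?thesis using zero_le_power2[of \<eta>] unfolding pot_def by linarith
  qed
  show ?thesis
  proof (cases "1 - \<eta> \<le> cmod (u (snd e)) \<and> 1 - \<eta> \<le> cmod (u (tgt e))")
    case False
    then show ?thesis using vert[of "snd e"] vert[of "tgt e"] w_nonneg[of e] pot_nonneg[of "snd e"] pot_nonneg[of "tgt e"]
      by auto
  next
    case True
    then have pe: "\<eta> < \<bar>p e\<bar>" using b by (auto simp: good_def)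
    have ppi: "\<bar>p e\<bar> \<le> pi" unfolding p_def using Arg_bounded[of "dir (tgt e) / (dir (snd e) * cis (\<alpha> e))"] by auto
    have "cos (p e) = cos \<bar>p e\<bar>" by simp
    also have "\<dots> \<le> cos \<eta>" using pe ppi \<eta> by (intro cos_monotone_0_pi_le) auto
    also have "\<dots> \<le> 1 - \<eta>\<^sup>2 / 2 + \<eta> ^ 4 / 24" by (rule cos_le_quartic)
    finally have c1: "\<eta>\<^sup>2 - \<eta> ^ 4 / 12 \<le> 2 - 2 * cos (p e)" by simp
    have "\<eta> ^ 4 \<le> \<eta>\<^sup>2" using \<eta> by (intro power_decreasing) auto
    then have c2: "\<eta>\<^sup>2 / 2 \<le> 2 - 2 * cos (p e)" using c1 zero_le_power2[of \<eta>] by linarith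
    have "(3/4)\<^sup>2 \<le> (1 - \<eta>)\<^sup>2" using \<eta> by (intro power_mono) auto
    then have "(1/4) * (\<eta>\<^sup>2 / 2) \<le> (1 - \<eta>)\<^sup>2 * (2 - 2 * cos (p e))"
      using c2 by (intro mult_mono) (auto simp: power2_eq_square)
    also have "\<dots> \<le> w e" using True by (intro w_ge_cos) auto
    finally show ?thesis using pot_nonneg[of "snd e"] pot_nonneg[of "tgt e"] by auto
  qed
qed

lemma sum_shift_le:
  assumes "\<And>g. 0 \<le> F g" "0 \<le> a" "a \<le> 1" "0 \<le> b" "b \<le> 1"
  shows "(\<Sum>g\<in>V1. F (fst g + a, snd g + b)) \<le> (\<Sum>g\<in>V. F g :: real)"
proof -
  let ?h = "\<lambda>g::site. (fst g + a, snd g + b)"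
  have inj: "inj_on ?h V1" by (auto simp: inj_on_def prod_eq_iff)
  have "(\<Sum>g\<in>V1. F (?h g)) = (\<Sum>g\<in>?h ` V1. F g)" by (simp add: sum.reindex[OF inj])
  also have "\<dots> \<le> (\<Sum>g\<in>V. F g)"
    using assms finite_V by (intro sum_mono2) (auto simp: V_def V1_def)
  finally show ?thesis .
qed

text \<open>Every bad plaquette carries local energy at least \<open>\<eta>^2 / 8\<close>. A bond
  belongs to at most two plaquettes and a site to at most four, so the local energies add up to at
  most \<open>4 * energy\<close>, which gives 32.\<close>

lemma card_X0: "real (card X0) \<le> 32 * energy / \<eta>\<^sup>2"
proof -
  define Loc where "Loc g = w (True, g) + w (False, fst g + 1, snd g) + w (True, fst g, snd g + 1) + w (False, g)
    + (pot g + pot (fst g + 1, snd g) + pot (fst g, snd g + 1) + pot (fst g + 1, snd g + 1))" for g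
  have Loc0: "0 \<le> Loc g" for g unfolding Loc_def by (intro add_nonneg_nonneg w_nonneg pot_nonneg)
  have locX: "\<eta>\<^sup>2 / 8 \<le> Loc g" if gX: "g \<in> X0" for g
  proof -
    obtain e where e: "e \<in> edges_of g" "\<not> good e" using gX by (auto simp: X0_def)
    have b: "\<eta>\<^sup>2 / 8 \<le> w e + pot (snd e) + pot (tgt e)" using bad_cost[OF e(2)] .
    have nn: "0 \<le> w (True, g)" "0 \<le> w (False, fst g + 1, snd g)" "0 \<le> w (True, fst g, snd g + 1)" "0 \<le> w (False, g)"
      "0 \<le> pot g" "0 \<le> pot (fst g + 1, snd g)" "0 \<le> pot (fst g, snd g + 1)" "0 \<le> pot (fst g + 1, snd g + 1)"
      by (auto simp: w_nonneg pot_nonneg)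
    consider "e = (True, g)" | "e = (False, fst g + 1, snd g)" | "e = (True, fst g, snd g + 1)" | "e = (False, g)"
      using e(1) by (auto simp: edges_of_def)
    then show ?thesis
      using b nn by cases (simp_all add: Loc_def tgt_def)
  qed
  have "real (card X0) * (\<eta>\<^sup>2 / 8) = (\<Sum>g\<in>X0. \<eta>\<^sup>2 / 8)" by simp
  also have "\<dots> \<le> (\<Sum>g\<in>X0. Loc g)" by (intro sum_mono locX)
  also have "\<dots> \<le> (\<Sum>g\<in>V1. Loc g)"
    using finite_V Loc0 by (intro sum_mono2) (auto simp: X0_def)
  also have "\<dots> = (\<Sum>g\<in>V1. w (True, g)) + (\<Sum>g\<in>V1. w (False, fst g + 1, snd g))
       + (\<Sum>g\<in>V1. w (True, fst g, snd g + 1)) + (\<Sum>g\<in>V1. w (False, g))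
       + ((\<Sum>g\<in>V1. pot g) + (\<Sum>g\<in>V1. pot (fst g + 1, snd g)) + (\<Sum>g\<in>V1. pot (fst g, snd g + 1))
       + (\<Sum>g\<in>V1. pot (fst g + 1, snd g + 1)))"
    by (simp add: Loc_def sum.distrib)
  also have "\<dots> \<le> 2 * (\<Sum>g\<in>V. w (True, g)) + 2 * (\<Sum>g\<in>V. w (False, g)) + 4 * (\<Sum>g\<in>V. pot g)"
    using sum_shift_le[of "\<lambda>g. w (True, g)" 0 0] sum_shift_le[of "\<lambda>g. w (False, g)" 1 0]
      sum_shift_le[of "\<lambda>g. w (True, g)" 0 1] sum_shift_le[of "\<lambda>g. w (False, g)" 0 0]
      sum_shift_le[of pot 0 0] sum_shift_le[of pot 1 0] sum_shift_le[of pot 0 1] sum_shift_le[of pot 1 1]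
    by (simp add: w_nonneg pot_nonneg)
  also have "\<dots> \<le> 4 * energy"
  proof -
    have "0 \<le> (\<Sum>g\<in>V. w (True, g))" "0 \<le> (\<Sum>g\<in>V. w (False, g))" by (auto intro: sum_nonneg w_nonneg)
    then show ?thesis by (simp add: energy_def sum.distrib)
  qed
  finally show ?thesis using \<eta> by (simp add: field_simps)
qed

lemma side_edges: "e \<in> edges_of (side1 e)" "e \<in> edges_of (side2 e)"
  using side1_iff[of e "side1 e"] side2_iff[of e "side2 e"] by (auto simp: edges_of_def)

lemma good_side: "\<lbrakk>g \<in> V1; g \<notin> X0; e \<in> edges_of g\<rbrakk> \<Longrightarrow> good e"
  by (auto simp: X0_def)

text \<open>Four good increments and a flux of at most 1 add up to at most
  \<open>4 * \<eta> + 1 \<le> 2\<close>, whereas a nonzero degree would force at least 2 pi.\<close>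

lemma d_zero:
  assumes "g \<in> V1" "g \<notin> X0" "\<bar>ecurl \<alpha> g\<bar> \<le> 1"
  shows "d g = 0"
proof (rule ccontr)
  assume "d g \<noteq> 0"
  then have "1 \<le> \<bar>real_of_int (d g)\<bar>" by (metis int_one_le_iff_zero_less of_int_1_le_iff of_int_abs zero_less_abs_iff)
  then have "2 * pi * 1 \<le> 2 * pi * \<bar>real_of_int (d g)\<bar>" by (intro mult_left_mono) auto
  also have "\<dots> = \<bar>ecurl p g + ecurl \<alpha> g\<bar>" by (simp add: d_curl abs_mult)
  also have "\<dots> \<le> 4 * \<eta> + 1"
  proof -
    have "\<bar>p e\<bar> \<le> \<eta>" if "e \<in> edges_of g" for e
      using good_side[OF assms(1,2) that] by (simp add: good_def)
    then have "\<bar>p (True, g)\<bar> \<le> \<eta>" "\<bar>p (False, fst g + 1, snd g)\<bar> \<le> \<eta>"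
      "\<bar>p (True, fst g, snd g + 1)\<bar> \<le> \<eta>" "\<bar>p (False, g)\<bar> \<le> \<eta>" by (auto simp: edges_of_def)
    then show ?thesis using assms(3) unfolding ecurl_def by linarith
  qed
  also have "\<dots> \<le> 2" using \<eta> by simp
  finally show False using pi_gt3 by simp
qed

end

section \<open>The ball construction on the lattice\<close>

locale lattice_gl_flux = lattice_gl +
  fixes \<theta> T :: real
  assumes \<theta>: "0 < \<theta>" "\<theta> \<le> 1" and T: "6 / (\<eta> * \<theta>)\<^sup>2 + 1 \<le> T"
    and flux1: "g \<in> V1 \<Longrightarrow> \<bar>ecurl \<alpha> g\<bar> \<le> 1"
begin

definition mu :: "complex set \<Rightarrow> real" where
  "mu S = (\<Sum>e\<in>{e \<in> UNIV \<times> V. emid e \<in> S}. w e)"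
definition sites_in :: "complex set \<Rightarrow> site set" where
  "sites_in S = {g\<in>V1. site g \<in> S}"
definition Dom :: "complex set" where
  "Dom = {z. 0 \<le> Re z \<and> Re z \<le> real N - 2 \<and> 0 \<le> Im z \<and> Im z \<le> real N - 2}"
text \<open>The degree is only counted in sets with little flux, where it is controlled by the energy.\<close>
definition q :: "complex set \<Rightarrow> real" where
  "q S = (if S \<subseteq> Dom \<and> (\<Sum>g\<in>sites_in S. \<bar>ecurl \<alpha> g\<bar>) \<le> \<eta> then \<bar>\<Sum>g\<in>sites_in S. real_of_int (d g)\<bar> else 0)"

lemma finite_sites_in [simp]: "finite (sites_in S)"
  using finite_V by (simp add: sites_in_def)

lemma finite_EE: "finite (UNIV \<times> V :: edge set)"
  using finite_V by simp

lemma site_Dom: "site g \<in> Dom \<Longrightarrow> g \<in> V1"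
  by (cases g) (auto simp: site_def Dom_def V1_def)

lemma mu_le_energy: "mu S \<le> energy"
proof -
  have "mu S \<le> (\<Sum>e\<in>UNIV \<times> V. w e)"
    unfolding mu_def using finite_EE w_nonneg by (intro sum_mono2) auto
  also have "\<dots> = (\<Sum>g\<in>V. w (True, g)) + (\<Sum>g\<in>V. w (False, g))"
  proof -
    have "(\<Sum>e\<in>UNIV \<times> V. w e) = (\<Sum>b\<in>UNIV. \<Sum>g\<in>V. w (b, g))" by (simp add: sum.cartesian_product)
    then show ?thesis by (simp add: UNIV_bool)
  qed
  also have "\<dots> \<le> energy"
    using sum_nonneg[of V pot] pot_nonneg by (simp add: energy_def sum.distrib)
  finally show ?thesis .
qed

lemma d_sum_X0:
  "(\<Sum>g\<in>sites_in S. real_of_int (d g)) = (\<Sum>g\<in>{g\<in>X0. site g \<in> S}. real_of_int (d g))"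
proof (rule sum.mono_neutral_right)
  show "{g\<in>X0. site g \<in> S} \<subseteq> sites_in S" by (auto simp: sites_in_def X0_def)
  show "\<forall>g\<in>sites_in S - {g\<in>X0. site g \<in> S}. real_of_int (d g) = 0"
    using d_zero flux1 by (auto simp: sites_in_def)
qed simp

lemma edges_of_EE: "g \<in> V1 \<Longrightarrow> e \<in> edges_of g \<Longrightarrow> e \<in> UNIV \<times> V"
  by (cases g) (auto simp: edges_of_def V1_def V_def)

text \<open>The annulus estimate is applied between \<open>s + 1\<close> and \<open>t - 1\<close>,
  so that all edges used belong to good plaquettes. Shrinking costs one \<open>\<theta>\<close>; a
  second one ensures that the remaining logarithm is at least \<open>\<theta>\<close>, as
  \<open>annulus_energy\<close> requires. The power 14 is 10 from that theorem and 4 from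
  \<open>good_w\<close>.\<close>

lemma growth_locale:
  "disc_growth mu q (site ` X0) T (2 * pi * (1 - \<eta>) ^ 14) (2 * \<theta>)"
proof
  show "0 \<le> mu S" for S by (simp add: mu_def sum_nonneg w_nonneg)
  show "mu (A \<union> B) = mu A + mu B" if "A \<inter> B = {}" for A B
  proof -
    have "{e \<in> UNIV \<times> V. emid e \<in> A \<union> B} = {e \<in> UNIV \<times> V. emid e \<in> A} \<union> {e \<in> UNIV \<times> V. emid e \<in> B}" by auto
    then show ?thesis unfolding mu_def
      using that finite_EE by (simp only:) (intro sum.union_disjoint; auto)
  qed
  show q0: "0 \<le> q S" for S by (simp add: q_def)
  show "0 \<le> 2 * pi * (1 - \<eta>) ^ 14" using \<eta> by simp
  show "0 \<le> 2 * \<theta>" using \<theta> by simp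
  have "0 \<le> 6 / (\<eta> * \<theta>)\<^sup>2" by simp
  then show "0 < T" using T by linarith
  show "q C \<le> (\<Sum>p\<in>G. q (cb p))"
    if G: "finite G" "\<And>p p'. \<lbrakk>p \<in> G; p' \<in> G; p \<noteq> p'\<rbrakk> \<Longrightarrow> site ` X0 \<inter> cb p \<inter> cb p' = {}"
      "\<And>p. p \<in> G \<Longrightarrow> cb p \<subseteq> C" "site ` X0 \<inter> C \<subseteq> (\<Union>p\<in>G. cb p)" for C and G :: "cdisc set"
  \<comment> \<open>Being counted passes to subsets; if \<open>C\<close> itself is not counted then
    \<open>q C = 0\<close>.\<close>
  proof (cases "C \<subseteq> Dom \<and> (\<Sum>g\<in>sites_in C. \<bar>ecurl \<alpha> g\<bar>) \<le> \<eta>")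
    case False
    then show ?thesis using q0 by (auto simp: q_def intro!: sum_nonneg)
  next
    case True
    have qp: "q (cb p) = \<bar>\<Sum>g\<in>sites_in (cb p). real_of_int (d g)\<bar>" if p: "p \<in> G" for p
    proof -
      have "(\<Sum>g\<in>sites_in (cb p). \<bar>ecurl \<alpha> g\<bar>) \<le> (\<Sum>g\<in>sites_in C. \<bar>ecurl \<alpha> g\<bar>)"
        using G(3)[OF p] finite_V by (intro sum_mono2) (auto simp: sites_in_def)
      then show ?thesis using True G(3)[OF p] by (auto simp: q_def)
    qed
    have "{g\<in>X0. site g \<in> C} = (\<Union>p\<in>G. {g\<in>X0. site g \<in> cb p})" using G(3,4) by blast
    then have "(\<Sum>g\<in>sites_in C. real_of_int (d g)) = (\<Sum>g\<in>(\<Union>p\<in>G. {g\<in>X0. site g \<in> cb p}). real_of_int (d g))"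
      unfolding d_sum_X0 by simp
    also have "\<dots> = (\<Sum>p\<in>G. \<Sum>g\<in>{g\<in>X0. site g \<in> cb p}. real_of_int (d g))"
    proof (rule sum.UNION_disjoint)
      show "\<forall>i\<in>G. \<forall>j\<in>G. i \<noteq> j \<longrightarrow> {g \<in> X0. site g \<in> cb i} \<inter> {g \<in> X0. site g \<in> cb j} = {}"
        using G(2) by blast
    qed (use G(1) finite_V in auto)
    also have "\<dots> = (\<Sum>p\<in>G. \<Sum>g\<in>sites_in (cb p). real_of_int (d g))" by (simp only: d_sum_X0)
    finally have "q C = \<bar>\<Sum>p\<in>G. \<Sum>g\<in>sites_in (cb p). real_of_int (d g)\<bar>" using True by (simp add: q_def)
    also have "\<dots> \<le> (\<Sum>p\<in>G. \<bar>\<Sum>g\<in>sites_in (cb p). real_of_int (d g)\<bar>)" by (rule sum_abs)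
    also have "\<dots> = (\<Sum>p\<in>G. q (cb p))" using qp by (intro sum.cong) auto
    finally show ?thesis .
  qed
  show "2 * pi * (1 - \<eta>) ^ 14 * q (cball a t) * (ln (t / s) - 2 * \<theta>) \<le> mu (ball a t - cball a s)"
    if st: "T \<le> s" "s < t" and X: "site ` X0 \<inter> cball a t \<subseteq> cball a s" for a s t
  proof (cases "2 * \<theta> < ln (t / s) \<and> cball a t \<subseteq> Dom \<and> (\<Sum>g\<in>sites_in (cball a t). \<bar>ecurl \<alpha> g\<bar>) \<le> \<eta>")
    case False
    have "2 * pi * (1 - \<eta>) ^ 14 * q (cball a t) * (ln (t / s) - 2 * \<theta>) \<le> 0"
    proof (cases "2 * \<theta> < ln (t / s)")
      case True
      then have "q (cball a t) = 0" using False by (auto simp: q_def)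
      then show ?thesis by simp
    next
      case F: False
      then show ?thesis using q0 \<eta> by (intro mult_nonneg_nonpos) auto
    qed
    also have "0 \<le> mu (ball a t - cball a s)" by (simp add: mu_def sum_nonneg w_nonneg)
    finally show ?thesis .
  next
    case True
    define th where "th = \<eta> * \<theta>"
    have th: "0 < th" "th \<le> \<theta>" "th \<le> 1/4"
      using \<eta> \<theta> mult_mono[of \<eta> "1/4" \<theta> 1] by (auto simp: th_def mult_left_le_one_le)
    have "24 / th \<le> 6 / th\<^sup>2" using th by (simp add: power2_eq_square field_simps)
    moreover have "24 / \<theta> \<le> 24 / th" using th \<theta> by (intro divide_left_mono) auto
    moreover have "24 / 1 \<le> 24 / \<theta>" using \<theta> by (intro divide_left_mono) auto
    ultimately have s24: "24 / \<theta> \<le> s" "24 \<le> s" using T st by (auto simp: th_def)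
    have s3: "3 / s \<le> \<theta>"
    proof -
      have "24 \<le> s * \<theta>" using s24 \<theta> by (simp add: pos_divide_le_eq)
      then show ?thesis using s24 by (simp add: pos_divide_le_eq mult.commute)
    qed
    have lnst: "ln (t / s) - 3 / s \<le> ln ((t - 1) / (s + 1))"
    proof -
      have "t - 1 = t * (1 - 1 / t)" "s + 1 = s * (1 + 1 / s)" "0 < 1 - 1 / t" "0 < 1 + 1 / s"
        using s24 st by (auto simp: field_simps)
      then have e: "ln ((t - 1) / (s + 1)) = ln (t / s) + ln (1 - 1 / t) - ln (1 + 1 / s)"
        using s24 st by (simp add: ln_div ln_mult)
      have "- (1 / t) - 2 * (1 / t)\<^sup>2 \<le> ln (1 - 1 / t)"
        using s24 st by (intro ln_one_minus_pos_lower_bound) (auto simp: field_simps)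
      moreover have "2 * (1 / t)\<^sup>2 \<le> 1 / t" using s24 st by (simp add: power2_eq_square field_simps)
      moreover have "1 / t \<le> 1 / s" using s24 st by (intro divide_left_mono) auto
      moreover have "ln (1 + 1 / s) \<le> 1 / s" using s24 by (intro ln_add_one_self_le_self) auto
      ultimately show ?thesis unfolding e by simp
    qed
    then have ln1: "ln (t / s) - \<theta> \<le> ln ((t - 1) / (s + 1))" using s3 by linarith
    then have ln2: "\<theta> \<le> ln ((t - 1) / (s + 1))" using True by linarith
    have st1: "s + 1 < t - 1"
    proof (rule ccontr)
      assume "\<not> s + 1 < t - 1"
      then have "(t - 1) / (s + 1) \<le> 1" "0 < (t - 1) / (s + 1)" using s24 st by auto
      then have "ln ((t - 1) / (s + 1)) \<le> 0" by (subst ln_le_zero_iff)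
      then show False using ln2 \<theta> by simp
    qed
    have inV: "g \<in> V1" if "dist a (site g) \<le> t" for g
      using that True by (intro site_Dom) (auto simp: subset_eq)
    have notX: "g \<notin> X0" if "dist a (site g) \<le> t" "s < dist a (site g)" for g
    proof
      assume "g \<in> X0"
      then have "site g \<in> site ` X0 \<inter> cball a t" using that by auto
      then have "site g \<in> cball a s" using X by blast
      then show False using that by simp
    qed
    have dz: "d g = 0" if "dist a (site g) \<le> t" "s < dist a (site g)" for g
      using inV[OF that(1)] notX[OF that] flux1 by (intro d_zero) auto
    have fl: "(\<Sum>g\<in>{g. dist a (site g) \<le> t - 1}. \<bar>ecurl \<alpha> g\<bar>) \<le> \<eta>"
    proof -
      have "(\<Sum>g\<in>{g. dist a (site g) \<le> t - 1}. \<bar>ecurl \<alpha> g\<bar>) \<le> (\<Sum>g\<in>sites_in (cball a t). \<bar>ecurl \<alpha> g\<bar>)"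
        using inV finite_V by (intro sum_mono2) (auto simp: sites_in_def)
      then show ?thesis using True by linarith
    qed
    let ?A = "{e. emid e \<in> ball a (t - 1) - cball a (s + 1)}"
    have ann: "2 * pi * (1 - \<eta>) ^ 10 * \<bar>\<Sum>g\<in>{g. dist a (site g) \<le> s + 1}. real_of_int (d g)\<bar> * ln ((t - 1) / (s + 1))
       \<le> (\<Sum>e\<in>?A. (p e)\<^sup>2)"
    proof (rule annulus_energy[where f = "ecurl \<alpha>" and \<theta> = \<theta>])
      show "d g = 0" if "s + 1 < dist a (site g)" "dist a (site g) \<le> t - 1" for g
        using that by (intro dz) auto
    qed (use d_curl \<theta> \<eta> T st ln2 st1 fl in auto)
    have qe: "\<bar>\<Sum>g\<in>{g. dist a (site g) \<le> s + 1}. real_of_int (d g)\<bar> = q (cball a t)"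
    proof -
      have "(\<Sum>g\<in>sites_in (cball a t). real_of_int (d g)) = (\<Sum>g\<in>{g. dist a (site g) \<le> s + 1}. real_of_int (d g))"
        using inV st1 dz finite_V by (intro sum.mono_neutral_right) (auto simp: sites_in_def)
      then show ?thesis using True by (simp add: q_def)
    qed
    \<comment> \<open>The plaquette \<open>side1 e\<close> has its centre within 1/2 of the midpoint
      of \<open>e\<close>, hence between radii \<open>s\<close> and \<open>t\<close>, where no
      plaquette is bad.\<close>
    have Agood: "good e \<and> e \<in> UNIV \<times> V" if "e \<in> ?A" for e
    proof -
      have "dist a (site (side1 e)) \<le> t" "s < dist a (site (side1 e))"
        using that dist_emid_side(1)[of e] dist_triangle[of a "site (side1 e)" "emid e"]
          dist_triangle[of a "emid e" "site (side1 e)"] by (auto simp: dist_commute)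
      then have "side1 e \<in> V1" "side1 e \<notin> X0" using inV notX by auto
      then show ?thesis using good_side edges_of_EE side_edges(1)[of e] by blast
    qed
    have finA: "finite ?A" using finite_subset[OF _ finite_edges[of a "t - 1"], of ?A] by auto
    have "(1 - \<eta>) ^ 4 * (\<Sum>e\<in>?A. (p e)\<^sup>2) \<le> (\<Sum>e\<in>?A. w e)"
      unfolding sum_distrib_left using Agood by (intro sum_mono good_w) auto
    also have "\<dots> \<le> mu (ball a t - cball a s)"
      unfolding mu_def using Agood w_nonneg finite_EE by (intro sum_mono2) auto
    finally have wm: "(1 - \<eta>) ^ 4 * (\<Sum>e\<in>?A. (p e)\<^sup>2) \<le> mu (ball a t - cball a s)" .
    have "2 * pi * (1 - \<eta>) ^ 14 * q (cball a t) * (ln (t / s) - 2 * \<theta>)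
        \<le> 2 * pi * (1 - \<eta>) ^ 14 * q (cball a t) * ln ((t - 1) / (s + 1))"
      using ln1 \<theta> \<eta> q0 by (intro mult_left_mono) auto
    also have "\<dots> = (1 - \<eta>) ^ 4 * (2 * pi * (1 - \<eta>) ^ 10 * q (cball a t) * ln ((t - 1) / (s + 1)))"
    proof -
      have "(1 - \<eta>) ^ 14 = (1 - \<eta>) ^ 4 * (1 - \<eta>) ^ 10" by (simp flip: power_add)
      then show ?thesis by simp
    qed
    also have "\<dots> \<le> (1 - \<eta>) ^ 4 * (\<Sum>e\<in>?A. (p e)\<^sup>2)"
      using ann unfolding qe using \<eta> by (intro mult_left_mono) auto
    also note wm
    finally show ?thesis .
  qed
qed

section \<open>Nested squares and their boundaries\<close>

definition depth :: "complex \<Rightarrow> real" where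
  "depth z = min (min (Re z) (Im z)) (min (real N - 2 - Re z) (real N - 2 - Im z))"

lemma depth_lipschitz: "\<bar>depth z - depth z'\<bar> \<le> dist z z'"
proof -
  have "\<bar>Re z - Re z'\<bar> \<le> dist z z'" "\<bar>Im z - Im z'\<bar> \<le> dist z z'"
    using abs_Re_le_cmod[of "z - z'"] abs_Im_le_cmod[of "z - z'"] by (auto simp: dist_norm)
  then show ?thesis unfolding depth_def by (auto simp: min_def abs_if split: if_splits)
qed

lemma depth_Dom: "0 \<le> depth z \<Longrightarrow> z \<in> Dom"
  by (auto simp: depth_def Dom_def)

text \<open>Superlevel set of \<open>depth\<close> among the sites. Since \<open>depth\<close> is
  1-Lipschitz, a disc can be compared with a level through its centre and radius alone.\<close>

definition inner :: "int \<Rightarrow> site set" where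
  "inner k = {k..int N - 2 - k} \<times> {k..int N - 2 - k}"

lemma inner_iff: "g \<in> inner k \<longleftrightarrow> of_int k \<le> depth (site g)"
proof -
  obtain i j where g: "g = (i, j)" by (cases g)
  have "depth (site g) = real_of_int (min (min i j) (min (int N - 2 - i) (int N - 2 - j)))"
    by (simp add: depth_def site_def g of_int_min)
  then have "of_int k \<le> depth (site g) \<longleftrightarrow> k \<le> min (min i j) (min (int N - 2 - i) (int N - 2 - j))"
    by (simp only: of_int_le_iff)
  then show ?thesis by (auto simp: inner_def g)
qed

lemma inner_V1: "0 \<le> k \<Longrightarrow> inner k \<subseteq> V1"
  by (auto simp: inner_def V1_def)

definition bd :: "int \<Rightarrow> edge set" where
  "bd k = {e. cograd (indicator (inner k)) e \<noteq> 0}"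

lemma bd_iff: "e \<in> bd k \<longleftrightarrow> (side1 e \<in> inner k \<longleftrightarrow> side2 e \<notin> inner k)"
  by (auto simp: bd_def cograd_def indicator_def)

lemma dist_sides: "dist (site (side1 e)) (site (side2 e)) \<le> 1"
  using dist_emid_side[of e] dist_triangle[of "site (side1 e)" "site (side2 e)" "emid e"]
  by (simp add: dist_commute)

lemma bd_depth:
  assumes "e \<in> bd k"
  shows "\<bar>depth (site (side1 e)) - of_int k\<bar> \<le> 1" "\<bar>depth (site (side2 e)) - of_int k\<bar> \<le> 1"
  using assms depth_lipschitz[of "site (side1 e)" "site (side2 e)"] dist_sides[of e]
  unfolding bd_iff inner_iff by linarith+

lemma depth_int: "depth (site g) \<in> \<int>"
proof -
  obtain i j where g: "g = (i, j)" by (cases g)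
  have "depth (site g) = real_of_int (min (min i j) (min (int N - 2 - i) (int N - 2 - j)))"
    by (simp add: depth_def site_def g of_int_min)
  then show ?thesis by (simp only: Ints_of_int)
qed

text \<open>\<open>depth\<close> is an integer at every site and changes by at most 1 along an edge,
  so an edge crosses at most one level. Disjointness makes the boundary energies of different levels
  add up to at most the whole.\<close>

lemma bd_disjoint:
  assumes "k \<noteq> k'" shows "bd k \<inter> bd k' = {}"
proof (rule ccontr)
  assume "bd k \<inter> bd k' \<noteq> {}"
  then obtain e where e: "e \<in> bd k" "e \<in> bd k'" by blast
  obtain m1 m2 where m: "depth (site (side1 e)) = of_int m1" "depth (site (side2 e)) = of_int m2"
    using depth_int by (metis Ints_cases)
  have "\<bar>m1 - m2\<bar> \<le> 1"
    using depth_lipschitz[of "site (side1 e)" "site (side2 e)"] dist_sides[of e] unfolding m by linarith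
  moreover have "(k \<le> m1) \<noteq> (k \<le> m2)" "(k' \<le> m1) \<noteq> (k' \<le> m2)"
    using e unfolding bd_iff inner_iff m by auto
  ultimately show False using assms by linarith
qed

lemma bd_subset:
  "bd k \<subseteq> (\<Union>i\<in>{k..int N - 2 - k}. {(True, i, k), (True, i, int N - 1 - k), (False, k, i), (False, int N - 1 - k, i)})"
proof
  fix e assume e: "e \<in> bd k"
  show "e \<in> (\<Union>i\<in>{k..int N - 2 - k}. {(True, i, k), (True, i, int N - 1 - k), (False, k, i), (False, int N - 1 - k, i)})"
    using e unfolding bd_iff by (cases e rule: side1.cases) (auto simp: inner_def)
qed

lemma finite_bd: "finite (bd k)"
  by (rule finite_subset[OF bd_subset]) auto

lemma card_bd: "0 \<le> k \<Longrightarrow> real (card (bd k)) \<le> 4 * real N"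
proof -
  assume k: "0 \<le> k"
  let ?I = "{k..int N - 2 - k}"
  let ?S = "\<lambda>i. {(True, i, k), (True, i, int N - 1 - k), (False, k, i), (False, int N - 1 - k, i)} :: edge set"
  have "card (bd k) \<le> card (\<Union>i\<in>?I. ?S i)" by (intro card_mono bd_subset) auto
  also have "\<dots> \<le> (\<Sum>i\<in>?I. card (?S i))" by (intro card_UN_le) auto
  also have "\<dots> \<le> (\<Sum>i\<in>?I. 4)" by (intro sum_mono) (simp add: card_insert_if)
  also have "\<dots> \<le> 4 * N" using k by simp
  finally show ?thesis by linarith
qed

text \<open>Among the nested squares \<open>inner k\<close> with \<open>K \<le> k < 2 K\<close>, at least half have a boundary that stays
  away from the final discs, and one of these has a boundary of small energy. Its circulation is
  negligible, so its flux is carried by the degrees of the discs inside.\<close>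

theorem vorticity_bound:
  fixes R :: real and K :: int
  assumes \<rho>: "(card X0 + 1) * T \<le> R" and R: "10 * R \<le> of_int K"
    and flux: "\<And>a r. r \<le> R \<Longrightarrow> (\<Sum>g\<in>sites_in (cball a r). \<bar>ecurl \<alpha> g\<bar>) \<le> \<eta>"
  shows "\<exists>k Q. K \<le> k \<and> k < 2 * K \<and> 0 \<le> Q \<and>
     2 * pi * (1 - \<eta>) ^ 14 * (ln (R / ((card X0 + 1) * T)) - card X0 * (2 * \<theta>)) * Q \<le> energy \<and>
     (\<Sum>g\<in>inner k. ecurl \<alpha> g) - sqrt (8 * N * energy / (of_int K * (1 - \<eta>) ^ 4)) \<le> 2 * pi * Q"
proof -
  interpret disc_growth mu q "site ` X0" T "2 * pi * (1 - \<eta>) ^ 14" "2 * \<theta>" by (rule growth_locale)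
  have T1: "1 \<le> T"
  proof -
    have "0 \<le> 6 / (\<eta> * \<theta>)\<^sup>2" by simp
    then show ?thesis using T by linarith
  qed
  define F0 where "F0 = (\<lambda>g. (site g, T)) ` X0"
  have finF0: "finite F0" using finite_V by (simp add: F0_def)
  have inj: "inj_on (\<lambda>g. (site g, T)) X0" using inj_site by (auto simp: inj_on_def inj_def)
  have cardF0: "card F0 = card X0" unfolding F0_def by (rule card_image[OF inj])
  have sumF0: "(\<Sum>p\<in>F0. snd p) = card X0 * T" unfolding F0_def sum.reindex[OF inj] by simp
  obtain F where F: "disc_family T F" "(\<Sum>p\<in>F. snd p) \<le> (\<Sum>p\<in>F0. snd p)" "card F \<le> card F0"
      "\<forall>p\<in>F0. \<exists>p'\<in>F. cb p \<subseteq> cb p'"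
    using merge_discs[of F0 T] finF0 T1 by (auto simp: F0_def)
  have XF: "site ` X0 \<subseteq> (\<Union>p\<in>F. cb p)"
  proof
    fix x assume "x \<in> site ` X0"
    then obtain g where g: "g \<in> X0" "x = site g" by blast
    then obtain p' where p': "p' \<in> F" "cb (site g, T) \<subseteq> cb p'" using F(4) by (auto simp: F0_def)
    have "x \<in> cb (site g, T)" using g T1 by simp
    then show "x \<in> (\<Union>p\<in>F. cb p)" using p' by blast
  qed
  \<comment> \<open>The extra 1 keeps the starting total positive when there are no bad
    plaquettes.\<close>
  define \<rho>0 where "\<rho>0 = (card X0 + 1) * T"
  have r0: "0 < \<rho>0" "(\<Sum>p\<in>F. snd p) \<le> \<rho>0" "\<rho>0 \<le> R"
    using T1 F(2) sumF0 \<rho> by (auto simp: \<rho>0_def algebra_simps intro: add_pos_nonneg)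
  obtain F' where F': "disc_family T F'" "(\<Sum>p\<in>F'. snd p) \<le> R" "\<forall>p\<in>F. \<exists>p'\<in>F'. cb p \<subseteq> cb p'"
     "2 * pi * (1 - \<eta>) ^ 14 * (ln (R / \<rho>0) - card F * (2 * \<theta>)) * (\<Sum>p\<in>F'. q (cb p))
        \<le> mu ((\<Union>p\<in>F'. cb p) - (\<Union>p\<in>F. cb p))"
    using growth[OF F(1) XF r0(2,1,3)] by auto
  define Q where "Q = (\<Sum>p\<in>F'. q (cb p))"
  have Q0: "0 \<le> Q" unfolding Q_def by (intro sum_nonneg q_nonneg)
  have en: "2 * pi * (1 - \<eta>) ^ 14 * (ln (R / \<rho>0) - card X0 * (2 * \<theta>)) * Q \<le> energy"
  proof -
    have "real (card F) * (2 * \<theta>) \<le> card X0 * (2 * \<theta>)" using F(3) cardF0 \<theta> by simp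
    then have "2 * pi * (1 - \<eta>) ^ 14 * (ln (R / \<rho>0) - card X0 * (2 * \<theta>)) * Q
       \<le> 2 * pi * (1 - \<eta>) ^ 14 * (ln (R / \<rho>0) - card F * (2 * \<theta>)) * Q"
      using \<eta> Q0 by (intro mult_right_mono mult_left_mono) auto
    also have "\<dots> \<le> energy" using F'(4) mu_le_energy order_trans unfolding Q_def by blast
    finally show ?thesis .
  qed
  have finF': "finite F'" and TF': "\<And>p. p \<in> F' \<Longrightarrow> T \<le> snd p" using F'(1) by (auto simp: disc_family_def)
  have XF': "site ` X0 \<subseteq> (\<Union>p\<in>F'. cb p)" using XF F'(3) by blast
  have T0: "0 < T" using T1 by simp
  have rR: "snd p \<le> R" if "p \<in> F'" for p
  proof -
    have "snd p \<le> (\<Sum>p\<in>F'. snd p)"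
      using that finF' TF' T0 by (intro member_le_sum) (auto intro: order_trans[OF less_imp_le])
    then show ?thesis using F'(2) by linarith
  qed
  have K0: "0 < K" using R r0 by (metis of_int_0_less_iff less_le_trans mult_pos_pos zero_less_numeral)
  \<comment> \<open>Levels spoiled by a disc, with one unit of slack for the length of an edge. A
    disc spoils at most \<open>5 * snd p\<close> levels, so all discs together spoil at most
    \<open>5 * R\<close>, half of the \<open>K\<close> available ones.\<close>
  define bad where "bad p = {k::int. \<bar>depth (fst p) - of_int k\<bar> \<le> snd p + 1}" for p :: cdisc
  have cardbad: "finite (bad p) \<and> real (card (bad p)) \<le> 5 * snd p" if "p \<in> F'" for p
  proof -
    have sub: "bad p \<subseteq> {\<lceil>depth (fst p) - snd p - 1\<rceil>..\<lfloor>depth (fst p) + snd p + 1\<rfloor>}"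
    proof
      fix k assume "k \<in> bad p"
      then have "depth (fst p) - snd p - 1 \<le> of_int k" "of_int k \<le> depth (fst p) + snd p + 1"
        by (auto simp: bad_def abs_le_iff)
      then show "k \<in> {\<lceil>depth (fst p) - snd p - 1\<rceil>..\<lfloor>depth (fst p) + snd p + 1\<rfloor>}"
        by (intro atLeastAtMost_iff[THEN iffD2] conjI ceiling_le le_floor_iff[THEN iffD2])
    qed
    have "real (card (bad p)) \<le> real (card {\<lceil>depth (fst p) - snd p - 1\<rceil>..\<lfloor>depth (fst p) + snd p + 1\<rfloor>})"
      by (rule of_nat_mono, rule card_mono[OF _ sub]) simp
    also have "\<dots> \<le> 2 * snd p + 3" using TF'[OF that] T1 by simp linarith
    also have "\<dots> \<le> 5 * snd p" using TF'[OF that] T1 by linarith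
    finally show ?thesis using finite_subset[OF sub] by auto
  qed
  define okk where "okk = {K..<2 * K} - (\<Union>p\<in>F'. bad p)"
  have finok: "finite okk" by (simp add: okk_def)
  have cardok: "of_int K / 2 \<le> real (card okk)"
  proof -
    have "real (card (\<Union>p\<in>F'. bad p)) \<le> (\<Sum>p\<in>F'. real (card (bad p)))"
      using card_UN_le[OF finF', of bad] by (metis of_nat_le_iff of_nat_sum)
    also have "\<dots> \<le> (\<Sum>p\<in>F'. 5 * snd p)" using cardbad by (intro sum_mono) auto
    also have "\<dots> \<le> 5 * R" using F'(2) by (simp add: sum_distrib_left[symmetric])
    finally have "real (card (\<Union>p\<in>F'. bad p)) \<le> of_int K / 2" using R by simp
    moreover have "card {K..<2 * K} - card (\<Union>p\<in>F'. bad p) \<le> card okk"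
      unfolding okk_def using finF' cardbad by (intro diff_card_le_card_Diff) auto
    moreover have "real (card {K..<2 * K}) = of_int K" using K0 by simp
    ultimately show ?thesis by linarith
  qed
  have goodbd: "good e \<and> e \<in> UNIV \<times> V" if k: "k \<in> okk" and e: "e \<in> bd k" for k e
  proof -
    have kK: "0 \<le> k" using k K0 by (auto simp: okk_def)
    have notX: "g \<notin> X0" if "\<bar>depth (site g) - of_int k\<bar> \<le> 1" for g
    proof
      assume "g \<in> X0"
      then obtain p' where p': "p' \<in> F'" "site g \<in> cb p'" using XF' by blast
      have "\<bar>depth (fst p') - depth (site g)\<bar> \<le> snd p'"
        using depth_lipschitz[of "fst p'" "site g"] p'(2) by simp
      then have "k \<in> bad p'" using that by (simp add: bad_def)
      then show False using k p' by (auto simp: okk_def)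
    qed
    have "side1 e \<in> inner k \<or> side2 e \<in> inner k" using e by (auto simp: bd_iff)
    then show ?thesis
    proof
      assume "side1 e \<in> inner k"
      then have "side1 e \<in> V1" using inner_V1[OF kK] by blast
      then show ?thesis using notX[OF bd_depth(1)[OF e]] good_side edges_of_EE side_edges(1)[of e] by blast
    next
      assume "side2 e \<in> inner k"
      then have "side2 e \<in> V1" using inner_V1[OF kK] by blast
      then show ?thesis using notX[OF bd_depth(2)[OF e]] good_side edges_of_EE side_edges(2)[of e] by blast
    qed
  qed
  \<comment> \<open>Averaging: at least \<open>K / 2\<close> admissible boundaries are disjoint, so
    one of them carries at most the fraction \<open>2 / K\<close> of the energy.\<close>
  have "\<exists>k\<in>okk. (\<Sum>e\<in>bd k. w e) \<le> 2 * energy / of_int K"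
  proof (rule ccontr)
    assume "\<not> ?thesis"
    then have less: "\<And>k. k \<in> okk \<Longrightarrow> 2 * energy / of_int K < (\<Sum>e\<in>bd k. w e)" by (meson not_le)
    have ne: "okk \<noteq> {}" using cardok K0 by auto
    have e0: "0 \<le> energy" using mu_le_energy[of UNIV] \<mu>_nonneg order_trans by blast
    have "energy = (of_int K / 2) * (2 * energy / of_int K)" using K0 by simp
    also have "\<dots> \<le> real (card okk) * (2 * energy / of_int K)"
      using cardok e0 K0 by (intro mult_right_mono) auto
    also have "\<dots> < (\<Sum>k\<in>okk. \<Sum>e\<in>bd k. w e)"
      using less finok ne sum_strict_mono[of okk "\<lambda>_. 2 * energy / of_int K" "\<lambda>k. \<Sum>e\<in>bd k. w e"] by simp
    also have "\<dots> = (\<Sum>e\<in>(\<Union>k\<in>okk. bd k). w e)"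
      using finok bd_disjoint finite_bd by (intro sum.UNION_disjoint[symmetric]) auto
    also have "\<dots> \<le> (\<Sum>e\<in>{e \<in> UNIV \<times> V. emid e \<in> UNIV}. w e)"
      using finite_EE w_nonneg goodbd by (intro sum_mono2) auto
    also have "\<dots> \<le> energy" using mu_le_energy[of UNIV] by (simp add: mu_def)
    finally show False by simp
  qed
  then obtain k where k: "k \<in> okk" "(\<Sum>e\<in>bd k. w e) \<le> 2 * energy / of_int K" by blast
  have kK: "K \<le> k" "k < 2 * K" "0 \<le> k" using k(1) K0 by (auto simp: okk_def)
  have fin_inner: "finite (inner k)" by (simp add: inner_def)
  \<comment> \<open>Summation by parts against the indicator of \<open>inner k\<close> leaves only
    boundary edges, all of them good; Cauchy--Schwarz with at most \<open>4 * N\<close> of them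
    gives the bound.\<close>
  have circ: "\<bar>\<Sum>g\<in>inner k. ecurl p g\<bar> \<le> sqrt (8 * N * energy / (of_int K * (1 - \<eta>) ^ 4))"
  proof -
    let ?i = "indicator (inner k) :: site \<Rightarrow> real"
    have "(\<Sum>g\<in>inner k. ecurl p g) = (\<Sum>g\<in>inner k. ?i g * ecurl p g)" by (intro sum.cong) auto
    also have "\<dots> = (\<Sum>e\<in>bd k. p e * cograd ?i e)"
      by (rule summation_by_parts[OF fin_inner _ finite_bd]) (auto simp: bd_def)
    finally have "(\<Sum>g\<in>inner k. ecurl p g)\<^sup>2 \<le> (\<Sum>e\<in>bd k. (p e)\<^sup>2) * (\<Sum>e\<in>bd k. (cograd ?i e)\<^sup>2)"
      using Cauchy_Schwarz_ineq_sum[of p "cograd ?i" "bd k"] by simp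
    also have "(\<Sum>e\<in>bd k. (cograd ?i e)\<^sup>2) = real (card (bd k))"
    proof -
      have "(cograd ?i e)\<^sup>2 = 1" if "e \<in> bd k" for e
        using that unfolding bd_iff cograd_def by (auto simp: indicator_def)
      then show ?thesis by simp
    qed
    also have "(\<Sum>e\<in>bd k. (p e)\<^sup>2) * real (card (bd k)) \<le> (2 * energy / of_int K / (1 - \<eta>) ^ 4) * (4 * real N)"
    proof (intro mult_mono card_bd kK)
      have "(1 - \<eta>) ^ 4 * (\<Sum>e\<in>bd k. (p e)\<^sup>2) \<le> (\<Sum>e\<in>bd k. w e)"
        unfolding sum_distrib_left using goodbd[OF k(1)] by (intro sum_mono good_w) auto
      then have "(1 - \<eta>) ^ 4 * (\<Sum>e\<in>bd k. (p e)\<^sup>2) \<le> 2 * energy / of_int K" using k(2) by linarith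
      then show "(\<Sum>e\<in>bd k. (p e)\<^sup>2) \<le> 2 * energy / of_int K / (1 - \<eta>) ^ 4"
        using \<eta> by (subst pos_le_divide_eq) (auto simp: mult.commute)
      have "0 \<le> energy" using mu_le_energy[of UNIV] \<mu>_nonneg order_trans by blast
      then show "0 \<le> 2 * energy / of_int K / (1 - \<eta>) ^ 4" using K0 \<eta> by simp
    qed auto
    also have "\<dots> = 8 * N * energy / (of_int K * (1 - \<eta>) ^ 4)" by simp
    finally show ?thesis using real_sqrt_le_mono by fastforce
  qed
  \<comment> \<open>Discs that contain a bad plaquette of \<open>inner k\<close>. Level
    \<open>k\<close> is avoided with a margin, so such a disc lies entirely at depth above
    \<open>k + 1\<close>; it is then inside \<open>Dom\<close> and its degree is counted by
    \<open>q\<close>.\<close>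
  define F'' where "F'' = {p'\<in>F'. \<exists>g\<in>X0. g \<in> inner k \<and> site g \<in> cb p'}"
  have F''k: "of_int k + 1 < depth z" if "p' \<in> F''" "z \<in> cb p'" for p' z
  proof -
    obtain g where g: "g \<in> inner k" "site g \<in> cb p'" and pF: "p' \<in> F'"
      using \<open>p' \<in> F''\<close> unfolding F''_def by blast
    have "k \<notin> bad p'" using k(1) pF by (auto simp: okk_def)
    then have 1: "\<not> \<bar>depth (fst p') - of_int k\<bar> \<le> snd p' + 1" by (simp add: bad_def)
    have "\<bar>depth (fst p') - depth (site g)\<bar> \<le> snd p'" "\<bar>depth (fst p') - depth z\<bar> \<le> snd p'"
      using depth_lipschitz[of "fst p'" "site g"] depth_lipschitz[of "fst p'" z] g(2) that(2) by auto
    moreover have "of_int k \<le> depth (site g)" using g(1) by (simp add: inner_iff)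
    ultimately show ?thesis using 1 by linarith
  qed
  have disjF': "cb p1 \<inter> cb p2 = {}" if "p1 \<in> F'" "p2 \<in> F'" "p1 \<noteq> p2" for p1 p2
  proof (rule ccontr)
    assume "cb p1 \<inter> cb p2 \<noteq> {}"
    then obtain x where x: "dist (fst p1) x \<le> snd p1" "dist (fst p2) x \<le> snd p2" by auto
    have "dist (fst p1) (fst p2) \<le> snd p1 + snd p2"
      using x dist_triangle[of "fst p1" "fst p2" x] by (simp add: dist_commute)
    moreover have "snd p1 + snd p2 < dist (fst p1) (fst p2)" using F'(1) that unfolding disc_family_def by blast
    ultimately show False by simp
  qed
  have qF'': "q (cb p') = \<bar>\<Sum>g\<in>{g\<in>X0. site g \<in> cb p'}. real_of_int (d g)\<bar>" if "p' \<in> F''" for p'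
  proof -
    have "cb p' \<subseteq> Dom"
    proof
      fix z assume "z \<in> cb p'"
      then have "of_int k + 1 < depth z" using F''k that by blast
      then show "z \<in> Dom" using kK by (intro depth_Dom) linarith
    qed
    moreover have "snd p' \<le> R" using that rR by (auto simp: F''_def)
    ultimately show ?thesis using flux by (simp add: q_def d_sum_X0)
  qed
  have "(\<Sum>g\<in>inner k. real_of_int (d g)) = (\<Sum>g\<in>{g\<in>X0. g \<in> inner k}. real_of_int (d g))"
    using inner_V1[OF kK(3)] d_zero flux1 fin_inner by (intro sum.mono_neutral_right) auto
  also have "{g\<in>X0. g \<in> inner k} = (\<Union>p'\<in>F''. {g\<in>X0. site g \<in> cb p'})"
  proof (intro set_eqI iffI)
    fix g assume g: "g \<in> {g\<in>X0. g \<in> inner k}"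
    then obtain p' where "p' \<in> F'" "site g \<in> cb p'" using XF' by blast
    then show "g \<in> (\<Union>p'\<in>F''. {g\<in>X0. site g \<in> cb p'})" using g unfolding F''_def by blast
  next
    fix g assume "g \<in> (\<Union>p'\<in>F''. {g\<in>X0. site g \<in> cb p'})"
    then obtain p' where "p' \<in> F''" "g \<in> X0" "site g \<in> cb p'" by blast
    then show "g \<in> {g\<in>X0. g \<in> inner k}" using F''k[of p' "site g"] by (simp add: inner_iff)
  qed
  also have "(\<Sum>g\<in>(\<Union>p'\<in>F''. {g\<in>X0. site g \<in> cb p'}). real_of_int (d g))
     = (\<Sum>p'\<in>F''. \<Sum>g\<in>{g\<in>X0. site g \<in> cb p'}. real_of_int (d g))"
  proof (rule sum.UNION_disjoint)
    show "finite F''" using finF' by (simp add: F''_def)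
    show "\<forall>i\<in>F''. finite {g \<in> X0. site g \<in> cb i}" using finite_V by auto
    show "\<forall>i\<in>F''. \<forall>j\<in>F''. i \<noteq> j \<longrightarrow> {g \<in> X0. site g \<in> cb i} \<inter> {g \<in> X0. site g \<in> cb j} = {}"
      using disjF' unfolding F''_def by blast
  qed
  also have "\<dots> \<le> (\<Sum>p'\<in>F''. q (cb p'))" using qF'' by (intro sum_mono) simp
  also have "\<dots> \<le> Q" unfolding Q_def using finF' by (intro sum_mono2) (auto simp: F''_def q_nonneg)
  finally have dQ: "(\<Sum>g\<in>inner k. real_of_int (d g)) \<le> Q" .
  have "(\<Sum>g\<in>inner k. ecurl p g) = 2 * pi * (\<Sum>g\<in>inner k. real_of_int (d g)) - (\<Sum>g\<in>inner k. ecurl \<alpha> g)"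
    by (simp add: d_curl sum_subtractf sum_distrib_left)
  then have "(\<Sum>g\<in>inner k. ecurl \<alpha> g) - sqrt (8 * N * energy / (of_int K * (1 - \<eta>) ^ 4)) \<le> 2 * pi * (\<Sum>g\<in>inner k. real_of_int (d g))"
    using circ by linarith
  also have "\<dots> \<le> 2 * pi * Q" using dQ by simp
  finally show ?thesis using kK Q0 en unfolding \<rho>0_def by blast
qed

end

text \<open>The quotient is the lower bound for the final radius over the upper bound for the
  initial total radius; apart from powers of \<open>L\<close> it is \<open>exp L\<close>. The term
  \<open>256 / \<eta>^2\<close> bounds the loss accumulated over the merging stages.\<close>

lemma eventually_log_loss:
  assumes "0 < (\<eta>::real)" "\<eta> \<le> 1/4"
  shows "\<forall>\<^sub>F L in at_top. (1 - \<eta>) * L \<le> ln (\<eta> * exp L / (12 * L) / ((128 * L ^ 3 / \<eta>\<^sup>2 + 1) * (6 * L ^ 6 / \<eta>\<^sup>2 + 1))) - 256 / \<eta>\<^sup>2"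
  using assms by real_asymp

lemma eventually_poly_exp:
  assumes "0 < (\<eta>::real)"
  shows "\<forall>\<^sub>F L in at_top. (128 * L ^ 3 / \<eta>\<^sup>2 + 1) * (6 * L ^ 6 / \<eta>\<^sup>2 + 1) \<le> \<eta> * exp L / (12 * L)"
  using assms by real_asymp

lemma card_int_interval_le: "x \<le> y \<Longrightarrow> real (card {\<lceil>x\<rceil>..\<lfloor>y\<rfloor>}) \<le> y - x + 1"
  by simp linarith

lemma card_sites_le:
  assumes "1 \<le> R"
  shows "real (card {g. dist a (site g) \<le> R}) \<le> 9 * R\<^sup>2"
proof -
  let ?I = "{\<lceil>Re a - R\<rceil>..\<lfloor>Re a + R\<rfloor>}" and ?J = "{\<lceil>Im a - R\<rceil>..\<lfloor>Im a + R\<rfloor>}"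
  have "{g. dist a (site g) \<le> R} \<subseteq> ?I \<times> ?J"
  proof
    fix g assume "g \<in> {g. dist a (site g) \<le> R}"
    then have "norm (site g - a) \<le> R" by (simp add: dist_norm norm_minus_commute)
    then have "\<bar>of_int (fst g) - Re a\<bar> \<le> R" "\<bar>of_int (snd g) - Im a\<bar> \<le> R"
      using abs_Re_le_cmod[of "site g - a"] abs_Im_le_cmod[of "site g - a"] by (auto simp: site_def)
    then have "Re a - R \<le> of_int (fst g)" "of_int (fst g) \<le> Re a + R"
        "Im a - R \<le> of_int (snd g)" "of_int (snd g) \<le> Im a + R" by linarith+
    then show "g \<in> ?I \<times> ?J" by (cases g) (auto intro!: ceiling_le le_floor_iff[THEN iffD2])
  qed
  then have "card {g. dist a (site g) \<le> R} \<le> card ?I * card ?J"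
    by (subst card_cartesian_product[symmetric]) (rule card_mono, auto)
  then have "real (card {g. dist a (site g) \<le> R}) \<le> real (card ?I) * real (card ?J)"
    by (metis of_nat_le_iff of_nat_mult)
  also have "\<dots> \<le> (3 * R) * (3 * R)"
    using card_int_interval_le[of "Re a - R" "Re a + R"] card_int_interval_le[of "Im a - R" "Im a + R"] assms
    by (intro mult_mono) auto
  finally show ?thesis by (simp add: power2_eq_square)
qed

lemma sum_dev_le:
  fixes f :: "'a \<Rightarrow> real"
  assumes "finite S" "(\<Sum>g\<in>S. (f g - b)\<^sup>2) \<le> m\<^sup>2" "0 \<le> m" "real (card S) \<le> c\<^sup>2" "0 \<le> c"
  shows "(\<Sum>g\<in>S. \<bar>f g - b\<bar>) \<le> c * m"
proof -
  have "(\<Sum>g\<in>S. \<bar>f g - b\<bar> * 1)\<^sup>2 \<le> (\<Sum>g\<in>S. \<bar>f g - b\<bar>\<^sup>2) * (\<Sum>g\<in>S. 1\<^sup>2)"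
    by (rule Cauchy_Schwarz_ineq_sum)
  also have "\<dots> \<le> m\<^sup>2 * c\<^sup>2" using assms by (intro mult_mono) auto
  finally have "(\<Sum>g\<in>S. \<bar>f g - b\<bar>)\<^sup>2 \<le> (c * m)\<^sup>2" by (simp add: power_mult_distrib mult.commute)
  then show ?thesis by (rule power2_le_imp_le) (use assms in auto)
qed

text \<open>In the factor, 14 powers come from the annuli and one from the logarithm. The term
  \<open>4 * \<eta>\<close> consists of \<open>2 * \<eta>\<close> for the removed boundary layers,
  \<open>\<eta>\<close> for the deviation of the flux from \<open>b\<close> and
  \<open>\<eta>\<close> for the boundary circulation.\<close>

theorem discrete_lower_bound:
  assumes \<eta>: "0 < \<eta>" "\<eta> \<le> 1/4"
  shows "\<exists>b0>0. \<forall>b N u \<alpha>. 0 < b \<longrightarrow> b < b0 \<longrightarrow> N = nat \<lceil>sqrt (1000 / \<eta> ^ 3 * ln (1 / sqrt b)) / sqrt b\<rceil> \<longrightarrow>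
     (\<Sum>g\<in>{0..int N - 2} \<times> {0..int N - 2}. (ecurl \<alpha> g - b)\<^sup>2) \<le> (\<eta> * real N * b)\<^sup>2 \<longrightarrow>
     (1 - \<eta>) ^ 15 * (1 - 4 * \<eta>) * (real N)\<^sup>2 * b * ln (1 / sqrt b) \<le> lattice_gl.energy u \<alpha> N"
proof -
  have "\<forall>\<^sub>F L::real in at_top. L * exp (- L) \<le> 1/2" by real_asymp
  then obtain L0 where L0: "\<And>L. L0 \<le> L \<Longrightarrow>
      (1 - \<eta>) * L \<le> ln (\<eta> * exp L / (12 * L) / ((128 * L ^ 3 / \<eta>\<^sup>2 + 1) * (6 * L ^ 6 / \<eta>\<^sup>2 + 1))) - 256 / \<eta>\<^sup>2
    \<and> (128 * L ^ 3 / \<eta>\<^sup>2 + 1) * (6 * L ^ 6 / \<eta>\<^sup>2 + 1) \<le> \<eta> * exp L / (12 * L)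
    \<and> L * exp (- L) \<le> 1/2"
    using eventually_conj[OF eventually_log_loss[OF \<eta>] eventually_conj[OF eventually_poly_exp[OF \<eta>(1)], of "\<lambda>L. L * exp (- L) \<le> 1/2"]]
    unfolding eventually_at_top_linorder by auto
  \<comment> \<open>The bound \<open>1000 / \<eta> ^ 3 \<le> L\<close> is what makes
    \<open>S \<le> L\<close>, hence \<open>N \<le> 2 * L / sqrt b\<close>.\<close>
  define L1 where "L1 = max L0 (1000 / \<eta> ^ 3)"
  have "(1 - \<eta>) ^ 15 * (1 - 4 * \<eta>) * (real N)\<^sup>2 * b * ln (1 / sqrt b) \<le> lattice_gl.energy u \<alpha> N"
    if b: "0 < b" "b < exp (- 2 * L1)" and N: "N = nat \<lceil>sqrt (1000 / \<eta> ^ 3 * ln (1 / sqrt b)) / sqrt b\<rceil>"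
      and dev: "(\<Sum>g\<in>{0..int N - 2} \<times> {0..int N - 2}. (ecurl \<alpha> g - b)\<^sup>2) \<le> (\<eta> * real N * b)\<^sup>2"
    for b N u \<alpha>
  proof -
    interpret lg: lattice_gl u \<alpha> N \<eta> using \<eta> by unfold_locales
    define L where "L = ln (1 / sqrt b)"
    have sb: "0 < sqrt b" using b by simp
    have Leq: "L = - ln b / 2" using b by (simp add: L_def ln_div ln_sqrt)
    have "ln b < - 2 * L1" using b by (metis exp_gt_zero ln_exp ln_less_cancel_iff)
    then have LL1: "L1 < L" using Leq by simp
    have expL: "exp L = 1 / sqrt b" using sb by (simp add: L_def)
    have sbL: "sqrt b = exp (- L)" using expL sb by (simp add: exp_minus field_simps)
    have Lbig: "1000 / \<eta> ^ 3 \<le> L" and LL0: "L0 \<le> L" using LL1 by (auto simp: L1_def)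
    have e3: "\<eta> ^ 3 \<le> \<eta>" "\<eta> ^ 3 \<le> 1" using \<eta> by (auto simp: power_le_one power3_eq_cube mult_le_one mult_le_cancel_left1)
    have "1000 / 1 \<le> 1000 / \<eta> ^ 3" using \<eta> e3 by (intro divide_left_mono) auto
    then have L1000: "1000 \<le> L" using Lbig by linarith
    have Lexp: "L * sqrt b \<le> 1/2" using L0[OF LL0] sbL by simp
    have sb1: "sqrt b \<le> 1/2"
    proof -
      have "1 * sqrt b \<le> L * sqrt b" using L1000 sb by (intro mult_right_mono) auto
      then show ?thesis using Lexp by simp
    qed
    have bsb: "b = sqrt b * sqrt b" using b by simp
    have b1: "b \<le> 1/4" using mult_mono[OF sb1 sb1] sb bsb by simp
    define S where "S = sqrt (1000 / \<eta> ^ 3 * L)"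
    have S2: "S\<^sup>2 = 1000 / \<eta> ^ 3 * L" using \<eta> L1000 by (simp add: S_def)
    have SL: "S \<le> L"
      using mult_right_mono[OF Lbig, of L] L1000 unfolding S_def by (intro real_le_lsqrt) (auto simp: power2_eq_square)
    have Sbig: "1000 / \<eta> \<le> S"
      unfolding S_def
    proof (rule real_le_rsqrt)
      have "(1000 / \<eta>)\<^sup>2 = 1000 / \<eta> ^ 3 * (1000 * \<eta>)" using \<eta> by (simp add: power2_eq_square power3_eq_cube)
      also have "\<dots> \<le> 1000 / \<eta> ^ 3 * L" using \<eta> L1000 by (intro mult_left_mono) auto
      finally show "(1000 / \<eta>)\<^sup>2 \<le> 1000 / \<eta> ^ 3 * L" .
    qed
    have S1: "1000 \<le> S"
    proof -
      have "1000 / 1 \<le> 1000 / \<eta>" using \<eta> by (intro divide_left_mono) auto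
      then show ?thesis using Sbig by simp
    qed
    have Nlo: "S / sqrt b \<le> N" using N by (simp add: S_def L_def) linarith
    have Nhi: "N \<le> 2 * L / sqrt b"
    proof -
      have "0 \<le> S / sqrt b" using S1 sb by simp
      then have "N \<le> S / sqrt b + 1" using N unfolding L_def[symmetric] S_def[symmetric] by linarith
      also have "\<dots> \<le> L / sqrt b + 1" using SL sb by (intro add_right_mono divide_right_mono) auto
      finally have "N \<le> L / sqrt b + 1" .
      moreover have "1 \<le> L / sqrt b" using L1000 sb sb1 by (simp add: pos_le_divide_eq)
      ultimately show ?thesis by simp
    qed
    have LN: "S \<le> N"
    proof -
      have "S / 1 \<le> S / sqrt b" using sb b b1 S1 by (intro divide_left_mono) auto
      then show ?thesis using Nlo by simp
    qed
    have N0: "0 < real N" using LN S1 by linarith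
    have N2b: "S\<^sup>2 \<le> (real N)\<^sup>2 * b" "(real N)\<^sup>2 * b \<le> 4 * L\<^sup>2"
    proof -
      have "S \<le> N * sqrt b" "N * sqrt b \<le> 2 * L"
        using Nlo Nhi sb by (simp_all add: pos_divide_le_eq pos_le_divide_eq)
      then have "S\<^sup>2 \<le> (N * sqrt b)\<^sup>2" "(N * sqrt b)\<^sup>2 \<le> (2 * L)\<^sup>2"
        using L1000 S1 sb by (intro power_mono; simp)+
      then show "S\<^sup>2 \<le> (real N)\<^sup>2 * b" "(real N)\<^sup>2 * b \<le> 4 * L\<^sup>2"
        using b by (simp_all add: power_mult_distrib)
    qed
    define E where "E = lg.energy"
    have fac1: "(1 - \<eta>) ^ 15 * (1 - 4 * \<eta>) \<le> 1" "0 \<le> (1 - \<eta>) ^ 15 * (1 - 4 * \<eta>)"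
      using \<eta> by (auto intro!: mult_le_one power_le_one)
    show ?thesis
    \<comment> \<open>If the energy is already this large there is nothing to prove; otherwise it is
      at most \<open>4 * L ^ 3\<close>, which bounds the number of bad plaquettes.\<close>
    proof (cases "(real N)\<^sup>2 * b * L \<le> E")
      case True
      have "(1 - \<eta>) ^ 15 * (1 - 4 * \<eta>) * ((real N)\<^sup>2 * b * L) \<le> 1 * ((real N)\<^sup>2 * b * L)"
        using fac1 b L1000 by (intro mult_right_mono) auto
      then show ?thesis using True by (simp add: E_def L_def mult.assoc)
    next
      case False
      have "(real N)\<^sup>2 * b * L \<le> 4 * L\<^sup>2 * L" using N2b L1000 by (intro mult_right_mono) auto
      then have E4: "E \<le> 4 * L ^ 3" using False by (simp add: power2_eq_square power3_eq_cube mult.assoc)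
      \<comment> \<open>With at most \<open>128 * L ^ 3 / \<eta>^2\<close> bad plaquettes, this
        \<open>\<theta>\<close> keeps the total loss of the merging stages bounded; \<open>T\<close>
        is then the radius required by the annulus estimate.\<close>
      define \<theta> where "\<theta> = 1 / L ^ 3"
      define T where "T = 6 * L ^ 6 / \<eta>\<^sup>2 + 1"
      have L3: "1 \<le> L ^ 3" using L1000 by (intro one_le_power) auto
      have V1: "lg.V1 = {0..int N - 2} \<times> {0..int N - 2}" by (simp add: lg.V1_def)
      have dev': "(\<Sum>g\<in>S. (ecurl \<alpha> g - b)\<^sup>2) \<le> (\<eta> * real N * b)\<^sup>2" if "S \<subseteq> lg.V1" for S
      proof -
        have "(\<Sum>g\<in>S. (ecurl \<alpha> g - b)\<^sup>2) \<le> (\<Sum>g\<in>lg.V1. (ecurl \<alpha> g - b)\<^sup>2)"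
          using that lg.finite_V by (intro sum_mono2) auto
        then show ?thesis using dev by (simp add: V1)
      qed
      have Nb: "real N * b \<le> 2 * L * sqrt b"
      proof -
        have "real N * b = (real N * sqrt b) * sqrt b" using bsb by (simp add: mult.assoc)
        also have "\<dots> \<le> (2 * L) * sqrt b"
          using Nhi sb by (intro mult_right_mono) (simp_all add: pos_le_divide_eq)
        finally show ?thesis .
      qed
      have m0: "0 \<le> \<eta> * real N * b" using \<eta> b by simp
      \<comment> \<open>A single plaquette is estimated by the whole sum of squares; its deviation
        is at most \<open>\<eta> * N * b\<close>, which \<open>L * sqrt b \<le> 1/2\<close> makes at
        most 1/4.\<close>
      have f1: "\<bar>ecurl \<alpha> g\<bar> \<le> 1" if "g \<in> lg.V1" for g
      proof -
        have "(ecurl \<alpha> g - b)\<^sup>2 \<le> (\<eta> * real N * b)\<^sup>2" using dev'[of "{g}"] that by simp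
        then have "\<bar>ecurl \<alpha> g - b\<bar> \<le> \<eta> * (real N * b)" using abs_le_square_iff[of "ecurl \<alpha> g - b" "\<eta> * real N * b"] m0 by (simp add: mult.assoc)
        also have "\<dots> \<le> (1/4) * (2 * L * sqrt b)" by (rule mult_mono) (use Nb \<eta> b in auto)
        also have "\<dots> \<le> 1/4" using Lexp by simp
        finally show ?thesis using b b1 by linarith
      qed
      interpret lf: lattice_gl_flux u \<alpha> N \<eta> \<theta> T
      proof
        show "0 < \<theta>" "\<theta> \<le> 1" using L3 L1000 by (auto simp: \<theta>_def divide_le_eq)
        show "6 / (\<eta> * \<theta>)\<^sup>2 + 1 \<le> T" by (simp add: \<theta>_def T_def power_mult_distrib power_divide flip: power_mult)
      qed (rule f1)
      \<comment> \<open>Chosen so that the flux through a disc of radius \<open>R\<close> stays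
        below \<open>\<eta>\<close>: the deviation part is bounded by
        \<open>3 * R * (\<eta> * N * b) = \<eta>^2 / 2\<close>, and the mean part
        \<open>b * (3 * R)^2\<close> is small because \<open>N^2 * b\<close> is large.
        \<open>K\<close> fixes a boundary layer of relative width of order
        \<open>\<eta>\<close>.\<close>
      define R where "R = \<eta> / (6 * N * b)"
      define K where "K = \<lceil>\<eta> * N / 8\<rceil>"
      define n where "n = real (card lg.X0)"
      have nle: "n \<le> 128 * L ^ 3 / \<eta>\<^sup>2"
      proof -
        have "n \<le> 32 * E / \<eta>\<^sup>2" unfolding n_def E_def by (rule lg.card_X0)
        also have "\<dots> \<le> 32 * (4 * L ^ 3) / \<eta>\<^sup>2" using E4 by (intro divide_right_mono) auto
        finally show ?thesis by simp
      qed
      have T1: "1 \<le> T" using L1000 by (simp add: T_def)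
      have rho: "(n + 1) * T \<le> (128 * L ^ 3 / \<eta>\<^sup>2 + 1) * (6 * L ^ 6 / \<eta>\<^sup>2 + 1)"
        unfolding T_def using nle L1000 by (intro mult_right_mono) auto
      have Rlow: "\<eta> * exp L / (12 * L) \<le> R"
      proof -
        have "\<eta> * exp L / (12 * L) = \<eta> / (6 * (2 * L * sqrt b))" unfolding expL by simp
        also have "\<dots> \<le> \<eta> / (6 * (real N * b))"
          using Nb \<eta> N0 b L1000 by (intro divide_left_mono mult_pos_pos) (auto simp: mult_ac)
        finally show ?thesis by (simp add: R_def mult.assoc)
      qed
      have n0: "0 \<le> n" by (simp add: n_def)
      have rpos: "0 < (n + 1) * T" using n0 T1 by (intro mult_pos_pos) auto
      have rhoR: "(n + 1) * T \<le> R" using rho Rlow L0[OF LL0] by linarith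
      have R1: "1 \<le> R"
      proof -
        have "1 * 1 \<le> (n + 1) * T" using n0 T1 by (intro mult_mono) auto
        then show ?thesis using rhoR by simp
      qed
      have L14: "14 \<le> (real N)\<^sup>2 * b"
      proof -
        have "1000\<^sup>2 \<le> S\<^sup>2" using S1 by (intro power_mono) auto
        then show ?thesis using N2b by simp
      qed
      have Klow: "\<eta> * N / 8 \<le> of_int K" and Khi: "of_int K \<le> \<eta> * N / 8 + 1" unfolding K_def by linarith+
      have RK: "10 * R \<le> of_int K"
      proof -
        have "10 * R * (6 * N * b) = 10 * \<eta>" using N0 b by (simp add: R_def)
        also have "\<dots> \<le> \<eta> * (6 / 8 * ((real N)\<^sup>2 * b))" using L14 \<eta> by simp
        also have "\<dots> = \<eta> * N / 8 * (6 * N * b)" by (simp add: power2_eq_square)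
        finally have "10 * R \<le> \<eta> * N / 8" using N0 b by (subst (asm) mult_le_cancel_right_pos) auto
        then show ?thesis using Klow by linarith
      qed
      have flux: "(\<Sum>g\<in>lf.sites_in (cball a r). \<bar>ecurl \<alpha> g\<bar>) \<le> \<eta>" if "r \<le> R" for a r
      proof -
        let ?S = "lf.sites_in (cball a R)"
        have cS: "real (card ?S) \<le> (3 * R)\<^sup>2"
        proof -
          have "card ?S \<le> card {g. dist a (site g) \<le> R}"
            by (intro card_mono finite_sites) (auto simp: lf.sites_in_def)
          then show ?thesis using card_sites_le[OF R1, of a] by (simp add: power_mult_distrib)
        qed
        have "(\<Sum>g\<in>lf.sites_in (cball a r). \<bar>ecurl \<alpha> g\<bar>) \<le> (\<Sum>g\<in>?S. \<bar>ecurl \<alpha> g\<bar>)"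
          using that lg.finite_V by (intro sum_mono2) (auto simp: lf.sites_in_def)
        also have "\<dots> \<le> (\<Sum>g\<in>?S. b + \<bar>ecurl \<alpha> g - b\<bar>)" using b by (intro sum_mono) auto
        also have "\<dots> = b * card ?S + (\<Sum>g\<in>?S. \<bar>ecurl \<alpha> g - b\<bar>)" by (simp add: sum.distrib)
        also have "\<dots> \<le> b * (3 * R)\<^sup>2 + 3 * R * (\<eta> * real N * b)"
          using cS b m0 R1 dev'[of ?S] lg.finite_V
          by (intro add_mono mult_left_mono sum_dev_le) (auto simp: lf.sites_in_def)
        also have "3 * R * (\<eta> * real N * b) = \<eta>\<^sup>2 / 2" using N0 b by (simp add: R_def power2_eq_square)
        also have "b * (3 * R)\<^sup>2 = \<eta>\<^sup>2 / (4 * ((real N)\<^sup>2 * b))"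
          using N0 b by (simp add: R_def power_mult_distrib power_divide power2_eq_square)
        also have "\<dots> + \<eta>\<^sup>2 / 2 \<le> \<eta>\<^sup>2 / (4 * 14) + \<eta>\<^sup>2 / 2"
          using L14 b N0 by (intro add_right_mono divide_left_mono) (auto simp: mult.commute)
        also have "\<dots> \<le> \<eta>"
        proof -
          have "\<eta>\<^sup>2 \<le> \<eta>" using \<eta> by (simp add: power2_eq_square mult_le_cancel_left1)
          then show ?thesis using \<eta> by simp
        qed
        finally show ?thesis .
      qed
      obtain k Q where kQ: "K \<le> k" "k < 2 * K" "0 \<le> Q"
        "2 * pi * (1 - \<eta>) ^ 14 * (ln (R / ((n + 1) * T)) - n * (2 * \<theta>)) * Q \<le> E"
        "(\<Sum>g\<in>lf.inner k. ecurl \<alpha> g) - sqrt (8 * N * E / (of_int K * (1 - \<eta>) ^ 4)) \<le> 2 * pi * Q"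
        using lf.vorticity_bound[of R K] rhoR RK flux by (auto simp: n_def E_def add.commute)
      have K0: "0 < real_of_int K" using RK R1 by linarith
      have loglow: "(1 - \<eta>) * L \<le> ln (R / ((n + 1) * T)) - n * (2 * \<theta>)"
      proof -
        have "n * (2 * \<theta>) \<le> 128 * L ^ 3 / \<eta>\<^sup>2 * (2 * \<theta>)" using nle L1000 by (intro mult_right_mono) (auto simp: \<theta>_def)
        also have "\<dots> = 256 / \<eta>\<^sup>2" using L1000 by (simp add: \<theta>_def)
        finally have 1: "n * (2 * \<theta>) \<le> 256 / \<eta>\<^sup>2" .
        have pos: "0 < \<eta> * exp L / (12 * L)" using \<eta> L1000 by simp
        have "\<eta> * exp L / (12 * L) / ((128 * L ^ 3 / \<eta>\<^sup>2 + 1) * (6 * L ^ 6 / \<eta>\<^sup>2 + 1)) \<le> R / ((n + 1) * T)"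
          using Rlow rho rpos pos by (intro frac_le) auto
        moreover have "0 < \<eta> * exp L / (12 * L) / ((128 * L ^ 3 / \<eta>\<^sup>2 + 1) * (6 * L ^ 6 / \<eta>\<^sup>2 + 1))"
          by (rule divide_pos_pos[OF pos]) (use rho rpos in linarith)
        ultimately have "ln (\<eta> * exp L / (12 * L) / ((128 * L ^ 3 / \<eta>\<^sup>2 + 1) * (6 * L ^ 6 / \<eta>\<^sup>2 + 1))) \<le> ln (R / ((n + 1) * T))"
          by (subst ln_le_cancel_iff) (auto intro: less_le_trans)
        then show ?thesis using 1 L0[OF LL0] by linarith
      qed
      have inner_low: "(real N)\<^sup>2 * b * (1 - 3 * \<eta>) \<le> (\<Sum>g\<in>lf.inner k. ecurl \<alpha> g)"
      proof -
        have "0 < K" using K0 by simp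
        then have k0: "0 \<le> k" using kQ(1) by linarith
        have fin: "finite (lf.inner k)" by (simp add: lf.inner_def)
        have "4 * real_of_int K \<le> \<eta> * N / 2 + 4" using Khi by simp
        moreover have "2 * real_of_int k \<le> 4 * real_of_int K" using kQ(2) by linarith
        \<comment> \<open>The layers removed on both sides take at most
          \<open>\<eta> * N / 2 + 5\<close> from the side, and this covers the additive
          constant.\<close>
        moreover have "10 \<le> \<eta> * N"
        proof -
          have "1000 \<le> S * \<eta>" using Sbig \<eta> by (simp add: pos_divide_le_eq)
          also have "\<dots> \<le> N * \<eta>" using LN \<eta> by (intro mult_right_mono) auto
          finally show ?thesis by (simp add: mult.commute)
        qed
        ultimately have side: "(1 - \<eta>) * N \<le> real N - 1 - 2 * real_of_int k" by (simp add: algebra_simps)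
        have s0: "0 \<le> (1 - \<eta>) * N" using \<eta> by simp
        then have "0 \<le> int N - 1 - 2 * k" using side by linarith
        then have cardi: "real (card (lf.inner k)) = (real N - 1 - 2 * real_of_int k)\<^sup>2"
          by (simp add: lf.inner_def card_cartesian_product power2_eq_square of_nat_diff) (simp add: algebra_simps)
        have c1: "((1 - \<eta>) * N)\<^sup>2 \<le> real (card (lf.inner k))"
          unfolding cardi using side \<eta> by (intro power_mono) auto
        have c2: "real (card (lf.inner k)) \<le> (real N)\<^sup>2"
          unfolding cardi using side k0 s0 by (intro power_mono) linarith+
        have "(\<Sum>g\<in>lf.inner k. \<bar>ecurl \<alpha> g - b\<bar>) \<le> real N * (\<eta> * real N * b)"
          using fin m0 c2 dev'[OF lf.inner_V1[OF k0]] by (intro sum_dev_le) auto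
        moreover have "b * card (lf.inner k) - (\<Sum>g\<in>lf.inner k. \<bar>ecurl \<alpha> g - b\<bar>) \<le> (\<Sum>g\<in>lf.inner k. ecurl \<alpha> g)"
        proof -
          have "b * card (lf.inner k) - (\<Sum>g\<in>lf.inner k. \<bar>ecurl \<alpha> g - b\<bar>) = (\<Sum>g\<in>lf.inner k. b - \<bar>ecurl \<alpha> g - b\<bar>)"
            by (simp add: sum_subtractf)
          also have "\<dots> \<le> (\<Sum>g\<in>lf.inner k. ecurl \<alpha> g)" by (intro sum_mono) auto
          finally show ?thesis .
        qed
        moreover have "b * ((1 - \<eta>) * N)\<^sup>2 \<le> b * card (lf.inner k)" using c1 b by (intro mult_left_mono) auto
        moreover have "(real N)\<^sup>2 * b * (1 - 3 * \<eta>) \<le> b * ((1 - \<eta>) * N)\<^sup>2 - real N * (\<eta> * real N * b)"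
        proof -
          have "b * ((1 - \<eta>) * N)\<^sup>2 - real N * (\<eta> * real N * b) = (real N)\<^sup>2 * b * ((1 - \<eta>)\<^sup>2 - \<eta>)"
            by (simp add: power_mult_distrib power2_eq_square algebra_simps)
          moreover have "1 - 3 * \<eta> \<le> (1 - \<eta>)\<^sup>2 - \<eta>" by (simp add: power2_eq_square algebra_simps)
          ultimately show ?thesis using b by (simp add: mult_left_mono)
        qed
        ultimately show ?thesis by linarith
      qed
      \<comment> \<open>With \<open>E < Y * L\<close> and \<open>\<eta> * N / 8 \<le> K\<close> the
        circulation is at most the square root of \<open>1000 * L * Y / \<eta>\<close>; the constant
        \<open>1000 / \<eta> ^ 3\<close> in the choice of \<open>N\<close> makes this at most
        \<open>\<eta> * Y\<close>.\<close>
      have sq: "sqrt (8 * N * E / (of_int K * (1 - \<eta>) ^ 4)) \<le> \<eta> * ((real N)\<^sup>2 * b)"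
      proof -
        define Y where "Y = (real N)\<^sup>2 * b"
        have Y0: "0 \<le> Y" using b by (simp add: Y_def)
        have "(3/4) ^ 4 \<le> (1 - \<eta>) ^ 4" using \<eta> by (intro power_mono) auto
        then have "\<eta> * N / 8 * (3/4) ^ 4 \<le> of_int K * (1 - \<eta>) ^ 4" using Klow K0 \<eta> by (intro mult_mono) auto
        then have "8 * N * E / (of_int K * (1 - \<eta>) ^ 4) \<le> 8 * N * (Y * L) / (\<eta> * N / 8 * (3/4) ^ 4)"
          using False N0 \<eta> L1000 Y0 by (intro frac_le mult_left_mono) (auto simp: Y_def)
        also have "\<dots> \<le> 1000 * L * Y / \<eta>" using N0 \<eta> L1000 Y0 by (simp add: power_divide field_simps)
        also have "\<dots> \<le> (\<eta> * Y)\<^sup>2"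
        proof -
          have "1000 * L \<le> Y * \<eta> ^ 3" using N2b(1) \<eta> unfolding S2 Y_def by (simp add: pos_divide_le_eq)
          then have "1000 * L * Y \<le> Y * \<eta> ^ 3 * Y" using Y0 by (intro mult_right_mono) auto
          also have "\<dots> = (\<eta> * Y)\<^sup>2 * \<eta>" by (simp add: power_mult_distrib power2_eq_square power3_eq_cube)
          finally show ?thesis using \<eta> by (simp add: pos_divide_le_eq)
        qed
        finally have "sqrt (8 * N * E / (of_int K * (1 - \<eta>) ^ 4)) \<le> \<eta> * Y"
          using \<eta> Y0 by (intro real_le_lsqrt) auto
        then show ?thesis by (simp add: Y_def)
      qed
      have Qlow: "(real N)\<^sup>2 * b * (1 - 4 * \<eta>) \<le> 2 * pi * Q"
        using inner_low sq kQ(5) by (simp add: algebra_simps)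
      have "(1 - \<eta>) ^ 15 * (1 - 4 * \<eta>) * (real N)\<^sup>2 * b * L
         = (1 - \<eta>) ^ 14 * ((1 - \<eta>) * L) * ((real N)\<^sup>2 * b * (1 - 4 * \<eta>))"
      proof -
        have "(1 - \<eta>) ^ 15 = (1 - \<eta>) ^ 14 * (1 - \<eta>)" by (simp flip: power_Suc2)
        then show ?thesis by simp
      qed
      also have "\<dots> \<le> (1 - \<eta>) ^ 14 * ((1 - \<eta>) * L) * (2 * pi * Q)"
        using Qlow \<eta> L1000 by (intro mult_left_mono) auto
      also have "\<dots> \<le> (1 - \<eta>) ^ 14 * (ln (R / ((n + 1) * T)) - n * (2 * \<theta>)) * (2 * pi * Q)"
        using loglow \<eta> kQ(3) by (intro mult_right_mono mult_left_mono) auto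
      also have "\<dots> \<le> E" using kQ(4) by (simp add: mult_ac)
      finally show ?thesis by (simp add: E_def L_def)
    qed
  qed
  then show ?thesis by (intro exI[of _ "exp (- 2 * L1)"]) auto
qed

section \<open>Weak derivatives along lines\<close>

text \<open>The functions \<open>flat p\<close> are closed under derivatives, so the algebra generated by them
  in the coordinates consists of smooth functions in the iterated sense of \<open>iter_pd\<close>.\<close>

definition flat :: "real poly \<Rightarrow> real \<Rightarrow> real" where
  "flat p t = (if t \<le> 0 then 0 else poly p (1 / t) * exp (- (1 / t)))"

lemma poly_exp_neg_tendsto: "((\<lambda>y. poly p y * exp (- y)) \<longlongrightarrow> 0) (at_top :: real filter)"
proof -
  have "((\<lambda>y. \<Sum>i\<le>degree p. coeff p i * (y ^ i / exp y)) \<longlongrightarrow> (\<Sum>i\<le>degree p. coeff p i * 0)) (at_top :: real filter)"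
    by (intro tendsto_intros tendsto_power_div_exp_0)
  then show ?thesis by (simp add: poly_altdef sum_distrib_right exp_minus divide_inverse mult.assoc)
qed

lemma flat_tendsto_0: "(flat p \<longlongrightarrow> 0) (at 0)"
proof (rule filterlim_split_at)
  have "\<forall>\<^sub>F x in at_left 0. flat p x = 0"
    by (auto simp: flat_def eventually_at_left_field intro: exI[of _ "-1"])
  then show "(flat p \<longlongrightarrow> 0) (at_left 0)" by (rule tendsto_eventually)
  have "((\<lambda>t. poly p (inverse t) * exp (- inverse t)) \<longlongrightarrow> 0) (at_right (0::real))"
    by (rule filterlim_compose[OF poly_exp_neg_tendsto filterlim_inverse_at_top_right])
  moreover have "\<forall>\<^sub>F x in at_right 0. poly p (inverse x) * exp (- inverse x) = flat p x"
    by (auto simp: flat_def eventually_at_right_field inverse_eq_divide intro: exI[of _ 1])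
  ultimately show "(flat p \<longlongrightarrow> 0) (at_right 0)" by (rule Lim_transform_eventually)
qed

text \<open>With \<open>y = 1 / t\<close>, the derivative of p(y) exp (-y) with respect to
  \<open>t\<close> is y^2 (p - p')(y) exp (-y).\<close>

definition flat' :: "real poly \<Rightarrow> real poly" where
  "flat' p = pCons 0 (pCons 0 (p - pderiv p))"

lemma flat_deriv: "(flat p has_real_derivative flat (flat' p) t) (at t)"
proof -
  consider "t < 0" | "t = 0" | "t > 0" by linarith
  then show ?thesis
  proof cases
    case 1
    have "((\<lambda>_. 0) has_real_derivative 0) (at t)" by simp
    then have "(flat p has_real_derivative 0) (at t)"
      by (rule has_field_derivative_transform_within_open[of _ _ _ "{..<0}"]) (use 1 in \<open>auto simp: flat_def\<close>)
    then show ?thesis using 1 by (simp add: flat_def)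
  next
    case 2
    \<comment> \<open>The difference quotient at 0 is again a flat function, so its limit is an
      instance of \<open>flat_tendsto_0\<close>.\<close>
    have "(\<lambda>h. (flat p (0 + h) - flat p 0) / h) = flat (pCons 0 p)"
      by (rule ext) (auto simp: flat_def)
    then show ?thesis using 2 flat_tendsto_0[of "pCons 0 p"]
      by (simp add: DERIV_def flat_def)
  next
    case 3
    have "((\<lambda>t. poly p (1 / t) * exp (- (1 / t))) has_real_derivative
        (poly (pderiv p) (1 / t) * (- 1 / t\<^sup>2)) * exp (- (1 / t)) + poly p (1 / t) * (exp (- (1 / t)) * (1 / t\<^sup>2))) (at t)"
      using 3 by (auto intro!: derivative_eq_intros simp: power2_eq_square field_simps)
    then have "((\<lambda>t. poly p (1 / t) * exp (- (1 / t))) has_real_derivative flat (flat' p) t) (at t)"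
      by (rule back_subst[where P = "\<lambda>D. (_ has_real_derivative D) (at t)"])
         (use 3 in \<open>simp add: flat_def flat'_def power2_eq_square field_simps\<close>)
    then show ?thesis
      by (rule has_field_derivative_transform_within_open[of _ _ _ "{0<..}"]) (use 3 in \<open>auto simp: flat_def\<close>)
  qed
qed

inductive flatalg :: "(R3 \<Rightarrow> real) \<Rightarrow> bool" where
  base: "flatalg (\<lambda>x. flat p (c * x $ i + r))"
| add: "flatalg f \<Longrightarrow> flatalg g \<Longrightarrow> flatalg (\<lambda>x. f x + g x)"
| mult: "flatalg f \<Longrightarrow> flatalg g \<Longrightarrow> flatalg (\<lambda>x. f x * g x)"
| scale: "flatalg f \<Longrightarrow> flatalg (\<lambda>x. k * f x)"

lemma pd_eq: "(f has_derivative D) (at x) \<Longrightarrow> pd j f x = D (axis j 1)"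
  unfolding pd_def using frechet_derivative_at by metis

lemma flatalg_diff: "flatalg f \<Longrightarrow> (\<forall>x. f differentiable (at x)) \<and> (\<forall>j. flatalg (pd j f))"
proof (induction rule: flatalg.induct)
  case (base p c i r)
  have d: "((\<lambda>x. flat p (c * x $ i + r)) has_derivative (\<lambda>h. c * h $ i * flat (flat' p) (c * x $ i + r))) (at x)" for x :: R3
  proof -
    have "((\<lambda>x. c * x $ i + r) has_derivative (\<lambda>h. c * h $ i)) (at x)"
      by (auto intro!: derivative_eq_intros bounded_linear.has_derivative[OF bounded_linear_vec_nth])
    from DERIV_compose_FDERIV[OF flat_deriv this] show ?thesis .
  qed
  have "pd j (\<lambda>x. flat p (c * x $ i + r)) = (\<lambda>x. (c * axis j 1 $ i) * flat (flat' p) (c * x $ i + r))" for j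
    by (rule ext) (rule pd_eq[OF d])
  then show ?case using d flatalg.base flatalg.scale unfolding differentiable_def by metis
next
  case (add f g)
  have "pd j (\<lambda>x. f x + g x) = (\<lambda>x. pd j f x + pd j g x)" for j
  proof
    fix x
    show "pd j (\<lambda>x. f x + g x) x = pd j f x + pd j g x"
      using add.IH unfolding pd_def
      by (subst frechet_derivative_at[symmetric, OF has_derivative_add]) (auto simp: frechet_derivative_works[symmetric])
  qed
  then show ?case using add flatalg.add by auto
next
  case (mult f g)
  have "pd j (\<lambda>x. f x * g x) = (\<lambda>x. f x * pd j g x + pd j f x * g x)" for j
  proof
    fix x
    show "pd j (\<lambda>x. f x * g x) x = f x * pd j g x + pd j f x * g x"
      using mult.IH unfolding pd_def
      by (subst frechet_derivative_at[symmetric, OF has_derivative_mult]) (auto simp: frechet_derivative_works[symmetric])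
  qed
  then show ?case using mult flatalg.add flatalg.mult by auto
next
  case (scale f k)
  have "pd j (\<lambda>x. k * f x) = (\<lambda>x. k * pd j f x)" for j
  proof
    fix x
    show "pd j (\<lambda>x. k * f x) x = k * pd j f x"
      using scale.IH unfolding pd_def
      by (subst frechet_derivative_at[symmetric, OF has_derivative_mult_right]) (auto simp: frechet_derivative_works[symmetric])
  qed
  then show ?case using scale flatalg.scale by auto
qed

lemma flatalg_smooth: "flatalg f \<Longrightarrow> smooth_on UNIV f"
proof -
  assume f: "flatalg f"
  have "flatalg (iter_pd js f)" for js
    by (induction js) (auto simp: f flatalg_diff)
  then show ?thesis using flatalg_diff by (simp add: smooth_on_def)
qed

text \<open>Values lie in [0, 1] and vanish off the box; as \<open>k\<close> grows the functions
  converge pointwise to the indicator of the open box, so dominated convergence takes the place of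
  mollification. Translating a bump only moves the corners.\<close>

definition bump :: "real \<Rightarrow> R3 \<Rightarrow> R3 \<Rightarrow> R3 \<Rightarrow> real" where
  "bump k a b x = (flat 1 (k * x $ 1 + - k * a $ 1) * flat 1 (- k * x $ 1 + k * b $ 1))
     * ((flat 1 (k * x $ 2 + - k * a $ 2) * flat 1 (- k * x $ 2 + k * b $ 2))
     * (flat 1 (k * x $ 3 + - k * a $ 3) * flat 1 (- k * x $ 3 + k * b $ 3)))"

lemma flatalg_bump: "flatalg (bump k a b)"
  unfolding bump_def by (intro flatalg.mult flatalg.base)

lemma flat1_bounds: "0 \<le> flat 1 t" "flat 1 t \<le> 1"
  by (auto simp: flat_def)

lemma bump_bounds: "0 \<le> bump k a b x" "bump k a b x \<le> 1"
  unfolding bump_def by (auto intro!: mult_nonneg_nonneg mult_le_one flat1_bounds)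

lemma mem_box3: "x \<in> box a (b::R3) \<longleftrightarrow> a $ 1 < x $ 1 \<and> x $ 1 < b $ 1 \<and> a $ 2 < x $ 2 \<and> x $ 2 < b $ 2 \<and> a $ 3 < x $ 3 \<and> x $ 3 < b $ 3"
  by (auto simp: mem_box_cart forall_3)

lemma bump_eq_0: "0 < k \<Longrightarrow> x \<notin> box a b \<Longrightarrow> bump k a b x = 0"
  unfolding bump_def mem_box3 flat_def
  by (auto simp: not_less mult_le_cancel_left_pos)

lemma bump_tendsto: "(\<lambda>n. bump (real (Suc n)) a b x) \<longlonglongrightarrow> indicator (box a b) x"
proof (cases "x \<in> box a b")
  case False
  then show ?thesis using bump_eq_0[OF _ False] by simp
next
  case True
  have l: "(\<lambda>n. flat 1 (real (Suc n) * y)) \<longlonglongrightarrow> 1" if "0 < y" for y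
  proof -
    have "(\<lambda>n. exp (- (inverse (real (Suc n)) * (1 / y)))) \<longlonglongrightarrow> exp (- (0 * (1 / y)))"
      by (intro tendsto_intros LIMSEQ_inverse_real_of_nat)
    moreover have "flat 1 (real (Suc n) * y) = exp (- (inverse (real (Suc n)) * (1 / y)))" for n
    proof -
      have "0 < real (Suc n) * y" using that by simp
      then show ?thesis by (simp add: flat_def divide_inverse)
    qed
    ultimately show ?thesis by simp
  qed
  have eq: "bump k a b x = (flat 1 (k * (x $ 1 - a $ 1)) * flat 1 (k * (b $ 1 - x $ 1)))
     * ((flat 1 (k * (x $ 2 - a $ 2)) * flat 1 (k * (b $ 2 - x $ 2)))
     * (flat 1 (k * (x $ 3 - a $ 3)) * flat 1 (k * (b $ 3 - x $ 3))))" for k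
    unfolding bump_def by (simp add: algebra_simps)
  have "(\<lambda>n. bump (real (Suc n)) a b x) \<longlonglongrightarrow> (1 * 1) * ((1 * 1) * (1 * 1))"
    unfolding eq using True unfolding mem_box3 by (intro tendsto_mult l) auto
  then show ?thesis using True by simp
qed

lemma bump_tsupp: "0 < k \<Longrightarrow> tsupp (bump k a b) \<subseteq> cbox a b"
proof -
  assume "0 < k"
  then have "{x. bump k a b x \<noteq> 0} \<subseteq> cbox a b" using bump_eq_0 box_subset_cbox by blast
  then show ?thesis unfolding tsupp_def by (intro closure_minimal) auto
qed

lemma test_fun_bump: "0 < k \<Longrightarrow> cbox a b \<subseteq> U \<Longrightarrow> test_fun U (bump k a b)"
  using bump_tsupp[of k a b] bounded_subset[OF bounded_cbox, of "tsupp (bump k a b)" a b] unfolding test_fun_def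
  by (auto simp: flatalg_smooth[OF flatalg_bump] compact_eq_bounded_closed tsupp_def)

lemma bump_shift: "bump k a b (x - v) = bump k (a + v) (b + v) x"
  by (simp add: bump_def algebra_simps)

section \<open>Fundamental lemma of the calculus of variations\<close>

lemma integral_all_borel_zero:
  fixes f :: "R3 \<Rightarrow> real"
  assumes f: "integrable lborel f" and z: "\<And>a b. (\<integral>x. indicator (box a b) x * f x \<partial>lborel) = 0"
    and A: "A \<in> sets borel"
  shows "(\<integral>x. indicator A x * f x \<partial>lborel) = 0"
proof -
  let ?G = "range (\<lambda>(a, b). box a b :: R3 set)"
  have int: "integrable lborel (\<lambda>x. indicator A x * f x)" if "A \<in> sets borel" for A
    using integrable_mult_indicator[of A lborel f] that f by simp
  \<comment> \<open>Open boxes form an intersection-stable generator, so Dynkin induction extends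
    the vanishing from boxes to all Borel sets.\<close>
  have "Int_stable ?G"
  proof (rule Int_stableI)
    fix S T assume "S \<in> ?G" "T \<in> ?G"
    then obtain a b c d where ST: "S = box a b" "T = box c d" by auto
    obtain a' b' where "box a b \<inter> box c d = box a' b'" using box_Int_box[of a b c d] by blast
    then show "S \<inter> T \<in> ?G" unfolding ST by auto
  qed
  moreover have "?G \<subseteq> Pow UNIV" by auto
  moreover have "A \<in> sigma_sets UNIV ?G" using A unfolding borel_eq_box by simp
  ultimately show ?thesis
  proof (induction rule: sigma_sets_induct_disjoint)
    case (basic A)
    then show ?case using z by auto
  next
    case empty
    then show ?case by simp
  next
    case (compl A)
    then have [measurable]: "A \<in> sets borel" unfolding borel_eq_box by simp
    \<comment> \<open>Complements need the integral over the whole space, obtained as a limit over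
      growing cubes.\<close>
    have whole: "(\<integral>x. f x \<partial>lborel) = 0"
    proof -
      have "(\<lambda>n. \<integral>x. indicator (box (- (\<chi> i. real n)) (\<chi> i. real n)) x * f x \<partial>lborel) \<longlonglongrightarrow> (\<integral>x. f x \<partial>lborel)"
      proof (rule integral_dominated_convergence[where w = "\<lambda>x. \<bar>f x\<bar>"])
        show "AE x in lborel. (\<lambda>n. indicator (box (- (\<chi> i. real n)) (\<chi> i. real n)) x * f x) \<longlonglongrightarrow> f x"
        proof (rule AE_I2, rule tendsto_eventually)
          fix x :: R3
          obtain m where m: "norm x < real m" using reals_Archimedean2 by blast
          have "indicator (box (- (\<chi> i. real n)) (\<chi> i. real n)) x * f x = f x" if "m \<le> n" for n
          proof -
            have "\<bar>x $ i\<bar> < real n" for i using component_le_norm_cart[of x i] m that by simp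
            then have "x \<in> box (- (\<chi> i. real n)) (\<chi> i. real n)"
              by (auto simp: mem_box_cart abs_less_iff) (metis minus_less_iff)
            then show ?thesis by simp
          qed
          then show "\<forall>\<^sub>F n in sequentially. indicator (box (- (\<chi> i. real n)) (\<chi> i. real n)) x * f x = f x"
            unfolding eventually_sequentially by blast
        qed
      qed (use f in \<open>auto simp: indicator_def\<close>)
      then show ?thesis using z LIMSEQ_unique[OF _ tendsto_const] by simp
    qed
    have "(\<integral>x. indicator (UNIV - A) x * f x \<partial>lborel) = (\<integral>x. f x - indicator A x * f x \<partial>lborel)"
      by (intro Bochner_Integration.integral_cong) (auto simp: indicator_def)
    also have "\<dots> = 0" using compl whole f int by (subst Bochner_Integration.integral_diff) auto
    finally show ?case .
  next
    case (union B)
    then have [measurable]: "B i \<in> sets borel" for i unfolding borel_eq_box by auto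
    have "(LINT x:(\<Union>i. B i)|lborel. f x) = (\<Sum>i. LINT x:B i|lborel. f x)"
    proof (rule lebesgue_integral_countable_add)
      show "set_integrable lborel (\<Union>i. B i) f"
        using int[of "\<Union>i. B i"] by (simp add: set_integrable_def)
    qed (use union in \<open>auto simp: disjoint_family_on_def\<close>)
    then show ?case using union by (simp add: set_lebesgue_integral_def)
  qed
qed

text \<open>Dominated convergence turns bumps into indicators of boxes; on each box inside
  \<open>W\<close> the restricted function then has zero integral over every Borel set, and
  countably many boxes cover \<open>W\<close>.\<close>

lemma AE_zero_of_bumps:
  fixes f :: "R3 \<Rightarrow> real"
  assumes W: "open W" and f[measurable]: "f \<in> borel_measurable borel"
    and int: "\<And>a b. cbox a b \<subseteq> W \<Longrightarrow> integrable lborel (\<lambda>x. indicator (cbox a b) x * f x)"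
    and z: "\<And>k a b. \<lbrakk>0 < k; cbox a b \<subseteq> W\<rbrakk> \<Longrightarrow> (\<integral>x. bump k a b x * f x \<partial>lborel) = 0"
  shows "AE x in lborel. x \<in> W \<longrightarrow> f x = 0"
proof -
  have [measurable]: "bump k a b \<in> borel_measurable borel" for k a b
    using flatalg_diff[OF flatalg_bump] by (intro borel_measurable_continuous_onI differentiable_imp_continuous_on)
      (auto simp: differentiable_on_def intro: differentiable_at_withinI)
  have boxz: "(\<integral>x. indicator (box a b) x * f x \<partial>lborel) = 0" if ab: "cbox a b \<subseteq> W" for a b
  proof -
    have "(\<lambda>n. \<integral>x. bump (real (Suc n)) a b x * f x \<partial>lborel) \<longlonglongrightarrow> (\<integral>x. indicator (box a b) x * f x \<partial>lborel)"
    proof (rule integral_dominated_convergence[where w = "\<lambda>x. \<bar>indicator (cbox a b) x * f x\<bar>"])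
      show "AE x in lborel. (\<lambda>n. bump (real (Suc n)) a b x * f x) \<longlonglongrightarrow> indicator (box a b) x * f x"
        by (intro AE_I2 tendsto_mult tendsto_const bump_tendsto)
      show "AE x in lborel. norm (bump (real (Suc n)) a b x * f x) \<le> \<bar>indicator (cbox a b) x * f x\<bar>" for n
      proof (rule AE_I2)
        fix x
        show "norm (bump (real (Suc n)) a b x * f x) \<le> \<bar>indicator (cbox a b) x * f x\<bar>"
        proof (cases "x \<in> box a b")
          case True
          then have "x \<in> cbox a b" using box_subset_cbox by blast
          then show ?thesis using bump_bounds[of "real (Suc n)" a b x]
            by (simp add: abs_mult mult_left_le_one_le)
        next
          case False
          then show ?thesis using bump_eq_0[of "real (Suc n)" x a b] by simp
        qed
      qed
    qed (use int[OF ab] in auto)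
    moreover have "(\<integral>x. bump (real (Suc n)) a b x * f x \<partial>lborel) = 0" for n
      using z[OF _ ab] by simp
    ultimately show ?thesis using LIMSEQ_unique[OF _ tendsto_const] by fastforce
  qed
  have loc: "AE x in lborel. x \<in> box c d \<longrightarrow> f x = 0" if cd: "cbox c d \<subseteq> W" for c d
  proof -
    define f1 where "f1 x = indicator (box c d) x * f x" for x
    have i1: "integrable lborel f1"
    proof -
      have "integrable lborel (\<lambda>x. indicator (box c d) x *\<^sub>R (indicator (cbox c d) x * f x))"
        using int[OF cd] by (intro integrable_mult_indicator) auto
      moreover have "(\<lambda>x. indicator (box c d) x *\<^sub>R (indicator (cbox c d) x * f x)) = f1"
        using box_subset_cbox[of c d] by (intro ext) (auto simp: f1_def indicator_def)
      ultimately show ?thesis by simp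
    qed
    have z1: "(\<integral>x. indicator (box a b) x * f1 x \<partial>lborel) = 0" for a b
    proof -
      obtain a' b' where ab': "box a b \<inter> box c d = box a' b'" by (auto simp: box_Int_box)
      show ?thesis
      \<comment> \<open>For a nonempty intersection the closed box is its closure and stays inside
        \<open>W\<close>; for an empty one the corners carry no information, but the integrand
        vanishes.\<close>
      proof (cases "box a' b' = {}")
        case True
        then have "(\<lambda>x. indicator (box a b) x * f1 x) = (\<lambda>_. 0)"
          using ab' by (intro ext) (auto simp: f1_def indicator_def)
        then show ?thesis by simp
      next
        case False
        then have "cbox a' b' = closure (box a' b')" by (simp add: closure_box)
        also have "\<dots> \<subseteq> closure (box c d)" using ab' by (intro closure_mono) auto
        also have "\<dots> \<subseteq> cbox c d" by (intro closure_minimal box_subset_cbox closed_cbox)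
        finally have "cbox a' b' \<subseteq> W" using cd by blast
        from boxz[OF this] show ?thesis
          unfolding ab'[symmetric] f1_def by (simp add: indicator_inter_arith mult.assoc)
      qed
    qed
    have "AE x in lborel. f1 x = 0"
    proof (rule density_unique_real[OF i1])
      show "(\<integral>x\<in>A. f1 x \<partial>lborel) = (\<integral>x\<in>A. 0 \<partial>lborel)" if "A \<in> sets lborel" for A
        using integral_all_borel_zero[OF i1 z1, of A] that by (simp add: set_lebesgue_integral_def)
    qed simp
    then show ?thesis by eventually_elim (auto simp: f1_def)
  qed
  obtain \<C> where C: "countable \<C>" "\<And>X. X \<in> \<C> \<Longrightarrow> X \<subseteq> W \<and> (\<exists>a b. X = cbox a b)" "\<Union>\<C> = W"
    using open_countable_Union_open_cbox[OF W] by (metis PowD subsetD)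
  have loc': "AE x in lborel. x \<in> X \<longrightarrow> f x = 0" if X: "X \<in> \<C>" for X
  proof -
    obtain a b where ab: "X = cbox a b" "cbox a b \<subseteq> W" using C(2)[OF X] by auto
    have "AE x in lborel. x \<notin> cbox a b - box a b"
    proof (rule AE_not_in)
      have "cbox a b - box a b = frontier (cbox a b)" by (simp add: frontier_cbox)
      then have "cbox a b - box a b \<in> null_sets lebesgue"
        using negligible_frontier_interval[of a b] by (simp add: negligible_iff_null_sets)
      then show "cbox a b - box a b \<in> null_sets lborel"
        by (simp add: null_sets_completion_iff)
    qed
    then show ?thesis using loc[OF ab(2)] by eventually_elim (auto simp: ab)
  qed
  have "AE x in lborel. \<forall>X\<in>\<C>. x \<in> X \<longrightarrow> f x = 0"
    using loc' by (subst AE_ball_countable[OF C(1)]) blast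
  then show ?thesis by eventually_elim (use C(3) in auto)
qed

lemma integral_translate:
  fixes f :: "R3 \<Rightarrow> 'b::{banach, second_countable_topology}"
  assumes [measurable]: "f \<in> borel_measurable borel"
  shows "(\<integral>x. f (x + c) \<partial>lborel) = (\<integral>x. f x \<partial>lborel)"
proof -
  have "(\<integral>x. f x \<partial>lborel) = (\<integral>x. f x \<partial>distr lborel borel ((+) c))" by (simp add: lborel_distr_plus)
  also have "\<dots> = (\<integral>x. f (c + x) \<partial>lborel)" by (subst integral_distr) auto
  finally show ?thesis by (simp add: add.commute)
qed

lemma nn_integral_translate:
  fixes f :: "R3 \<Rightarrow> ennreal"
  assumes [measurable]: "f \<in> borel_measurable borel"
  shows "(\<integral>\<^sup>+x. f (x + c) \<partial>lborel) = (\<integral>\<^sup>+x. f x \<partial>lborel)"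
proof -
  have "(\<integral>\<^sup>+x. f x \<partial>lborel) = (\<integral>\<^sup>+x. f x \<partial>distr lborel borel ((+) c))" by (simp add: lborel_distr_plus)
  also have "\<dots> = (\<integral>\<^sup>+x. f (c + x) \<partial>lborel)" by (subst nn_integral_distr) auto
  finally show ?thesis by (simp add: add.commute)
qed

lemma integrable_translate:
  fixes f :: "R3 \<Rightarrow> real"
  assumes "integrable lborel f"
  shows "integrable lborel (\<lambda>x. f (x + c))"
proof -
  have [measurable]: "f \<in> borel_measurable borel" using borel_measurable_integrable[OF assms] by simp
  have "integrable (distr lborel borel ((+) c)) f" using assms by (simp add: lborel_distr_plus)
  then have "integrable lborel (\<lambda>x. f (c + x))" by (subst (asm) integrable_distr_eq) auto
  then show ?thesis by (simp add: add.commute)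
qed

lemma flatalg_cont: "flatalg f \<Longrightarrow> continuous_on S f"
  using flatalg_diff by (meson differentiable_at_withinI differentiable_imp_continuous_on differentiable_on_def)

lemma flatalg_measurable: "flatalg f \<Longrightarrow> f \<in> borel_measurable borel"
  by (intro borel_measurable_continuous_onI flatalg_cont)

lemma flatalg_pd: "flatalg f \<Longrightarrow> flatalg (pd j f)"
  using flatalg_diff by blast

section \<open>The fundamental theorem of calculus on almost every segment\<close>

lemma line_deriv:
  assumes "\<phi> differentiable (at (y + \<tau> *\<^sub>R axis j 1))"
  shows "((\<lambda>\<tau>. \<phi> (y + \<tau> *\<^sub>R axis j 1)) has_real_derivative pd j \<phi> (y + \<tau> *\<^sub>R axis j 1)) (at \<tau>)"
proof -
  obtain D where D: "(\<phi> has_derivative D) (at (y + \<tau> *\<^sub>R axis j 1))" using assms by (auto simp: differentiable_def)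
  have l: "((\<lambda>\<tau>. y + \<tau> *\<^sub>R axis j 1) has_derivative (\<lambda>h. h *\<^sub>R axis j 1)) (at \<tau>)"
    by (auto intro!: derivative_eq_intros)
  have "((\<lambda>\<tau>. \<phi> (y + \<tau> *\<^sub>R axis j 1)) has_derivative (\<lambda>h. D (h *\<^sub>R axis j 1))) (at \<tau>)"
    using has_derivative_compose[OF l D] .
  moreover have "(\<lambda>h. D (h *\<^sub>R axis j 1)) = (*) (pd j \<phi> (y + \<tau> *\<^sub>R axis j 1))"
    using linear_scale[OF has_derivative_linear[OF D]] by (auto simp: pd_eq[OF D])
  ultimately show ?thesis by (simp add: has_field_derivative_def)
qed

lemma pd_bump_eq_0: "0 < k \<Longrightarrow> x \<notin> cbox a b \<Longrightarrow> pd j (bump k a b) x = 0"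
proof -
  assume k: "0 < k" and x: "x \<notin> cbox a b"
  have z: "bump k a b y = 0" if "y \<notin> cbox a b" for y
    using that bump_eq_0[OF k, of y a b] box_subset_cbox[of a b] by blast
  have "((\<lambda>_. 0) has_derivative (\<lambda>_. 0)) (at x)" by simp
  then have "(bump k a b has_derivative (\<lambda>_. 0)) (at x)"
    by (rule has_derivative_transform_within_open[of _ _ _ _ "- cbox a b"])
       (use x z in \<open>auto simp: closed_cbox open_Compl\<close>)
  from pd_eq[OF this] show ?thesis by simp
qed

lemma pd_bump_bound: "0 < k \<Longrightarrow> \<exists>M\<ge>0. \<forall>x. \<bar>pd j (bump k a b) x\<bar> \<le> M * indicator (cbox a b) x"
proof -
  assume k: "0 < k"
  have "bounded (pd j (bump k a b) ` cbox a b)"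
    by (intro compact_imp_bounded compact_continuous_image flatalg_cont flatalg_pd flatalg_bump compact_cbox)
  then obtain M where M: "\<And>x. x \<in> cbox a b \<Longrightarrow> \<bar>pd j (bump k a b) x\<bar> \<le> M" by (auto simp: bounded_iff)
  have "\<bar>pd j (bump k a b) x\<bar> \<le> max M 0 * indicator (cbox a b) x" for x
    using M[of x] pd_bump_eq_0[OF k, of x a b j] by (auto simp: indicator_def)
  then show ?thesis by (intro exI[of _ "max M 0"]) auto
qed

lemma pd_bump_shift: "pd j (bump k a b) (x - v) = pd j (bump k (a + v) (b + v)) x"
proof -
  have "bump k a b differentiable (at (x - v))" using flatalg_diff flatalg_bump by blast
  then obtain D where D: "(bump k a b has_derivative D) (at (x - v))" by (auto simp: differentiable_def)
  have l: "((\<lambda>x. x - v) has_derivative (\<lambda>h. h)) (at x)" by (auto intro!: derivative_eq_intros)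
  have "((\<lambda>x. bump k a b (x - v)) has_derivative D) (at x)" using has_derivative_compose[OF l D] .
  then have "(bump k (a + v) (b + v) has_derivative D) (at x)" by (simp add: bump_shift)
  then show ?thesis using pd_eq[OF D] pd_eq by metis
qed

text \<open>The defect \<open>f\<close> is tested against bumps. The translation by
  \<open>\<tau>\<close> is moved onto the bump, and the weak identity replaces \<open>g\<close> by
  \<open>u\<close> paired with the derivative of the translated bump. Integrating in
  \<open>\<tau>\<close> gives the bump minus its translate by \<open>t\<close>, which is exactly the
  contribution of the two end values of \<open>u\<close>. So \<open>f\<close> has zero integral
  against every bump.\<close>

lemma line_identity_real:
  fixes u g :: "R3 \<Rightarrow> real" and j :: 3
  defines "e \<equiv> axis j 1 :: R3"
  assumes U: "open U" and W: "open W" and t: "0 \<le> t"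
    and seg: "\<And>x \<tau>. \<lbrakk>x \<in> W; 0 \<le> \<tau>; \<tau> \<le> t\<rbrakk> \<Longrightarrow> x + \<tau> *\<^sub>R e \<in> U"
    and u[measurable]: "u \<in> borel_measurable borel" and g[measurable]: "g \<in> borel_measurable borel"
    and ui: "\<And>K. compact K \<Longrightarrow> K \<subseteq> U \<Longrightarrow> set_integrable lborel K u"
    and gi: "\<And>K. compact K \<Longrightarrow> K \<subseteq> U \<Longrightarrow> set_integrable lborel K g"
    and weak: "\<And>k a b. 0 < k \<Longrightarrow> cbox a b \<subseteq> U \<Longrightarrow>
        (\<integral>x. pd j (bump k a b) x * u x \<partial>lborel) = - (\<integral>x. bump k a b x * g x \<partial>lborel)"
  shows "AE x in lborel. x \<in> W \<longrightarrow> set_integrable lborel {0..t} (\<lambda>\<tau>. g (x + \<tau> *\<^sub>R e)) \<and>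
      u (x + t *\<^sub>R e) - u x = (LBINT \<tau>:{0..t}. g (x + \<tau> *\<^sub>R e))"
proof -
  have bm[measurable]: "bump k a b \<in> borel_measurable borel" "pd j (bump k a b) \<in> borel_measurable borel" for k a b
    by (intro flatalg_measurable flatalg_bump flatalg_pd)+
  define f where "f x = u (x + t *\<^sub>R e) - u x - (\<integral>\<tau>. indicator {0..t} \<tau> * g (x + \<tau> *\<^sub>R e) \<partial>lborel)" for x
  have fm[measurable]: "f \<in> borel_measurable borel" unfolding f_def by measurable
  define G where "G a b = (\<lambda>(x, \<tau>). indicator (cbox a b) x * (indicator {0..t} \<tau> * g (x + \<tau> *\<^sub>R e)))" for a b :: R3
  have Gm[measurable]: "G a b \<in> borel_measurable (borel \<Otimes>\<^sub>M borel)" for a b unfolding G_def by measurable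
  \<comment> \<open>Compact sweep of a box along the segment; it stays in \<open>U\<close>, so local
    integrability on it serves all \<open>\<tau>\<close> at once.\<close>
  define tube where "tube a b = (\<lambda>(x, \<tau>). x + \<tau> *\<^sub>R e) ` (cbox a b \<times> {0..t})" for a b
  have tube: "compact (tube a b)" for a b
    unfolding tube_def by (intro compact_continuous_image compact_Times) (auto intro!: continuous_intros simp: case_prod_beta)
  have tubeU: "tube a b \<subseteq> U" if "cbox a b \<subseteq> W" for a b using that seg by (auto simp: tube_def)
  have tubeI: "x + \<tau> *\<^sub>R e \<in> tube a b" if "x \<in> cbox a b" "0 \<le> \<tau>" "\<tau> \<le> t" for x a b \<tau>
    using that by (force simp: tube_def)
  have tm[measurable]: "tube a b \<in> sets borel" for a b using tube by (simp add: borel_compact)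
  have Gint: "integrable (lborel \<Otimes>\<^sub>M lborel) (G a b)" if ab: "cbox a b \<subseteq> W" for a b
  proof (rule integrableI_bounded)
    show "G a b \<in> borel_measurable (lborel \<Otimes>\<^sub>M lborel)" by simp
    have fin: "(\<integral>\<^sup>+x. ennreal (indicator (tube a b) x * \<bar>g x\<bar>) \<partial>lborel) < \<infinity>"
      using gi[OF tube tubeU[OF ab]] by (simp add: set_integrable_def integrable_iff_bounded abs_mult)
    have "(\<integral>\<^sup>+z. ennreal (norm (G a b z)) \<partial>(lborel \<Otimes>\<^sub>M lborel)) = (\<integral>\<^sup>+\<tau>. \<integral>\<^sup>+x. ennreal (norm (G a b (x, \<tau>))) \<partial>lborel \<partial>lborel)"
      by (rule lborel_pair.nn_integral_snd[symmetric]) simp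
    also have "\<dots> \<le> (\<integral>\<^sup>+\<tau>. indicator {0..t} \<tau> * (\<integral>\<^sup>+x. ennreal (indicator (tube a b) x * \<bar>g x\<bar>) \<partial>lborel) \<partial>lborel)"
    proof (rule nn_integral_mono)
      fix \<tau> :: real
      show "(\<integral>\<^sup>+x. ennreal (norm (G a b (x, \<tau>))) \<partial>lborel) \<le> indicator {0..t} \<tau> * (\<integral>\<^sup>+x. ennreal (indicator (tube a b) x * \<bar>g x\<bar>) \<partial>lborel)"
      proof (cases "\<tau> \<in> {0..t}")
        case True
        have "(\<integral>\<^sup>+x. ennreal (norm (G a b (x, \<tau>))) \<partial>lborel)
            \<le> (\<integral>\<^sup>+x. ennreal (indicator (tube a b) (x + \<tau> *\<^sub>R e) * \<bar>g (x + \<tau> *\<^sub>R e)\<bar>) \<partial>lborel)"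
        proof (rule nn_integral_mono, rule ennreal_leI)
          fix x :: R3
          show "norm (G a b (x, \<tau>)) \<le> indicator (tube a b) (x + \<tau> *\<^sub>R e) * \<bar>g (x + \<tau> *\<^sub>R e)\<bar>"
            using True tubeI[of x a b \<tau>] by (auto simp: G_def indicator_def)
        qed
        also have "\<dots> = (\<integral>\<^sup>+x. ennreal (indicator (tube a b) x * \<bar>g x\<bar>) \<partial>lborel)"
          by (rule nn_integral_translate) simp
        finally show ?thesis using True by simp
      qed (simp add: G_def)
    qed
    also have "\<dots> = emeasure lborel {0..t} * (\<integral>\<^sup>+x. ennreal (indicator (tube a b) x * \<bar>g x\<bar>) \<partial>lborel)"
      by (simp add: nn_integral_multc)
    also have "\<dots> < \<infinity>" using fin t by (simp add: ennreal_mult_less_top)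
    finally show "(\<integral>\<^sup>+z. ennreal (norm (G a b z)) \<partial>(lborel \<Otimes>\<^sub>M lborel)) < \<infinity>" .
  qed
  have ucell: "integrable lborel (\<lambda>x. indicator (cbox a b) x * u (x + \<tau> *\<^sub>R e))"
    if ab: "cbox a b \<subseteq> W" "0 \<le> \<tau>" "\<tau> \<le> t" for a b \<tau>
  proof -
    have "integrable lborel (\<lambda>x. indicator (tube a b) (x + \<tau> *\<^sub>R e) * u (x + \<tau> *\<^sub>R e))"
      using integrable_translate[of "\<lambda>x. indicator (tube a b) x * u x" "\<tau> *\<^sub>R e"] ui[OF tube tubeU[OF ab(1)]]
      by (simp add: set_integrable_def)
    then show ?thesis
    proof (rule Bochner_Integration.integrable_bound)
      show "AE x in lborel. norm (indicator (cbox a b) x * u (x + \<tau> *\<^sub>R e)) \<le> norm (indicator (tube a b) (x + \<tau> *\<^sub>R e) * u (x + \<tau> *\<^sub>R e))"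
        using tubeI[OF _ ab(2,3)] by (auto simp: indicator_def)
    qed simp
  qed
  have Gfst: "integrable lborel (\<lambda>x. indicator (cbox a b) x * (\<integral>\<tau>. indicator {0..t} \<tau> * g (x + \<tau> *\<^sub>R e) \<partial>lborel))"
    if ab: "cbox a b \<subseteq> W" for a b
    using lborel_pair.integrable_fst'[OF Gint[OF ab]] by (simp add: G_def)
  have fint: "integrable lborel (\<lambda>x. indicator (cbox a b) x * f x)" if ab: "cbox a b \<subseteq> W" for a b
    using ucell[OF ab t] ucell[OF ab, of 0] t Gfst[OF ab] by (simp add: f_def right_diff_distrib)
  have zero: "(\<integral>x. bump k a b x * f x \<partial>lborel) = 0" if k: "0 < k" and ab: "cbox a b \<subseteq> W" for k a b
  proof -
    define B where "B = bump k a b"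
    define B' where "B' = pd j (bump k a b)"
    have [measurable]: "B \<in> borel_measurable borel" "B' \<in> borel_measurable borel" by (simp_all add: B_def B'_def)
    have B0: "B x = 0" if "x \<notin> cbox a b" for x using that bump_eq_0[OF k] box_subset_cbox unfolding B_def by blast
    have B1: "\<bar>B x\<bar> \<le> indicator (cbox a b) x" for x
      using B0[of x] bump_bounds[of k a b x] by (auto simp: B_def indicator_def)
    obtain M where M: "0 \<le> M" "\<And>x. \<bar>B' x\<bar> \<le> M * indicator (cbox a b) x" using pd_bump_bound[OF k] unfolding B'_def by blast
    have Bint: "integrable lborel (\<lambda>x. B x * h x)" if "integrable lborel (\<lambda>x. indicator (cbox a b) x * h x)" "h \<in> borel_measurable borel" for h
    proof (rule Bochner_Integration.integrable_bound[OF that(1)])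
      show "AE x in lborel. norm (B x * h x) \<le> norm (indicator (cbox a b) x * h x)"
        using B1 by (intro AE_I2) (simp add: abs_mult mult_right_mono)
    qed (use that(2) in simp)
    have i1: "integrable lborel (\<lambda>x. B x * u (x + t *\<^sub>R e))" by (rule Bint[OF ucell[OF ab t order_refl]]) simp
    have i2: "integrable lborel (\<lambda>x. B x * u x)" using Bint[of u] ucell[OF ab, of 0] t by simp
    have i3: "integrable lborel (\<lambda>x. B x * (\<integral>\<tau>. indicator {0..t} \<tau> * g (x + \<tau> *\<^sub>R e) \<partial>lborel))"
      by (rule Bint[OF Gfst[OF ab]]) simp
    have e1: "(\<integral>x. B x * u (x + t *\<^sub>R e) \<partial>lborel) = (\<integral>y. B (y - t *\<^sub>R e) * u y \<partial>lborel)"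
      using integral_translate[of "\<lambda>y. B (y - t *\<^sub>R e) * u y" "t *\<^sub>R e"] by simp
    \<comment> \<open>The bump translated by \<open>\<tau>\<close> is again a bump, with its box
      inside \<open>U\<close> by \<open>seg\<close>, so \<open>weak\<close> applies to it.\<close>
    have step: "(\<integral>x. B x * g (x + \<tau> *\<^sub>R e) \<partial>lborel) = - (\<integral>y. B' (y - \<tau> *\<^sub>R e) * u y \<partial>lborel)"
      if \<tau>: "0 \<le> \<tau>" "\<tau> \<le> t" for \<tau>
    proof -
      have sub: "cbox (a + \<tau> *\<^sub>R e) (b + \<tau> *\<^sub>R e) \<subseteq> U"
      proof
        fix y assume "y \<in> cbox (a + \<tau> *\<^sub>R e) (b + \<tau> *\<^sub>R e)"
        then have "y - \<tau> *\<^sub>R e \<in> cbox a b" by (auto simp: mem_box inner_diff_left inner_add_left)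
        then have "y - \<tau> *\<^sub>R e \<in> W" using ab by blast
        from seg[OF this \<tau>] show "y \<in> U" by simp
      qed
      have "(\<integral>x. B x * g (x + \<tau> *\<^sub>R e) \<partial>lborel) = (\<integral>y. B (y - \<tau> *\<^sub>R e) * g y \<partial>lborel)"
        using integral_translate[of "\<lambda>y. B (y - \<tau> *\<^sub>R e) * g y" "\<tau> *\<^sub>R e"] by simp
      also have "\<dots> = - (\<integral>y. B' (y - \<tau> *\<^sub>R e) * u y \<partial>lborel)"
        using weak[OF k sub] by (simp add: B_def B'_def bump_shift pd_bump_shift)
      finally show ?thesis .
    qed
    have pint: "integrable (lborel \<Otimes>\<^sub>M lborel) (\<lambda>(y, \<tau>). indicator {0..t} \<tau> * (B' (y - \<tau> *\<^sub>R e) * u y))"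
    proof (rule Bochner_Integration.integrable_bound)
      show "integrable (lborel \<Otimes>\<^sub>M lborel) (\<lambda>(y, \<tau>). (indicator (tube a b) y * \<bar>u y\<bar>) * (M * indicator {0..t} \<tau>))"
      proof (rule lborel_pair.Fubini_integrable)
        have iu: "integrable lborel (\<lambda>y. indicator (tube a b) y * \<bar>u y\<bar>)"
          using integrable_abs[OF ui[OF tube tubeU[OF ab], unfolded set_integrable_def]] by (simp add: abs_mult)
        have it: "integrable lborel (\<lambda>\<tau>::real. M * indicator {0..t} \<tau>)"
          using t by (intro integrable_mult_right integrable_real_indicator) auto
        show "integrable lborel (\<lambda>x. \<integral>\<tau>. norm (case (x, \<tau>) of (y, \<tau>) \<Rightarrow> indicator (tube a b) y * \<bar>u y\<bar> * (M * indicator {0..t} \<tau>)) \<partial>lborel)"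
          using M(1) iu by (simp add: abs_mult)
        show "AE x in lborel. integrable lborel (\<lambda>\<tau>. case (x, \<tau>) of (y, \<tau>) \<Rightarrow> indicator (tube a b) y * \<bar>u y\<bar> * (M * indicator {0..t} \<tau>))"
          using it by simp
      qed simp
      show "AE z in lborel \<Otimes>\<^sub>M lborel. norm (case z of (y, \<tau>) \<Rightarrow> indicator {0..t} \<tau> * (B' (y - \<tau> *\<^sub>R e) * u y))
          \<le> norm (case z of (y, \<tau>) \<Rightarrow> indicator (tube a b) y * \<bar>u y\<bar> * (M * indicator {0..t} \<tau>))"
      proof (rule AE_I2, clarify)
        fix y :: R3 and \<tau> :: real
        show "norm (indicator {0..t} \<tau> * (B' (y - \<tau> *\<^sub>R e) * u y)) \<le> norm (indicator (tube a b) y * \<bar>u y\<bar> * (M * indicator {0..t} \<tau>))"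
        proof (cases "\<tau> \<in> {0..t} \<and> y - \<tau> *\<^sub>R e \<in> cbox a b")
          case True
          then have "y \<in> tube a b" using tubeI[of "y - \<tau> *\<^sub>R e" a b \<tau>] by auto
          moreover have "\<bar>B' (y - \<tau> *\<^sub>R e)\<bar> \<le> M" using M(2)[of "y - \<tau> *\<^sub>R e"] True by auto
          moreover from this have "\<bar>B' (y - \<tau> *\<^sub>R e)\<bar> * \<bar>u y\<bar> \<le> M * \<bar>u y\<bar>" by (rule mult_right_mono) simp
          ultimately show ?thesis using True M(1) by (simp add: abs_mult mult_ac)
        next
          case False
          then show ?thesis using M(2)[of "y - \<tau> *\<^sub>R e"] by (auto simp: indicator_def)
        qed
      qed
    qed simp
    have "(\<integral>x. B x * (\<integral>\<tau>. indicator {0..t} \<tau> * g (x + \<tau> *\<^sub>R e) \<partial>lborel) \<partial>lborel)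
       = (\<integral>x. \<integral>\<tau>. B x * (indicator {0..t} \<tau> * g (x + \<tau> *\<^sub>R e)) \<partial>lborel \<partial>lborel)"
      by simp
    also have "\<dots> = (\<integral>\<tau>. \<integral>x. B x * (indicator {0..t} \<tau> * g (x + \<tau> *\<^sub>R e)) \<partial>lborel \<partial>lborel)"
    proof (rule lborel_pair.Fubini_integral[symmetric])
      show "integrable (lborel \<Otimes>\<^sub>M lborel) (\<lambda>(x, \<tau>). B x * (indicator {0..t} \<tau> * g (x + \<tau> *\<^sub>R e)))"
      proof (rule Bochner_Integration.integrable_bound[OF Gint[OF ab]])
        show "AE z in lborel \<Otimes>\<^sub>M lborel. norm (case z of (x, \<tau>) \<Rightarrow> B x * (indicator {0..t} \<tau> * g (x + \<tau> *\<^sub>R e))) \<le> norm (G a b z)"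
          by (rule AE_I2, clarify) (simp add: G_def abs_mult B1 mult_right_mono)
      qed simp
    qed
    also have "\<dots> = (\<integral>\<tau>. indicator {0..t} \<tau> * (\<integral>x. B x * g (x + \<tau> *\<^sub>R e) \<partial>lborel) \<partial>lborel)"
    proof -
      have "(\<integral>x. B x * (c * h x) \<partial>lborel) = c * (\<integral>x. B x * h x \<partial>lborel)" for c h
        by (subst Bochner_Integration.integral_mult_right_zero[symmetric]) (simp add: mult_ac)
      then show ?thesis by simp
    qed
    also have "\<dots> = (\<integral>\<tau>. indicator {0..t} \<tau> * - (\<integral>y. B' (y - \<tau> *\<^sub>R e) * u y \<partial>lborel) \<partial>lborel)"
      using step by (intro Bochner_Integration.integral_cong) (auto simp: indicator_def)
    also have "\<dots> = - (\<integral>\<tau>. \<integral>y. indicator {0..t} \<tau> * (B' (y - \<tau> *\<^sub>R e) * u y) \<partial>lborel \<partial>lborel)" by simp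
    also have "\<dots> = - (\<integral>y. \<integral>\<tau>. indicator {0..t} \<tau> * (B' (y - \<tau> *\<^sub>R e) * u y) \<partial>lborel \<partial>lborel)"
      using lborel_pair.Fubini_integral[OF pint] by simp
    also have "\<dots> = - (\<integral>y. (B y - B (y - t *\<^sub>R e)) * u y \<partial>lborel)"
    proof -
      have "(\<integral>\<tau>. indicator {0..t} \<tau> * (B' (y - \<tau> *\<^sub>R e) * u y) \<partial>lborel) = (B y - B (y - t *\<^sub>R e)) * u y" for y
      proof -
        have d: "((\<lambda>\<tau>. - B (y - \<tau> *\<^sub>R e)) has_real_derivative B' (y - \<tau> *\<^sub>R e)) (at \<tau>)" for \<tau>
        proof -
          have "((\<lambda>\<tau>. B (y + (- \<tau>) *\<^sub>R e)) has_real_derivative (B' (y + (- \<tau>) *\<^sub>R e)) * (-1)) (at \<tau>)"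
            by (rule DERIV_chain2[where g = uminus and f = "\<lambda>\<tau>. B (y + \<tau> *\<^sub>R e)"])
               (use line_deriv[of "bump k a b" y "- \<tau>" j] flatalg_diff[OF flatalg_bump, of k a b] in \<open>auto simp: B_def B'_def e_def intro!: derivative_eq_intros\<close>)
          from DERIV_minus[OF this] show ?thesis by simp
        qed
        have c: "isCont (\<lambda>\<tau>. B' (y - \<tau> *\<^sub>R e)) \<tau>" for \<tau>
        proof -
          have "continuous_on UNIV (\<lambda>\<tau>. B' (y - \<tau> *\<^sub>R e))"
            unfolding B'_def
            by (rule continuous_on_compose2[OF flatalg_cont[OF flatalg_pd[OF flatalg_bump], of UNIV]])
               (auto intro!: continuous_intros)
          then show ?thesis by (simp add: continuous_on_eq_continuous_at)
        qed
        have "(\<integral>\<tau>. B' (y - \<tau> *\<^sub>R e) * indicator {0..t} \<tau> \<partial>lborel) = - B (y - t *\<^sub>R e) - (- B (y - 0 *\<^sub>R e))"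
          by (rule integral_FTC_Icc_real[OF t d c])
        then have "(\<integral>\<tau>. indicator {0..t} \<tau> * B' (y - \<tau> *\<^sub>R e) \<partial>lborel) = B y - B (y - t *\<^sub>R e)"
          by (simp add: mult.commute)
        moreover have "(\<integral>\<tau>. indicator {0..t} \<tau> * (B' (y - \<tau> *\<^sub>R e) * u y) \<partial>lborel) = (\<integral>\<tau>. indicator {0..t} \<tau> * B' (y - \<tau> *\<^sub>R e) \<partial>lborel) * u y"
          by (simp flip: mult.assoc)
        ultimately show ?thesis by simp
      qed
      then show ?thesis by simp
    qed
    finally have e3: "(\<integral>x. B x * (\<integral>\<tau>. indicator {0..t} \<tau> * g (x + \<tau> *\<^sub>R e) \<partial>lborel) \<partial>lborel)
        = - (\<integral>y. (B y - B (y - t *\<^sub>R e)) * u y \<partial>lborel)" .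
    have i4: "integrable lborel (\<lambda>y. B (y - t *\<^sub>R e) * u y)"
      using integrable_translate[OF i1, of "- (t *\<^sub>R e)"] by simp
    have "(\<integral>x. B x * f x \<partial>lborel) = (\<integral>x. B x * u (x + t *\<^sub>R e) \<partial>lborel) - (\<integral>x. B x * u x \<partial>lborel)
        - (\<integral>x. B x * (\<integral>\<tau>. indicator {0..t} \<tau> * g (x + \<tau> *\<^sub>R e) \<partial>lborel) \<partial>lborel)"
      using i1 i2 i3 by (simp add: f_def right_diff_distrib)
    also have "\<dots> = 0" unfolding e1 e3 using i2 i4 by (simp add: left_diff_distrib)
    finally show ?thesis by (simp add: B_def)
  qed
  have AE1: "AE x in lborel. x \<in> W \<longrightarrow> f x = 0"
    by (rule AE_zero_of_bumps[OF W fm fint zero])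
  obtain \<C> where C: "countable \<C>" "\<And>X. X \<in> \<C> \<Longrightarrow> X \<subseteq> W \<and> (\<exists>a b. X = cbox a b)" "\<Union>\<C> = W"
    using open_countable_Union_open_cbox[OF W] by (metis PowD subsetD)
  have loc: "AE x in lborel. x \<in> X \<longrightarrow> set_integrable lborel {0..t} (\<lambda>\<tau>. g (x + \<tau> *\<^sub>R e))" if X: "X \<in> \<C>" for X
  proof -
    obtain a b where ab: "X = cbox a b" "cbox a b \<subseteq> W" using C(2)[OF X] by auto
    have "AE x in lborel. integrable lborel (\<lambda>\<tau>. G a b (x, \<tau>))" by (rule lborel_pair.AE_integrable_fst'[OF Gint[OF ab(2)]])
    then show ?thesis by eventually_elim (auto simp: ab(1) G_def set_integrable_def)
  qed
  have "AE x in lborel. \<forall>X\<in>\<C>. x \<in> X \<longrightarrow> set_integrable lborel {0..t} (\<lambda>\<tau>. g (x + \<tau> *\<^sub>R e))"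
    using loc by (subst AE_ball_countable[OF C(1)]) blast
  with AE1 show ?thesis
  proof eventually_elim
    case (elim x)
    show ?case
    proof
      assume x: "x \<in> W"
      then show "set_integrable lborel {0..t} (\<lambda>\<tau>. g (x + \<tau> *\<^sub>R e)) \<and>
         u (x + t *\<^sub>R e) - u x = (LBINT \<tau>:{0..t}. g (x + \<tau> *\<^sub>R e))"
        using elim C(3) by (auto simp: f_def set_lebesgue_integral_def)
    qed
  qed
qed

section \<open>Borel representatives and the line property\<close>

definition borel_rep :: "R3 set \<Rightarrow> (R3 \<Rightarrow> 'b::{banach, second_countable_topology}) \<Rightarrow> (R3 \<Rightarrow> 'b) \<Rightarrow> bool" where
  "borel_rep U f f' \<longleftrightarrow> f' \<in> borel_measurable borel \<and> (AE x in lborel. x \<in> U \<longrightarrow> f' x = f x)"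

text \<open>Locally integrable functions are only Lebesgue measurable; iterated integrals over lines need
  a Borel version.\<close>

lemma loc_int_measurable:
  fixes f :: "R3 \<Rightarrow> 'b::{banach, second_countable_topology}"
  assumes U: "open U" and f: "loc_int U f"
  shows "(\<lambda>x. indicator U x *\<^sub>R f x) \<in> borel_measurable lebesgue"
proof -
  obtain \<C> where C: "countable \<C>" "\<And>X. X \<in> \<C> \<Longrightarrow> X \<subseteq> U \<and> (\<exists>a b. X = cbox a b)" "\<Union>\<C> = U"
    using open_countable_Union_open_cbox[OF U] by (metis PowD subsetD)
  define K where "K n = (\<Union>i<n. from_nat_into (insert {} \<C>) i)" for n
  have ne: "insert {} \<C> \<noteq> {}" "countable (insert {} \<C>)" using C by auto
  have inC: "from_nat_into (insert {} \<C>) i \<in> insert {} \<C>" for i by (rule from_nat_into[OF ne(1)])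
  have "compact (from_nat_into (insert {} \<C>) i) \<and> from_nat_into (insert {} \<C>) i \<subseteq> U" for i
    using inC[of i] C(2) by (metis compact_cbox compact_empty empty_subsetI insertE)
  then have K: "compact (K n)" "K n \<subseteq> U" for n unfolding K_def by (auto intro!: compact_UN)
  have UK: "U = (\<Union>n. K n)"
  proof -
    have "range (from_nat_into (insert {} \<C>)) = insert {} \<C>" using range_from_nat_into[OF ne] .
    then have "U = (\<Union>i. from_nat_into (insert {} \<C>) i)" using C(3) by (metis Union_insert Un_empty_left)
    also have "\<dots> = (\<Union>n. K n)" unfolding K_def by auto
    finally show ?thesis .
  qed
  show ?thesis
  proof (rule borel_measurable_LIMSEQ_metric)
    show "(\<lambda>x. indicator (K n) x *\<^sub>R f x) \<in> borel_measurable lebesgue" for n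
      using f K[of n] by (auto simp: loc_int_def set_integrable_def dest: borel_measurable_integrable)
    show "(\<lambda>n. indicator (K n) x *\<^sub>R f x) \<longlonglongrightarrow> indicator U x *\<^sub>R f x" for x
    proof (rule tendsto_eventually, cases "x \<in> U")
      case True
      then obtain m where "x \<in> K m" using UK by blast
      then have "x \<in> K n" if "m \<le> n" for n using that by (force simp: K_def)
      then show "\<forall>\<^sub>F n in sequentially. indicator (K n) x *\<^sub>R f x = indicator U x *\<^sub>R f x"
        using True by (auto simp: eventually_sequentially intro!: exI[of _ m])
    next
      case False
      then have "x \<notin> K n" for n using K(2) by blast
      then show "\<forall>\<^sub>F n in sequentially. indicator (K n) x *\<^sub>R f x = indicator U x *\<^sub>R f x"
        using False by simp
    qed
  qed
qed

lemma borel_rep_exists_real: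
  fixes f :: "R3 \<Rightarrow> real"
  assumes "open U" "loc_int U f"
  shows "\<exists>f'. borel_rep U f f'"
proof -
  obtain f' where "f' \<in> borel_measurable lborel" "AE x in lborel. indicator U x *\<^sub>R f x = f' x"
    using completion_ex_borel_measurable_real[OF loc_int_measurable[OF assms]] by blast
  then have "f' \<in> borel_measurable borel \<and> (AE x in lborel. x \<in> U \<longrightarrow> f' x = f x)"
    by (auto elim!: eventually_mono)
  then show ?thesis unfolding borel_rep_def by blast
qed

lemma loc_int_Re_Im:
  fixes f :: "R3 \<Rightarrow> complex"
  assumes "loc_int U f"
  shows "loc_int U (\<lambda>x. Re (f x))" "loc_int U (\<lambda>x. Im (f x))"
proof -
  have i: "set_integrable lebesgue K f" if "compact K" "K \<subseteq> U" for K using assms that by (auto simp: loc_int_def)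
  show "loc_int U (\<lambda>x. Re (f x))"
    unfolding loc_int_def set_integrable_def
  proof (intro allI impI)
    fix K assume "compact K \<and> K \<subseteq> U"
    then have "integrable lebesgue (\<lambda>x. Re (indicator K x *\<^sub>R f x))" using i[of K] unfolding set_integrable_def by (intro integrable_Re) auto
    then show "integrable lebesgue (\<lambda>x. indicator K x *\<^sub>R Re (f x))" by simp
  qed
  show "loc_int U (\<lambda>x. Im (f x))"
    unfolding loc_int_def set_integrable_def
  proof (intro allI impI)
    fix K assume "compact K \<and> K \<subseteq> U"
    then have "integrable lebesgue (\<lambda>x. Im (indicator K x *\<^sub>R f x))" using i[of K] unfolding set_integrable_def by (intro integrable_Im) auto
    then show "integrable lebesgue (\<lambda>x. indicator K x *\<^sub>R Im (f x))" by simp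
  qed
qed

lemma borel_rep_exists_complex:
  fixes f :: "R3 \<Rightarrow> complex"
  assumes "open U" "loc_int U f"
  shows "\<exists>f'. borel_rep U f f'"
proof -
  obtain r where r: "borel_rep U (\<lambda>x. Re (f x)) r" using borel_rep_exists_real assms loc_int_Re_Im by blast
  obtain i where i: "borel_rep U (\<lambda>x. Im (f x)) i" using borel_rep_exists_real assms loc_int_Re_Im by blast
  have [measurable]: "r \<in> borel_measurable borel" "i \<in> borel_measurable borel" using r i by (auto simp: borel_rep_def)
  have "(\<lambda>x. Complex (r x) (i x)) \<in> borel_measurable borel"
    unfolding borel_measurable_complex_iff by simp
  moreover have "AE x in lborel. x \<in> U \<longrightarrow> Complex (r x) (i x) = f x"
  proof -
    have "AE x in lborel. x \<in> U \<longrightarrow> r x = Re (f x)" "AE x in lborel. x \<in> U \<longrightarrow> i x = Im (f x)"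
      using r i by (auto simp: borel_rep_def)
    then show ?thesis by eventually_elim (auto simp: complex_eq_iff)
  qed
  ultimately show ?thesis unfolding borel_rep_def by blast
qed

lemma borel_rep_integrable:
  fixes f :: "R3 \<Rightarrow> 'b::{banach, second_countable_topology}"
  assumes f: "loc_int U f" "borel_rep U f f'" and K: "compact K" "K \<subseteq> U"
  shows "set_integrable lborel K f'"
proof -
  have [measurable]: "f' \<in> borel_measurable borel" "K \<in> sets borel"
    using f(2) K borel_compact by (auto simp: borel_rep_def)
  have ae: "AE x in lborel. indicator K x *\<^sub>R f x = indicator K x *\<^sub>R f' x"
  proof -
    have "AE x in lborel. x \<in> U \<longrightarrow> f' x = f x" using f(2) by (simp add: borel_rep_def)
    then show ?thesis by eventually_elim (use K in \<open>auto simp: indicator_def\<close>)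
  qed
  have i: "integrable lebesgue (\<lambda>x. indicator K x *\<^sub>R f x)" using f(1) K by (auto simp: loc_int_def set_integrable_def)
  have m: "(\<lambda>x. indicator K x *\<^sub>R f' x) \<in> borel_measurable lborel" by simp
  have "integrable lebesgue (\<lambda>x. indicator K x *\<^sub>R f' x)"
    by (rule integrable_cong_AE_imp[OF i measurable_completion[OF m]]) (use AE_completion[OF ae] in \<open>eventually_elim; simp\<close>)
  then show ?thesis using integrable_completion[OF m] by (simp add: set_integrable_def)
qed

text \<open>The definition integrates over \<open>U\<close> against Lebesgue measure; here the
  identity is moved to Borel representatives and \<open>lborel\<close> on the whole space, where
  Fubini and translations are available. The test function vanishes off the box, so values of the
  representatives outside \<open>U\<close> do not enter.\<close>

lemma weak_pd_bump:
  fixes u g :: "R3 \<Rightarrow> 'b::{real_normed_field, banach, second_countable_topology}"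
  assumes U: "open U" and w: "weak_pd U j u g" and ru: "borel_rep U u u'" and rg: "borel_rep U g g'"
    and k: "0 < k" and ab: "cbox a b \<subseteq> U"
  shows "(\<integral>x. of_real (pd j (bump k a b) x) * u' x \<partial>lborel) = - (\<integral>x. of_real (bump k a b x) * g' x \<partial>lborel)"
proof -
  have swap: "(\<integral>x. indicator U x *\<^sub>R (of_real (\<phi> x) * f x) \<partial>lebesgue) = (\<integral>x. of_real (\<phi> x) * f' x \<partial>lborel)"
    if f: "loc_int U f" "borel_rep U f f'" and \<phi>: "\<phi> \<in> borel_measurable borel" "\<And>x. x \<notin> cbox a b \<Longrightarrow> \<phi> x = 0"
    for f f' :: "R3 \<Rightarrow> 'b" and \<phi> :: "R3 \<Rightarrow> real"
  proof -
    have [measurable]: "\<phi> \<in> borel_measurable borel" "f' \<in> borel_measurable borel"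
      using that by (auto simp: borel_rep_def)
    have eq: "indicator U x *\<^sub>R (of_real (\<phi> x) * f x) = of_real (\<phi> x) * (indicator (cbox a b) x *\<^sub>R f x)" for x
      using \<phi>(2)[of x] ab by (auto simp: indicator_def)
    have "set_integrable lebesgue (cbox a b) f" using f(1) ab by (auto simp: loc_int_def)
    then have m1: "(\<lambda>x. indicator (cbox a b) x *\<^sub>R f x) \<in> borel_measurable lebesgue"
      unfolding set_integrable_def by (rule borel_measurable_integrable)
    have m2: "(\<lambda>x. of_real (\<phi> x) :: 'b) \<in> borel_measurable lebesgue"
      by (rule measurable_completion) simp
    have m3: "(\<lambda>x. of_real (\<phi> x) * f' x) \<in> borel_measurable lborel" by simp
    have "(\<integral>x. indicator U x *\<^sub>R (of_real (\<phi> x) * f x) \<partial>lebesgue) = (\<integral>x. of_real (\<phi> x) * f' x \<partial>lebesgue)"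
    proof (rule integral_cong_AE)
      show "(\<lambda>x. indicator U x *\<^sub>R (of_real (\<phi> x) * f x)) \<in> borel_measurable lebesgue"
        unfolding eq by (intro borel_measurable_times m1 m2)
      show "(\<lambda>x. of_real (\<phi> x) * f' x) \<in> borel_measurable lebesgue" by (rule measurable_completion[OF m3])
      have "AE x in lborel. x \<in> U \<longrightarrow> f' x = f x" using f(2) by (simp add: borel_rep_def)
      then have "AE x in lborel. indicator U x *\<^sub>R (of_real (\<phi> x) * f x) = of_real (\<phi> x) * f' x"
      proof eventually_elim
        case (elim x)
        show ?case using elim \<phi>(2)[of x] ab by (cases "x \<in> cbox a b") (auto simp: indicator_def)
      qed
      then show "AE x in lebesgue. indicator U x *\<^sub>R (of_real (\<phi> x) * f x) = of_real (\<phi> x) * f' x"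
        by (rule AE_completion)
    qed
    also have "\<dots> = (\<integral>x. of_real (\<phi> x) * f' x \<partial>lborel)" by (rule integral_completion[OF m3])
    finally show ?thesis .
  qed
  have l: "loc_int U u" "loc_int U g" using w by (auto simp: weak_pd_def)
  have b0: "bump k a b x = 0" if "x \<notin> cbox a b" for x
    using that bump_eq_0[OF k, of x a b] box_subset_cbox[of a b] by blast
  have "(\<integral>x. indicator U x *\<^sub>R (of_real (pd j (bump k a b) x) * u x) \<partial>lebesgue)
     = - (\<integral>x. indicator U x *\<^sub>R (of_real (bump k a b x) * g x) \<partial>lebesgue)"
    using w test_fun_bump[OF k ab] by (auto simp: weak_pd_def)
  moreover have "(\<integral>x. indicator U x *\<^sub>R (of_real (pd j (bump k a b) x) * u x) \<partial>lebesgue)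
      = (\<integral>x. of_real (pd j (bump k a b) x) * u' x \<partial>lborel)"
    by (rule swap[OF l(1) ru flatalg_measurable[OF flatalg_pd[OF flatalg_bump]] pd_bump_eq_0[OF k]])
  moreover have "(\<integral>x. indicator U x *\<^sub>R (of_real (bump k a b x) * g x) \<partial>lebesgue)
      = (\<integral>x. of_real (bump k a b x) * g' x \<partial>lborel)"
    by (rule swap[OF l(2) rg flatalg_measurable[OF flatalg_bump] b0])
  ultimately show ?thesis by simp
qed

text \<open>Absolute continuity on almost every line, stated on open sets of starting points. The
  exceptional null set may depend on the length \<open>t\<close>; statements for almost all lengths
  at once are recovered by Fubini where needed.\<close>

definition line_pd :: "R3 set \<Rightarrow> 3 \<Rightarrow> (R3 \<Rightarrow> 'b::{real_normed_field, banach, second_countable_topology}) \<Rightarrow> (R3 \<Rightarrow> 'b) \<Rightarrow> bool" where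
  "line_pd U j u g \<longleftrightarrow> (\<forall>W t. open W \<longrightarrow> 0 \<le> t \<longrightarrow> (\<forall>x \<tau>. x \<in> W \<longrightarrow> 0 \<le> \<tau> \<longrightarrow> \<tau> \<le> t \<longrightarrow> x + \<tau> *\<^sub>R axis j 1 \<in> U) \<longrightarrow>
     (AE x in lborel. x \<in> W \<longrightarrow> set_integrable lborel {0..t} (\<lambda>\<tau>. g (x + \<tau> *\<^sub>R axis j 1)) \<and>
        u (x + t *\<^sub>R axis j 1) - u x = (LBINT \<tau>:{0..t}. g (x + \<tau> *\<^sub>R axis j 1))))"

lemma line_pd_real:
  fixes u g :: "R3 \<Rightarrow> real"
  assumes U: "open U" and w: "weak_pd U j u g" and ru: "borel_rep U u u'" and rg: "borel_rep U g g'"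
  shows "line_pd U j u' g'"
  unfolding line_pd_def
proof (intro allI impI)
  fix W t
  assume W: "open W" "(0::real) \<le> t" "\<forall>x \<tau>. x \<in> W \<longrightarrow> 0 \<le> \<tau> \<longrightarrow> \<tau> \<le> t \<longrightarrow> x + \<tau> *\<^sub>R axis j 1 \<in> U"
  have l: "loc_int U u" "loc_int U g" using w by (auto simp: weak_pd_def)
  show "AE x in lborel. x \<in> W \<longrightarrow> set_integrable lborel {0..t} (\<lambda>\<tau>. g' (x + \<tau> *\<^sub>R axis j 1)) \<and>
        u' (x + t *\<^sub>R axis j 1) - u' x = (LBINT \<tau>:{0..t}. g' (x + \<tau> *\<^sub>R axis j 1))"
    by (rule line_identity_real[OF U W(1,2)])
       (use W ru rg weak_pd_bump[OF U w ru rg] borel_rep_integrable[OF l(1) ru] borel_rep_integrable[OF l(2) rg] in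
         \<open>auto simp: borel_rep_def\<close>)
qed

lemma test_fun_smooth:
  assumes "test_fun U \<phi>"
  shows "\<phi> differentiable (at x)" "pd j \<phi> differentiable (at x)"
proof -
  have s: "iter_pd js \<phi> differentiable (at x)" for js using assms by (auto simp: test_fun_def smooth_on_def)
  show "\<phi> differentiable (at x)" using s[of "[]"] by simp
  show "pd j \<phi> differentiable (at x)" using s[of "[j]"] by simp
qed

lemma diff_cont: "(\<And>x. f differentiable (at x)) \<Longrightarrow> continuous_on S (f :: R3 \<Rightarrow> real)"
  by (meson differentiable_at_withinI differentiable_imp_continuous_on differentiable_on_def)

lemma test_fun_zero:
  assumes "test_fun U \<phi>" "x \<notin> tsupp \<phi>"
  shows "\<phi> x = 0" "pd j \<phi> x = 0"
proof -
  have z: "\<phi> y = 0" if "y \<in> - tsupp \<phi>" for y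
    using that closure_subset[of "{x. \<phi> x \<noteq> 0}"] by (auto simp: tsupp_def)
  show "\<phi> x = 0" using z assms(2) by simp
  have "((\<lambda>_. 0) has_derivative (\<lambda>_. 0)) (at x)" by simp
  then have "(\<phi> has_derivative (\<lambda>_. 0)) (at x)"
  proof (rule has_derivative_transform_within_open)
    show "open (- tsupp \<phi>)" unfolding tsupp_def by (intro open_Compl closed_closure)
    show "x \<in> - tsupp \<phi>" using assms(2) by simp
    show "0 = \<phi> y" if "y \<in> - tsupp \<phi>" for y using z[OF that] by simp
  qed
  from pd_eq[OF this] show "pd j \<phi> x = 0" by simp
qed

lemma test_fun_times_integrable:
  fixes h :: "R3 \<Rightarrow> 'b::{real_normed_field, banach, second_countable_topology}"
  assumes t: "test_fun U \<phi>" and h: "loc_int U h"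
  shows "integrable lebesgue (\<lambda>x. indicator U x *\<^sub>R (of_real (\<phi> x) * h x))"
    "integrable lebesgue (\<lambda>x. indicator U x *\<^sub>R (of_real (pd j \<phi> x) * h x))"
proof -
  have K: "compact (tsupp \<phi>)" "tsupp \<phi> \<subseteq> U" using t by (auto simp: test_fun_def)
  have hi: "integrable lebesgue (\<lambda>x. indicator (tsupp \<phi>) x *\<^sub>R h x)" using h K by (auto simp: loc_int_def set_integrable_def)
  have "integrable lebesgue (\<lambda>x. indicator U x *\<^sub>R (of_real (p x) * h x))"
    if p: "continuous_on UNIV p" "\<And>x. x \<notin> tsupp \<phi> \<Longrightarrow> p x = 0" for p
  proof -
    have pb: "p \<in> borel_measurable borel" using p(1) by (rule borel_measurable_continuous_onI)
    have pm: "(\<lambda>x. of_real (p x) :: 'b) \<in> borel_measurable lebesgue" by (rule measurable_completion) (use pb in simp)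
    obtain M where M: "\<And>x. x \<in> tsupp \<phi> \<Longrightarrow> norm (p x) \<le> M"
      using compact_imp_bounded[OF compact_continuous_image[OF continuous_on_subset[OF p(1)] K(1)]] by (auto simp: bounded_iff)
    have eq: "(\<lambda>x. indicator U x *\<^sub>R (of_real (p x) * h x)) = (\<lambda>x. of_real (p x) * (indicator (tsupp \<phi>) x *\<^sub>R h x))"
      using p(2) K(2) by (intro ext) (auto simp: indicator_def)
    show ?thesis unfolding eq
    proof (rule Bochner_Integration.integrable_bound)
      show "integrable lebesgue (\<lambda>x. of_real M * (indicator (tsupp \<phi>) x *\<^sub>R h x))" using hi by (rule integrable_mult_right)
      show "AE x in lebesgue. norm (of_real (p x) * (indicator (tsupp \<phi>) x *\<^sub>R h x)) \<le> norm (of_real M * (indicator (tsupp \<phi>) x *\<^sub>R h x))"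
      proof (rule AE_I2)
        fix x
        show "norm (of_real (p x) * (indicator (tsupp \<phi>) x *\<^sub>R h x)) \<le> norm (of_real M * (indicator (tsupp \<phi>) x *\<^sub>R h x))"
        proof (cases "x \<in> tsupp \<phi>")
          case True
          then have "\<bar>p x\<bar> \<le> \<bar>M\<bar>" using M[OF True] by simp
          then have "\<bar>p x\<bar> * norm (h x) \<le> \<bar>M\<bar> * norm (h x)" by (rule mult_right_mono) simp
          then show ?thesis using True by (simp add: norm_mult)
        qed simp
      qed
    qed (rule borel_measurable_times[OF pm borel_measurable_integrable[OF hi]])
  qed
  moreover have "continuous_on UNIV \<phi>" "continuous_on UNIV (pd j \<phi>)"
    using diff_cont test_fun_smooth[OF t] by blast+
  ultimately show "integrable lebesgue (\<lambda>x. indicator U x *\<^sub>R (of_real (\<phi> x) * h x))"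
    "integrable lebesgue (\<lambda>x. indicator U x *\<^sub>R (of_real (pd j \<phi> x) * h x))"
    using test_fun_zero[OF t] by blast+
qed

lemma weak_pd_Re_Im:
  fixes u g :: "R3 \<Rightarrow> complex"
  assumes w: "weak_pd U j u g"
  shows "weak_pd U j (\<lambda>x. Re (u x)) (\<lambda>x. Re (g x))" "weak_pd U j (\<lambda>x. Im (u x)) (\<lambda>x. Im (g x))"
proof -
  have l: "loc_int U u" "loc_int U g" using w by (auto simp: weak_pd_def)
  have eqs: "(\<integral>x. indicator U x *\<^sub>R (pd j \<phi> x * Re (u x)) \<partial>lebesgue) = - (\<integral>x. indicator U x *\<^sub>R (\<phi> x * Re (g x)) \<partial>lebesgue)"
    "(\<integral>x. indicator U x *\<^sub>R (pd j \<phi> x * Im (u x)) \<partial>lebesgue) = - (\<integral>x. indicator U x *\<^sub>R (\<phi> x * Im (g x)) \<partial>lebesgue)"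
    if t: "test_fun U \<phi>" for \<phi>
  proof -
    note i1 = test_fun_times_integrable(2)[OF t l(1), of j] and i2 = test_fun_times_integrable(1)[OF t l(2)]
    have eq: "(\<integral>x. indicator U x *\<^sub>R (of_real (pd j \<phi> x) * u x) \<partial>lebesgue) = - (\<integral>x. indicator U x *\<^sub>R (of_real (\<phi> x) * g x) \<partial>lebesgue)"
      using w t by (simp add: weak_pd_def)
    show "(\<integral>x. indicator U x *\<^sub>R (pd j \<phi> x * Re (u x)) \<partial>lebesgue) = - (\<integral>x. indicator U x *\<^sub>R (\<phi> x * Re (g x)) \<partial>lebesgue)"
      using arg_cong[OF eq, of Re] integral_Re[OF i1] integral_Re[OF i2] by simp
    show "(\<integral>x. indicator U x *\<^sub>R (pd j \<phi> x * Im (u x)) \<partial>lebesgue) = - (\<integral>x. indicator U x *\<^sub>R (\<phi> x * Im (g x)) \<partial>lebesgue)"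
      using arg_cong[OF eq, of Im] integral_Im[OF i1] integral_Im[OF i2] by simp
  qed
  show "weak_pd U j (\<lambda>x. Re (u x)) (\<lambda>x. Re (g x))" "weak_pd U j (\<lambda>x. Im (u x)) (\<lambda>x. Im (g x))"
    unfolding weak_pd_def of_real_eq_id id_apply
    by (intro conjI allI impI loc_int_Re_Im l eqs; assumption)+
qed

lemma line_pd_complex:
  fixes u g :: "R3 \<Rightarrow> complex"
  assumes U: "open U" and w: "weak_pd U j u g" and ru: "borel_rep U u u'" and rg: "borel_rep U g g'"
  shows "line_pd U j u' g'"
  unfolding line_pd_def
proof (intro allI impI)
  fix W t
  assume W: "open W" "(0::real) \<le> t" "\<forall>x \<tau>. x \<in> W \<longrightarrow> 0 \<le> \<tau> \<longrightarrow> \<tau> \<le> t \<longrightarrow> x + \<tau> *\<^sub>R axis j 1 \<in> U"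
  have r: "borel_rep U (\<lambda>x. Re (u x)) (\<lambda>x. Re (u' x))" "borel_rep U (\<lambda>x. Re (g x)) (\<lambda>x. Re (g' x))"
    "borel_rep U (\<lambda>x. Im (u x)) (\<lambda>x. Im (u' x))" "borel_rep U (\<lambda>x. Im (g x)) (\<lambda>x. Im (g' x))"
    using ru rg by (auto simp: borel_rep_def elim: eventually_mono)
  note re = line_pd_real[OF U weak_pd_Re_Im(1)[OF w] r(1,2), unfolded line_pd_def, THEN spec, THEN spec, THEN mp, THEN mp, THEN mp, OF W]
    and im = line_pd_real[OF U weak_pd_Re_Im(2)[OF w] r(3,4), unfolded line_pd_def, THEN spec, THEN spec, THEN mp, THEN mp, THEN mp, OF W]
  from re im show "AE x in lborel. x \<in> W \<longrightarrow> set_integrable lborel {0..t} (\<lambda>\<tau>. g' (x + \<tau> *\<^sub>R axis j 1)) \<and>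
        u' (x + t *\<^sub>R axis j 1) - u' x = (LBINT \<tau>:{0..t}. g' (x + \<tau> *\<^sub>R axis j 1))"
  proof eventually_elim
    case (elim x)
    show ?case
    proof (intro impI conjI)
      assume x: "x \<in> W"
      let ?g = "\<lambda>\<tau>. g' (x + \<tau> *\<^sub>R axis j 1)"
      have i: "integrable lborel (\<lambda>\<tau>. indicator {0..t} \<tau> * Re (?g \<tau>))" "integrable lborel (\<lambda>\<tau>. indicator {0..t} \<tau> * Im (?g \<tau>))"
        using elim x by (auto simp: set_integrable_def)
      have "integrable lborel (\<lambda>\<tau>. complex_of_real (indicator {0..t} \<tau> * Re (?g \<tau>)) + \<i> * complex_of_real (indicator {0..t} \<tau> * Im (?g \<tau>)))"
        using i by (intro Bochner_Integration.integrable_add integrable_mult_right integrable_of_real)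
      moreover have "(\<lambda>\<tau>. complex_of_real (indicator {0..t} \<tau> * Re (?g \<tau>)) + \<i> * complex_of_real (indicator {0..t} \<tau> * Im (?g \<tau>)))
         = (\<lambda>\<tau>. indicator {0..t} \<tau> *\<^sub>R ?g \<tau>)"
        by (rule ext) (simp add: complex_eq_iff)
      ultimately have gi: "integrable lborel (\<lambda>\<tau>. indicator {0..t} \<tau> *\<^sub>R ?g \<tau>)" by simp
      then show "set_integrable lborel {0..t} ?g" by (simp add: set_integrable_def)
      show "u' (x + t *\<^sub>R axis j 1) - u' x = (LBINT \<tau>:{0..t}. ?g \<tau>)"
        using elim x integral_Re[OF gi] integral_Im[OF gi]
        by (simp add: set_lebesgue_integral_def complex_eq_iff)
    qed
  qed
qed

section \<open>From the continuum to the lattice\<close>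

text \<open>Dominated convergence on intervals shrinking to \<open>x\<close>. The form at a single
  point, with intervals containing it, is what the bisection principle \<open>Bolzano\<close>
  consumes in \<open>gauge_increment\<close>.\<close>

lemma small_interval_integral:
  fixes f :: "real \<Rightarrow> 'a::{banach, second_countable_topology}"
  assumes f: "integrable lborel f" and e: "0 < e"
  shows "\<exists>d>0. \<forall>s s'. s \<le> x \<and> x \<le> s' \<and> s' - s < d \<longrightarrow> (LBINT \<tau>. indicator {s<..s'} \<tau> * norm (f \<tau>)) \<le> e"
proof -
  have [measurable]: "f \<in> borel_measurable borel" using f by auto
  let ?J = "\<lambda>n. {x - 1 / real (Suc n)..x + 1 / real (Suc n)}"
  have "(\<lambda>n. LBINT \<tau>. indicator (?J n) \<tau> * norm (f \<tau>)) \<longlonglongrightarrow> (LBINT \<tau>. indicator {x} \<tau> * norm (f \<tau>))"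
  proof (rule integral_dominated_convergence[where w = "\<lambda>\<tau>. norm (f \<tau>)"])
    show "AE \<tau> in lborel. (\<lambda>n. indicator (?J n) \<tau> * norm (f \<tau>)) \<longlonglongrightarrow> indicator {x} \<tau> * norm (f \<tau>)"
    proof (rule AE_I2, rule tendsto_eventually)
      fix \<tau>
      show "\<forall>\<^sub>F n in sequentially. indicator (?J n) \<tau> * norm (f \<tau>) = indicator {x} \<tau> * norm (f \<tau>)"
      proof (cases "\<tau> = x")
        case True
        then show ?thesis by simp
      next
        case False
        then have "0 < \<bar>\<tau> - x\<bar>" by simp
        then obtain m where m: "inverse (real (Suc m)) < \<bar>\<tau> - x\<bar>" using reals_Archimedean by blast
        have "\<tau> \<notin> ?J n" if "m \<le> n" for n
        proof -
          have "1 / real (Suc n) \<le> 1 / real (Suc m)" using that by (intro divide_left_mono) auto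
          then have "1 / real (Suc n) < \<bar>\<tau> - x\<bar>" using m by (simp add: inverse_eq_divide)
          then show ?thesis by auto
        qed
        then show ?thesis using False by (auto simp: eventually_sequentially intro!: exI[of _ m])
      qed
    qed
  qed (use f in \<open>auto simp: indicator_def\<close>)
  moreover have "(LBINT \<tau>. indicator {x} \<tau> * norm (f \<tau>)) = 0"
  proof -
    have "AE \<tau> in lborel. \<tau> \<noteq> x" by (rule AE_lborel_singleton)
    then have "AE \<tau> in lborel. indicator {x} \<tau> * norm (f \<tau>) = 0" by eventually_elim auto
    then show ?thesis by (simp add: integral_eq_zero_AE)
  qed
  ultimately have "(\<lambda>n. LBINT \<tau>. indicator (?J n) \<tau> * norm (f \<tau>)) \<longlonglongrightarrow> 0" by simp
  then have "\<forall>\<^sub>F n in sequentially. (LBINT \<tau>. indicator (?J n) \<tau> * norm (f \<tau>)) < e"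
    using e by (rule order_tendstoD(2))
  then obtain n where n: "(LBINT \<tau>. indicator (?J n) \<tau> * norm (f \<tau>)) < e" by (auto simp: eventually_sequentially)
  show ?thesis
  proof (intro exI conjI allI impI)
    show "0 < 1 / real (Suc n)" by simp
    fix s s' assume s: "s \<le> x \<and> x \<le> s' \<and> s' - s < 1 / real (Suc n)"
    have fi: "integrable lborel (\<lambda>\<tau>. norm (f \<tau>))" using f by simp
    have "(LBINT \<tau>. indicator {s<..s'} \<tau> * norm (f \<tau>)) \<le> (LBINT \<tau>. indicator (?J n) \<tau> * norm (f \<tau>))"
    proof (rule integral_mono)
      show "integrable lborel (\<lambda>\<tau>. indicator {s<..s'} \<tau> * norm (f \<tau>))" "integrable lborel (\<lambda>\<tau>. indicator (?J n) \<tau> * norm (f \<tau>))"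
        using integrable_mult_indicator[OF _ fi, of "{s<..s'}"] integrable_mult_indicator[OF _ fi, of "?J n"] by simp_all
      show "indicator {s<..s'} \<tau> * norm (f \<tau>) \<le> indicator (?J n) \<tau> * norm (f \<tau>)" for \<tau>
        using s by (intro mult_right_mono) (auto simp: indicator_def)
    qed
    then show "(LBINT \<tau>. indicator {s<..s'} \<tau> * norm (f \<tau>)) \<le> e" using n by linarith
  qed
qed

lemma cis_minus_linear: "cmod (cis x - 1 - \<i> * of_real x) \<le> x\<^sup>2"
proof -
  have "cmod (exp (\<i> * of_real x) - (\<Sum>k\<le>1. (\<i> * of_real x) ^ k / fact k))
      \<le> exp \<bar>Re (\<i> * of_real x)\<bar> * cmod (\<i> * of_real x) ^ Suc 1 / fact 1"
    by (rule Taylor_exp)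
  then show ?thesis by (simp add: cis_conv_exp norm_mult power2_eq_square diff_diff_eq)
qed

text \<open>A Gronwall-free form of \<open>d/dt (y e\<^sup>-\<^sup>i\<^sup>\<theta>) = (y' - i \<theta>' y) e\<^sup>-\<^sup>i\<^sup>\<theta>\<close> for absolutely continuous
  \<open>y\<close> and \<open>\<theta>\<close>: the increments over short intervals are compared directly.\<close>

lemma gauge_increment:
  fixes a :: "real \<Rightarrow> real" and g :: "real \<Rightarrow> complex" and c :: complex
  assumes a: "integrable lborel a" and g: "integrable lborel g" and st: "lo \<le> hi"
  defines "I \<equiv> \<lambda>s s'. LBINT \<tau>. indicator {s<..s'} \<tau> *\<^sub>R g \<tau>"
    and "\<Theta> \<equiv> \<lambda>s s'. LBINT \<tau>. indicator {s<..s'} \<tau> * a \<tau>"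
  shows "cmod (c + I lo hi - cis (\<Theta> lo hi) * c)
     \<le> (LBINT \<tau>. indicator {lo<..hi} \<tau> * cmod (g \<tau> - \<i> * of_real (a \<tau>) * (c + I lo \<tau>)))"
proof -
  have [measurable]: "a \<in> borel_measurable borel" "g \<in> borel_measurable borel" using a g by auto
  have inda: "integrable lborel (\<lambda>\<tau>. indicator {s<..s'} \<tau> * a \<tau>)" for s s'
    using integrable_mult_indicator[OF _ a, of "{s<..s'}"] by simp
  have indg: "integrable lborel (\<lambda>\<tau>. indicator {s<..s'} \<tau> *\<^sub>R g \<tau>)" for s s'
    using integrable_mult_indicator[OF _ g, of "{s<..s'}"] by simp
  define y where "y s = c + I lo s" for s
  define D where "D \<tau> = g \<tau> - \<i> * of_real (a \<tau>) * y \<tau>" for \<tau>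
  \<comment> \<open>Half-open intervals make all the interval functions exactly additive, with no
    exceptional points.\<close>
  have split: "indicator {s<..s''} \<tau> = (indicator {s<..s'} \<tau> + indicator {s'<..s''} \<tau> :: real)"
    if "s \<le> s'" "s' \<le> s''" for s s' s'' \<tau> :: real using that by (auto simp: indicator_def)
  have Iadd: "I s s'' = I s s' + I s' s''" if "s \<le> s'" "s' \<le> s''" for s s' s''
    unfolding I_def split[OF that] scaleR_add_left by (intro Bochner_Integration.integral_add indg)
  have Tadd: "\<Theta> s s'' = \<Theta> s s' + \<Theta> s' s''" if "s \<le> s'" "s' \<le> s''" for s s' s''
    unfolding \<Theta>_def split[OF that] distrib_right by (intro Bochner_Integration.integral_add inda)
  define Y where "Y = cmod c + (LBINT \<tau>. cmod (g \<tau>))"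
  have Ile: "cmod (I s s') \<le> (LBINT \<tau>. indicator {s<..s'} \<tau> * cmod (g \<tau>))" for s s'
  proof -
    have "cmod (I s s') \<le> (LBINT \<tau>. norm (indicator {s<..s'} \<tau> *\<^sub>R g \<tau>))" unfolding I_def by (rule integral_norm_bound)
    then show ?thesis by simp
  qed
  have ng: "integrable lborel (\<lambda>\<tau>. cmod (g \<tau>))" using g by simp
  have indng: "integrable lborel (\<lambda>\<tau>. indicator {s<..s'} \<tau> * cmod (g \<tau>))" for s s'
    using integrable_mult_indicator[OF _ ng, of "{s<..s'}"] by simp
  have yY: "cmod (y s) \<le> Y" for s
  proof -
    have "(LBINT \<tau>. indicator {lo<..s} \<tau> * cmod (g \<tau>)) \<le> (LBINT \<tau>. cmod (g \<tau>))"
      using ng indng by (intro integral_mono) (auto simp: indicator_def)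
    then show ?thesis unfolding y_def Y_def using Ile[of lo s] norm_triangle_ineq[of c "I lo s"] by linarith
  qed
  have Y0: "0 \<le> Y" using yY norm_ge_zero order_trans by blast
  have ym[measurable]: "y \<in> borel_measurable borel"
  proof -
    have "(\<lambda>s. LBINT \<tau>. (if lo < \<tau> \<and> \<tau> \<le> s then 1 else 0) *\<^sub>R g \<tau>) \<in> borel_measurable borel" by measurable
    moreover have "(\<lambda>s. LBINT \<tau>. (if lo < \<tau> \<and> \<tau> \<le> s then 1 else 0) *\<^sub>R g \<tau>) = I lo"
      unfolding I_def by (intro ext Bochner_Integration.integral_cong) (auto simp: indicator_def)
    ultimately show ?thesis unfolding y_def by simp
  qed
  have aY: "integrable lborel (\<lambda>\<tau>. of_real (a \<tau>) * y \<tau>)"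
  proof (rule Bochner_Integration.integrable_bound)
    show "integrable lborel (\<lambda>\<tau>. Y * a \<tau>)" using a by simp
    show "AE \<tau> in lborel. norm (of_real (a \<tau>) * y \<tau>) \<le> norm (Y * a \<tau>)"
    proof (rule AE_I2)
      fix \<tau>
      have "\<bar>a \<tau>\<bar> * cmod (y \<tau>) \<le> \<bar>a \<tau>\<bar> * Y" using yY by (intro mult_left_mono) auto
      then show "norm (of_real (a \<tau>) * y \<tau>) \<le> norm (Y * a \<tau>)" using Y0 by (simp add: norm_mult abs_mult mult.commute)
    qed
  qed simp
  have Di: "integrable lborel D"
    unfolding D_def using g integrable_mult_right[OF aY, of \<i>] by (simp add: mult.assoc)
  have nD: "integrable lborel (\<lambda>\<tau>. cmod (D \<tau>))" using Di by simp
  have na: "integrable lborel (\<lambda>\<tau>. \<bar>a \<tau>\<bar>)" using a by simp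
  have indD: "integrable lborel (\<lambda>\<tau>. indicator {s<..s'} \<tau> * cmod (D \<tau>))" for s s'
    using integrable_mult_indicator[OF _ nD, of "{s<..s'}"] by simp
  have indna: "integrable lborel (\<lambda>\<tau>. indicator {s<..s'} \<tau> * \<bar>a \<tau>\<bar>)" for s s'
    using integrable_mult_indicator[OF _ na, of "{s<..s'}"] by simp
  define JD where "JD s s' = (LBINT \<tau>. indicator {s<..s'} \<tau> * cmod (D \<tau>))" for s s'
  define Ja where "Ja s s' = (LBINT \<tau>. indicator {s<..s'} \<tau> * \<bar>a \<tau>\<bar>)" for s s'
  have JDadd: "JD s s'' = JD s s' + JD s' s''" if "s \<le> s'" "s' \<le> s''" for s s' s''
    unfolding JD_def split[OF that] distrib_right by (intro Bochner_Integration.integral_add indD)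
  have Jaadd: "Ja s s'' = Ja s s' + Ja s' s''" if "s \<le> s'" "s' \<le> s''" for s s' s''
    unfolding Ja_def split[OF that] distrib_right by (intro Bochner_Integration.integral_add indna)
  have Ja0: "0 \<le> Ja s s'" for s s' unfolding Ja_def by (intro Bochner_Integration.integral_nonneg) auto
  have Tle: "\<bar>\<Theta> s s'\<bar> \<le> Ja s s'" for s s'
  proof -
    have "norm (\<Theta> s s') \<le> (LBINT \<tau>. norm (indicator {s<..s'} \<tau> * a \<tau>))" unfolding \<Theta>_def by (rule integral_norm_bound)
    then show ?thesis by (simp add: Ja_def abs_mult)
  qed
  \<comment> \<open>The error is proportional to the additive quantity \<open>Ja\<close>, so local
    estimates can be chained over adjacent intervals without accumulating; \<open>Bolzano\<close>
    passes from short intervals to the whole one.\<close>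
  have main: "cmod (y hi - cis (\<Theta> lo hi) * y lo) \<le> JD lo hi + e * (1 + Y) * Ja lo hi" if e: "0 < e" for e
  proof -
    define P where "P s s' \<longleftrightarrow> (lo \<le> s \<longrightarrow> cmod (y s' - cis (\<Theta> s s') * y s) \<le> JD s s' + e * (1 + Y) * Ja s s')" for s s'
    have "P lo hi" using st
    proof (induction rule: Bolzano)
      case (trans s s' s'')
      show ?case unfolding P_def
      proof
        assume "lo \<le> s"
        then have 1: "cmod (y s' - cis (\<Theta> s s') * y s) \<le> JD s s' + e * (1 + Y) * Ja s s'"
          and 2: "cmod (y s'' - cis (\<Theta> s' s'') * y s') \<le> JD s' s'' + e * (1 + Y) * Ja s' s''"
          using trans by (auto simp: P_def)
        have eq: "y s'' - cis (\<Theta> s s'') * y s = (y s'' - cis (\<Theta> s' s'') * y s') + cis (\<Theta> s' s'') * (y s' - cis (\<Theta> s s') * y s)"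
          unfolding Tadd[OF trans(3,4)] by (simp add: cis_mult[symmetric] algebra_simps)
        have "cmod (y s'' - cis (\<Theta> s s'') * y s) \<le> cmod (y s'' - cis (\<Theta> s' s'') * y s') + cmod (y s' - cis (\<Theta> s s') * y s)"
          unfolding eq using norm_triangle_ineq[of "y s'' - cis (\<Theta> s' s'') * y s'" "cis (\<Theta> s' s'') * (y s' - cis (\<Theta> s s') * y s)"]
          by (simp add: norm_mult)
        then show "cmod (y s'' - cis (\<Theta> s s'') * y s) \<le> JD s s'' + e * (1 + Y) * Ja s s''"
          unfolding JDadd[OF trans(3,4)] Jaadd[OF trans(3,4)] using 1 2 by (simp add: algebra_simps)
      qed
    next
      case (local x)
      obtain d1 where d1: "0 < d1" "\<And>s s'. s \<le> x \<Longrightarrow> x \<le> s' \<Longrightarrow> s' - s < d1 \<Longrightarrow> (LBINT \<tau>. indicator {s<..s'} \<tau> * norm (g \<tau>)) \<le> e"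
        using small_interval_integral[OF g e, of x] by blast
      obtain d2 where d2: "0 < d2" "\<And>s s'. s \<le> x \<Longrightarrow> x \<le> s' \<Longrightarrow> s' - s < d2 \<Longrightarrow> (LBINT \<tau>. indicator {s<..s'} \<tau> * norm (a \<tau>)) \<le> e"
        using small_interval_integral[OF a e, of x] by blast
      show ?case
      proof (intro exI conjI allI impI)
        show "0 < min d1 d2" using d1 d2 by simp
        fix s s' assume s: "s \<le> x \<and> x \<le> s' \<and> s' - s < min d1 d2"
        then have ss: "s \<le> s'" by simp
        show "P s s'" unfolding P_def
        proof
          assume los: "lo \<le> s"
          have ge: "(LBINT \<tau>. indicator {s<..s'} \<tau> * cmod (g \<tau>)) \<le> e" and ae: "Ja s s' \<le> e"
            using d1(2)[of s s'] d2(2)[of s s'] s by (auto simp: Ja_def)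
          have osc: "cmod (y \<tau> - y s) \<le> e" if "\<tau> \<in> {s<..s'}" for \<tau>
          proof -
            have "y \<tau> - y s = I s \<tau>" using Iadd[of lo s \<tau>] los that by (simp add: y_def)
            then have "cmod (y \<tau> - y s) \<le> (LBINT \<rho>. indicator {s<..\<tau>} \<rho> * cmod (g \<rho>))" using Ile by simp
            also have "\<dots> \<le> (LBINT \<rho>. indicator {s<..s'} \<rho> * cmod (g \<rho>))"
              using that indng by (intro integral_mono mult_right_mono) (auto simp: indicator_def)
            finally show ?thesis using ge by linarith
          qed
          define R1 where "R1 = (LBINT \<tau>. indicator {s<..s'} \<tau> *\<^sub>R D \<tau>)"
          define R2 where "R2 = (LBINT \<tau>. indicator {s<..s'} \<tau> *\<^sub>R (of_real (a \<tau>) * (y \<tau> - y s)))"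
          have iD: "integrable lborel (\<lambda>\<tau>. indicator {s<..s'} \<tau> *\<^sub>R D \<tau>)" by (intro integrable_mult_indicator Di) simp
          have iay: "integrable lborel (\<lambda>\<tau>. indicator {s<..s'} \<tau> *\<^sub>R (of_real (a \<tau>) * (y \<tau> - y s)))"
          proof (intro integrable_mult_indicator)
            have "integrable lborel (\<lambda>\<tau>. of_real (a \<tau>) * y \<tau> - of_real (a \<tau>) * y s)"
              using aY a by (intro Bochner_Integration.integrable_diff integrable_mult_left) auto
            then show "integrable lborel (\<lambda>\<tau>. of_real (a \<tau>) * (y \<tau> - y s))" by (simp add: right_diff_distrib)
          qed simp
          have ia: "integrable lborel (\<lambda>\<tau>. of_real (indicator {s<..s'} \<tau> * a \<tau>) * (\<i> * y s))"
            using inda by (intro integrable_mult_left integrable_of_real)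
          \<comment> \<open>\<open>y\<close> is frozen at the left end point:
            \<open>g = D + \<i> * a * (y - y s) + \<i> * a * y s\<close>. The last part cancels the
            linear term of \<open>cis\<close>, and the middle one is small by the oscillation
            bound.\<close>
          have Ieq: "I s s' = R1 + \<i> * R2 + of_real (\<Theta> s s') * (\<i> * y s)"
          proof -
            have "I s s' = (LBINT \<tau>. indicator {s<..s'} \<tau> *\<^sub>R D \<tau> + \<i> * (indicator {s<..s'} \<tau> *\<^sub>R (of_real (a \<tau>) * (y \<tau> - y s)))
               + of_real (indicator {s<..s'} \<tau> * a \<tau>) * (\<i> * y s))"
              unfolding I_def by (intro Bochner_Integration.integral_cong) (auto simp: D_def indicator_def algebra_simps)
            also have "\<dots> = R1 + \<i> * R2 + (LBINT \<tau>. of_real (indicator {s<..s'} \<tau> * a \<tau>) * (\<i> * y s))"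
            proof -
              have add3: "(LBINT \<tau>. F1 \<tau> + \<i> * F2 \<tau> + F3 \<tau>) = (LBINT \<tau>. F1 \<tau>) + \<i> * (LBINT \<tau>. F2 \<tau>) + (LBINT \<tau>. F3 \<tau>)"
                if "integrable lborel F1" "integrable lborel F2" "integrable lborel F3" for F1 F2 F3 :: "real \<Rightarrow> complex"
                using that by simp
              show ?thesis unfolding R1_def R2_def by (rule add3[OF iD iay ia])
            qed
            also have "(LBINT \<tau>. of_real (indicator {s<..s'} \<tau> * a \<tau>) * (\<i> * y s)) = of_real (\<Theta> s s') * (\<i> * y s)"
              unfolding \<Theta>_def by (simp only: integral_mult_left_zero integral_complex_of_real)
            finally show ?thesis .
          qed
          have "y s' = y s + I s s'" using Iadd[of lo s s'] los ss by (simp add: y_def)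
          then have eq: "y s' - cis (\<Theta> s s') * y s = R1 + \<i> * R2 - (cis (\<Theta> s s') - 1 - \<i> * of_real (\<Theta> s s')) * y s"
            unfolding Ieq by (simp add: algebra_simps)
          have "cmod (y s' - cis (\<Theta> s s') * y s) \<le> cmod R1 + cmod R2 + cmod (cis (\<Theta> s s') - 1 - \<i> * of_real (\<Theta> s s')) * cmod (y s)"
            unfolding eq using norm_triangle_ineq4[of "R1 + \<i> * R2" "(cis (\<Theta> s s') - 1 - \<i> * of_real (\<Theta> s s')) * y s"]
              norm_triangle_ineq[of R1 "\<i> * R2"] by (simp add: norm_mult)
          moreover have "cmod R1 \<le> JD s s'"
            unfolding R1_def JD_def using integral_norm_bound[of lborel "\<lambda>\<tau>. indicator {s<..s'} \<tau> *\<^sub>R D \<tau>"] by simp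
          moreover have "cmod R2 \<le> e * Ja s s'"
          proof -
            have "cmod R2 \<le> (LBINT \<tau>. norm (indicator {s<..s'} \<tau> *\<^sub>R (of_real (a \<tau>) * (y \<tau> - y s))))"
              unfolding R2_def by (rule integral_norm_bound)
            also have "\<dots> \<le> (LBINT \<tau>. e * (indicator {s<..s'} \<tau> * \<bar>a \<tau>\<bar>))"
            proof (rule integral_mono)
              show "norm (indicator {s<..s'} \<tau> *\<^sub>R (of_real (a \<tau>) * (y \<tau> - y s))) \<le> e * (indicator {s<..s'} \<tau> * \<bar>a \<tau>\<bar>)" for \<tau>
                using mult_left_mono[OF osc[of \<tau>], of "\<bar>a \<tau>\<bar>"] by (auto simp: indicator_def norm_mult mult.commute)
            qed (use integrable_norm[OF iay] indna in auto)
            also have "\<dots> = e * Ja s s'" by (simp add: Ja_def)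
            finally show ?thesis .
          qed
          moreover have "cmod (cis (\<Theta> s s') - 1 - \<i> * of_real (\<Theta> s s')) * cmod (y s) \<le> (e * Ja s s') * Y"
          proof (rule mult_mono)
            have "(\<Theta> s s')\<^sup>2 = \<bar>\<Theta> s s'\<bar> * \<bar>\<Theta> s s'\<bar>" by (simp add: power2_eq_square)
            also have "\<dots> \<le> e * Ja s s'" using Tle[of s s'] ae e by (intro mult_mono) auto
            finally show "cmod (cis (\<Theta> s s') - 1 - \<i> * of_real (\<Theta> s s')) \<le> e * Ja s s'"
              using cis_minus_linear[of "\<Theta> s s'"] by linarith
          qed (use yY e Ja0 in auto)
          ultimately show "cmod (y s' - cis (\<Theta> s s') * y s) \<le> JD s s' + e * (1 + Y) * Ja s s'"
            by (simp add: algebra_simps)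
        qed
      qed
    qed
    then show ?thesis by (simp add: P_def)
  qed
  have "cmod (y hi - cis (\<Theta> lo hi) * y lo) \<le> JD lo hi"
  proof (rule field_le_epsilon)
    fix e :: real assume e: "0 < e"
    define e' where "e' = e / ((1 + Y) * (Ja lo hi + 1))"
    have pos: "0 < (1 + Y) * (Ja lo hi + 1)" using Y0 Ja0[of lo hi] by (intro mult_pos_pos) auto
    have "e' * (1 + Y) * Ja lo hi \<le> e' * (1 + Y) * (Ja lo hi + 1)"
      using e pos Y0 by (intro mult_left_mono mult_nonneg_nonneg) (auto simp: e'_def)
    also have "\<dots> = e' * ((1 + Y) * (Ja lo hi + 1))" by (simp only: mult.assoc)
    also have "\<dots> = e" using pos by (metis e'_def less_irrefl nonzero_eq_divide_eq)
    finally show "cmod (y hi - cis (\<Theta> lo hi) * y lo) \<le> JD lo hi + e"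
      using main[of e'] divide_pos_pos[OF e pos] by (simp add: e'_def)
  qed
  moreover have "y lo = c" by (simp add: y_def I_def)
  ultimately show ?thesis by (simp add: y_def JD_def D_def)
qed

section \<open>Averages over segments\<close>

lemma AE_translate:
  fixes c :: R3
  assumes "AE x in lborel. P x"
  shows "AE x in lborel. P (x + c)"
proof -
  have "AE x in distr lborel borel ((+) c). P x" using assms unfolding lborel_distr_plus .
  from AE_distrD[OF _ this] show ?thesis by (simp add: add.commute)
qed

text \<open>Tonelli and translation invariance: for each \<open>\<tau>\<close> the translate of
  \<open>K\<close> by \<open>\<tau> *\<^sub>R e\<close> lies in \<open>K'\<close>.\<close>

lemma line_average:
  fixes h :: "R3 \<Rightarrow> ennreal" and e :: R3
  assumes [measurable]: "h \<in> borel_measurable borel" "K \<in> sets borel" "K' \<in> sets borel" and s: "0 \<le> s"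
    and sub: "\<And>x \<tau>. x \<in> K \<Longrightarrow> 0 \<le> \<tau> \<Longrightarrow> \<tau> \<le> s \<Longrightarrow> x + \<tau> *\<^sub>R e \<in> K'"
  shows "(\<integral>\<^sup>+x\<in>K. (\<integral>\<^sup>+\<tau>\<in>{0..s}. h (x + \<tau> *\<^sub>R e) \<partial>lborel) \<partial>lborel) \<le> ennreal s * (\<integral>\<^sup>+x\<in>K'. h x \<partial>lborel)"
proof -
  have "(\<integral>\<^sup>+x\<in>K. (\<integral>\<^sup>+\<tau>\<in>{0..s}. h (x + \<tau> *\<^sub>R e) \<partial>lborel) \<partial>lborel)
     = (\<integral>\<^sup>+x. \<integral>\<^sup>+\<tau>. h (x + \<tau> *\<^sub>R e) * indicator {0..s} \<tau> * indicator K x \<partial>lborel \<partial>lborel)"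
    by (simp add: nn_integral_multc)
  also have "\<dots> = (\<integral>\<^sup>+\<tau>. \<integral>\<^sup>+x. h (x + \<tau> *\<^sub>R e) * indicator {0..s} \<tau> * indicator K x \<partial>lborel \<partial>lborel)"
    by (rule lborel_pair.Fubini') simp
  also have "\<dots> \<le> (\<integral>\<^sup>+\<tau>. (\<integral>\<^sup>+x\<in>K'. h x \<partial>lborel) * indicator {0..s} \<tau> \<partial>(lborel :: real measure))"
  proof (rule nn_integral_mono)
    fix \<tau> :: real
    show "(\<integral>\<^sup>+x. h (x + \<tau> *\<^sub>R e) * indicator {0..s} \<tau> * indicator K x \<partial>lborel) \<le> (\<integral>\<^sup>+x\<in>K'. h x \<partial>lborel) * indicator {0..s} \<tau>"
    proof (cases "\<tau> \<in> {0..s}")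
      case True
      have "(\<integral>\<^sup>+x. h (x + \<tau> *\<^sub>R e) * indicator {0..s} \<tau> * indicator K x \<partial>lborel)
          \<le> (\<integral>\<^sup>+x. h (x + \<tau> *\<^sub>R e) * indicator K' (x + \<tau> *\<^sub>R e) \<partial>lborel)"
        using True sub by (intro nn_integral_mono) (auto simp: indicator_def)
      also have "\<dots> = (\<integral>\<^sup>+x\<in>K'. h x \<partial>lborel)" by (rule nn_integral_translate) simp
      finally show ?thesis using True by simp
    qed simp
  qed
  also have "\<dots> = ennreal s * (\<integral>\<^sup>+x\<in>K'. h x \<partial>lborel)" using s by (subst nn_integral_cmult_indicator) (simp_all add: mult.commute)
  finally show ?thesis .
qed

text \<open>Local integrability for nonnegative extended functions. The class is stable under
  integration along segments, so finiteness almost everywhere also follows for iterated line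
  integrals.\<close>

definition loc_finite :: "(R3 \<Rightarrow> ennreal) \<Rightarrow> bool" where
  "loc_finite h \<longleftrightarrow> h \<in> borel_measurable borel \<and> (\<forall>K. compact K \<longrightarrow> (\<integral>\<^sup>+x\<in>K. h x \<partial>lborel) < \<infinity>)"

lemma loc_finite_line:
  assumes h: "loc_finite h" and s: "0 \<le> s"
  shows "loc_finite (\<lambda>x. \<integral>\<^sup>+\<tau>\<in>{0..s}. h (x + \<tau> *\<^sub>R e) \<partial>lborel)"
proof -
  have [measurable]: "h \<in> borel_measurable borel" using h by (simp add: loc_finite_def)
  have m: "(\<lambda>x. \<integral>\<^sup>+\<tau>\<in>{0..s}. h (x + \<tau> *\<^sub>R e) \<partial>lborel) \<in> borel_measurable borel" by measurable
  have "(\<integral>\<^sup>+x\<in>K. (\<integral>\<^sup>+\<tau>\<in>{0..s}. h (x + \<tau> *\<^sub>R e) \<partial>lborel) \<partial>lborel) < \<infinity>" if K: "compact K" for K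
  proof -
    define K' where "K' = (\<lambda>(x, \<tau>). x + \<tau> *\<^sub>R e) ` (K \<times> {0..s})"
    have K': "compact K'" unfolding K'_def using K
      by (intro compact_continuous_image compact_Times) (auto intro!: continuous_intros simp: case_prod_beta)
    have "(\<integral>\<^sup>+x\<in>K. (\<integral>\<^sup>+\<tau>\<in>{0..s}. h (x + \<tau> *\<^sub>R e) \<partial>lborel) \<partial>lborel) \<le> ennreal s * (\<integral>\<^sup>+x\<in>K'. h x \<partial>lborel)"
      by (rule line_average) (use K K' s in \<open>auto simp: borel_compact K'_def\<close>)
    also have "\<dots> < \<infinity>" using h K' by (auto simp: loc_finite_def ennreal_mult_less_top)
    finally show ?thesis .
  qed
  then show ?thesis using m by (simp add: loc_finite_def)
qed

lemma loc_finite_AE: assumes "loc_finite h" shows "AE x in lborel. h x < \<infinity>"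
proof -
  have [measurable]: "h \<in> borel_measurable borel" using assms by (simp add: loc_finite_def)
  have "AE x in lborel. x \<in> cball 0 (real n) \<longrightarrow> h x < \<infinity>" for n
  proof -
    have [measurable]: "cball 0 (real n) \<in> sets (borel :: R3 measure)" by simp
    have "AE x in lborel. h x * indicator (cball 0 (real n)) x \<noteq> \<infinity>"
    proof (rule nn_integral_PInf_AE)
      show "(\<integral>\<^sup>+x\<in>cball 0 (real n). h x \<partial>lborel) \<noteq> \<infinity>" using assms by (auto simp: loc_finite_def less_top)
    qed measurable
    then show ?thesis by eventually_elim (auto simp: indicator_def less_top)
  qed
  then have "AE x in lborel. \<forall>n. x \<in> cball 0 (real n) \<longrightarrow> h x < \<infinity>" by (subst AE_all_countable) blast
  then show ?thesis
  proof eventually_elim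
    case (elim x)
    obtain n where "norm x \<le> real n" using real_arch_simple by blast
    then show ?case using elim by auto
  qed
qed

lemma loc_finite_norm:
  fixes f :: "R3 \<Rightarrow> 'b::{banach, second_countable_topology}"
  assumes f: "f \<in> borel_measurable borel" "\<And>K. compact K \<Longrightarrow> set_integrable lborel K f"
  shows "loc_finite (\<lambda>x. ennreal (norm (f x)))"
  unfolding loc_finite_def
proof (intro conjI allI impI)
  show "(\<lambda>x. ennreal (norm (f x))) \<in> borel_measurable borel" using f(1) by simp
  fix K :: "R3 set" assume "compact K"
  then have "(\<integral>\<^sup>+x. ennreal (norm (indicator K x *\<^sub>R f x)) \<partial>lborel) < \<infinity>"
    using f(2)[of K] by (simp add: set_integrable_def integrable_iff_bounded)
  moreover have "(\<integral>\<^sup>+x\<in>K. ennreal (norm (f x)) \<partial>lborel) = (\<integral>\<^sup>+x. ennreal (norm (indicator K x *\<^sub>R f x)) \<partial>lborel)"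
    by (intro nn_integral_cong) (auto simp: indicator_def)
  ultimately show "(\<integral>\<^sup>+x\<in>K. ennreal (norm (f x)) \<partial>lborel) < \<infinity>" by simp
qed

lemma AE_line_integrable:
  fixes f :: "R3 \<Rightarrow> 'b::{banach, second_countable_topology}"
  assumes f[measurable]: "f \<in> borel_measurable borel" and i: "\<And>K. compact K \<Longrightarrow> set_integrable lborel K f" and s: "0 \<le> s"
  shows "AE x in lborel. set_integrable lborel {0..s} (\<lambda>\<tau>. f (x + \<tau> *\<^sub>R e))"
proof -
  have "AE x in lborel. (\<integral>\<^sup>+\<tau>\<in>{0..s}. ennreal (norm (f (x + \<tau> *\<^sub>R e))) \<partial>lborel) < \<infinity>"
    by (intro loc_finite_AE loc_finite_line loc_finite_norm s f i)
  then show ?thesis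
  proof eventually_elim
    case (elim x)
    have "(\<integral>\<^sup>+\<tau>. ennreal (norm (indicator {0..s} \<tau> *\<^sub>R f (x + \<tau> *\<^sub>R e))) \<partial>lborel)
        = (\<integral>\<^sup>+\<tau>\<in>{0..s}. ennreal (norm (f (x + \<tau> *\<^sub>R e))) \<partial>lborel)"
      by (intro nn_integral_cong) (auto simp: indicator_def)
    then show ?case using elim by (simp add: set_integrable_def integrable_iff_bounded)
  qed
qed

text \<open>If \<open>f\<close> is not integrable, its Bochner integral is 0 by convention and the
  inequality survives.\<close>

lemma ennreal_integral_le:
  fixes f :: "'a \<Rightarrow> real"
  assumes "\<And>x. 0 \<le> f x"
  shows "ennreal (integral\<^sup>L M f) \<le> (\<integral>\<^sup>+x. ennreal (f x) \<partial>M)"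
proof (cases "integrable M f")
  case True
  then show ?thesis using assms by (simp add: nn_integral_eq_integral)
next
  case False
  then show ?thesis by (simp add: not_integrable_integral_eq)
qed

lemma nn_Cauchy_Schwarz_interval:
  assumes [measurable]: "h \<in> borel_measurable borel" and s: "0 \<le> s"
  shows "(\<integral>\<^sup>+\<tau>\<in>{0..s::real}. h \<tau> \<partial>lborel)\<^sup>2 \<le> ennreal s * (\<integral>\<^sup>+\<tau>\<in>{0..s}. (h \<tau>)\<^sup>2 \<partial>lborel)"
proof -
  have "(\<integral>\<^sup>+\<tau>\<in>{0..s}. h \<tau> \<partial>lborel)\<^sup>2 = (\<integral>\<^sup>+\<tau>. (h \<tau> * indicator {0..s} \<tau>) * indicator {0..s} \<tau> \<partial>lborel)\<^sup>2"
    by (intro arg_cong[where f = "\<lambda>z. z\<^sup>2"] nn_integral_cong) (auto simp: indicator_def)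
  also have "\<dots> \<le> (\<integral>\<^sup>+\<tau>. (h \<tau> * indicator {0..s} \<tau>)\<^sup>2 \<partial>lborel) * (\<integral>\<^sup>+\<tau>. (indicator {0..s} \<tau>)\<^sup>2 \<partial>lborel)"
    by (rule Cauchy_Schwarz_nn_integral) measurable
  also have "(\<integral>\<^sup>+\<tau>. (indicator {0..s} \<tau>)\<^sup>2 \<partial>lborel) = ennreal s"
  proof -
    have "(\<integral>\<^sup>+\<tau>. (indicator {0..s} \<tau>)\<^sup>2 \<partial>lborel) = (\<integral>\<^sup>+\<tau>. indicator {0..s} \<tau> \<partial>lborel)"
      by (intro nn_integral_cong) (auto simp: indicator_def)
    then show ?thesis using s by simp
  qed
  also have "(\<integral>\<^sup>+\<tau>. (h \<tau> * indicator {0..s} \<tau>)\<^sup>2 \<partial>lborel) = (\<integral>\<^sup>+\<tau>\<in>{0..s}. (h \<tau>)\<^sup>2 \<partial>lborel)"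
    by (intro nn_integral_cong) (auto simp: indicator_def)
  finally show ?thesis by (simp add: mult.commute)
qed

text \<open>Gauge covariant fundamental theorem followed by Cauchy--Schwarz on the segment. To use
  \<open>gauge_increment\<close>, \<open>\<psi>\<close> along the segment must be the integral of
  \<open>G\<close> for almost every length, on almost every segment.\<close>

lemma edge_inequality:
  fixes \<psi> G :: "R3 \<Rightarrow> complex" and a :: "R3 \<Rightarrow> real" and j :: 3
  defines "e \<equiv> axis j 1 :: R3"
  assumes [measurable]: "\<psi> \<in> borel_measurable borel" "G \<in> borel_measurable borel" "a \<in> borel_measurable borel"
    and lp: "line_pd U j \<psi> G" and W: "open W" and s: "0 \<le> s"
    and seg: "\<And>x \<tau>. \<lbrakk>x \<in> W; 0 \<le> \<tau>; \<tau> \<le> s\<rbrakk> \<Longrightarrow> x + \<tau> *\<^sub>R e \<in> U"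
    and ai: "\<And>K. compact K \<Longrightarrow> set_integrable lborel K a"
  shows "AE x in lborel. x \<in> W \<longrightarrow>
     ennreal ((cmod (\<psi> (x + s *\<^sub>R e) - cis (LBINT \<tau>:{0..s}. a (x + \<tau> *\<^sub>R e)) * \<psi> x))\<^sup>2)
       \<le> ennreal s * (\<integral>\<^sup>+\<tau>\<in>{0..s}. ennreal ((cmod (G (x + \<tau> *\<^sub>R e) - \<i> * of_real (a (x + \<tau> *\<^sub>R e)) * \<psi> (x + \<tau> *\<^sub>R e)))\<^sup>2) \<partial>lborel)"
proof -
  have [measurable]: "W \<in> sets borel" using W by simp
  have at_t: "AE x in lborel. x \<in> W \<longrightarrow> set_integrable lborel {0..t} (\<lambda>\<tau>. G (x + \<tau> *\<^sub>R e)) \<and>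
        \<psi> (x + t *\<^sub>R e) - \<psi> x = (LBINT \<tau>:{0..t}. G (x + \<tau> *\<^sub>R e))" if "0 \<le> t" "t \<le> s" for t
    using lp W that seg unfolding line_pd_def e_def by auto
  define Q where "Q x t \<longleftrightarrow> (x \<in> W \<longrightarrow> 0 \<le> t \<longrightarrow> t \<le> s \<longrightarrow>
      \<psi> (x + t *\<^sub>R e) - \<psi> x = (LBINT \<tau>. (if 0 \<le> \<tau> \<and> \<tau> \<le> t then 1 else 0) *\<^sub>R G (x + \<tau> *\<^sub>R e)))" for x t
  have Iif: "(LBINT \<tau>:{0..t}. g \<tau>) = (LBINT \<tau>. (if 0 \<le> \<tau> \<and> \<tau> \<le> t then 1 else 0) *\<^sub>R g \<tau>)" for t and g :: "real \<Rightarrow> complex"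
    unfolding set_lebesgue_integral_def by (intro Bochner_Integration.integral_cong) (auto simp: indicator_def)
  have "AE t in lborel. AE x in lborel. Q x t"
  proof (rule AE_I2)
    fix t :: real
    show "AE x in lborel. Q x t"
    proof (cases "0 \<le> t \<and> t \<le> s")
      case True
      then have "0 \<le> t" "t \<le> s" by auto
      from at_t[OF this] show ?thesis by eventually_elim (auto simp: Q_def Iif)
    next
      case False
      then show ?thesis by (auto simp: Q_def)
    qed
  qed
  moreover have "{z \<in> space (lborel \<Otimes>\<^sub>M lborel). Q (fst z) (snd z)} \<in> sets (lborel \<Otimes>\<^sub>M lborel)"
    unfolding Q_def by measurable
  \<comment> \<open>This exchanges the quantifiers: the null set of starting points may vary with
    \<open>t\<close>, but for almost every starting point the identity holds for almost every
    \<open>t\<close>, which suffices under the integral.\<close>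
  ultimately have "AE x in lborel. AE t in lborel. Q x t"
    by (subst lborel_pair.AE_commute)
  moreover have "AE x in lborel. set_integrable lborel {0..s} (\<lambda>\<tau>. a (x + \<tau> *\<^sub>R e))"
    by (rule AE_line_integrable[OF _ ai s]) simp_all
  moreover note at_t[OF s order_refl]
  ultimately show ?thesis
  proof eventually_elim
    case (elim x)
    show ?case
    proof
      assume x: "x \<in> W"
      let ?G = "\<lambda>\<tau>. indicator {0..s} \<tau> *\<^sub>R G (x + \<tau> *\<^sub>R e)" and ?a = "\<lambda>\<tau>. indicator {0..s} \<tau> * a (x + \<tau> *\<^sub>R e)"
      have i: "integrable lborel ?a" "integrable lborel ?G"
        using elim x by (auto simp: set_integrable_def)
      note inc = gauge_increment[OF i s, of "\<psi> x"]
      have drop0: "(LBINT \<rho>. indicator {0<..\<tau>} \<rho> *\<^sub>R (indicator {0..s} \<rho> *\<^sub>R g \<rho>)) = (LBINT \<rho>:{0..\<tau>}. g \<rho>)"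
        if "\<tau> \<le> s" and g: "g \<in> borel_measurable borel" for \<tau> and g :: "real \<Rightarrow> 'c::{banach, second_countable_topology}"
        unfolding set_lebesgue_integral_def
      proof (rule integral_cong_AE)
        have "AE \<rho> in lborel. \<rho> \<noteq> (0::real)" by (rule AE_lborel_singleton)
        then show "AE \<rho> in lborel. indicator {0<..\<tau>} \<rho> *\<^sub>R (indicator {0..s} \<rho> *\<^sub>R g \<rho>) = indicator {0..\<tau>} \<rho> *\<^sub>R g \<rho>"
          by eventually_elim (use that in \<open>auto simp: indicator_def\<close>)
      qed (use g in auto)
      have eG: "(LBINT \<rho>. indicator {0<..\<tau>} \<rho> *\<^sub>R ?G \<rho>) = (LBINT \<rho>:{0..\<tau>}. G (x + \<rho> *\<^sub>R e))" if "\<tau> \<le> s" for \<tau>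
        using drop0[OF that, of "\<lambda>\<rho>. G (x + \<rho> *\<^sub>R e)"] by simp
      have ea: "(LBINT \<rho>. indicator {0<..s} \<rho> * ?a \<rho>) = (LBINT \<rho>:{0..s}. a (x + \<rho> *\<^sub>R e))"
        using drop0[of s "\<lambda>\<rho>. a (x + \<rho> *\<^sub>R e)"] by simp
      have final: "\<psi> x + (LBINT \<rho>. indicator {0<..s} \<rho> *\<^sub>R ?G \<rho>) = \<psi> (x + s *\<^sub>R e)"
        unfolding eG[OF order_refl] using elim x by (simp add: algebra_simps)
      let ?d = "\<lambda>\<tau>. cmod (G (x + \<tau> *\<^sub>R e) - \<i> * of_real (a (x + \<tau> *\<^sub>R e)) * \<psi> (x + \<tau> *\<^sub>R e))"
      have "ennreal (cmod (\<psi> (x + s *\<^sub>R e) - cis (LBINT \<tau>:{0..s}. a (x + \<tau> *\<^sub>R e)) * \<psi> x))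
         \<le> ennreal (LBINT \<tau>. indicator {0<..s} \<tau> * cmod (?G \<tau> - \<i> * of_real (?a \<tau>) * (\<psi> x + (LBINT \<rho>. indicator {0<..\<tau>} \<rho> *\<^sub>R ?G \<rho>))))"
        using inc unfolding final ea by (rule ennreal_leI)
      also have "\<dots> \<le> (\<integral>\<^sup>+\<tau>. ennreal (indicator {0<..s} \<tau> * cmod (?G \<tau> - \<i> * of_real (?a \<tau>) * (\<psi> x + (LBINT \<rho>. indicator {0<..\<tau>} \<rho> *\<^sub>R ?G \<rho>)))) \<partial>lborel)"
        by (rule ennreal_integral_le) simp
      also have "\<dots> \<le> (\<integral>\<^sup>+\<tau>\<in>{0..s}. ennreal (?d \<tau>) \<partial>lborel)"
      proof (rule nn_integral_mono_AE)
        have "AE \<tau> in lborel. Q x \<tau>" using elim by blast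
        then show "AE \<tau> in lborel. ennreal (indicator {0<..s} \<tau> * cmod (?G \<tau> - \<i> * of_real (?a \<tau>) * (\<psi> x + (LBINT \<rho>. indicator {0<..\<tau>} \<rho> *\<^sub>R ?G \<rho>))))
            \<le> ennreal (?d \<tau>) * indicator {0..s} \<tau>"
        proof eventually_elim
          case (elim \<tau>)
          show ?case
          proof (cases "\<tau> \<in> {0<..s}")
            case True
            then have "\<psi> x + (LBINT \<rho>. indicator {0<..\<tau>} \<rho> *\<^sub>R ?G \<rho>) = \<psi> (x + \<tau> *\<^sub>R e)"
              using elim x eG[of \<tau>] by (simp add: Q_def Iif algebra_simps)
            then show ?thesis using True by simp
          qed simp
        qed
      qed
      finally have 1: "ennreal (cmod (\<psi> (x + s *\<^sub>R e) - cis (LBINT \<tau>:{0..s}. a (x + \<tau> *\<^sub>R e)) * \<psi> x)) \<le> (\<integral>\<^sup>+\<tau>\<in>{0..s}. ennreal (?d \<tau>) \<partial>lborel)" .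
      have "ennreal ((cmod (\<psi> (x + s *\<^sub>R e) - cis (LBINT \<tau>:{0..s}. a (x + \<tau> *\<^sub>R e)) * \<psi> x))\<^sup>2)
          = (ennreal (cmod (\<psi> (x + s *\<^sub>R e) - cis (LBINT \<tau>:{0..s}. a (x + \<tau> *\<^sub>R e)) * \<psi> x)))\<^sup>2"
        by (simp add: ennreal_power)
      also have "\<dots> \<le> (\<integral>\<^sup>+\<tau>\<in>{0..s}. ennreal (?d \<tau>) \<partial>lborel)\<^sup>2" using 1 by (rule power_mono) simp
      also have "\<dots> \<le> ennreal s * (\<integral>\<^sup>+\<tau>\<in>{0..s}. (ennreal (?d \<tau>))\<^sup>2 \<partial>lborel)"
        by (rule nn_Cauchy_Schwarz_interval[OF _ s]) measurable
      finally show "ennreal ((cmod (\<psi> (x + s *\<^sub>R e) - cis (LBINT \<tau>:{0..s}. a (x + \<tau> *\<^sub>R e)) * \<psi> x))\<^sup>2)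
         \<le> ennreal s * (\<integral>\<^sup>+\<tau>\<in>{0..s}. ennreal ((?d \<tau>)\<^sup>2) \<partial>lborel)"
        by (simp add: ennreal_power)
    qed
  qed
qed

text \<open>The one-dimensional identity in direction \<open>e\<close> is integrated over a segment
  in direction \<open>e'\<close>. This is one half of Stokes' formula on a plaquette.\<close>

lemma line_difference:
  fixes u g :: "R3 \<Rightarrow> real" and j :: 3 and e' :: R3
  defines "e \<equiv> axis j 1 :: R3"
  assumes [measurable]: "u \<in> borel_measurable borel" "g \<in> borel_measurable borel"
    and lp: "line_pd UNIV j u g" and s: "0 \<le> s"
    and ui: "\<And>K. compact K \<Longrightarrow> set_integrable lborel K u"
  shows "AE x in lborel. (LBINT \<rho>:{0..s}. u (x + s *\<^sub>R e + \<rho> *\<^sub>R e')) - (LBINT \<rho>:{0..s}. u (x + \<rho> *\<^sub>R e'))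
     = (LBINT \<rho>:{0..s}. (LBINT \<tau>:{0..s}. g (x + \<rho> *\<^sub>R e' + \<tau> *\<^sub>R e)))"
proof -
  define Q where "Q y \<longleftrightarrow> u (y + s *\<^sub>R e) - u y = (LBINT \<tau>:{0..s}. g (y + \<tau> *\<^sub>R e))" for y
  have "AE y in lborel. Q y"
    using lp s unfolding line_pd_def e_def[symmetric] Q_def by (auto dest!: spec[of _ UNIV] spec[of _ s] elim!: eventually_mono)
  then have "AE x in lborel. Q (x + \<rho> *\<^sub>R e')" for \<rho> by (rule AE_translate)
  then have "AE \<rho> in lborel. AE x in lborel. Q (x + \<rho> *\<^sub>R e')" by (rule AE_I2)
  moreover have "{z \<in> space (lborel \<Otimes>\<^sub>M lborel). Q (fst z + snd z *\<^sub>R e')} \<in> sets (lborel \<Otimes>\<^sub>M lborel)"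
    unfolding Q_def set_lebesgue_integral_def by measurable
  ultimately have "AE x in lborel. AE \<rho> in lborel. Q (x + \<rho> *\<^sub>R e')"
    by (subst lborel_pair.AE_commute)
  moreover have "AE x in lborel. set_integrable lborel {0..s} (\<lambda>\<rho>. u (x + \<rho> *\<^sub>R e'))"
    by (rule AE_line_integrable[OF _ ui s]) simp
  moreover from AE_translate[OF this, of "s *\<^sub>R e"]
  have "AE x in lborel. set_integrable lborel {0..s} (\<lambda>\<rho>. u (x + s *\<^sub>R e + \<rho> *\<^sub>R e'))" .
  ultimately show ?thesis
  proof eventually_elim
    case (elim x)
    have "(LBINT \<rho>:{0..s}. u (x + s *\<^sub>R e + \<rho> *\<^sub>R e')) - (LBINT \<rho>:{0..s}. u (x + \<rho> *\<^sub>R e'))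
       = (LBINT \<rho>:{0..s}. u (x + s *\<^sub>R e + \<rho> *\<^sub>R e') - u (x + \<rho> *\<^sub>R e'))"
      using elim by (intro set_integral_diff(2)[symmetric])
    also have "\<dots> = (LBINT \<rho>:{0..s}. (LBINT \<tau>:{0..s}. g (x + \<rho> *\<^sub>R e' + \<tau> *\<^sub>R e)))"
      unfolding set_lebesgue_integral_def
    proof (rule integral_cong_AE)
      have "AE \<rho> in lborel. Q (x + \<rho> *\<^sub>R e')" using elim by blast
      then show "AE \<rho> in lborel. indicator {0..s} \<rho> *\<^sub>R (u (x + s *\<^sub>R e + \<rho> *\<^sub>R e') - u (x + \<rho> *\<^sub>R e'))
          = indicator {0..s} \<rho> *\<^sub>R (LBINT \<tau>. indicator {0..s} \<tau> *\<^sub>R g (x + \<rho> *\<^sub>R e' + \<tau> *\<^sub>R e))"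
        by eventually_elim (simp add: Q_def set_lebesgue_integral_def add_ac)
    qed measurable
    finally show ?case .
  qed
qed

text \<open>Stokes' theorem on the square of side \<open>s\<close> at almost every corner, with
  \<open>h21 - h12\<close> as the curl: two uses of \<open>line_difference\<close>, one with the
  order of integration exchanged. The squared defect from \<open>s^2\<close> is bounded by two
  Cauchy--Schwarz steps, each giving one factor \<open>s\<close>.\<close>

lemma circulation:
  fixes a1 a2 h12 h21 :: "R3 \<Rightarrow> real"
  defines "e1 \<equiv> axis 1 1 :: R3" and "e2 \<equiv> axis 2 1 :: R3"
  assumes [measurable]: "a1 \<in> borel_measurable borel" "a2 \<in> borel_measurable borel"
      "h12 \<in> borel_measurable borel" "h21 \<in> borel_measurable borel"
    and lp: "line_pd UNIV 1 a2 h21" "line_pd UNIV 2 a1 h12" and s: "0 \<le> s"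
    and ai: "\<And>K. compact K \<Longrightarrow> set_integrable lborel K a1" "\<And>K. compact K \<Longrightarrow> set_integrable lborel K a2"
    and hi: "\<And>K. compact K \<Longrightarrow> set_integrable lborel K h12" "\<And>K. compact K \<Longrightarrow> set_integrable lborel K h21"
  shows "AE x in lborel. ennreal (((LBINT \<tau>:{0..s}. a1 (x + \<tau> *\<^sub>R e1)) + (LBINT \<tau>:{0..s}. a2 (x + s *\<^sub>R e1 + \<tau> *\<^sub>R e2))
       - (LBINT \<tau>:{0..s}. a1 (x + s *\<^sub>R e2 + \<tau> *\<^sub>R e1)) - (LBINT \<tau>:{0..s}. a2 (x + \<tau> *\<^sub>R e2)) - s\<^sup>2)\<^sup>2)
     \<le> ennreal (s\<^sup>2) * (\<integral>\<^sup>+\<rho>\<in>{0..s}. (\<integral>\<^sup>+\<tau>\<in>{0..s}. ennreal ((h21 (x + \<rho> *\<^sub>R e2 + \<tau> *\<^sub>R e1) - h12 (x + \<rho> *\<^sub>R e2 + \<tau> *\<^sub>R e1) - 1)\<^sup>2) \<partial>lborel) \<partial>lborel)"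
proof -
  \<comment> \<open>Two uses of \<open>loc_finite_line\<close> give absolute integrability over
    almost every plaquette, which Fubini needs.\<close>
  have fin: "AE x in lborel. (\<integral>\<^sup>+\<rho>\<in>{0..s}. (\<integral>\<^sup>+\<tau>\<in>{0..s}. ennreal (norm (h (x + \<rho> *\<^sub>R e2 + \<tau> *\<^sub>R e1))) \<partial>lborel) \<partial>lborel) < \<infinity>"
    if "h \<in> borel_measurable borel" "\<And>K. compact K \<Longrightarrow> set_integrable lborel K h" for h :: "R3 \<Rightarrow> real"
    by (intro loc_finite_AE loc_finite_line loc_finite_norm s that)
  have d1: "AE x in lborel. (LBINT \<rho>:{0..s}. a2 (x + s *\<^sub>R e1 + \<rho> *\<^sub>R e2)) - (LBINT \<rho>:{0..s}. a2 (x + \<rho> *\<^sub>R e2))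
     = (LBINT \<rho>:{0..s}. (LBINT \<tau>:{0..s}. h21 (x + \<rho> *\<^sub>R e2 + \<tau> *\<^sub>R e1)))"
    unfolding e1_def by (rule line_difference) (use lp s ai in auto)
  have d2: "AE x in lborel. (LBINT \<rho>:{0..s}. a1 (x + s *\<^sub>R e2 + \<rho> *\<^sub>R e1)) - (LBINT \<rho>:{0..s}. a1 (x + \<rho> *\<^sub>R e1))
     = (LBINT \<rho>:{0..s}. (LBINT \<tau>:{0..s}. h12 (x + \<rho> *\<^sub>R e1 + \<tau> *\<^sub>R e2)))"
    unfolding e2_def by (rule line_difference) (use lp s ai in auto)
  have f1: "AE x in lborel. (\<integral>\<^sup>+\<rho>\<in>{0..s}. (\<integral>\<^sup>+\<tau>\<in>{0..s}. ennreal (norm (h12 (x + \<rho> *\<^sub>R e2 + \<tau> *\<^sub>R e1))) \<partial>lborel) \<partial>lborel) < \<infinity>"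
    by (rule fin) (use hi in auto)
  have f2: "AE x in lborel. (\<integral>\<^sup>+\<rho>\<in>{0..s}. (\<integral>\<^sup>+\<tau>\<in>{0..s}. ennreal (norm (h21 (x + \<rho> *\<^sub>R e2 + \<tau> *\<^sub>R e1))) \<partial>lborel) \<partial>lborel) < \<infinity>"
    by (rule fin) (use hi in auto)
  from d1 d2 f1 f2 show ?thesis
  proof eventually_elim
    case (elim x)
    define P where "P h z = indicator {0..s} (fst z) * (indicator {0..s} (snd z) * h (x + fst z *\<^sub>R e2 + snd z *\<^sub>R e1))"
      for h :: "R3 \<Rightarrow> real" and z :: "real \<times> real"
    have Pm[measurable]: "P h \<in> borel_measurable (borel \<Otimes>\<^sub>M borel)" if [measurable]: "h \<in> borel_measurable borel" for h
      unfolding P_def by measurable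
    have Pi: "integrable (lborel \<Otimes>\<^sub>M lborel) (P h)"
      if [measurable]: "h \<in> borel_measurable borel"
      and f: "(\<integral>\<^sup>+\<rho>\<in>{0..s}. (\<integral>\<^sup>+\<tau>\<in>{0..s}. ennreal (norm (h (x + \<rho> *\<^sub>R e2 + \<tau> *\<^sub>R e1))) \<partial>lborel) \<partial>lborel) < \<infinity>" for h
    proof (rule integrableI_bounded)
      have "(\<integral>\<^sup>+z. ennreal (norm (P h z)) \<partial>(lborel \<Otimes>\<^sub>M lborel)) = (\<integral>\<^sup>+\<rho>. \<integral>\<^sup>+\<tau>. ennreal (norm (P h (\<rho>, \<tau>))) \<partial>lborel \<partial>lborel)"
        by (rule lborel.nn_integral_fst[symmetric]) measurable
      also have "\<dots> = (\<integral>\<^sup>+\<rho>\<in>{0..s}. (\<integral>\<^sup>+\<tau>\<in>{0..s}. ennreal (norm (h (x + \<rho> *\<^sub>R e2 + \<tau> *\<^sub>R e1))) \<partial>lborel) \<partial>lborel)"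
        by (intro nn_integral_cong) (auto simp: P_def indicator_def intro!: nn_integral_cong)
      finally show "(\<integral>\<^sup>+z. ennreal (norm (P h z)) \<partial>(lborel \<Otimes>\<^sub>M lborel)) < \<infinity>" using f by simp
    qed (use that(1) in measurable)
    define h where "h y = h21 y - h12 y - 1" for y
    have [measurable]: "h \<in> borel_measurable borel" unfolding h_def by measurable
    have one: "integrable (lborel \<Otimes>\<^sub>M lborel) (P (\<lambda>_. 1))"
      using s by (intro Pi) (auto simp: nn_integral_cmult ennreal_mult_less_top)
    have i12: "integrable (lborel \<Otimes>\<^sub>M lborel) (P h12)" and i21: "integrable (lborel \<Otimes>\<^sub>M lborel) (P h21)"
      using elim by (auto intro!: Pi)
    have Ph: "P h = (\<lambda>z. P h21 z - P h12 z - P (\<lambda>_. 1) z)"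
      by (rule ext) (simp add: P_def h_def algebra_simps)
    have iter: "(LBINT \<rho>:{0..s}. (LBINT \<tau>:{0..s}. g (x + \<rho> *\<^sub>R e2 + \<tau> *\<^sub>R e1))) = integral\<^sup>L (lborel \<Otimes>\<^sub>M lborel) (P g)"
      if "integrable (lborel \<Otimes>\<^sub>M lborel) (P g)" for g
    proof -
      have "(LBINT \<rho>:{0..s}. (LBINT \<tau>:{0..s}. g (x + \<rho> *\<^sub>R e2 + \<tau> *\<^sub>R e1))) = (LBINT \<rho>. (LBINT \<tau>. P g (\<rho>, \<tau>)))"
        by (simp add: set_lebesgue_integral_def P_def)
      then show ?thesis using lborel_pair.integral_fst'[OF that] by simp
    qed
    have swap: "(LBINT \<tau>:{0..s}. (LBINT \<rho>:{0..s}. h12 (x + \<tau> *\<^sub>R e1 + \<rho> *\<^sub>R e2))) = integral\<^sup>L (lborel \<Otimes>\<^sub>M lborel) (P h12)"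
    proof -
      have "(LBINT \<tau>:{0..s}. (LBINT \<rho>:{0..s}. h12 (x + \<tau> *\<^sub>R e1 + \<rho> *\<^sub>R e2))) = (LBINT \<tau>. (LBINT \<rho>. P h12 (\<rho>, \<tau>)))"
        unfolding set_lebesgue_integral_def P_def
        by (simp add: add_ac flip: Bochner_Integration.integral_mult_right_zero) (simp add: mult.left_commute)
      then show ?thesis using lborel_pair.integral_snd[of "\<lambda>\<rho> \<tau>. P h12 (\<rho>, \<tau>)"] i12 by simp
    qed
    have val1: "integral\<^sup>L (lborel \<Otimes>\<^sub>M lborel) (P (\<lambda>_. 1)) = s\<^sup>2"
      using iter[OF one] s by (simp add: set_lebesgue_integral_def power2_eq_square)
    have "(LBINT \<tau>:{0..s}. a1 (x + \<tau> *\<^sub>R e1)) + (LBINT \<tau>:{0..s}. a2 (x + s *\<^sub>R e1 + \<tau> *\<^sub>R e2))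
       - (LBINT \<tau>:{0..s}. a1 (x + s *\<^sub>R e2 + \<tau> *\<^sub>R e1)) - (LBINT \<tau>:{0..s}. a2 (x + \<tau> *\<^sub>R e2)) - s\<^sup>2
       = integral\<^sup>L (lborel \<Otimes>\<^sub>M lborel) (P h21) - integral\<^sup>L (lborel \<Otimes>\<^sub>M lborel) (P h12) - integral\<^sup>L (lborel \<Otimes>\<^sub>M lborel) (P (\<lambda>_. 1))"
      using elim(1,2) unfolding iter[OF i21] swap val1 by simp
    also have "\<dots> = integral\<^sup>L (lborel \<Otimes>\<^sub>M lborel) (P h)" unfolding Ph using i12 i21 one by simp
    finally have eq: "(LBINT \<tau>:{0..s}. a1 (x + \<tau> *\<^sub>R e1)) + (LBINT \<tau>:{0..s}. a2 (x + s *\<^sub>R e1 + \<tau> *\<^sub>R e2))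
       - (LBINT \<tau>:{0..s}. a1 (x + s *\<^sub>R e2 + \<tau> *\<^sub>R e1)) - (LBINT \<tau>:{0..s}. a2 (x + \<tau> *\<^sub>R e2)) - s\<^sup>2
       = integral\<^sup>L (lborel \<Otimes>\<^sub>M lborel) (P h)" .
    let ?k = "\<lambda>\<rho> \<tau>. ennreal \<bar>h (x + \<rho> *\<^sub>R e2 + \<tau> *\<^sub>R e1)\<bar>"
    have "ennreal \<bar>integral\<^sup>L (lborel \<Otimes>\<^sub>M lborel) (P h)\<bar> \<le> ennreal (integral\<^sup>L (lborel \<Otimes>\<^sub>M lborel) (\<lambda>z. norm (P h z)))"
      using integral_norm_bound[of "lborel \<Otimes>\<^sub>M lborel" "P h"] by (intro ennreal_leI) simp
    also have "\<dots> \<le> (\<integral>\<^sup>+z. ennreal (norm (P h z)) \<partial>(lborel \<Otimes>\<^sub>M lborel))" by (rule ennreal_integral_le) simp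
    also have "\<dots> = (\<integral>\<^sup>+\<rho>. \<integral>\<^sup>+\<tau>. ennreal (norm (P h (\<rho>, \<tau>))) \<partial>lborel \<partial>lborel)"
      by (rule lborel.nn_integral_fst[symmetric]) measurable
    also have "\<dots> = (\<integral>\<^sup>+\<rho>\<in>{0..s}. (\<integral>\<^sup>+\<tau>\<in>{0..s}. ?k \<rho> \<tau> \<partial>lborel) \<partial>lborel)"
      by (intro nn_integral_cong) (auto simp: P_def indicator_def intro!: nn_integral_cong)
    finally have 1: "ennreal \<bar>integral\<^sup>L (lborel \<Otimes>\<^sub>M lborel) (P h)\<bar> \<le> (\<integral>\<^sup>+\<rho>\<in>{0..s}. (\<integral>\<^sup>+\<tau>\<in>{0..s}. ?k \<rho> \<tau> \<partial>lborel) \<partial>lborel)" .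
    have "ennreal ((integral\<^sup>L (lborel \<Otimes>\<^sub>M lborel) (P h))\<^sup>2) = (ennreal \<bar>integral\<^sup>L (lborel \<Otimes>\<^sub>M lborel) (P h)\<bar>)\<^sup>2"
      by (simp add: ennreal_power)
    also have "\<dots> \<le> (\<integral>\<^sup>+\<rho>\<in>{0..s}. (\<integral>\<^sup>+\<tau>\<in>{0..s}. ?k \<rho> \<tau> \<partial>lborel) \<partial>lborel)\<^sup>2" using 1 by (rule power_mono) simp
    also have "\<dots> \<le> ennreal s * (\<integral>\<^sup>+\<rho>\<in>{0..s}. (\<integral>\<^sup>+\<tau>\<in>{0..s}. ?k \<rho> \<tau> \<partial>lborel)\<^sup>2 \<partial>lborel)"
      by (rule nn_Cauchy_Schwarz_interval[OF _ s]) measurable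
    also have "\<dots> \<le> ennreal s * (\<integral>\<^sup>+\<rho>\<in>{0..s}. (ennreal s * (\<integral>\<^sup>+\<tau>\<in>{0..s}. (?k \<rho> \<tau>)\<^sup>2 \<partial>lborel)) \<partial>lborel)"
      by (intro mult_left_mono nn_integral_mono mult_right_mono nn_Cauchy_Schwarz_interval[OF _ s]) (simp_all, measurable)
    also have "\<dots> = ennreal (s\<^sup>2) * (\<integral>\<^sup>+\<rho>\<in>{0..s}. (\<integral>\<^sup>+\<tau>\<in>{0..s}. (?k \<rho> \<tau>)\<^sup>2 \<partial>lborel) \<partial>lborel)"
      using s by (simp add: nn_integral_cmult mult.assoc power2_eq_square ennreal_mult)
    finally show ?case unfolding eq by (simp add: ennreal_power h_def)
  qed
qed

section \<open>Averaging over translates of the grid\<close>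

lemma (in lattice_gl) energy_explicit:
  "energy = (\<Sum>g\<in>{0..<int N} \<times> {0..<int N}. (cmod (u (fst g + 1, snd g) - cis (\<alpha> (True, g)) * u g))\<^sup>2
     + (cmod (u (fst g, snd g + 1) - cis (\<alpha> (False, g)) * u g))\<^sup>2 + (1 - (cmod (u g))\<^sup>2)\<^sup>2 / 2)"
  by (simp add: energy_def V_def w_def pot_def tgt_def)

lemma nn_integral_shift_le:
  fixes f :: "R3 \<Rightarrow> ennreal"
  assumes [measurable]: "f \<in> borel_measurable borel" "D \<in> sets borel" and sub: "\<And>x. x \<in> K \<Longrightarrow> x + v \<in> D"
  shows "(\<integral>\<^sup>+x\<in>K. f (x + v) \<partial>lborel) \<le> (\<integral>\<^sup>+x\<in>D. f x \<partial>lborel)"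
proof -
  have "(\<integral>\<^sup>+x\<in>K. f (x + v) \<partial>lborel) \<le> (\<integral>\<^sup>+x. f (x + v) * indicator D (x + v) \<partial>lborel)"
    using sub by (intro nn_integral_mono) (auto simp: indicator_def)
  also have "\<dots> = (\<integral>\<^sup>+x\<in>D. f x \<partial>lborel)" by (rule nn_integral_translate) simp
  finally show ?thesis .
qed

definition grid_point :: "real \<Rightarrow> site \<Rightarrow> R3" where
  "grid_point s g = (s * of_int (fst g)) *\<^sub>R axis 1 1 + (s * of_int (snd g)) *\<^sub>R axis 2 1"

lemma grid_point_right: "grid_point s (fst g + 1, snd g) = grid_point s g + s *\<^sub>R axis 1 1"
  and grid_point_up: "grid_point s (fst g, snd g + 1) = grid_point s g + s *\<^sub>R axis 2 1"
  by (simp_all add: grid_point_def algebra_simps)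

lemma norm_grid_point:
  assumes "0 \<le> s" "g \<in> {0..int N} \<times> {0..int N}"
  shows "norm (grid_point s g) \<le> 2 * real N * s"
proof -
  have g: "0 \<le> fst g" "fst g \<le> int N" "0 \<le> snd g" "snd g \<le> int N" using assms(2) by auto
  have "norm (grid_point s g) \<le> norm ((s * of_int (fst g)) *\<^sub>R (axis 1 1 :: R3)) + norm ((s * of_int (snd g)) *\<^sub>R (axis 2 1 :: R3))"
    unfolding grid_point_def by (rule norm_triangle_ineq)
  also have "\<dots> = s * of_int (fst g) + s * of_int (snd g)" using assms(1) g by (simp add: norm_axis_1 abs_mult)
  also have "\<dots> \<le> s * real N + s * real N"
  proof -
    have "of_int (fst g) \<le> real N" "of_int (snd g) \<le> real N" using g by linarith+
    then show ?thesis using assms(1) by (intro add_mono mult_left_mono) auto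
  qed
  finally show ?thesis by (simp add: mult_ac)
qed

text \<open>The factor \<open>measure lborel K - F / \<eta>\<^sup>2\<close> bounds from below the measure of the translations in \<open>K\<close> for
  which the plaquette fluxes satisfy the hypothesis of \<open>disc\<close>, by Chebyshev's inequality.\<close>

theorem averaged_lower_bound:
  fixes \<psi> G1 G2 :: "R3 \<Rightarrow> complex" and a1 a2 h12 h21 :: "R3 \<Rightarrow> real"
  defines "e1 \<equiv> axis 1 1 :: R3" and "e2 \<equiv> axis 2 1 :: R3"
  assumes \<eta>: "0 < \<eta>" "\<eta> \<le> 1/4"
    and disc: "\<And>u \<alpha>. (\<Sum>g\<in>{0..int N - 2} \<times> {0..int N - 2}. (ecurl \<alpha> g - b)\<^sup>2) \<le> (\<eta> * real N * b)\<^sup>2 \<Longrightarrow> c \<le> lattice_gl.energy u \<alpha> N"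
    and c: "0 \<le> c" and N: "0 < N" and s: "0 < s" and q: "0 < q" and b: "b = q * s\<^sup>2"
    and [measurable]: "\<psi> \<in> borel_measurable borel" "G1 \<in> borel_measurable borel" "G2 \<in> borel_measurable borel"
      "a1 \<in> borel_measurable borel" "a2 \<in> borel_measurable borel" "h12 \<in> borel_measurable borel" "h21 \<in> borel_measurable borel"
    and lpG: "line_pd D 1 \<psi> G1" "line_pd D 2 \<psi> G2" and lpa: "line_pd UNIV 1 a2 h21" "line_pd UNIV 2 a1 h12"
    and ai: "\<And>K. compact K \<Longrightarrow> set_integrable lborel K a1" "\<And>K. compact K \<Longrightarrow> set_integrable lborel K a2"
    and hi: "\<And>K. compact K \<Longrightarrow> set_integrable lborel K h12" "\<And>K. compact K \<Longrightarrow> set_integrable lborel K h21"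
    and D: "open D" and K: "compact K" and sep: "\<And>x. x \<in> K \<Longrightarrow> cball x \<delta> \<subseteq> D" and small: "(2 * real N + 2) * s \<le> \<delta>"
    and F: "(\<integral>\<^sup>+x. ennreal ((h21 x - h12 x - 1)\<^sup>2) \<partial>lborel) \<le> ennreal F" "0 \<le> F"
  shows "ennreal (c * (measure lborel K - F / \<eta>\<^sup>2)) \<le> ennreal ((real N)\<^sup>2) *
     (\<integral>\<^sup>+x\<in>D. ennreal (s\<^sup>2 * ((cmod (G1 x - \<i> * of_real (q * a1 x) * \<psi> x))\<^sup>2 + (cmod (G2 x - \<i> * of_real (q * a2 x) * \<psi> x))\<^sup>2)
        + (1 - (cmod (\<psi> x))\<^sup>2)\<^sup>2 / 2) \<partial>lborel)"
proof -
  have [measurable]: "D \<in> sets borel" "K \<in> sets borel" using D K by (auto simp: borel_compact)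
  define V where "V = {0..<int N} \<times> {0..<int N}"
  define V1 where "V1 = {0..int N - 2} \<times> {0..int N - 2}"
  have fin: "finite V" "finite V1" by (simp_all add: V_def V1_def)
  have cardV: "card V = N\<^sup>2" by (simp add: V_def card_cartesian_product power2_eq_square)
  have cardV1: "card V1 \<le> N\<^sup>2"
  proof -
    have "card V1 \<le> card V" by (intro card_mono fin) (auto simp: V_def V1_def)
    then show ?thesis by (simp add: cardV)
  qed
  have inV: "g \<in> {0..int N} \<times> {0..int N}" if "g \<in> V \<or> g \<in> V1" for g using that by (auto simp: V_def V1_def)
  let ?p = "grid_point s"
  \<comment> \<open>Grid points lie within \<open>2 * N * s\<close> of the base point and the
    further displacement is at most \<open>2 * s\<close>; \<open>small\<close> keeps everything
    inside \<open>D\<close>.\<close>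
  have near: "x + ?p g + v \<in> D" if "x \<in> K" "g \<in> V \<or> g \<in> V1" "norm v \<le> 2 * s" for x g v
  proof -
    have "norm (?p g + v) \<le> 2 * real N * s + 2 * s"
      using norm_triangle_ineq[of "?p g" v] norm_grid_point[OF _ inV[OF that(2)], of s] s that(3) by linarith
    also have "\<dots> \<le> \<delta>" using small by (simp add: algebra_simps)
    finally have le: "norm (?p g + v) \<le> \<delta>" .
    have "dist x (x + y) = norm y" for y :: R3 by (simp add: dist_norm)
    then have "x + (?p g + v) \<in> cball x \<delta>" using le by (simp only: mem_cball)
    then show ?thesis using sep[OF that(1)] by (auto simp: add.assoc)
  qed
  define d1 where "d1 x = ennreal ((cmod (G1 x - \<i> * of_real (q * a1 x) * \<psi> x))\<^sup>2)" for x
  define d2 where "d2 x = ennreal ((cmod (G2 x - \<i> * of_real (q * a2 x) * \<psi> x))\<^sup>2)" for x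
  define w where "w x = ennreal ((1 - (cmod (\<psi> x))\<^sup>2)\<^sup>2 / 2)" for x
  define k where "k x = ennreal ((h21 x - h12 x - 1)\<^sup>2)" for x
  have [measurable]: "d1 \<in> borel_measurable borel" "d2 \<in> borel_measurable borel" "w \<in> borel_measurable borel" "k \<in> borel_measurable borel"
    unfolding d1_def d2_def w_def k_def by measurable
  \<comment> \<open>Samples of \<open>\<psi>\<close> and line integrals of the scaled potential on
    the grid translated by \<open>x\<close>. The functions \<open>en\<close> and \<open>dev\<close>
    below are the upper bounds for the energy per site and the squared flux deviation per plaquette
    that can be averaged over \<open>x\<close>.\<close>
  define u where "u x g = \<psi> (x + ?p g)" for x g
  define \<alpha> where "\<alpha> x e = (if fst e then (LBINT \<tau>:{0..s}. q * a1 (x + ?p (snd e) + \<tau> *\<^sub>R e1))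
      else (LBINT \<tau>:{0..s}. q * a2 (x + ?p (snd e) + \<tau> *\<^sub>R e2)))" for x and e :: edge
  define en where "en g x = ennreal s * (\<integral>\<^sup>+\<tau>\<in>{0..s}. d1 (x + ?p g + \<tau> *\<^sub>R e1) \<partial>lborel)
     + ennreal s * (\<integral>\<^sup>+\<tau>\<in>{0..s}. d2 (x + ?p g + \<tau> *\<^sub>R e2) \<partial>lborel) + w (x + ?p g)" for g x
  define dev where "dev g x = ennreal (q\<^sup>2 * s\<^sup>2) * (\<integral>\<^sup>+\<rho>\<in>{0..s}. (\<integral>\<^sup>+\<tau>\<in>{0..s}. k (x + ?p g + \<rho> *\<^sub>R e2 + \<tau> *\<^sub>R e1) \<partial>lborel) \<partial>lborel)" for g x
  have [measurable]: "en g \<in> borel_measurable borel" "dev g \<in> borel_measurable borel" for g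
    unfolding en_def dev_def by measurable
  have edge: "AE x in lborel. x \<in> K \<longrightarrow> ennreal ((cmod (\<psi> (x + ?p g + s *\<^sub>R axis j 1) - cis (LBINT \<tau>:{0..s}. q * a (x + ?p g + \<tau> *\<^sub>R axis j 1)) * \<psi> (x + ?p g)))\<^sup>2)
       \<le> ennreal s * (\<integral>\<^sup>+\<tau>\<in>{0..s}. ennreal ((cmod (G (x + ?p g + \<tau> *\<^sub>R axis j 1) - \<i> * of_real (q * a (x + ?p g + \<tau> *\<^sub>R axis j 1)) * \<psi> (x + ?p g + \<tau> *\<^sub>R axis j 1)))\<^sup>2) \<partial>lborel)"
    if g: "g \<in> V" and [measurable]: "G \<in> borel_measurable borel" "a \<in> borel_measurable borel"
      and lp: "line_pd D j \<psi> G" and ai: "\<And>K. compact K \<Longrightarrow> set_integrable lborel K a" for g j and G :: "R3 \<Rightarrow> complex" and a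
  proof -
    define W where "W = (\<Union>x\<in>K. ball (x + ?p g) s)"
    have W: "open W" unfolding W_def by (intro open_UN ballI open_ball)
    have seg: "y + \<tau> *\<^sub>R axis j 1 \<in> D" if yW: "y \<in> W" and t: "0 \<le> \<tau>" "\<tau> \<le> s" for y \<tau>
    proof -
      obtain x where x: "x \<in> K" "dist (x + ?p g) y < s" using yW by (auto simp: W_def)
      have n: "norm (y - (x + ?p g) + \<tau> *\<^sub>R axis j 1) \<le> 2 * s"
        using norm_triangle_ineq[of "y - (x + ?p g)" "\<tau> *\<^sub>R axis j 1"] x(2) t
        by (simp add: dist_norm norm_minus_commute norm_axis_1)
      have "x + ?p g + (y - (x + ?p g) + \<tau> *\<^sub>R axis j 1) \<in> D" by (rule near[OF x(1) disjI1[OF g] n])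
      then show ?thesis by simp
    qed
    have ei: "AE y in lborel. y \<in> W \<longrightarrow>
       ennreal ((cmod (\<psi> (y + s *\<^sub>R axis j 1) - cis (LBINT \<tau>:{0..s}. q * a (y + \<tau> *\<^sub>R axis j 1)) * \<psi> y))\<^sup>2)
         \<le> ennreal s * (\<integral>\<^sup>+\<tau>\<in>{0..s}. ennreal ((cmod (G (y + \<tau> *\<^sub>R axis j 1) - \<i> * of_real (q * a (y + \<tau> *\<^sub>R axis j 1)) * \<psi> (y + \<tau> *\<^sub>R axis j 1)))\<^sup>2) \<partial>lborel)"
      by (rule edge_inequality[where a = "\<lambda>x. q * a x", OF _ _ _ lp W _ seg])
         (use s ai in \<open>auto intro: set_integrable_mult_right\<close>)
    from AE_translate[OF ei, of "?p g"] show ?thesis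
    proof eventually_elim
      case (elim x)
      show ?case
      proof
        assume "x \<in> K"
        moreover have "x + ?p g \<in> ball (x + ?p g) s" using s by simp
        ultimately have "x + ?p g \<in> W" unfolding W_def by blast
        then show "ennreal ((cmod (\<psi> (x + ?p g + s *\<^sub>R axis j 1) - cis (LBINT \<tau>:{0..s}. q * a (x + ?p g + \<tau> *\<^sub>R axis j 1)) * \<psi> (x + ?p g)))\<^sup>2)
       \<le> ennreal s * (\<integral>\<^sup>+\<tau>\<in>{0..s}. ennreal ((cmod (G (x + ?p g + \<tau> *\<^sub>R axis j 1) - \<i> * of_real (q * a (x + ?p g + \<tau> *\<^sub>R axis j 1)) * \<psi> (x + ?p g + \<tau> *\<^sub>R axis j 1)))\<^sup>2) \<partial>lborel)"
          using elim by blast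
      qed
    qed
  qed
  have AEedge1: "AE x in lborel. \<forall>g\<in>V. x \<in> K \<longrightarrow> ennreal ((cmod (u x (fst g + 1, snd g) - cis (\<alpha> x (True, g)) * u x g))\<^sup>2)
      \<le> ennreal s * (\<integral>\<^sup>+\<tau>\<in>{0..s}. d1 (x + ?p g + \<tau> *\<^sub>R e1) \<partial>lborel)"
  proof (subst AE_ball_countable[OF countable_finite[OF fin(1)]], rule ballI)
    fix g assume "g \<in> V"
    from edge[OF this _ _ lpG(1) ai(1)]
    show "AE x in lborel. x \<in> K \<longrightarrow> ennreal ((cmod (u x (fst g + 1, snd g) - cis (\<alpha> x (True, g)) * u x g))\<^sup>2)
      \<le> ennreal s * (\<integral>\<^sup>+\<tau>\<in>{0..s}. d1 (x + ?p g + \<tau> *\<^sub>R e1) \<partial>lborel)"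
      by (simp add: u_def \<alpha>_def d1_def grid_point_right e1_def add.assoc)
  qed
  have AEedge2: "AE x in lborel. \<forall>g\<in>V. x \<in> K \<longrightarrow> ennreal ((cmod (u x (fst g, snd g + 1) - cis (\<alpha> x (False, g)) * u x g))\<^sup>2)
      \<le> ennreal s * (\<integral>\<^sup>+\<tau>\<in>{0..s}. d2 (x + ?p g + \<tau> *\<^sub>R e2) \<partial>lborel)"
  proof (subst AE_ball_countable[OF countable_finite[OF fin(1)]], rule ballI)
    fix g assume "g \<in> V"
    from edge[OF this _ _ lpG(2) ai(2)]
    show "AE x in lborel. x \<in> K \<longrightarrow> ennreal ((cmod (u x (fst g, snd g + 1) - cis (\<alpha> x (False, g)) * u x g))\<^sup>2)
      \<le> ennreal s * (\<integral>\<^sup>+\<tau>\<in>{0..s}. d2 (x + ?p g + \<tau> *\<^sub>R e2) \<partial>lborel)"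
      by (simp add: u_def \<alpha>_def d2_def grid_point_up e2_def add.assoc)
  qed
  have circ: "AE y in lborel. ennreal (((LBINT \<tau>:{0..s}. a1 (y + \<tau> *\<^sub>R e1)) + (LBINT \<tau>:{0..s}. a2 (y + s *\<^sub>R e1 + \<tau> *\<^sub>R e2))
       - (LBINT \<tau>:{0..s}. a1 (y + s *\<^sub>R e2 + \<tau> *\<^sub>R e1)) - (LBINT \<tau>:{0..s}. a2 (y + \<tau> *\<^sub>R e2)) - s\<^sup>2)\<^sup>2)
     \<le> ennreal (s\<^sup>2) * (\<integral>\<^sup>+\<rho>\<in>{0..s}. (\<integral>\<^sup>+\<tau>\<in>{0..s}. k (y + \<rho> *\<^sub>R e2 + \<tau> *\<^sub>R e1) \<partial>lborel) \<partial>lborel)"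
    unfolding k_def e1_def e2_def by (rule circulation) (use lpa s ai hi in auto)
  have AEdev: "AE x in lborel. \<forall>g\<in>V1. ennreal ((ecurl (\<alpha> x) g - b)\<^sup>2) \<le> dev g x"
  proof (subst AE_ball_countable[OF countable_finite[OF fin(2)]], rule ballI)
    fix g assume "g \<in> V1"
    from AE_translate[OF circ, of "?p g"] show "AE x in lborel. ennreal ((ecurl (\<alpha> x) g - b)\<^sup>2) \<le> dev g x"
    proof eventually_elim
      case (elim x)
      let ?y = "x + ?p g"
      let ?C = "(LBINT \<tau>:{0..s}. a1 (?y + \<tau> *\<^sub>R e1)) + (LBINT \<tau>:{0..s}. a2 (?y + s *\<^sub>R e1 + \<tau> *\<^sub>R e2))
       - (LBINT \<tau>:{0..s}. a1 (?y + s *\<^sub>R e2 + \<tau> *\<^sub>R e1)) - (LBINT \<tau>:{0..s}. a2 (?y + \<tau> *\<^sub>R e2))"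
      have ec: "ecurl (\<alpha> x) g = q * ?C"
        unfolding ecurl_def \<alpha>_def fst_conv snd_conv grid_point_right grid_point_up e1_def e2_def
        by (simp add: right_diff_distrib distrib_left add.assoc)
      have "ennreal ((ecurl (\<alpha> x) g - b)\<^sup>2) = ennreal (q\<^sup>2) * ennreal ((?C - s\<^sup>2)\<^sup>2)"
        unfolding ec b by (simp add: ennreal_mult[symmetric] power_mult_distrib[symmetric] right_diff_distrib)
      also have "\<dots> \<le> ennreal (q\<^sup>2) * (ennreal (s\<^sup>2) * (\<integral>\<^sup>+\<rho>\<in>{0..s}. (\<integral>\<^sup>+\<tau>\<in>{0..s}. k (?y + \<rho> *\<^sub>R e2 + \<tau> *\<^sub>R e1) \<partial>lborel) \<partial>lborel))"
        using elim by (intro mult_left_mono) auto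
      also have "\<dots> = dev g x" by (simp add: dev_def ennreal_mult mult.assoc)
      finally show ?case .
    qed
  qed
  define EN where "EN x = (\<Sum>g\<in>V. en g x)" for x
  define BN where "BN x = (\<Sum>g\<in>V1. dev g x)" for x
  have [measurable]: "EN \<in> borel_measurable borel" "BN \<in> borel_measurable borel" unfolding EN_def BN_def by measurable
  have key: "AE x in lborel. x \<in> K \<and> BN x \<le> ennreal ((\<eta> * real N * b)\<^sup>2) \<longrightarrow> ennreal c \<le> EN x"
    using AEedge1 AEedge2 AEdev
  proof eventually_elim
    case (elim x)
    show ?case
    proof
      assume x: "x \<in> K \<and> BN x \<le> ennreal ((\<eta> * real N * b)\<^sup>2)"
      have "ennreal (\<Sum>g\<in>V1. (ecurl (\<alpha> x) g - b)\<^sup>2) = (\<Sum>g\<in>V1. ennreal ((ecurl (\<alpha> x) g - b)\<^sup>2))"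
        by (simp add: sum_ennreal)
      also have "\<dots> \<le> BN x" unfolding BN_def using elim by (intro sum_mono) blast
      also have "\<dots> \<le> ennreal ((\<eta> * real N * b)\<^sup>2)" using x by blast
      finally have "(\<Sum>g\<in>V1. (ecurl (\<alpha> x) g - b)\<^sup>2) \<le> (\<eta> * real N * b)\<^sup>2" by (simp add: ennreal_le_iff)
      then have "c \<le> lattice_gl.energy (u x) (\<alpha> x) N" unfolding V1_def by (rule disc)
      then have "ennreal c \<le> ennreal (lattice_gl.energy (u x) (\<alpha> x) N)" by (rule ennreal_leI)
      also have "\<dots> = (\<Sum>g\<in>V. ennreal ((cmod (u x (fst g + 1, snd g) - cis (\<alpha> x (True, g)) * u x g))\<^sup>2)
          + ennreal ((cmod (u x (fst g, snd g + 1) - cis (\<alpha> x (False, g)) * u x g))\<^sup>2) + ennreal ((1 - (cmod (u x g))\<^sup>2)\<^sup>2 / 2))"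
      proof -
        have "lattice_gl \<eta>" using \<eta> by unfold_locales
        from lattice_gl.energy_explicit[OF this] show ?thesis
          by (simp add: V_def ennreal_plus[symmetric] sum_ennreal add_nonneg_nonneg del: ennreal_plus)
      qed
      also have "\<dots> \<le> EN x"
        unfolding EN_def en_def using elim x
        by (intro sum_mono add_mono) (auto simp: w_def u_def)
      finally show "ennreal c \<le> EN x" .
    qed
  qed
  define ID where "ID = (\<integral>\<^sup>+x\<in>D. ennreal (s\<^sup>2 * ((cmod (G1 x - \<i> * of_real (q * a1 x) * \<psi> x))\<^sup>2 + (cmod (G2 x - \<i> * of_real (q * a2 x) * \<psi> x))\<^sup>2)
        + (1 - (cmod (\<psi> x))\<^sup>2)\<^sup>2 / 2) \<partial>lborel)"
  have line: "(\<integral>\<^sup>+x\<in>K. (\<integral>\<^sup>+\<tau>\<in>{0..s}. d (x + ?p g + \<tau> *\<^sub>R axis j 1) \<partial>lborel) \<partial>lborel) \<le> ennreal s * (\<integral>\<^sup>+x\<in>D. d x \<partial>lborel)"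
    if g: "g \<in> V" and [measurable]: "d \<in> borel_measurable borel" for g d j
  proof -
    define K' where "K' = (\<lambda>(x, \<tau>). x + \<tau> *\<^sub>R axis j 1) ` (K \<times> {0..s})"
    have K': "compact K'" unfolding K'_def using K
      by (intro compact_continuous_image compact_Times) (auto intro!: continuous_intros simp: case_prod_beta)
    have "(\<integral>\<^sup>+x\<in>K. (\<integral>\<^sup>+\<tau>\<in>{0..s}. d (x + ?p g + \<tau> *\<^sub>R axis j 1) \<partial>lborel) \<partial>lborel)
        = (\<integral>\<^sup>+x\<in>K. (\<integral>\<^sup>+\<tau>\<in>{0..s}. d (x + \<tau> *\<^sub>R axis j 1 + ?p g) \<partial>lborel) \<partial>lborel)" by (simp add: add_ac)
    also have "\<dots> \<le> ennreal s * (\<integral>\<^sup>+x\<in>K'. d (x + ?p g) \<partial>lborel)"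
      by (rule line_average[where h = "\<lambda>x. d (x + ?p g)"]) (use K' s in \<open>auto simp: borel_compact K'_def\<close>)
    also have "\<dots> \<le> ennreal s * (\<integral>\<^sup>+x\<in>D. d x \<partial>lborel)"
    proof (intro mult_left_mono nn_integral_shift_le)
      fix y assume "y \<in> K'"
      then obtain x \<tau> where x: "x \<in> K" "0 \<le> \<tau>" "\<tau> \<le> s" "y = x + \<tau> *\<^sub>R axis j 1" by (auto simp: K'_def)
      have "norm (\<tau> *\<^sub>R (axis j 1 :: R3)) \<le> 2 * s" using x s by (simp add: norm_axis_1)
      from near[OF x(1) disjI1[OF g] this] show "y + ?p g \<in> D" unfolding x(4) by (simp add: add_ac)
    qed auto
    finally show ?thesis .
  qed
  have enint: "(\<integral>\<^sup>+x\<in>K. en g x \<partial>lborel) \<le> ID" if g: "g \<in> V" for g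
  proof -
    have "(\<integral>\<^sup>+x\<in>K. en g x \<partial>lborel)
      = ennreal s * (\<integral>\<^sup>+x\<in>K. (\<integral>\<^sup>+\<tau>\<in>{0..s}. d1 (x + ?p g + \<tau> *\<^sub>R e1) \<partial>lborel) \<partial>lborel)
      + ennreal s * (\<integral>\<^sup>+x\<in>K. (\<integral>\<^sup>+\<tau>\<in>{0..s}. d2 (x + ?p g + \<tau> *\<^sub>R e2) \<partial>lborel) \<partial>lborel)
      + (\<integral>\<^sup>+x\<in>K. w (x + ?p g) \<partial>lborel)"
      unfolding en_def distrib_right mult.assoc by (simp add: nn_integral_add nn_integral_cmult)
    also have "\<dots> \<le> ennreal s * (ennreal s * (\<integral>\<^sup>+x\<in>D. d1 x \<partial>lborel)) + ennreal s * (ennreal s * (\<integral>\<^sup>+x\<in>D. d2 x \<partial>lborel)) + (\<integral>\<^sup>+x\<in>D. w x \<partial>lborel)"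
    proof (intro add_mono mult_left_mono)
      show "(\<integral>\<^sup>+x\<in>K. w (x + ?p g) \<partial>lborel) \<le> (\<integral>\<^sup>+x\<in>D. w x \<partial>lborel)"
        by (rule nn_integral_shift_le) (use near[of _ g 0] g s in auto)
    qed (use line[OF g, of d1 1] line[OF g, of d2 2] in \<open>auto simp: e1_def e2_def\<close>)
    also have "\<dots> = (\<integral>\<^sup>+x. ennreal (s\<^sup>2) * (d1 x * indicator D x) + ennreal (s\<^sup>2) * (d2 x * indicator D x) + w x * indicator D x \<partial>lborel)"
      using s by (simp add: nn_integral_add nn_integral_cmult power2_eq_square ennreal_mult mult.assoc)
    also have "\<dots> = ID"
      unfolding ID_def using s
      by (intro nn_integral_cong)
         (auto simp: d1_def d2_def w_def indicator_def distrib_left ennreal_mult[symmetric] ennreal_plus[symmetric] simp del: ennreal_plus)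
    finally show ?thesis .
  qed
  have ENint: "(\<integral>\<^sup>+x\<in>K. EN x \<partial>lborel) \<le> ennreal ((real N)\<^sup>2) * ID"
  proof -
    have "(\<integral>\<^sup>+x\<in>K. EN x \<partial>lborel) = (\<Sum>g\<in>V. \<integral>\<^sup>+x\<in>K. en g x \<partial>lborel)"
      unfolding EN_def sum_distrib_right by (rule nn_integral_sum) simp
    also have "\<dots> \<le> (\<Sum>g\<in>V. ID)" by (intro sum_mono enint)
    also have "\<dots> = ennreal ((real N)\<^sup>2) * ID" by (simp add: cardV ennreal_of_nat_eq_real_of_nat)
    finally show ?thesis .
  qed
  \<comment> \<open>Averaging over a square of side \<open>s\<close> contributes another
    \<open>s^2\<close>, so with \<open>b = q * s^2\<close> the bound is the same
    \<open>b^2 * F\<close> for every plaquette.\<close>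
  have devint: "(\<integral>\<^sup>+x\<in>K. dev g x \<partial>lborel) \<le> ennreal (b\<^sup>2 * F)" for g
  proof -
    let ?f = "\<lambda>x. \<integral>\<^sup>+\<tau>\<in>{0..s}. k (x + \<tau> *\<^sub>R e1) \<partial>lborel"
    have "(\<integral>\<^sup>+x\<in>K. (\<integral>\<^sup>+\<rho>\<in>{0..s}. (\<integral>\<^sup>+\<tau>\<in>{0..s}. k (x + ?p g + \<rho> *\<^sub>R e2 + \<tau> *\<^sub>R e1) \<partial>lborel) \<partial>lborel) \<partial>lborel)
      \<le> (\<integral>\<^sup>+x. (\<integral>\<^sup>+\<rho>\<in>{0..s}. ?f (x + ?p g + \<rho> *\<^sub>R e2) \<partial>lborel) \<partial>lborel)"
      by (intro nn_integral_mono) (auto simp: indicator_def)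
    also have "\<dots> = (\<integral>\<^sup>+x. (\<integral>\<^sup>+\<rho>\<in>{0..s}. ?f (x + \<rho> *\<^sub>R e2) \<partial>lborel) \<partial>lborel)"
      by (rule nn_integral_translate[where f = "\<lambda>x. \<integral>\<^sup>+\<rho>\<in>{0..s}. ?f (x + \<rho> *\<^sub>R e2) \<partial>lborel"]) measurable
    also have "\<dots> \<le> ennreal s * (\<integral>\<^sup>+x. ?f x \<partial>lborel)"
      using line_average[of ?f UNIV UNIV s e2] s by simp
    also have "\<dots> \<le> ennreal s * (ennreal s * (\<integral>\<^sup>+x. k x \<partial>lborel))"
      using line_average[of k UNIV UNIV s e1] s by (intro mult_left_mono) auto
    also have "\<dots> \<le> ennreal s * (ennreal s * ennreal F)"
      using F(1) by (intro mult_left_mono) (auto simp: k_def)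
    finally have 1: "(\<integral>\<^sup>+x\<in>K. (\<integral>\<^sup>+\<rho>\<in>{0..s}. (\<integral>\<^sup>+\<tau>\<in>{0..s}. k (x + ?p g + \<rho> *\<^sub>R e2 + \<tau> *\<^sub>R e1) \<partial>lborel) \<partial>lborel) \<partial>lborel) \<le> ennreal s * (ennreal s * ennreal F)" .
    have "(\<integral>\<^sup>+x\<in>K. dev g x \<partial>lborel) = ennreal (q\<^sup>2 * s\<^sup>2) * (\<integral>\<^sup>+x\<in>K. (\<integral>\<^sup>+\<rho>\<in>{0..s}. (\<integral>\<^sup>+\<tau>\<in>{0..s}. k (x + ?p g + \<rho> *\<^sub>R e2 + \<tau> *\<^sub>R e1) \<partial>lborel) \<partial>lborel) \<partial>lborel)"
      unfolding dev_def mult.assoc by (rule nn_integral_cmult) measurable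
    also have "\<dots> \<le> ennreal (q\<^sup>2 * s\<^sup>2) * (ennreal s * (ennreal s * ennreal F))" using 1 by (rule mult_left_mono) simp
    also have "\<dots> = ennreal (b\<^sup>2 * F)"
    proof -
      have "ennreal (q\<^sup>2 * s\<^sup>2) * (ennreal s * (ennreal s * ennreal F)) = ennreal (q\<^sup>2 * s\<^sup>2 * (s * (s * F)))"
        using s F(2) by (simp only: ennreal_mult[symmetric] mult_nonneg_nonneg less_imp_le zero_le_power2)
      also have "q\<^sup>2 * s\<^sup>2 * (s * (s * F)) = b\<^sup>2 * F" by (simp add: b power_mult_distrib power2_eq_square mult_ac)
      finally show ?thesis .
    qed
    finally show ?thesis .
  qed
  have b0: "0 < b" using q s by (simp add: b)
  define bad where "bad = {x\<in>K. ennreal ((\<eta> * real N * b)\<^sup>2) < BN x}"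
  have badm[measurable]: "bad \<in> sets borel"
  proof -
    have "bad = K \<inter> {x\<in>space borel. ennreal ((\<eta> * real N * b)\<^sup>2) < BN x}" by (auto simp: bad_def)
    then show ?thesis by simp
  qed
  have eK: "emeasure lborel K = ennreal (measure lborel K)"
    using emeasure_compact_finite[OF K] by (intro emeasure_eq_ennreal_measure) (metis infinity_ennreal_def less_irrefl)
  have m0: "0 < (\<eta> * real N * b)\<^sup>2" using \<eta> N b0 by simp
  \<comment> \<open>At most \<open>N^2\<close> plaquettes with integral \<open>b^2 * F\<close> each,
    against the threshold \<open>(\<eta> * N * b)^2\<close>: the powers of \<open>N\<close> and
    \<open>b\<close> cancel and only \<open>F / \<eta>^2\<close> remains.\<close>
  have badle: "emeasure lborel bad \<le> ennreal (F / \<eta>\<^sup>2)"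
  proof -
    have "ennreal ((\<eta> * real N * b)\<^sup>2) * emeasure lborel bad = (\<integral>\<^sup>+x. ennreal ((\<eta> * real N * b)\<^sup>2) * indicator bad x \<partial>lborel)"
      by (simp add: nn_integral_cmult_indicator)
    also have "\<dots> \<le> (\<integral>\<^sup>+x\<in>K. BN x \<partial>lborel)"
      by (intro nn_integral_mono) (auto simp: bad_def indicator_def)
    also have "\<dots> = (\<Sum>g\<in>V1. \<integral>\<^sup>+x\<in>K. dev g x \<partial>lborel)"
      unfolding BN_def sum_distrib_right by (rule nn_integral_sum) simp
    also have "\<dots> \<le> (\<Sum>g\<in>V1. ennreal (b\<^sup>2 * F))" by (intro sum_mono devint)
    also have "\<dots> = ennreal (real (card V1) * (b\<^sup>2 * F))" using F(2) by (simp add: ennreal_mult ennreal_of_nat_eq_real_of_nat)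
    also have "\<dots> \<le> ennreal ((real N)\<^sup>2 * (b\<^sup>2 * F))"
    proof (intro ennreal_leI mult_right_mono)
      show "real (card V1) \<le> (real N)\<^sup>2" using cardV1 by (metis of_nat_le_iff of_nat_power)
    qed (use F(2) in auto)
    also have "\<dots> = ennreal ((\<eta> * real N * b)\<^sup>2) * ennreal (F / \<eta>\<^sup>2)"
      using \<eta> F(2) by (simp add: ennreal_mult[symmetric] power_mult_distrib mult_ac)
    finally show ?thesis using m0 by (subst (asm) ennreal_mult_le_mult_iff) auto
  qed
  have "ennreal c * emeasure lborel (K - bad) = (\<integral>\<^sup>+x. ennreal c * indicator (K - bad) x \<partial>lborel)"
    by (simp add: nn_integral_cmult_indicator)
  also have "\<dots> \<le> (\<integral>\<^sup>+x\<in>K. EN x \<partial>lborel)"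
  proof (rule nn_integral_mono_AE)
    show "AE x in lborel. ennreal c * indicator (K - bad) x \<le> EN x * indicator K x"
      using key by eventually_elim (auto simp: bad_def indicator_def not_less)
  qed
  also have "\<dots> \<le> ennreal ((real N)\<^sup>2) * ID" by (rule ENint)
  finally have fin1: "ennreal c * emeasure lborel (K - bad) \<le> ennreal ((real N)\<^sup>2) * ID" .
  have "ennreal (measure lborel K - F / \<eta>\<^sup>2) \<le> emeasure lborel (K - bad)"
  proof -
    have sub: "bad \<subseteq> K" by (auto simp: bad_def)
    have "emeasure lborel bad \<noteq> \<infinity>" using badle by (auto simp: top_unique)
    then have "emeasure lborel (K - bad) = emeasure lborel K - emeasure lborel bad"
      using sub by (intro emeasure_Diff) auto
    also have "\<dots> \<ge> ennreal (measure lborel K) - ennreal (F / \<eta>\<^sup>2)" unfolding eK by (intro ennreal_minus_mono badle) simp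
    finally show ?thesis using F(2) by (simp add: ennreal_minus)
  qed
  then have "ennreal c * ennreal (measure lborel K - F / \<eta>\<^sup>2) \<le> ennreal ((real N)\<^sup>2) * ID"
    using fin1 by (meson mult_left_mono order_trans zero_le)
  then show ?thesis using c unfolding ID_def by (simp add: ennreal_mult')
qed

section \<open>The vortex lattice test state\<close>

lemma integrable_bounded_compact:
  fixes f :: "R3 \<Rightarrow> 'b::{banach, second_countable_topology}"
  assumes f: "f \<in> borel_measurable borel" and K: "compact K" and b: "bounded (f ` K)" and z: "\<And>x. x \<notin> K \<Longrightarrow> f x = 0"
  shows "integrable lborel f"
proof -
  obtain M where M: "\<And>x. x \<in> K \<Longrightarrow> norm (f x) \<le> M" using b by (auto simp: bounded_iff)
  show ?thesis
  proof (rule Bochner_Integration.integrable_bound)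
    show "integrable lborel (\<lambda>x. M * indicator K x)"
      using K emeasure_compact_finite[OF K] by (intro integrable_mult_right integrable_real_indicator) (auto simp: borel_compact)
    show "AE x in lborel. norm (f x) \<le> norm (M * indicator K x)"
    proof (rule AE_I2)
      fix x
      show "norm (f x) \<le> norm (M * indicator K x)"
        using M[of x] z[of x] by (cases "x \<in> K") auto
    qed
  qed (use f in simp)
qed

lemma loc_int_of_bounded:
  fixes f :: "R3 \<Rightarrow> 'b::{banach, second_countable_topology}"
  assumes f[measurable]: "f \<in> borel_measurable borel" and b: "\<And>K. compact K \<Longrightarrow> bounded (f ` K)"
  shows "loc_int U f"
  unfolding loc_int_def
proof (intro allI impI)
  fix K assume K: "compact K \<and> K \<subseteq> U"
  then have [measurable]: "K \<in> sets borel" by (simp add: borel_compact)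
  obtain M where M: "\<And>x. x \<in> K \<Longrightarrow> norm (f x) \<le> M" using b[of K] K by (auto simp: bounded_iff)
  have m: "(\<lambda>x. indicator K x *\<^sub>R f x) \<in> borel_measurable lborel" by simp
  have "integrable lborel (\<lambda>x. indicator K x *\<^sub>R f x)"
  proof (rule integrable_bounded_compact[of _ K])
    show "bounded ((\<lambda>x. indicator K x *\<^sub>R f x) ` K)"
      unfolding bounded_iff by (rule exI[of _ M]) (use M in auto)
  qed (use K m in auto)
  then show "set_integrable lebesgue K f" using integrable_completion[OF m] by (simp add: set_integrable_def)
qed

text \<open>For the product \<open>F\<close> of \<open>\<phi>\<close> and \<open>u\<close>, the
  fundamental theorem on unit segments expresses \<open>F (x + e) - F x\<close> as the integral of
  the derivative of \<open>F\<close>. Integrated over all \<open>x\<close>, the left side vanishes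
  by translation invariance and the right side is the integral of that derivative, which is the weak
  identity. Finitely many kinks per segment are harmless because \<open>u\<close> is continuous
  along lines.\<close>

lemma weak_pd_piecewise:
  fixes u g :: "R3 \<Rightarrow> 'b::{real_normed_field, euclidean_space}" and j :: 3
  defines "e \<equiv> axis j 1 :: R3"
  assumes u[measurable]: "u \<in> borel_measurable borel" and g[measurable]: "g \<in> borel_measurable borel"
    and bu: "\<And>K. compact K \<Longrightarrow> bounded (u ` K)" and bg: "\<And>K. compact K \<Longrightarrow> bounded (g ` K)"
    and cont: "\<And>x. continuous_on UNIV (\<lambda>\<tau>. u (x + \<tau> *\<^sub>R e))"
    and der: "\<And>x. \<exists>S. finite S \<and> (\<forall>\<tau>\<in>{0..1} - S. ((\<lambda>\<tau>. u (x + \<tau> *\<^sub>R e)) has_vector_derivative g (x + \<tau> *\<^sub>R e)) (at \<tau>))"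
  shows "weak_pd U j u g"
  unfolding weak_pd_def
proof (intro conjI allI impI)
  show "loc_int U u" by (rule loc_int_of_bounded[OF u bu])
  show "loc_int U g" by (rule loc_int_of_bounded[OF g bg])
  fix \<phi> assume t: "test_fun U \<phi>"
  define K where "K = tsupp \<phi>"
  have K: "compact K" "K \<subseteq> U" using t by (auto simp: K_def test_fun_def)
  have z: "\<phi> x = 0" "pd j \<phi> x = 0" if "x \<notin> K" for x using test_fun_zero[OF t] that by (auto simp: K_def)
  have c: "continuous_on S \<phi>" "continuous_on S (pd j \<phi>)" for S
    using diff_cont test_fun_smooth[OF t] by blast+
  have [measurable]: "\<phi> \<in> borel_measurable borel" "pd j \<phi> \<in> borel_measurable borel"
    using c by (auto intro: borel_measurable_continuous_onI)
  define f where "f x = of_real (pd j \<phi> x) * u x + of_real (\<phi> x) * g x" for x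
  have [measurable]: "f \<in> borel_measurable borel" unfolding f_def by measurable
  have bmul: "bounded ((\<lambda>x. of_real (p x) * h x) ` K)" if pc: "continuous_on K p" and hb: "bounded (h ` K)" for p and h :: "R3 \<Rightarrow> 'b"
  proof -
    have "bounded (p ` K)" using pc K(1) by (intro compact_imp_bounded compact_continuous_image)
    then obtain M1 M2 where M: "\<And>x. x \<in> K \<Longrightarrow> norm (p x) \<le> M1" "\<And>x. x \<in> K \<Longrightarrow> norm (h x) \<le> M2"
      using hb by (auto simp: bounded_iff)
    have "norm (of_real (p x) * h x) \<le> M1 * M2" if "x \<in> K" for x
      unfolding norm_mult norm_of_real using M[OF that] by (intro mult_mono) (auto intro: order_trans[OF norm_ge_zero])
    then show ?thesis by (auto simp: bounded_iff)
  qed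
  have i1: "integrable lborel (\<lambda>x. of_real (pd j \<phi> x) * u x)"
    by (rule integrable_bounded_compact[OF _ K(1) bmul[OF c(2) bu[OF K(1)]]]) (use z in auto)
  have i2: "integrable lborel (\<lambda>x. of_real (\<phi> x) * g x)"
    by (rule integrable_bounded_compact[OF _ K(1) bmul[OF c(1) bg[OF K(1)]]]) (use z in auto)
  have fi: "integrable lborel f" unfolding f_def using i1 i2 by simp
  define F where "F x = of_real (\<phi> x) * u x" for x
  have [measurable]: "F \<in> borel_measurable borel" unfolding F_def by measurable
  have Fi: "integrable lborel F" unfolding F_def
    by (rule integrable_bounded_compact[OF _ K(1) bmul[OF c(1) bu[OF K(1)]]]) (use z in auto)
  obtain M where M: "\<And>x. norm (f x) \<le> M"
  proof -
    obtain M1 M2 where M12: "\<And>x. x \<in> K \<Longrightarrow> norm (of_real (pd j \<phi> x) * u x) \<le> M1" "\<And>x. x \<in> K \<Longrightarrow> norm (of_real (\<phi> x) * g x) \<le> M2"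
      using bmul[OF c(2) bu[OF K(1)]] bmul[OF c(1) bg[OF K(1)]] by (auto simp: bounded_iff)
    have "norm (f x) \<le> max 0 (M1 + M2)" for x
    proof (cases "x \<in> K")
      case True
      have "norm (f x) \<le> M1 + M2" unfolding f_def by (rule norm_triangle_mono[OF M12[OF True]])
      then show ?thesis by simp
    next
      case False
      then show ?thesis using z[of x] by (simp add: f_def)
    qed
    then show ?thesis using that by blast
  qed
  have line: "F (x + e) - F x = (\<integral>\<tau>. indicator {0..1} \<tau> *\<^sub>R f (x + \<tau> *\<^sub>R e) \<partial>lborel)" for x
  proof -
    obtain S where S: "finite S" "\<And>\<tau>. \<tau> \<in> {0..1} - S \<Longrightarrow> ((\<lambda>\<tau>. u (x + \<tau> *\<^sub>R e)) has_vector_derivative g (x + \<tau> *\<^sub>R e)) (at \<tau>)"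
      using der by meson
    have h: "((\<lambda>\<tau>. f (x + \<tau> *\<^sub>R e)) has_integral (F (x + 1 *\<^sub>R e) - F (x + 0 *\<^sub>R e))) {0..1}"
    proof (rule fundamental_theorem_of_calculus_interior_strong[OF S(1)])
      show "continuous_on {0..1} (\<lambda>\<tau>. F (x + \<tau> *\<^sub>R e))"
        unfolding F_def
      proof (intro continuous_intros)
        show "continuous_on {0..1} (\<lambda>\<tau>. \<phi> (x + \<tau> *\<^sub>R e))"
          by (rule continuous_on_compose2[OF c(1)[of UNIV]]) (auto intro!: continuous_intros)
        show "continuous_on {0..1} (\<lambda>\<tau>. u (x + \<tau> *\<^sub>R e))" by (rule continuous_on_subset[OF cont]) simp
      qed
      fix \<tau> :: real assume "\<tau> \<in> {0<..<1} - S"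
      then have \<tau>: "\<tau> \<in> {0..1} - S" by auto
      have d1: "((\<lambda>\<tau>. of_real (\<phi> (x + \<tau> *\<^sub>R e)) :: 'b) has_vector_derivative of_real (pd j \<phi> (x + \<tau> *\<^sub>R e))) (at \<tau>)"
        using line_deriv[OF test_fun_smooth(1)[OF t]] unfolding e_def
        by (intro has_vector_derivative_of_real) (simp add: has_real_derivative_iff_has_vector_derivative)
      show "((\<lambda>\<tau>. F (x + \<tau> *\<^sub>R e)) has_vector_derivative f (x + \<tau> *\<^sub>R e)) (at \<tau>)"
        unfolding F_def f_def
        using has_vector_derivative_mult[OF d1 S(2)[OF \<tau>]] by (simp add: add.commute)
    qed simp
    have si: "set_integrable lborel {0..1} (\<lambda>\<tau>. f (x + \<tau> *\<^sub>R e))"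
      unfolding set_integrable_def
    proof (rule Bochner_Integration.integrable_bound)
      show "integrable lborel (\<lambda>\<tau>::real. M * indicator {0..1} \<tau>)" by (intro integrable_mult_right integrable_real_indicator) auto
      show "AE \<tau> in lborel. norm (indicator {0..1} \<tau> *\<^sub>R f (x + \<tau> *\<^sub>R e)) \<le> norm (M * indicator {0..1} \<tau>)"
        using M order_trans[OF norm_ge_zero M] by (intro AE_I2) (auto simp: indicator_def)
    qed measurable
    show ?thesis
      using set_borel_integral_eq_integral(2)[OF si] integral_unique[OF h] by (simp add: set_lebesgue_integral_def)
  qed
  have sh: "(\<integral>x. F (x + e) \<partial>lborel) = (\<integral>x. F x \<partial>lborel)" by (rule integral_translate) simp
  have Fsh: "integrable lborel (\<lambda>x. F (x + e))"
  proof -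
    have "integrable (distr lborel borel ((+) e)) F" using Fi by (simp add: lborel_distr_plus)
    then have "integrable lborel (\<lambda>x. F (e + x))" by (subst (asm) integrable_distr_eq) auto
    then show ?thesis by (simp add: add.commute)
  qed
  have "0 = (\<integral>x. F (x + e) - F x \<partial>lborel)" using Fi Fsh sh by simp
  also have "\<dots> = (\<integral>x. \<integral>\<tau>. indicator {0..1} \<tau> *\<^sub>R f (x + \<tau> *\<^sub>R e) \<partial>lborel \<partial>lborel)" by (simp only: line)
  also have "\<dots> = (\<integral>\<tau>. \<integral>x. indicator {0..1} \<tau> *\<^sub>R f (x + \<tau> *\<^sub>R e) \<partial>lborel \<partial>lborel)"
  proof (rule lborel_pair.Fubini_integral[symmetric])
    show "integrable (lborel \<Otimes>\<^sub>M lborel) (\<lambda>(x, \<tau>). indicator {0..1} \<tau> *\<^sub>R f (x + \<tau> *\<^sub>R e))"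
    proof (rule integrableI_bounded)
      have "(\<integral>\<^sup>+z. ennreal (norm (case z of (x, \<tau>) \<Rightarrow> indicator {0..1} \<tau> *\<^sub>R f (x + \<tau> *\<^sub>R e))) \<partial>(lborel \<Otimes>\<^sub>M lborel))
         = (\<integral>\<^sup>+x. \<integral>\<^sup>+\<tau>. ennreal (norm (indicator {0..1} \<tau> *\<^sub>R f (x + \<tau> *\<^sub>R e))) \<partial>lborel \<partial>lborel)"
        by (subst lborel.nn_integral_fst[symmetric]) simp_all
      also have "\<dots> = (\<integral>\<^sup>+x\<in>UNIV. (\<integral>\<^sup>+\<tau>\<in>{0..1}. ennreal (norm (f (x + \<tau> *\<^sub>R e))) \<partial>lborel) \<partial>lborel)"
        by (intro nn_integral_cong) (auto simp: indicator_def intro!: nn_integral_cong)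
      also have "\<dots> \<le> ennreal 1 * (\<integral>\<^sup>+x\<in>UNIV. ennreal (norm (f x)) \<partial>lborel)"
        by (rule line_average) auto
      also have "\<dots> < \<infinity>" using fi by (simp add: integrable_iff_bounded)
      finally show "(\<integral>\<^sup>+z. ennreal (norm (case z of (x, \<tau>) \<Rightarrow> indicator {0..1} \<tau> *\<^sub>R f (x + \<tau> *\<^sub>R e))) \<partial>(lborel \<Otimes>\<^sub>M lborel)) < \<infinity>" .
    qed measurable
  qed
  also have "\<dots> = (\<integral>\<tau>. indicator {0..1} \<tau> *\<^sub>R (\<integral>x. f x \<partial>lborel) \<partial>(lborel :: real measure))"
    by (simp add: integral_translate)
  also have "\<dots> = (\<integral>x. f x \<partial>lborel)" by simp
  also have "\<dots> = (\<integral>x. of_real (pd j \<phi> x) * u x \<partial>lborel) + (\<integral>x. of_real (\<phi> x) * g x \<partial>lborel)"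
    unfolding f_def using i1 i2 by simp
  finally have sum0: "(\<integral>x. of_real (pd j \<phi> x) * u x \<partial>lborel) + (\<integral>x. of_real (\<phi> x) * g x \<partial>lborel) = 0" by simp
  have e1: "(\<integral>x. indicator U x *\<^sub>R (of_real (pd j \<phi> x) * u x) \<partial>lebesgue) = (\<integral>x. of_real (pd j \<phi> x) * u x \<partial>lborel)"
  proof -
    have "(\<integral>x. indicator U x *\<^sub>R (of_real (pd j \<phi> x) * u x) \<partial>lebesgue) = (\<integral>x. of_real (pd j \<phi> x) * u x \<partial>lebesgue)"
      using z K(2) by (intro Bochner_Integration.integral_cong) (auto simp: indicator_def)
    then show ?thesis by (simp add: integral_completion)
  qed
  have e2: "(\<integral>x. indicator U x *\<^sub>R (of_real (\<phi> x) * g x) \<partial>lebesgue) = (\<integral>x. of_real (\<phi> x) * g x \<partial>lborel)"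
  proof -
    have "(\<integral>x. indicator U x *\<^sub>R (of_real (\<phi> x) * g x) \<partial>lebesgue) = (\<integral>x. of_real (\<phi> x) * g x \<partial>lebesgue)"
      using z K(2) by (intro Bochner_Integration.integral_cong) (auto simp: indicator_def)
    then show ?thesis by (simp add: integral_completion)
  qed
  show "(\<integral>x. indicator U x *\<^sub>R (of_real (pd j \<phi> x) * u x) \<partial>lebesgue) = - (\<integral>x. indicator U x *\<^sub>R (of_real (\<phi> x) * g x) \<partial>lebesgue)"
    unfolding e1 e2 using sum0 by (simp add: eq_neg_iff_add_eq_0)
qed

lemma wpd_works: assumes "weak_pd U j u g" shows "weak_pd U j u (wpd U j u)"
  unfolding wpd_def by (rule someI[of "weak_pd U j u", OF assms])

text \<open>\<open>wpd\<close> is an arbitrary choice among the weak derivatives; uniqueness almost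
  everywhere lets it be replaced by an explicit one under integrals.\<close>

lemma weak_pd_unique_real:
  fixes u g1 g2 :: "R3 \<Rightarrow> real"
  assumes U: "open U" and w: "weak_pd U j u g1" "weak_pd U j u g2"
  shows "AE x in lborel. x \<in> U \<longrightarrow> g1 x = g2 x"
proof -
  have l: "loc_int U u" "loc_int U g1" "loc_int U g2" using w by (auto simp: weak_pd_def)
  obtain u' where u': "borel_rep U u u'" using borel_rep_exists_real[OF U l(1)] by blast
  obtain h1 where h1: "borel_rep U g1 h1" using borel_rep_exists_real[OF U l(2)] by blast
  obtain h2 where h2: "borel_rep U g2 h2" using borel_rep_exists_real[OF U l(3)] by blast
  have [measurable]: "h1 \<in> borel_measurable borel" "h2 \<in> borel_measurable borel" using h1 h2 by (auto simp: borel_rep_def)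
  have si: "set_integrable lborel (cbox a b) h1" "set_integrable lborel (cbox a b) h2" if "cbox a b \<subseteq> U" for a b
    using borel_rep_integrable[OF l(2) h1 compact_cbox that] borel_rep_integrable[OF l(3) h2 compact_cbox that] .
  have "AE x in lborel. x \<in> U \<longrightarrow> h1 x - h2 x = 0"
  proof (rule AE_zero_of_bumps[OF U])
    show "integrable lborel (\<lambda>x. indicator (cbox a b) x * (h1 x - h2 x))" if "cbox a b \<subseteq> U" for a b
      using si[OF that] by (simp add: set_integrable_def right_diff_distrib)
    show "(\<integral>x. bump k a b x * (h1 x - h2 x) \<partial>lborel) = 0" if k: "0 < k" and ab: "cbox a b \<subseteq> U" for k a b
    proof -
      have i: "integrable lborel (\<lambda>x. bump k a b x * h x)" if "set_integrable lborel (cbox a b) h" "h \<in> borel_measurable borel" for h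
      proof (rule Bochner_Integration.integrable_bound[OF that(1)[unfolded set_integrable_def]])
        show "AE x in lborel. norm (bump k a b x * h x) \<le> norm (indicator (cbox a b) x *\<^sub>R h x)"
        proof (rule AE_I2)
          fix x
          have "bump k a b x = 0" if "x \<notin> cbox a b"
            using that bump_eq_0[OF k, of x a b] box_subset_cbox[of a b] by blast
          then show "norm (bump k a b x * h x) \<le> norm (indicator (cbox a b) x *\<^sub>R h x)"
            using bump_bounds[of k a b x] by (cases "x \<in> cbox a b") (auto simp: abs_mult mult_left_le_one_le)
        qed
      qed (use that(2) flatalg_measurable[OF flatalg_bump] in simp)
      show ?thesis
        using weak_pd_bump[OF U w(1) u' h1 k ab] weak_pd_bump[OF U w(2) u' h2 k ab] i[OF si(1)[OF ab]] i[OF si(2)[OF ab]]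
        by (simp add: right_diff_distrib)
    qed
  qed simp
  moreover have "AE x in lborel. x \<in> U \<longrightarrow> h1 x = g1 x" "AE x in lborel. x \<in> U \<longrightarrow> h2 x = g2 x"
    using h1 h2 by (auto simp: borel_rep_def)
  ultimately show ?thesis by eventually_elim auto
qed

lemma weak_pd_add:
  fixes u g :: "R3 \<Rightarrow> 'b::{real_normed_field, banach, second_countable_topology}"
  assumes w: "weak_pd U j u g" "weak_pd U j v h"
  shows "weak_pd U j (\<lambda>x. u x + v x) (\<lambda>x. g x + h x)"
  unfolding weak_pd_def
proof (intro conjI allI impI)
  have l: "loc_int U u" "loc_int U g" "loc_int U v" "loc_int U h" using w by (auto simp: weak_pd_def)
  then show "loc_int U (\<lambda>x. u x + v x)" "loc_int U (\<lambda>x. g x + h x)" by (auto simp: loc_int_def)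
  fix \<phi> assume t: "test_fun U \<phi>"
  have "(\<integral>x. indicator U x *\<^sub>R (of_real (pd j \<phi> x) * (u x + v x)) \<partial>lebesgue) =
     (\<integral>x. indicator U x *\<^sub>R (of_real (pd j \<phi> x) * u x) \<partial>lebesgue) + (\<integral>x. indicator U x *\<^sub>R (of_real (pd j \<phi> x) * v x) \<partial>lebesgue)"
    unfolding distrib_left scaleR_add_right
    by (rule Bochner_Integration.integral_add) (intro test_fun_times_integrable t l)+
  also have "\<dots> = - ((\<integral>x. indicator U x *\<^sub>R (of_real (\<phi> x) * g x) \<partial>lebesgue) + (\<integral>x. indicator U x *\<^sub>R (of_real (\<phi> x) * h x) \<partial>lebesgue))"
    using w t by (simp add: weak_pd_def)
  also have "\<dots> = - (\<integral>x. indicator U x *\<^sub>R (of_real (\<phi> x) * (g x + h x)) \<partial>lebesgue)"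
    unfolding distrib_left scaleR_add_right
    by (subst Bochner_Integration.integral_add) (intro test_fun_times_integrable t l refl)+
  finally show "(\<integral>x. indicator U x *\<^sub>R (of_real (pd j \<phi> x) * (u x + v x)) \<partial>lebesgue) =
      - (\<integral>x. indicator U x *\<^sub>R (of_real (\<phi> x) * (g x + h x)) \<partial>lebesgue)" .
qed

lemma weak_pd_unique_complex:
  fixes u g1 g2 :: "R3 \<Rightarrow> complex"
  assumes U: "open U" and w: "weak_pd U j u g1" "weak_pd U j u g2"
  shows "AE x in lborel. x \<in> U \<longrightarrow> g1 x = g2 x"
  using weak_pd_unique_real[OF U weak_pd_Re_Im(1)[OF w(1)] weak_pd_Re_Im(1)[OF w(2)]]
    weak_pd_unique_real[OF U weak_pd_Re_Im(2)[OF w(1)] weak_pd_Re_Im(2)[OF w(2)]]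
  by eventually_elim (auto simp: complex_eq_iff)

lemma bounded_image_compact_bound:
  fixes f :: "R3 \<Rightarrow> 'b::real_normed_vector"
  assumes "\<And>R. \<exists>M. \<forall>x. norm x \<le> R \<longrightarrow> norm (f x) \<le> M" "compact K"
  shows "bounded (f ` K)"
proof -
  obtain R where "\<And>x. x \<in> K \<Longrightarrow> norm x \<le> R" using compact_imp_bounded[OF assms(2)] by (auto simp: bounded_iff)
  then show ?thesis using assms(1)[of R] by (auto simp: bounded_iff)
qed

lemma weak_pd_coordinate: "weak_pd U j (\<lambda>x::R3. c * x $ i :: real) (\<lambda>_. c * axis j 1 $ i)"
proof (rule weak_pd_piecewise)
  show "bounded ((\<lambda>x::R3. c * x $ i) ` K)" if "compact K" for K
    using that by (intro compact_imp_bounded compact_continuous_image continuous_intros)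
  show "continuous_on UNIV (\<lambda>\<tau>. c * (x + \<tau> *\<^sub>R axis j 1) $ i)" for x :: R3 by (intro continuous_intros)
  show "\<exists>S. finite S \<and> (\<forall>\<tau>\<in>{0..1} - S. ((\<lambda>\<tau>. c * (x + \<tau> *\<^sub>R axis j 1) $ i) has_vector_derivative c * axis j 1 $ i) (at \<tau>))" for x :: R3
    by (intro exI[of _ "{}"]) (auto intro!: derivative_eq_intros simp: has_real_derivative_iff_has_vector_derivative[symmetric])
  show "bounded ((\<lambda>_. c * axis j 1 $ i) ` K)" for K :: "R3 set"
    by (rule bounded_subset[of "{c * axis j 1 $ i}"]) auto
qed auto

section \<open>The reference potential\<close>

lemma comp_Fpot: "comp Fpot 1 = (\<lambda>x. (- 1/2) * x $ 2)" "comp Fpot 2 = (\<lambda>x. (1/2) * x $ 1)" "comp Fpot 3 = (\<lambda>x. 0 * x $ 1)"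
  by (auto simp: comp_def Fpot_def vector_3)

text \<open>Jacobian matrix of \<open>Fpot\<close>: component \<open>k\<close>, direction
  \<open>j\<close>.\<close>

definition dF :: "3 \<Rightarrow> 3 \<Rightarrow> real" where
  "dF k j = (if k = 1 \<and> j = 2 then - 1/2 else if k = 2 \<and> j = 1 then 1/2 else 0)"

lemma weak_pd_Fpot: "weak_pd UNIV j (comp Fpot k) (\<lambda>_. dF k j)"
proof -
  have "k = 1 \<or> k = 2 \<or> k = 3" using exhaust_3 by blast
  moreover have "weak_pd UNIV j (comp Fpot 1) (\<lambda>_. dF 1 j)"
    using weak_pd_coordinate[of UNIV j "-1/2" 2] unfolding comp_Fpot by (auto simp: dF_def axis_def)
  moreover have "weak_pd UNIV j (comp Fpot 2) (\<lambda>_. dF 2 j)"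
    using weak_pd_coordinate[of UNIV j "1/2" 1] unfolding comp_Fpot by (auto simp: dF_def axis_def)
  moreover have "weak_pd UNIV j (comp Fpot 3) (\<lambda>_. dF 3 j)"
    using weak_pd_coordinate[of UNIV j 0 1] unfolding comp_Fpot by (auto simp: dF_def axis_def)
  ultimately show ?thesis by auto
qed

lemma wpd_Fpot: "AE x in lebesgue. \<forall>j k. wpd UNIV j (comp Fpot k) x = dF k j"
proof -
  have "AE x in lborel. wpd UNIV j (comp Fpot k) x = dF k j" for j k
    using weak_pd_unique_real[OF open_UNIV wpd_works[OF weak_pd_Fpot] weak_pd_Fpot] by simp
  then have "AE x in lborel. \<forall>j k. wpd UNIV j (comp Fpot k) x = dF k j"
    by (simp add: AE_all_countable)
  then show ?thesis by (rule AE_completion)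
qed

lemma weak_curl_Fpot: "AE x in lebesgue. weak_curl Fpot x = beta"
  using wpd_Fpot by eventually_elim (simp add: weak_curl_def beta_def dF_def)

lemma field_energy_Fpot: "(\<integral>\<^sup>+x. ennreal ((norm (weak_curl Fpot x - beta))\<^sup>2) \<partial>lebesgue) = 0"
proof -
  have "(\<integral>\<^sup>+x. ennreal ((norm (weak_curl Fpot x - beta))\<^sup>2) \<partial>lebesgue) = (\<integral>\<^sup>+x. 0 \<partial>(lebesgue :: R3 measure))"
    by (rule nn_integral_cong_AE) (use weak_curl_Fpot in \<open>eventually_elim; simp\<close>)
  then show ?thesis by simp
qed

lemma Hdot1_zero: "Hdot1 (\<lambda>_. 0)"
proof -
  have w0: "weak_pd UNIV j (\<lambda>_. 0 :: real) (\<lambda>_. 0)" for j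
    using weak_pd_coordinate[of UNIV j 0 1] by simp
  have pd0: "pd j (\<lambda>_. 0) = (\<lambda>_. 0)" for j
    by (rule ext, rule pd_eq) simp
  have it: "iter_pd js (\<lambda>_. 0) = (\<lambda>_. 0)" for js by (induction js) (auto simp: pd0)
  have tf: "test_fun UNIV (\<lambda>_. 0)" by (simp add: test_fun_def smooth_on_def it tsupp_def)
  have ae: "AE x in lebesgue. \<forall>j. wpd UNIV j (\<lambda>_. 0 :: real) x = 0"
  proof -
    have "AE x in lborel. wpd UNIV j (\<lambda>_. 0 :: real) x = 0" for j
      using weak_pd_unique_real[OF open_UNIV wpd_works[OF w0] w0] by simp
    then have "AE x in lborel. \<forall>j. wpd UNIV j (\<lambda>_. 0 :: real) x = 0" by (simp add: AE_all_countable)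
    then show ?thesis by (rule AE_completion)
  qed
  have z: "(\<integral>\<^sup>+x. ennreal (\<Sum>j\<in>UNIV. (pd j (\<lambda>_. 0) x - wpd UNIV j (\<lambda>_. 0) x)\<^sup>2) \<partial>lebesgue) = 0"
  proof -
    have "(\<integral>\<^sup>+x. ennreal (\<Sum>j\<in>UNIV. (pd j (\<lambda>_. 0) x - wpd UNIV j (\<lambda>_. 0) x)\<^sup>2) \<partial>lebesgue) = (\<integral>\<^sup>+x. 0 \<partial>(lebesgue :: R3 measure))"
      by (rule nn_integral_cong_AE) (use ae in \<open>eventually_elim; simp add: pd0\<close>)
    then show ?thesis by simp
  qed
  have L2: "L2_on UNIV (\<lambda>_. 0 :: real)" by (simp add: L2_on_def)
  show ?thesis unfolding Hdot1_def
  proof (intro conjI allI exI[of _ "\<lambda>_ _. 0"])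
    show "\<exists>g. weak_pd UNIV j (\<lambda>_. 0 :: real) g \<and> L2_on UNIV g" for j by (intro exI[of _ "\<lambda>_. 0"] conjI w0 L2)
  qed (use tf z in auto)
qed

lemma Hdiv_F_Fpot: "Hdiv_F Fpot"
  unfolding Hdiv_F_def
proof (intro conjI allI)
  show "Hdot1 (\<lambda>x. Fpot x $ j - Fpot x $ j)" for j using Hdot1_zero by simp
  show "\<exists>g. weak_pd UNIV j (comp Fpot j) g" for j using weak_pd_Fpot by blast
  show "AE x in lebesgue. (\<Sum>j\<in>UNIV. wpd UNIV j (comp Fpot j) x) = 0"
    using wpd_Fpot by eventually_elim (simp add: dF_def sum_3)
qed

section \<open>Regularised normalisation of complex values\<close>

definition nrm :: "real \<Rightarrow> complex \<Rightarrow> complex" where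
  "nrm \<epsilon> z = (1 / sqrt ((cmod z)\<^sup>2 + \<epsilon>\<^sup>2)) *\<^sub>R z"

text \<open>Differential of \<open>nrm \<epsilon>\<close> at \<open>z\<close> in direction
  \<open>w\<close>. The map \<open>nrm \<epsilon>\<close> is a smooth substitute for
  \<open>sgn\<close>, rounded off where \<open>cmod z\<close> is below
  \<open>\<epsilon>\<close>.\<close>

definition dnrm :: "real \<Rightarrow> complex \<Rightarrow> complex \<Rightarrow> complex" where
  "dnrm \<epsilon> z w = (1 / sqrt ((cmod z)\<^sup>2 + \<epsilon>\<^sup>2)) *\<^sub>R w - (Re (cnj z * w) / sqrt ((cmod z)\<^sup>2 + \<epsilon>\<^sup>2) ^ 3) *\<^sub>R z"

lemma nrm_deriv:
  assumes \<epsilon>: "0 < \<epsilon>" and z: "(z has_vector_derivative z') (at t)"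
  shows "((\<lambda>t. nrm \<epsilon> (z t)) has_vector_derivative dnrm \<epsilon> (z t) z') (at t)"
proof -
  have re: "((\<lambda>t. Re (z t)) has_real_derivative Re z') (at t)"
    using bounded_linear.has_vector_derivative[OF bounded_linear_Re z] by (simp add: has_real_derivative_iff_has_vector_derivative)
  have im: "((\<lambda>t. Im (z t)) has_real_derivative Im z') (at t)"
    using bounded_linear.has_vector_derivative[OF bounded_linear_Im z] by (simp add: has_real_derivative_iff_has_vector_derivative)
  let ?s = "(Re (z t))\<^sup>2 + (Im (z t))\<^sup>2 + \<epsilon>\<^sup>2"
  have pos: "0 < ?s" using \<epsilon> by (intro add_nonneg_pos) auto
  have d: "((\<lambda>t. 1 / sqrt ((Re (z t))\<^sup>2 + (Im (z t))\<^sup>2 + \<epsilon>\<^sup>2)) has_real_derivative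
       - (Re (cnj (z t) * z')) / sqrt ?s ^ 3) (at t)"
  proof -
    have s: "((\<lambda>t. (Re (z t))\<^sup>2 + (Im (z t))\<^sup>2 + \<epsilon>\<^sup>2) has_real_derivative 2 * Re (cnj (z t) * z')) (at t)"
      by (rule derivative_eq_intros re im refl | simp)+
    have "((\<lambda>t. sqrt ((Re (z t))\<^sup>2 + (Im (z t))\<^sup>2 + \<epsilon>\<^sup>2)) has_real_derivative (inverse (sqrt ?s) / 2) * (2 * Re (cnj (z t) * z'))) (at t)"
      by (rule DERIV_chain2[OF DERIV_real_sqrt[OF pos] s])
    then have "((\<lambda>t. inverse (sqrt ((Re (z t))\<^sup>2 + (Im (z t))\<^sup>2 + \<epsilon>\<^sup>2))) has_real_derivative
        - ((inverse (sqrt ?s) / 2) * (2 * Re (cnj (z t) * z')) * inverse (sqrt ?s ^ Suc (Suc 0)))) (at t)"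
      by (rule DERIV_inverse_fun) (use pos in simp)
    moreover have "- ((inverse (sqrt ?s) / 2) * (2 * Re (cnj (z t) * z')) * inverse (sqrt ?s ^ Suc (Suc 0))) = - (Re (cnj (z t) * z')) / sqrt ?s ^ 3"
    proof -
      have "- ((inverse S / 2) * (2 * c) * inverse (S ^ Suc (Suc 0))) = - c / S ^ 3" for S c :: real
        by (cases "S = 0") (simp_all add: field_simps power3_eq_cube)
      from this[of "sqrt ?s" "Re (cnj (z t) * z')"] show ?thesis .
    qed
    ultimately show ?thesis by (simp only: inverse_eq_divide)
  qed
  have "((\<lambda>t. (1 / sqrt ((Re (z t))\<^sup>2 + (Im (z t))\<^sup>2 + \<epsilon>\<^sup>2)) *\<^sub>R z t) has_vector_derivative
      ((1 / sqrt ?s) *\<^sub>R z' + (- (Re (cnj (z t) * z')) / sqrt ?s ^ 3) *\<^sub>R z t)) (at t)"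
    by (rule has_vector_derivative_scaleR[OF d z])
  then show ?thesis
    unfolding nrm_def dnrm_def cmod_power2 minus_divide_left[symmetric] scaleR_minus_left diff_conv_add_uminus[symmetric] .
qed

text \<open>The radial correction in \<open>dnrm\<close> is no larger than the bound for the main
  term, whence the factor 2. The last identity lets the potential energy be controlled by the same
  denominator as the gradient.\<close>

lemma nrm_bounds:
  assumes \<epsilon>: "0 < \<epsilon>"
  defines "r \<equiv> \<lambda>z. sqrt ((cmod z)\<^sup>2 + \<epsilon>\<^sup>2)"
  shows "0 < r z" "\<epsilon> \<le> r z" "cmod (nrm \<epsilon> z) = cmod z / r z" "cmod (nrm \<epsilon> z) \<le> 1"
    and "cmod (dnrm \<epsilon> z w) \<le> 2 * cmod w / r z" "1 - (cmod (nrm \<epsilon> z))\<^sup>2 = \<epsilon>\<^sup>2 / (r z)\<^sup>2"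
proof -
  have pos: "0 < (cmod z)\<^sup>2 + \<epsilon>\<^sup>2" using \<epsilon> by (intro add_nonneg_pos) auto
  show rp: "0 < r z" using pos by (simp add: r_def)
  show "\<epsilon> \<le> r z" unfolding r_def by (rule real_le_rsqrt) simp
  have zr: "cmod z \<le> r z" unfolding r_def by (rule real_le_rsqrt) simp
  show n: "cmod (nrm \<epsilon> z) = cmod z / r z" using rp by (simp add: nrm_def r_def)
  then show "cmod (nrm \<epsilon> z) \<le> 1" using zr rp by simp
  have r2: "(r z)\<^sup>2 = (cmod z)\<^sup>2 + \<epsilon>\<^sup>2" using pos by (simp add: r_def)
  show "1 - (cmod (nrm \<epsilon> z))\<^sup>2 = \<epsilon>\<^sup>2 / (r z)\<^sup>2"
  proof -
    have "1 - (cmod (nrm \<epsilon> z))\<^sup>2 = ((r z)\<^sup>2 - (cmod z)\<^sup>2) / (r z)\<^sup>2"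
      unfolding n power_divide using rp by (simp add: diff_divide_distrib)
    then show ?thesis unfolding r2 by simp
  qed
  have "cmod (dnrm \<epsilon> z w) \<le> cmod w / r z + \<bar>Re (cnj z * w)\<bar> / r z ^ 3 * cmod z"
    using rp unfolding dnrm_def r_def
    by (intro order_trans[OF norm_triangle_ineq4]) (simp add: abs_divide)
  also have "\<bar>Re (cnj z * w)\<bar> / r z ^ 3 * cmod z \<le> (r z * cmod w) / r z ^ 3 * r z"
  proof (intro mult_mono divide_right_mono)
    have "\<bar>Re (cnj z * w)\<bar> \<le> cmod (cnj z * w)" by (rule abs_Re_le_cmod)
    also have "\<dots> = cmod z * cmod w" by (simp add: norm_mult)
    also have "\<dots> \<le> r z * cmod w" using zr by (rule mult_right_mono) simp
    finally show "\<bar>Re (cnj z * w)\<bar> \<le> r z * cmod w" .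
  qed (use zr rp in auto)
  also have "\<dots> = cmod w / r z" using rp by (simp add: power3_eq_cube)
  finally show "cmod (dnrm \<epsilon> z w) \<le> 2 * cmod w / r z" by simp
qed

lemma cis_deriv: "(\<theta> has_real_derivative \<theta>') (at t) \<Longrightarrow> ((\<lambda>t. cis (\<theta> t)) has_vector_derivative \<theta>' *\<^sub>R (\<i> * cis (\<theta> t))) (at t)"
proof -
  assume d: "(\<theta> has_real_derivative \<theta>') (at t)"
  have "(cis has_vector_derivative \<i> * cis (\<theta> t)) (at (\<theta> t))"
    unfolding has_vector_derivative_complex_iff by (auto intro!: derivative_eq_intros)
  with d show ?thesis using vector_diff_chain_at[of \<theta> \<theta>' t cis "\<i> * cis (\<theta> t)"]
    by (simp add: has_real_derivative_iff_has_vector_derivative o_def)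
qed

text \<open>In the strip \<open>n l \<le> x\<^sub>2 < (n + 1) l\<close> the test state is the normalisation of the section
  \<open>qq\<close>, which interpolates linearly between the two boundary phases \<open>1\<close> and
  \<open>e\<^sup>-\<^sup>2\<^sup>\<pi>\<^sup>i\<^sup>s\<^sup>/\<^sup>l\<close> and vanishes once per cell of side \<open>l\<close>; the gauge phase \<open>ph\<close>
  makes consecutive strips match because a cell carries exactly one flux quantum. The functions
  \<open>g1\<close> and \<open>g2\<close> are the first two partial derivatives of \<open>\<psi>0\<close>.\<close>

locale vortex_lattice =
  fixes B \<kappa> :: real
  assumes B: "0 < B" and \<kappa>: "0 < \<kappa>"
begin

definition l :: real where "l = sqrt (2 * pi / B)"
text \<open>The core size \<open>1 / \<kappa>\<close> in units of the cell side, since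
  \<open>qq\<close> varies by order 1 across a cell.\<close>

definition \<epsilon> :: real where "\<epsilon> = 1 / (\<kappa> * l)"
definition cell :: "real \<Rightarrow> real" where "cell t = of_int \<lfloor>t / l\<rfloor>"
definition fr :: "real \<Rightarrow> real" where "fr t = t / l - cell t"
definition qq :: "real \<Rightarrow> real \<Rightarrow> complex" where
  "qq s y = of_real (1 - y) + of_real y * cis (- (2 * pi / l) * s)"
definition ph :: "real \<Rightarrow> real \<Rightarrow> real \<Rightarrow> real" where
  "ph s t n = B * s * t / 2 - (2 * pi / l) * n * s"
definition \<psi>0 :: "R3 \<Rightarrow> complex" where
  "\<psi>0 x = cis (ph (x $ 1) (x $ 2) (cell (x $ 2))) * nrm \<epsilon> (qq (x $ 1) (fr (x $ 2)))"
definition g1 :: "R3 \<Rightarrow> complex" where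
  "g1 x = cis (ph (x $ 1) (x $ 2) (cell (x $ 2))) *
     (\<i> * of_real (B * x $ 2 / 2 - (2 * pi / l) * cell (x $ 2)) * nrm \<epsilon> (qq (x $ 1) (fr (x $ 2)))
      + dnrm \<epsilon> (qq (x $ 1) (fr (x $ 2))) (of_real (- (2 * pi / l) * fr (x $ 2)) * (\<i> * cis (- (2 * pi / l) * x $ 1))))"
definition g2 :: "R3 \<Rightarrow> complex" where
  "g2 x = cis (ph (x $ 1) (x $ 2) (cell (x $ 2))) *
     (\<i> * of_real (B * x $ 1 / 2) * nrm \<epsilon> (qq (x $ 1) (fr (x $ 2)))
      + dnrm \<epsilon> (qq (x $ 1) (fr (x $ 2))) (of_real (1 / l) * (cis (- (2 * pi / l) * x $ 1) - 1)))"

lemma l: "0 < l" "B * l\<^sup>2 = 2 * pi" "B = 2 * pi / l\<^sup>2"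
proof -
  show l0: "0 < l" using B by (simp add: l_def)
  show "B * l\<^sup>2 = 2 * pi" using B by (simp add: l_def)
  then show "B = 2 * pi / l\<^sup>2" using l0 by (simp add: field_simps)
qed

lemma \<epsilon>: "0 < \<epsilon>" using l \<kappa> by (simp add: \<epsilon>_def)

lemma cell_bounds: "cell t \<le> t / l" "t / l < cell t + 1" "\<bar>cell t\<bar> \<le> \<bar>t\<bar> / l + 1"
proof -
  show 1: "cell t \<le> t / l" and 2: "t / l < cell t + 1" unfolding cell_def by linarith+
  have "\<bar>t / l\<bar> = \<bar>t\<bar> / l" using l by simp
  then show "\<bar>cell t\<bar> \<le> \<bar>t\<bar> / l + 1" using 1 2 by linarith
qed

lemma fr_bounds: "0 \<le> fr t" "fr t < 1"
  using cell_bounds[of t] by (auto simp: fr_def)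

lemma qq_deriv1: "((\<lambda>s. qq (s0 + s) y) has_vector_derivative of_real (- (2 * pi / l) * y) * (\<i> * cis (- (2 * pi / l) * (s0 + s)))) (at s)"
proof -
  have d: "((\<lambda>s. - (2 * pi / l) * (s0 + s)) has_real_derivative - (2 * pi / l)) (at s)"
    using l(1) by (auto intro!: derivative_eq_intros)
  have "((\<lambda>s. of_real (1 - y) + of_real y * cis (- (2 * pi / l) * (s0 + s))) has_vector_derivative
     0 + of_real y * ((- (2 * pi / l)) *\<^sub>R (\<i> * cis (- (2 * pi / l) * (s0 + s))))) (at s)"
    by (intro derivative_intros has_vector_derivative_mult_right cis_deriv[OF d])
  then show ?thesis unfolding qq_def by (simp add: scaleR_conv_of_real mult_ac)
qed

lemma qq_deriv2: "((\<lambda>y. qq s ((t0 + y) / l - n)) has_vector_derivative of_real (1 / l) * (cis (- (2 * pi / l) * s) - 1)) (at y)"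
proof -
  have d: "((\<lambda>y. of_real ((t0 + y) / l - n) :: complex) has_vector_derivative of_real (1 / l)) (at y)"
    by (rule has_vector_derivative_of_real)
       (use l(1) in \<open>auto intro!: derivative_eq_intros simp: has_real_derivative_iff_has_vector_derivative[symmetric]\<close>)
  have "((\<lambda>y. (1 - of_real ((t0 + y) / l - n)) + of_real ((t0 + y) / l - n) * cis (- (2 * pi / l) * s)) has_vector_derivative
     (0 - of_real (1 / l)) + of_real (1 / l) * cis (- (2 * pi / l) * s)) (at y)"
    by (intro derivative_intros has_vector_derivative_mult_left d)
  then show ?thesis unfolding qq_def by (simp add: algebra_simps)
qed

lemma measurable_\<psi>0 [measurable]: "\<psi>0 \<in> borel_measurable borel" "g1 \<in> borel_measurable borel" "g2 \<in> borel_measurable borel"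
proof -
  have [measurable]: "cis \<in> borel_measurable borel" by (intro borel_measurable_continuous_onI continuous_intros)
  have c: "cell \<in> borel_measurable borel" unfolding cell_def by measurable
  note [measurable] = c
  have q: "(\<lambda>x::R3. qq (x $ 1) (fr (x $ 2))) \<in> borel_measurable borel" unfolding qq_def fr_def by measurable
  note [measurable] = q
  show "\<psi>0 \<in> borel_measurable borel" unfolding \<psi>0_def ph_def nrm_def by measurable
  have [measurable]: "Re \<in> borel_measurable borel" "cnj \<in> borel_measurable borel"
    by (auto intro!: borel_measurable_continuous_onI continuous_intros)
  have f: "fr \<in> borel_measurable borel" unfolding fr_def by measurable
  note [measurable] = f
  show "g1 \<in> borel_measurable borel" unfolding g1_def ph_def nrm_def dnrm_def by measurable
  show "g2 \<in> borel_measurable borel" unfolding g2_def ph_def nrm_def dnrm_def by measurable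
qed

end

context vortex_lattice
begin

text \<open>The formula of \<open>\<psi>0\<close> with the strip index \<open>n\<close> kept fixed.
  It is smooth in \<open>t\<close> across strip boundaries, so continuity and derivatives of
  \<open>\<psi>0\<close> follow by gluing branches.\<close>

definition br :: "real \<Rightarrow> real \<Rightarrow> real \<Rightarrow> complex" where
  "br s n t = cis (ph s t n) * nrm \<epsilon> (qq s (t / l - n))"

lemma \<psi>0_br: "\<psi>0 x = br (x $ 1) (cell (x $ 2)) (x $ 2)"
  by (simp add: \<psi>0_def br_def fr_def)

text \<open>At the upper end of a strip the section equals \<open>cis (- (2 * pi / l) * s)\<close>,
  at the lower end of the next one it equals 1. The jump of \<open>ph\<close> when \<open>n\<close>
  increases by 1 supplies exactly this factor.\<close>

lemma br_step: "br s n ((n + 1) * l) = br s (n + 1) ((n + 1) * l)"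
proof -
  let ?a = "- (2 * pi / l) * s"
  have n: "nrm \<epsilon> (cis ?a) = (1 / sqrt (1 + \<epsilon>\<^sup>2)) *\<^sub>R cis ?a" "nrm \<epsilon> 1 = (1 / sqrt (1 + \<epsilon>\<^sup>2)) *\<^sub>R 1"
    by (simp_all add: nrm_def)
  have d: "(n + 1) * l / l = n + 1" using l(1) by simp
  have q: "qq s ((n + 1) * l / l - n) = cis ?a" "qq s ((n + 1) * l / l - (n + 1)) = 1" unfolding d by (simp_all add: qq_def)
  have p: "ph s ((n + 1) * l) n + ?a = ph s ((n + 1) * l) (n + 1)" by (simp add: ph_def algebra_simps add_divide_distrib)
  have "cis (ph s ((n + 1) * l) n) * cis ?a = cis (ph s ((n + 1) * l) (n + 1))" by (simp only: cis_mult p)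
  then show ?thesis unfolding br_def q n by (simp add: scaleR_conv_of_real)
qed

lemma cell_eq: "of_int n \<le> t / l \<Longrightarrow> t / l < of_int n + 1 \<Longrightarrow> cell t = of_int n"
  unfolding cell_def by (metis floor_unique)

lemma br_line: "of_int n * l \<le> t \<Longrightarrow> t \<le> (of_int n + 1) * l \<Longrightarrow> br s (cell t) t = br s (of_int n) t"
proof -
  assume t: "of_int n * l \<le> t" "t \<le> (of_int n + 1) * l"
  show ?thesis
  proof (cases "t = (of_int n + 1) * l")
    case True
    have "cell t = of_int (n + 1)" using l(1) by (intro cell_eq) (auto simp: True)
    then show ?thesis using br_step[of s "of_int n"] True by simp
  next
    case False
    then have "cell t = of_int n" using t l(1) by (intro cell_eq) (auto simp: field_simps)
    then show ?thesis by simp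
  qed
qed

lemma br_deriv2: "((\<lambda>t. br s n (t0 + t)) has_vector_derivative
   cis (ph s (t0 + t) n) * (\<i> * of_real (B * s / 2) * nrm \<epsilon> (qq s ((t0 + t) / l - n))
      + dnrm \<epsilon> (qq s ((t0 + t) / l - n)) (of_real (1 / l) * (cis (- (2 * pi / l) * s) - 1)))) (at t)"
proof -
  have "((\<lambda>t. ph s (t0 + t) n) has_real_derivative B * s / 2) (at t)"
    unfolding ph_def by (auto intro!: derivative_eq_intros)
  note d = has_vector_derivative_mult[OF cis_deriv[OF this] nrm_deriv[OF \<epsilon> qq_deriv2[of s t0 n t]]]
  show ?thesis unfolding br_def
    by (rule has_vector_derivative_eq_rhs[OF d]) (simp add: scaleR_conv_of_real algebra_simps)
qed

lemma continuous_line2: "continuous_on UNIV (\<lambda>t. br s (cell (t0 + t)) (t0 + t))"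
proof -
  have cb: "isCont (br s n) t" for n t
    using has_vector_derivative_continuous[OF br_deriv2[of s n 0 t]] by simp
  have piece: "continuous_on {of_int n * l..(of_int n + 1) * l} (\<lambda>t. br s (cell t) t)" for n
    by (rule continuous_on_eq[of _ "br s (of_int n)"]) (auto simp: br_line continuous_at_imp_continuous_on cb)
  have "isCont (\<lambda>t. br s (cell t) t) t" for t
  proof -
    define n where "n = \<lfloor>t / l\<rfloor>"
    have "of_int n \<le> t / l" "t / l < of_int n + 1" unfolding n_def by linarith+
    then have n: "of_int n * l \<le> t" "t < (of_int n + 1) * l" using l(1) by (auto simp: field_simps)
    let ?A = "{(of_int n - 1) * l..of_int n * l}" and ?C = "{of_int n * l..(of_int n + 1) * l}"
    have "continuous_on (?A \<union> ?C) (\<lambda>t. br s (cell t) t)"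
      using piece[of "n - 1"] piece[of n] by (intro continuous_on_closed_Un) auto
    moreover have "t \<in> interior (?A \<union> ?C)"
    proof (rule interiorI)
      show "t \<in> {(of_int n - 1) * l<..<(of_int n + 1) * l}" using n l(1) by (auto simp: algebra_simps)
    qed (use l(1) in auto)
    ultimately show ?thesis by (rule continuous_on_interior)
  qed
  then have "continuous_on UNIV (\<lambda>t. br s (cell t) t)" by (intro continuous_at_imp_continuous_on) auto
  then show ?thesis
    by (rule continuous_on_compose2) (auto intro!: continuous_intros)
qed

lemma section_gradient_bounds:
  "cmod (of_real (- (2 * pi / l) * fr t) * (\<i> * cis \<theta>)) \<le> 2 * pi / l"
  "cmod (of_real (1 / l) * (cis \<theta> - 1)) \<le> 2 / l"
proof -
  have "2 * pi / l * fr t \<le> 2 * pi / l * 1" using l(1) fr_bounds[of t] by (intro mult_left_mono) auto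
  then show "cmod (of_real (- (2 * pi / l) * fr t) * (\<i> * cis \<theta>)) \<le> 2 * pi / l" using l(1) fr_bounds(1)[of t]
    by (simp only: norm_mult norm_of_real norm_cis norm_ii) (simp add: abs_mult)
  have "cmod (cis \<theta> - 1) \<le> 2" by (rule order_trans[OF norm_triangle_ineq4]) simp
  then have "(1 / l) * cmod (cis \<theta> - 1) \<le> (1 / l) * 2" using l(1) by (intro mult_left_mono) auto
  then show "cmod (of_real (1 / l) * (cis \<theta> - 1)) \<le> 2 / l" using l(1)
    by (simp only: norm_mult norm_of_real) (simp add: abs_mult)
qed

text \<open>Crude bounds, growing linearly in \<open>norm x\<close>, that serve local boundedness:
  weak differentiability and square integrability on bounded sets. The estimate that sees the
  cancellation of the potential is \<open>density_bound\<close>.\<close>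

lemma test_state_bounds:
  "cmod (\<psi>0 x) \<le> 1"
  "cmod (g1 x) \<le> B * norm x / 2 + (2 * pi / l) * (norm x / l + 1) + 4 * pi / (l * \<epsilon>)"
  "cmod (g2 x) \<le> B * norm x / 2 + 4 / (l * \<epsilon>)"
proof -
  let ?q = "qq (x $ 1) (fr (x $ 2))"
  have n1: "cmod (nrm \<epsilon> ?q) \<le> 1" using nrm_bounds(4)[OF \<epsilon>] .
  show "cmod (\<psi>0 x) \<le> 1" using n1 by (simp add: \<psi>0_def norm_mult)
  have d: "cmod (dnrm \<epsilon> ?q w) \<le> 2 * a / \<epsilon>" if "cmod w \<le> a" for w a
  proof -
    have "cmod (dnrm \<epsilon> ?q w) \<le> 2 * cmod w / sqrt ((cmod ?q)\<^sup>2 + \<epsilon>\<^sup>2)" using nrm_bounds(5)[OF \<epsilon>] .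
    also have "\<dots> \<le> 2 * a / \<epsilon>" using that \<epsilon> nrm_bounds(2)[OF \<epsilon>, of ?q] by (intro frac_le) (auto intro: order_trans[OF norm_ge_zero])
    finally show ?thesis .
  qed
  have x: "\<bar>x $ i\<bar> \<le> norm x" for i using component_le_norm_cart .
  have prod: "cmod (\<i> * of_real c * nrm \<epsilon> ?q) \<le> a" if "\<bar>c\<bar> \<le> a" for c a
    using mult_mono[OF that n1] that by (simp add: norm_mult)
  have y1: "\<bar>B * x $ 1 / 2\<bar> \<le> B * norm x / 2" using x[of 1] B by (simp add: abs_mult)
  have y2: "\<bar>B * x $ 2 / 2 - (2 * pi / l) * cell (x $ 2)\<bar> \<le> B * norm x / 2 + (2 * pi / l) * (norm x / l + 1)"
  proof (rule order_trans[OF abs_triangle_ineq4] add_mono)+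
    show "\<bar>B * x $ 2 / 2\<bar> \<le> B * norm x / 2" using x[of 2] B by (simp add: abs_mult)
    have "\<bar>cell (x $ 2)\<bar> \<le> norm x / l + 1"
      using cell_bounds(3)[of "x $ 2"] divide_right_mono[OF x[of 2], of l] l(1) by simp
    then have "(2 * pi / l) * \<bar>cell (x $ 2)\<bar> \<le> (2 * pi / l) * (norm x / l + 1)" using l(1) by (intro mult_left_mono) auto
    then show "\<bar>(2 * pi / l) * cell (x $ 2)\<bar> \<le> (2 * pi / l) * (norm x / l + 1)" using l(1) by (simp add: abs_mult)
  qed
  have "cmod (g1 x) \<le> (B * norm x / 2 + (2 * pi / l) * (norm x / l + 1)) + 2 * (2 * pi / l) / \<epsilon>"
    unfolding g1_def using norm_triangle_le[OF add_mono[OF prod[OF y2] d[OF section_gradient_bounds(1)]]] by (simp add: norm_mult)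
  also have "2 * (2 * pi / l) / \<epsilon> = 4 * pi / (l * \<epsilon>)" by simp
  finally show "cmod (g1 x) \<le> B * norm x / 2 + (2 * pi / l) * (norm x / l + 1) + 4 * pi / (l * \<epsilon>)" .
  have "cmod (g2 x) \<le> B * norm x / 2 + 2 * (2 / l) / \<epsilon>"
    unfolding g2_def using norm_triangle_le[OF add_mono[OF prod[OF y1] d[OF section_gradient_bounds(2)]]] by (simp add: norm_mult)
  then show "cmod (g2 x) \<le> B * norm x / 2 + 4 / (l * \<epsilon>)" by simp
qed

lemma bounded_test_state:
  assumes "compact K" shows "bounded (\<psi>0 ` K)" "bounded (g1 ` K)" "bounded (g2 ` K)"
proof -
  show "bounded (\<psi>0 ` K)" using test_state_bounds(1) by (auto simp: bounded_iff)
  have "cmod (g1 x) \<le> B * R / 2 + (2 * pi / l) * (R / l + 1) + 4 * pi / (l * \<epsilon>)" if "norm x \<le> R" for x R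
    by (rule order_trans[OF test_state_bounds(2)])
       (use that B l(1) \<epsilon> in \<open>intro add_mono mult_left_mono divide_right_mono; simp\<close>)
  then show "bounded (g1 ` K)" by (intro bounded_image_compact_bound assms) blast
  have "cmod (g2 x) \<le> B * R / 2 + 4 / (l * \<epsilon>)" if "norm x \<le> R" for x R
    by (rule order_trans[OF test_state_bounds(3)])
       (use that B l(1) \<epsilon> in \<open>intro add_mono mult_left_mono divide_right_mono; simp\<close>)
  then show "bounded (g2 ` K)" by (intro bounded_image_compact_bound assms) blast
qed

lemma weak_pd_1: "weak_pd U 1 \<psi>0 g1"
proof (rule weak_pd_piecewise)
  have D: "((\<lambda>\<tau>. \<psi>0 (x + \<tau> *\<^sub>R axis 1 1)) has_vector_derivative g1 (x + \<tau> *\<^sub>R axis 1 1)) (at \<tau>)" for x \<tau>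
  proof -
    let ?t = "x $ 2" and ?n = "cell (x $ 2)"
    have "((\<lambda>\<tau>. ph (x $ 1 + \<tau>) ?t ?n) has_real_derivative B * ?t / 2 - (2 * pi / l) * ?n) (at \<tau>)"
      unfolding ph_def using l(1) by (auto intro!: derivative_eq_intros)
    note d = has_vector_derivative_mult[OF cis_deriv[OF this] nrm_deriv[OF \<epsilon> qq_deriv1[of "x $ 1" "fr ?t" \<tau>]]]
    have c: "(x + \<tau> *\<^sub>R axis 1 1) $ 1 = x $ 1 + \<tau>" "(x + \<tau> *\<^sub>R axis 1 1) $ 2 = x $ 2" for \<tau> by (simp_all add: axis_def)
    show ?thesis unfolding \<psi>0_def g1_def c
      by (rule has_vector_derivative_eq_rhs[OF d]) (simp add: scaleR_conv_of_real algebra_simps)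
  qed
  show "continuous_on UNIV (\<lambda>\<tau>. \<psi>0 (x + \<tau> *\<^sub>R axis 1 1))" for x
    using D by (intro continuous_at_imp_continuous_on) (auto intro: has_vector_derivative_continuous)
  show "\<exists>S. finite S \<and> (\<forall>\<tau>\<in>{0..1} - S. ((\<lambda>\<tau>. \<psi>0 (x + \<tau> *\<^sub>R axis 1 1)) has_vector_derivative g1 (x + \<tau> *\<^sub>R axis 1 1)) (at \<tau>))" for x
    using D by (intro exI[of _ "{}"]) auto
qed (use bounded_test_state in auto)

lemma weak_pd_2: "weak_pd U 2 \<psi>0 g2"
proof (rule weak_pd_piecewise)
  show "continuous_on UNIV (\<lambda>\<tau>. \<psi>0 (x + \<tau> *\<^sub>R axis 2 1))" for x
    using continuous_line2[of "x $ 1" "x $ 2"] by (simp add: \<psi>0_br axis_def)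
  show "\<exists>S. finite S \<and> (\<forall>\<tau>\<in>{0..1} - S. ((\<lambda>\<tau>. \<psi>0 (x + \<tau> *\<^sub>R axis 2 1)) has_vector_derivative g2 (x + \<tau> *\<^sub>R axis 2 1)) (at \<tau>))" for x
  proof (intro exI conjI ballI)
    \<comment> \<open>Parameters at which the segment crosses a strip boundary; elsewhere the strip
      index is locally constant.\<close>
    let ?S = "(\<lambda>n. of_int n * l - x $ 2) ` {\<lfloor>x $ 2 / l\<rfloor>..\<lfloor>(x $ 2 + 1) / l\<rfloor>}"
    show "finite ?S" by simp
    fix \<tau> assume \<tau>: "\<tau> \<in> {0..1} - ?S"
    define n where "n = \<lfloor>(x $ 2 + \<tau>) / l\<rfloor>"
    have "n \<in> {\<lfloor>x $ 2 / l\<rfloor>..\<lfloor>(x $ 2 + 1) / l\<rfloor>}"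
      unfolding n_def using \<tau> l(1) by (auto intro!: floor_mono divide_right_mono)
    then have ne: "\<tau> \<noteq> of_int n * l - x $ 2" using \<tau> by auto
    have "of_int n \<le> (x $ 2 + \<tau>) / l" "(x $ 2 + \<tau>) / l < of_int n + 1" unfolding n_def by linarith+
    then have n: "of_int n * l < x $ 2 + \<tau>" "x $ 2 + \<tau> < (of_int n + 1) * l" using ne l(1) by (auto simp: field_simps)
    define I where "I = {of_int n * l - x $ 2<..<(of_int n + 1) * l - x $ 2}"
    have cI: "cell (x $ 2 + t) = of_int n" if "t \<in> I" for t
      using that l(1) by (intro cell_eq) (auto simp: I_def field_simps)
    have \<tau>I: "\<tau> \<in> I" using n by (auto simp: I_def)
    have "((\<lambda>t. \<psi>0 (x + t *\<^sub>R axis 2 1)) has_vector_derivative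
       cis (ph (x $ 1) (x $ 2 + \<tau>) (of_int n)) * (\<i> * of_real (B * x $ 1 / 2) * nrm \<epsilon> (qq (x $ 1) ((x $ 2 + \<tau>) / l - of_int n))
      + dnrm \<epsilon> (qq (x $ 1) ((x $ 2 + \<tau>) / l - of_int n)) (of_real (1 / l) * (cis (- (2 * pi / l) * x $ 1) - 1)))) (at \<tau>)"
    proof (rule has_vector_derivative_transform_within_open[OF br_deriv2[of "x $ 1" "of_int n" "x $ 2" \<tau>]])
      show "open I" by (simp add: I_def)
      show "br (x $ 1) (of_int n) (x $ 2 + t) = \<psi>0 (x + t *\<^sub>R axis 2 1)" if "t \<in> I" for t
        using cI[OF that] by (simp add: \<psi>0_br axis_def)
    qed (use \<tau>I in simp)
    then show "((\<lambda>\<tau>. \<psi>0 (x + \<tau> *\<^sub>R axis 2 1)) has_vector_derivative g2 (x + \<tau> *\<^sub>R axis 2 1)) (at \<tau>)"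
      unfolding g2_def fr_def using cI[OF \<tau>I] by (simp add: axis_def)
  qed
qed (use bounded_test_state in auto)

lemma weak_pd_3: "weak_pd U 3 \<psi>0 (\<lambda>_. 0)"
proof (rule weak_pd_piecewise)
  have c: "\<psi>0 (x + \<tau> *\<^sub>R axis 3 1) = \<psi>0 x" for x \<tau> by (simp add: \<psi>0_def axis_def)
  show "continuous_on UNIV (\<lambda>\<tau>. \<psi>0 (x + \<tau> *\<^sub>R axis 3 1))" for x by (simp add: c)
  show "\<exists>S. finite S \<and> (\<forall>\<tau>\<in>{0..1} - S. ((\<lambda>\<tau>. \<psi>0 (x + \<tau> *\<^sub>R axis 3 1)) has_vector_derivative 0) (at \<tau>))" for x
    by (intro exI[of _ "{}"]) (simp add: c)
  show "bounded ((\<lambda>_. 0 :: complex) ` K)" for K :: "R3 set" by (rule bounded_subset[of "{0}"]) auto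
qed (use bounded_test_state in auto)

end

section \<open>Energy of the vortex lattice\<close>

lemma cos_2pi_le:
  assumes t: "\<bar>t\<bar> \<le> 1/2"
  shows "cos (2 * pi * t) \<le> 1 - 2 * t\<^sup>2"
proof -
  have p: "9 \<le> pi\<^sup>2" "pi\<^sup>2 \<le> 10"
  proof -
    have "3 * 3 \<le> pi * pi" using pi_approx by (intro mult_mono) auto
    then show "9 \<le> pi\<^sup>2" by (simp add: power2_eq_square)
    have "pi * pi \<le> 3.15 * 3.15" using pi_approx by (intro mult_mono) auto
    then show "pi\<^sup>2 \<le> 10" by (simp add: power2_eq_square)
  qed
  have sq: "(2 * pi * t)\<^sup>2 = 4 * (pi\<^sup>2 * t\<^sup>2)" by (simp add: power_mult_distrib)
  have t2: "t\<^sup>2 \<le> 1/4" using power_mono[OF t, of 2] by (simp add: power_divide)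
  have "4 * (pi\<^sup>2 * t\<^sup>2) \<le> 4 * (10 * (1/4))" using p t2 by (intro mult_left_mono mult_mono) auto
  then have w2: "(2 * pi * t)\<^sup>2 \<le> 10" using sq by linarith
  have "(2 * pi * t)^4 = (2 * pi * t)\<^sup>2 * (2 * pi * t)\<^sup>2" by (simp add: power4_eq_xxxx power2_eq_square)
  also have "\<dots> \<le> 10 * (2 * pi * t)\<^sup>2" using w2 by (intro mult_right_mono) auto
  finally have "cos (2 * pi * t) \<le> 1 - (2 * pi * t)\<^sup>2 / 12" using cos_le_quartic[of "2 * pi * t"] by linarith
  moreover have "9 * t\<^sup>2 \<le> pi\<^sup>2 * t\<^sup>2" using p by (intro mult_right_mono) auto
  ultimately show ?thesis using sq zero_le_power2[of t] by linarith
qed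

context vortex_lattice
begin

definition rr :: "R3 \<Rightarrow> real" where
  "rr x = (cmod (qq (x $ 1) (fr (x $ 2))))\<^sup>2 + \<epsilon>\<^sup>2"

text \<open>For \<open>y\<close> between 0 and 1 this form shows the zeros: \<open>y = 1/2\<close>
  together with cosine -1, that is, the centres of the cells.\<close>

lemma cmod_qq: "(cmod (qq s y))\<^sup>2 = 1 - 2 * y * (1 - y) * (1 - cos ((2 * pi / l) * s))"
proof -
  have "(cmod (qq s y))\<^sup>2 = (1 - y + y * cos ((2 * pi / l) * s))\<^sup>2 + (y * sin ((2 * pi / l) * s))\<^sup>2"
    unfolding cmod_power2 by (simp add: qq_def)
  also have "(y * sin ((2 * pi / l) * s))\<^sup>2 = y\<^sup>2 * (1 - (cos ((2 * pi / l) * s))\<^sup>2)"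
    unfolding power_mult_distrib sin_squared_eq ..
  finally show ?thesis by (simp add: power2_eq_square algebra_simps)
qed

lemma rr_bounds: "0 < rr x" "\<epsilon>\<^sup>2 \<le> rr x" "rr x \<le> 1 + \<epsilon>\<^sup>2"
proof -
  show "0 < rr x" unfolding rr_def using \<epsilon> by (intro add_nonneg_pos) auto
  show "\<epsilon>\<^sup>2 \<le> rr x" unfolding rr_def by simp
  have "0 \<le> 2 * fr (x $ 2) * (1 - fr (x $ 2)) * (1 - cos ((2 * pi / l) * x $ 1))"
    using fr_bounds[of "x $ 2"] by (intro mult_nonneg_nonneg) auto
  then show "rr x \<le> 1 + \<epsilon>\<^sup>2" unfolding rr_def cmod_qq by simp
qed

text \<open>In the first direction the gauge phase and the potential combine to
  \<open>(2 * pi / l) * fr (x $ 2)\<close>, which stays bounded; in the second they cancel. What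
  remains is the gradient of the normalised section, of order \<open>1 / (l * r)\<close>. The
  constant 400 exceeds 36 pi^2 + 16 + 1.\<close>

lemma density_bound:
  "(cmod (g1 x - \<i> * of_real (B * (- x $ 2 / 2)) * \<psi>0 x))\<^sup>2 + (cmod (g2 x - \<i> * of_real (B * (x $ 1 / 2)) * \<psi>0 x))\<^sup>2
     + \<kappa>\<^sup>2 / 2 * (1 - (cmod (\<psi>0 x))\<^sup>2)\<^sup>2 \<le> 400 / (l\<^sup>2 * rr x)"
proof -
  let ?q = "qq (x $ 1) (fr (x $ 2))"
  define r where "r = sqrt (rr x)"
  have r: "0 < r" "r\<^sup>2 = rr x" using rr_bounds(1)[of x] by (auto simp: r_def)
  have rq: "sqrt ((cmod ?q)\<^sup>2 + \<epsilon>\<^sup>2) = r" by (simp add: r_def rr_def)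
  note nb = nrm_bounds[OF \<epsilon>, where z = ?q, unfolded rq]
  have q1: "cmod ?q \<le> 1"
    using rr_bounds(3)[of x] by (simp add: rr_def power_le_one_iff abs_square_le_1)
  have fr: "0 \<le> fr (x $ 2)" "fr (x $ 2) \<le> 1" using fr_bounds[of "x $ 2"] by auto
  have n1: "cmod (nrm \<epsilon> ?q) \<le> 1 / r" unfolding nb(3) using q1 r(1) by (simp add: divide_right_mono)
  have Bx: "B * x $ 2 / 2 - (2 * pi / l) * cell (x $ 2) + B * x $ 2 / 2 = (2 * pi / l) * fr (x $ 2)"
  proof -
    have "B * x $ 2 = (2 * pi / l) * (x $ 2 / l)" by (subst l(3)) (simp add: power2_eq_square)
    then show ?thesis unfolding fr_def right_diff_distrib by linarith
  qed
  define w where "w = of_real (- (2 * pi / l) * fr (x $ 2)) * (\<i> * cis (- (2 * pi / l) * x $ 1))"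
  have w: "cmod w \<le> 2 * pi / l" unfolding w_def by (rule section_gradient_bounds)
  have "g1 x - \<i> * of_real (B * (- x $ 2 / 2)) * \<psi>0 x
      = cis (ph (x $ 1) (x $ 2) (cell (x $ 2))) * (\<i> * of_real (B * x $ 2 / 2 - (2 * pi / l) * cell (x $ 2) + B * x $ 2 / 2) * nrm \<epsilon> ?q + dnrm \<epsilon> ?q w)"
    unfolding g1_def \<psi>0_def w_def[symmetric] by (simp add: algebra_simps)
  then have "cmod (g1 x - \<i> * of_real (B * (- x $ 2 / 2)) * \<psi>0 x) = cmod (\<i> * of_real ((2 * pi / l) * fr (x $ 2)) * nrm \<epsilon> ?q + dnrm \<epsilon> ?q w)"
    unfolding Bx by (simp only: norm_mult norm_cis)
  also have "\<dots> \<le> (2 * pi / l) * (1 / r) + 2 * (2 * pi / l) / r"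
  proof (rule norm_triangle_le[OF add_mono])
    have "cmod (\<i> * of_real ((2 * pi / l) * fr (x $ 2)) * nrm \<epsilon> ?q) = ((2 * pi / l) * fr (x $ 2)) * cmod (nrm \<epsilon> ?q)"
      using l(1) fr(1) by (simp only: norm_mult norm_of_real norm_ii) (simp add: abs_mult)
    also have "\<dots> \<le> ((2 * pi / l) * 1) * (1 / r)" using n1 fr l(1) r(1) by (intro mult_mono) auto
    finally show "cmod (\<i> * of_real ((2 * pi / l) * fr (x $ 2)) * nrm \<epsilon> ?q) \<le> (2 * pi / l) * (1 / r)" by simp
    show "cmod (dnrm \<epsilon> ?q w) \<le> 2 * (2 * pi / l) / r"
      by (rule order_trans[OF nb(5)]) (use w r(1) in \<open>intro divide_right_mono; simp\<close>)
  qed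
  also have "\<dots> = 6 * pi / (l * r)" using l(1) r(1) by (simp add: field_simps)
  finally have a1: "(cmod (g1 x - \<i> * of_real (B * (- x $ 2 / 2)) * \<psi>0 x))\<^sup>2 \<le> (6 * pi / (l * r))\<^sup>2"
    by (rule power_mono) simp
  have "g2 x - \<i> * of_real (B * (x $ 1 / 2)) * \<psi>0 x
      = cis (ph (x $ 1) (x $ 2) (cell (x $ 2))) * dnrm \<epsilon> ?q (of_real (1 / l) * (cis (- (2 * pi / l) * x $ 1) - 1))"
    unfolding g2_def \<psi>0_def by (simp add: algebra_simps)
  then have "cmod (g2 x - \<i> * of_real (B * (x $ 1 / 2)) * \<psi>0 x) = cmod (dnrm \<epsilon> ?q (of_real (1 / l) * (cis (- (2 * pi / l) * x $ 1) - 1)))"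
    by (simp only: norm_mult norm_cis)
  also have "\<dots> \<le> 2 * (2 / l) / r"
  proof (rule order_trans[OF nb(5)])
    have "cmod (of_real (1 / l) * (cis (- (2 * pi / l) * x $ 1) - 1)) \<le> 2 / l" by (rule section_gradient_bounds)
    then show "2 * cmod (of_real (1 / l) * (cis (- (2 * pi / l) * x $ 1) - 1)) / r \<le> 2 * (2 / l) / r"
      using r(1) by (intro divide_right_mono mult_left_mono) auto
  qed
  also have "\<dots> = 4 / (l * r)" using l(1) r(1) by (simp add: field_simps)
  finally have a2: "(cmod (g2 x - \<i> * of_real (B * (x $ 1 / 2)) * \<psi>0 x))\<^sup>2 \<le> (4 / (l * r))\<^sup>2"
    by (rule power_mono) simp
  have a3: "\<kappa>\<^sup>2 / 2 * (1 - (cmod (\<psi>0 x))\<^sup>2)\<^sup>2 \<le> 1 / (l * r)\<^sup>2"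
  proof -
    have c: "cmod (\<psi>0 x) = cmod (nrm \<epsilon> ?q)" by (simp add: \<psi>0_def norm_mult)
    have e: "\<epsilon>\<^sup>2 / r\<^sup>2 \<le> 1" unfolding r(2) using rr_bounds[of x] by simp
    have "\<kappa>\<^sup>2 / 2 * (1 - (cmod (\<psi>0 x))\<^sup>2)\<^sup>2 = \<kappa>\<^sup>2 / 2 * ((\<epsilon>\<^sup>2 / r\<^sup>2) * (\<epsilon>\<^sup>2 / r\<^sup>2))"
      unfolding c nb(6) by (simp add: power2_eq_square)
    also have "\<dots> \<le> \<kappa>\<^sup>2 * ((\<epsilon>\<^sup>2 / r\<^sup>2) * 1)"
      using e by (intro mult_mono) auto
    also have "\<dots> = 1 / (l * r)\<^sup>2" using \<kappa> l(1) r(1) by (simp add: \<epsilon>_def power_mult_distrib power_divide field_simps)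
    finally show ?thesis .
  qed
  have p: "pi\<^sup>2 \<le> 10"
  proof -
    have "pi * pi \<le> 3.15 * 3.15" using pi_approx by (intro mult_mono) auto
    then show ?thesis by (simp add: power2_eq_square)
  qed
  have "(6 * pi / (l * r))\<^sup>2 + (4 / (l * r))\<^sup>2 + 1 / (l * r)\<^sup>2 = (36 * pi\<^sup>2 + 17) / (l * r)\<^sup>2"
    by (simp add: power_divide power_mult_distrib add_divide_distrib)
  also have "\<dots> \<le> 400 / (l * r)\<^sup>2" using p by (intro divide_right_mono) auto
  also have lr: "(l * r)\<^sup>2 = l\<^sup>2 * rr x" by (simp add: power_mult_distrib r(2))
  finally show ?thesis using a1 a2 a3[unfolded lr] by linarith
qed

text \<open>Small \<open>rr\<close> forces both factors in \<open>cmod_qq\<close> to be nearly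
  extremal: y (1 - y) near 1/4 confines the second coordinate, and a cosine near -1 confines the
  first one through \<open>cos_2pi_le\<close>.\<close>

lemma level_set:
  assumes "rr x < \<delta>\<^sup>2" "0 < \<delta>"
  shows "\<bar>fr (x $ 1) - 1/2\<bar> < \<delta>" "\<bar>fr (x $ 2) - 1/2\<bar> < \<delta>"
proof -
  let ?y = "fr (x $ 2)" and ?t = "fr (x $ 1) - 1/2" and ?c = "cos ((2 * pi / l) * x $ 1)"
  have q: "1 - 2 * ?y * (1 - ?y) * (1 - ?c) < \<delta>\<^sup>2"
    using assms(1) unfolding rr_def cmod_qq by (smt (verit) zero_le_power2)
  have y: "0 \<le> ?y * (1 - ?y)" "?y * (1 - ?y) \<le> 1/4"
  proof -
    show "0 \<le> ?y * (1 - ?y)" using fr_bounds[of "x $ 2"] by simp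
    have "0 \<le> (?y - 1/2)\<^sup>2" by simp
    then show "?y * (1 - ?y) \<le> 1/4" by (simp add: power2_eq_square algebra_simps)
  qed
  have c: "1 - ?c \<le> 2" "0 \<le> 1 - ?c" using cos_ge_minus_one[of "(2 * pi / l) * x $ 1"] by auto
  have "?y * (1 - ?y) * (1 - ?c) \<le> ?y * (1 - ?y) * 2" using y c by (intro mult_left_mono) auto
  then have "4 * (?y - 1/2)\<^sup>2 < \<delta>\<^sup>2" using q by (simp add: power2_eq_square algebra_simps)
  then have "(?y - 1/2)\<^sup>2 < \<delta>\<^sup>2" by (smt (verit) zero_le_power2)
  then show "\<bar>?y - 1/2\<bar> < \<delta>" using assms(2) by (simp add: real_less_rsqrt abs_le_square_iff power2_less_imp_less[of "\<bar>?y - 1/2\<bar>" \<delta>])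
  \<comment> \<open>Measured from the middle of a cell the cosine changes sign, and whole cells drop
    out by periodicity.\<close>
  have w: "(2 * pi / l) * x $ 1 = 2 * pi * ?t + pi + 2 * pi * cell (x $ 1)"
    by (simp add: fr_def algebra_simps)
  have "?c = cos (2 * pi * ?t + pi)"
    unfolding w cell_def by (subst cos_add) (simp only: cos_int_2pin sin_int_2pin mult_1_right mult_zero_right diff_zero)
  then have cc: "?c = - cos (2 * pi * ?t)" by simp
  have t: "\<bar>?t\<bar> \<le> 1/2" using fr_bounds[of "x $ 1"] by linarith
  have c2: "2 * ?t\<^sup>2 \<le> 1 + ?c" using cos_2pi_le[OF t] unfolding cc by linarith
  have "2 * ?y * (1 - ?y) * (1 - ?c) \<le> (1/2) * (1 - ?c)" using y c by (intro mult_right_mono) auto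
  then have "1 - (1/2) * (1 - ?c) < \<delta>\<^sup>2" using q by (smt (verit))
  moreover have "?t\<^sup>2 \<le> 1 - (1/2) * (1 - ?c)" using c2 by argo
  ultimately have "?t\<^sup>2 < \<delta>\<^sup>2" by (rule le_less_trans[rotated])
  then show "\<bar>?t\<bar> < \<delta>" using assms(2) power2_less_imp_less[of "\<bar>?t\<bar>" \<delta>] by simp
qed

text \<open>Square columns of half width \<open>\<delta> * l\<close> around the vortex lines, for
  all cells that can meet the ball of radius \<open>R\<close>.\<close>

definition core :: "real \<Rightarrow> real \<Rightarrow> R3 set" where
  "core R \<delta> = (\<Union>(m, n) \<in> {\<lfloor>- R / l\<rfloor>..\<lfloor>R / l\<rfloor>} \<times> {\<lfloor>- R / l\<rfloor>..\<lfloor>R / l\<rfloor>}.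
     cbox (vector [(of_int m + 1/2 - \<delta>) * l, (of_int n + 1/2 - \<delta>) * l, - R])
          (vector [(of_int m + 1/2 + \<delta>) * l, (of_int n + 1/2 + \<delta>) * l, R]))"

lemma core_measurable [measurable]: "core R \<delta> \<in> sets borel"
  unfolding core_def by (intro sets.countable_UN') auto

text \<open>There are at most \<open>(4 * R / l)^2\<close> columns, each of cross section
  \<open>(2 * \<delta> * l)^2\<close> and height \<open>2 * R\<close>, so the cell side
  cancels.\<close>

lemma core_emeasure:
  assumes R: "l \<le> R" and \<delta>: "0 < \<delta>"
  shows "emeasure lborel (core R \<delta>) \<le> ennreal (128 * R^3 * \<delta>\<^sup>2)"
proof -
  let ?J = "{\<lfloor>- R / l\<rfloor>..\<lfloor>R / l\<rfloor>}"
  let ?b = "\<lambda>(m, n). cbox (vector [(of_int m + 1/2 - \<delta>) * l, (of_int n + 1/2 - \<delta>) * l, - R])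
          (vector [(of_int m + 1/2 + \<delta>) * l, (of_int n + 1/2 + \<delta>) * l, R]) :: R3 set"
  have R0: "0 < R" using R l(1) by simp
  have one: "emeasure lborel (?b p) \<le> ennreal ((2 * \<delta> * l)\<^sup>2 * (2 * R))" for p
  proof -
    obtain m n where p: "p = (m, n)" by (cases p)
    let ?u = "vector [(of_int m + 1/2 - \<delta>) * l, (of_int n + 1/2 - \<delta>) * l, - R] :: R3"
    let ?v = "vector [(of_int m + 1/2 + \<delta>) * l, (of_int n + 1/2 + \<delta>) * l, R] :: R3"
    have "measure lborel (cbox ?u ?v) = (2 * \<delta> * l)\<^sup>2 * (2 * R)"
    proof (subst content_cbox_cart)
      have "?u \<in> cbox ?u ?v" using \<delta> l(1) R0 by (auto simp: mem_box_cart forall_3 intro!: mult_right_mono)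
      then show "cbox ?u ?v \<noteq> {}" by blast
      show "(\<Prod>i\<in>UNIV. ?v $ i - ?u $ i) = (2 * \<delta> * l)\<^sup>2 * (2 * R)"
      proof -
        have w: "(a + 1/2 + \<delta>) * l - (a + 1/2 - \<delta>) * l = 2 * \<delta> * l" for a by (simp add: algebra_simps)
        have "(\<Prod>i\<in>UNIV. ?v $ i - ?u $ i) = ((of_int m + 1/2 + \<delta>) * l - (of_int m + 1/2 - \<delta>) * l) *
            ((of_int n + 1/2 + \<delta>) * l - (of_int n + 1/2 - \<delta>) * l) * (R - (- R))"
          unfolding UNIV_3 by simp
        then show ?thesis unfolding w by (simp add: power2_eq_square)
      qed
    qed
    then show ?thesis using emeasure_eq_ennreal_measure[of lborel "cbox ?u ?v"] emeasure_lborel_cbox_finite[of ?u ?v] p by simp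
  qed
  have J: "real (card ?J) \<le> 4 * R / l"
  proof -
    have "real_of_int (\<lfloor>R / l\<rfloor> + 1 - \<lfloor>- R / l\<rfloor>) \<le> 2 * (R / l) + 2" by linarith
    also have "\<dots> \<le> 4 * R / l" using R l(1) by (simp add: field_simps)
    finally have le: "real_of_int (\<lfloor>R / l\<rfloor> + 1 - \<lfloor>- R / l\<rfloor>) \<le> 4 * R / l" .
    have "- R / l \<le> R / l" using R0 l(1) by (intro divide_right_mono) auto
    then have "\<lfloor>- R / l\<rfloor> \<le> \<lfloor>R / l\<rfloor>" by (rule floor_mono)
    then have "real (card ?J) = real_of_int (\<lfloor>R / l\<rfloor> + 1 - \<lfloor>- R / l\<rfloor>)" unfolding card_atLeastAtMost_int by simp
    then show ?thesis using le by simp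
  qed
  have "emeasure lborel (core R \<delta>) \<le> (\<Sum>p\<in>?J \<times> ?J. emeasure lborel (?b p))"
    unfolding core_def by (rule emeasure_subadditive_finite) auto
  also have "\<dots> \<le> (\<Sum>p\<in>?J \<times> ?J. ennreal ((2 * \<delta> * l)\<^sup>2 * (2 * R)))" by (rule sum_mono) (rule one)
  also have "\<dots> = ennreal (real (card (?J \<times> ?J)) * ((2 * \<delta> * l)\<^sup>2 * (2 * R)))"
    by (simp only: sum_constant) (simp add: ennreal_mult' ennreal_of_nat_eq_real_of_nat)
  also have "\<dots> \<le> ennreal (128 * R^3 * \<delta>\<^sup>2)"
  proof (rule ennreal_leI)
    have "real (card (?J \<times> ?J)) * ((2 * \<delta> * l)\<^sup>2 * (2 * R)) \<le> (4 * R / l * (4 * R / l)) * ((2 * \<delta> * l)\<^sup>2 * (2 * R))"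
      unfolding card_cartesian_product of_nat_mult using J R0 l(1) by (intro mult_right_mono mult_mono) auto
    also have "\<dots> = 128 * R^3 * \<delta>\<^sup>2" using l(1) by (simp add: power2_eq_square power3_eq_cube)
    finally show "real (card (?J \<times> ?J)) * ((2 * \<delta> * l)\<^sup>2 * (2 * R)) \<le> 128 * R^3 * \<delta>\<^sup>2" .
  qed
  finally show ?thesis .
qed

lemma core_covers:
  assumes x: "norm x \<le> R" and r: "rr x < \<delta>\<^sup>2" and \<delta>: "0 < \<delta>"
  shows "x \<in> core R \<delta>"
proof -
  have c: "\<bar>x $ i\<bar> \<le> R" for i using component_le_norm_cart[of x i] x by simp
  have J: "\<lfloor>x $ i / l\<rfloor> \<in> {\<lfloor>- R / l\<rfloor>..\<lfloor>R / l\<rfloor>}" for i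
    unfolding atLeastAtMost_iff using c[of i] l(1)
    by (intro conjI floor_mono divide_right_mono) (simp_all add: abs_le_iff)
  have b: "(of_int \<lfloor>x $ i / l\<rfloor> + 1/2 - \<delta>) * l \<le> x $ i" "x $ i \<le> (of_int \<lfloor>x $ i / l\<rfloor> + 1/2 + \<delta>) * l"
    if "\<bar>fr (x $ i) - 1/2\<bar> < \<delta>" for i
  proof -
    have "of_int \<lfloor>x $ i / l\<rfloor> + 1/2 - \<delta> \<le> x $ i / l" "x $ i / l \<le> of_int \<lfloor>x $ i / l\<rfloor> + 1/2 + \<delta>"
      using that by (auto simp: fr_def cell_def abs_less_iff)
    then show "(of_int \<lfloor>x $ i / l\<rfloor> + 1/2 - \<delta>) * l \<le> x $ i" "x $ i \<le> (of_int \<lfloor>x $ i / l\<rfloor> + 1/2 + \<delta>) * l"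
      using l(1) by (simp_all add: pos_le_divide_eq pos_divide_le_eq)
  qed
  have 3: "- R \<le> x $ 3" "x $ 3 \<le> R" using c[of 3] by auto
  note L = level_set[OF r \<delta>]
  show ?thesis unfolding core_def
    by (rule UN_I[of "(\<lfloor>x $ 1 / l\<rfloor>, \<lfloor>x $ 2 / l\<rfloor>)"])
       (use J[of 1] J[of 2] b[OF L(1)] b[OF L(2)] 3 in \<open>auto simp: mem_box_cart forall_3\<close>)
qed

text \<open>For the least \<open>k\<close> with \<open>(1/4)^k \<le> rr x\<close>, the value
  \<open>1 / rr x\<close> is at most \<open>4^k\<close>, and minimality puts \<open>x\<close> into
  the core with parameter \<open>2 * (1/2)^k\<close>. The layers stop at \<open>K\<close> because
  \<open>rr\<close> never falls below \<open>\<epsilon>^2\<close>; the case \<open>k = 0\<close>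
  uses \<open>\<epsilon> \<le> 1\<close>.\<close>

lemma inverse_rr_layers:
  assumes \<epsilon>1: "\<epsilon> \<le> 1" and K: "(1/4)^K \<le> \<epsilon>\<^sup>2" and x: "norm x \<le> R"
  shows "1 / rr x \<le> (\<Sum>k\<le>K. 4^k * indicator (core R (2 * (1/2)^k)) x)"
proof -
  define k where "k = (LEAST k. (1/4)^k \<le> rr x)"
  have ex: "(1/4)^K \<le> rr x" using K rr_bounds(2)[of x] by linarith
  have k: "(1/4)^k \<le> rr x" unfolding k_def using ex by (rule LeastI)
  have kK: "k \<le> K" unfolding k_def using ex by (rule Least_le)
  have up: "rr x < (2 * (1/2)^k)\<^sup>2"
  proof (cases k)
    case 0
    have "rr x \<le> 1 + 1" using rr_bounds(3)[of x] power_le_one[OF less_imp_le[OF \<epsilon>] \<epsilon>1, of 2] by linarith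
    then show ?thesis using 0 by simp
  next
    case (Suc j)
    have "\<not> (1/4)^j \<le> rr x" using not_less_Least[of j "\<lambda>k. (1/4)^k \<le> rr x"] Suc k_def by auto
    moreover have "(2 * (1/2)^k)\<^sup>2 = ((1/4)^j :: real)"
      unfolding Suc by (simp add: power_mult_distrib power2_eq_square) (simp add: power_mult_distrib[symmetric])
    ultimately show ?thesis by simp
  qed
  have "1 / rr x \<le> 4^k"
  proof -
    have "1 / rr x \<le> 1 / (1/4)^k" using k by (intro divide_left_mono) (auto intro: mult_pos_pos rr_bounds)
    then show ?thesis by (simp add: power_divide)
  qed
  also have "\<dots> = 4^k * indicator (core R (2 * (1/2)^k)) x" using core_covers[OF x up] by simp
  also have "\<dots> \<le> (\<Sum>k\<le>K. 4^k * indicator (core R (2 * (1/2)^k)) x)"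
    using kK by (intro member_le_sum) auto
  finally show ?thesis .
qed

text \<open>Each of the \<open>K + 1\<close> dyadic layers around the vortex lines contributes the same amount, which is
  where the logarithm comes from.\<close>

lemma integral_inverse_rr:
  assumes \<epsilon>1: "\<epsilon> \<le> 1" and K: "(1/4)^K \<le> \<epsilon>\<^sup>2" and R: "l \<le> R" and U: "U \<subseteq> cball 0 R"
  shows "(\<integral>\<^sup>+x\<in>U. ennreal (1 / rr x) \<partial>lborel) \<le> ennreal (512 * R^3 * (real K + 1))"
proof -
  let ?c = "\<lambda>k. core R (2 * (1/2)^k)"
  have R0: "0 < R" using R l(1) by simp
  have "(\<integral>\<^sup>+x\<in>U. ennreal (1 / rr x) \<partial>lborel) \<le> (\<integral>\<^sup>+x. (\<Sum>k\<le>K. ennreal (4^k) * indicator (?c k) x) \<partial>lborel)"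
  proof (rule nn_integral_mono)
    fix x :: R3
    show "ennreal (1 / rr x) * indicator U x \<le> (\<Sum>k\<le>K. ennreal (4^k) * indicator (?c k) x)"
    proof (cases "x \<in> U")
      case True
      then have "norm x \<le> R" using U by auto
      from ennreal_leI[OF inverse_rr_layers[OF \<epsilon>1 K this]]
      have "ennreal (1 / rr x) \<le> (\<Sum>k\<le>K. ennreal (4^k * indicator (?c k) x))" by (subst sum_ennreal) auto
      also have "\<dots> = (\<Sum>k\<le>K. ennreal (4^k) * indicator (?c k) x)"
        by (intro sum.cong refl) (auto simp: indicator_def)
      finally show ?thesis using True by simp
    qed simp
  qed
  also have "\<dots> = (\<Sum>k\<le>K. ennreal (4^k) * emeasure lborel (?c k))"
    by (subst nn_integral_sum) (auto simp: nn_integral_cmult_indicator)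
  also have "\<dots> \<le> (\<Sum>k\<le>K. ennreal (512 * R^3))"
  proof (rule sum_mono)
    fix k
    have "ennreal (4^k) * emeasure lborel (?c k) \<le> ennreal (4^k) * ennreal (128 * R^3 * (2 * (1/2)^k)\<^sup>2)"
      by (intro mult_left_mono core_emeasure R) auto
    also have "\<dots> = ennreal (4^k * (128 * R^3 * (2 * (1/2)^k)\<^sup>2))" using R0 by (simp add: ennreal_mult')
    also have "4^k * (128 * R^3 * (2 * (1/2)^k)\<^sup>2) = 512 * R^3"
    proof -
      have "((1/2)^k)\<^sup>2 = (1/4 :: real)^k" by (simp add: power_mult[symmetric] power_mult_distrib mult.commute[of k]) (simp add: power_mult power_divide)
      moreover have "4^k * (1/4 :: real)^k = 1" by (simp add: power_mult_distrib[symmetric])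
      ultimately show ?thesis by (simp add: power_mult_distrib mult_ac)
    qed
    finally show "ennreal (4^k) * emeasure lborel (?c k) \<le> ennreal (512 * R^3)" .
  qed
  also have "\<dots> = ennreal (512 * R^3 * (real K + 1))"
  proof -
    have "(\<Sum>k\<le>K. ennreal (512 * R^3)) = ennreal (real (card {..K})) * ennreal (512 * R^3)"
      by (simp only: sum_constant ennreal_of_nat_eq_real_of_nat)
    also have "\<dots> = ennreal (real (card {..K}) * (512 * R^3))" by (rule ennreal_mult'[symmetric]) (use R0 in simp)
    also have "real (card {..K}) * (512 * R^3) = 512 * R^3 * (real K + 1)" by simp
    finally show ?thesis .
  qed
  finally show ?thesis .
qed

end

lemma L2_on_bounded:
  fixes f :: "R3 \<Rightarrow> complex"
  assumes f: "f \<in> borel_measurable borel" and b: "\<And>K. compact K \<Longrightarrow> bounded (f ` K)" and U: "bounded U"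
  shows "L2_on U f"
proof -
  have "compact (closure U)" using U by simp
  from b[OF this] obtain M where M: "\<And>x. x \<in> closure U \<Longrightarrow> norm (f x) \<le> M" by (auto simp: bounded_iff)
  have "(\<integral>\<^sup>+x\<in>U. ennreal ((norm (f x))\<^sup>2) \<partial>lebesgue) \<le> (\<integral>\<^sup>+x. ennreal (M\<^sup>2) * indicator (closure U) x \<partial>lebesgue)"
  proof (rule nn_integral_mono)
    fix x
    show "ennreal ((norm (f x))\<^sup>2) * indicator U x \<le> ennreal (M\<^sup>2) * indicator (closure U) x"
    proof (cases "x \<in> U")
      case True
      then have "x \<in> closure U" using closure_subset by auto
      then show ?thesis using True M[of x] by (simp add: power_mono ennreal_leI)
    qed simp
  qed
  also have "\<dots> = ennreal (M\<^sup>2) * emeasure lebesgue (closure U)"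
    by (intro nn_integral_cmult_indicator) auto
  also have "\<dots> < \<infinity>"
    using emeasure_compact_finite[OF \<open>compact (closure U)\<close>] by (simp add: ennreal_mult_less_top)
  finally have fin: "(\<integral>\<^sup>+x\<in>U. ennreal ((norm (f x))\<^sup>2) \<partial>lebesgue) < \<infinity>" .
  have "f \<in> borel_measurable lborel" using f by simp
  then show ?thesis
    unfolding L2_on_def using measurable_restrict_space1[OF measurable_completion] fin by blast
qed

context vortex_lattice
begin

lemma H1_\<psi>0: assumes "bounded U" shows "H1 U \<psi>0"
proof -
  have "bounded ((\<lambda>_. 0 :: complex) ` K)" for K :: "R3 set" by (rule bounded_subset[of "{0}"]) auto
  then have "L2_on U \<psi>0" "L2_on U g1" "L2_on U g2" "L2_on U (\<lambda>_. 0 :: complex)"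
    using bounded_test_state by (auto intro!: L2_on_bounded assms)
  then have "\<exists>g. weak_pd U j \<psi>0 g \<and> L2_on U g" for j
    using exhaust_3[of j] weak_pd_1[of U] weak_pd_2[of U] weak_pd_3[of U] by blast
  then show ?thesis using \<open>L2_on U \<psi>0\<close> by (simp add: H1_def)
qed

lemma energy_upper:
  assumes U: "open U" "U \<subseteq> cball 0 R" and R: "l \<le> R" and \<epsilon>1: "\<epsilon> \<le> 1" and H: "\<kappa> * H = B"
    and L: "1 \<le> ln (\<kappa> / sqrt B)"
  shows "GL_energy U \<kappa> H \<psi>0 Fpot \<le> ennreal (240000 * R^3 * (B * ln (\<kappa> / sqrt B)))"
proof -
  define L where "L = ln (\<kappa> / sqrt B)"
  define K where "K = nat \<lceil>log 2 (1 / \<epsilon>)\<rceil>"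
  have R0: "0 < R" using R l(1) by simp
  have \<epsilon>inv: "1 / \<epsilon> = \<kappa> / sqrt B * sqrt (2 * pi)"
    by (simp add: \<epsilon>_def l_def real_sqrt_divide)
  have lnL: "ln (1 / \<epsilon>) \<le> L + 2"
  proof -
    have "sqrt (2 * pi) \<le> 3" using pi_approx by (intro real_le_lsqrt) auto
    moreover have "ln (sqrt (2 * pi)) \<le> sqrt (2 * pi) - 1" by (intro ln_le_minus_one) simp
    moreover have "ln (1 / \<epsilon>) = L + ln (sqrt (2 * pi))"
      unfolding \<epsilon>inv L_def using \<kappa> B by (intro ln_mult_pos) auto
    ultimately show ?thesis by linarith
  qed
  have K: "(1/4)^K \<le> \<epsilon>\<^sup>2"
  proof -
    have "1 / \<epsilon> = 2 powr log 2 (1 / \<epsilon>)" using \<epsilon> by simp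
    also have "\<dots> \<le> 2 powr real K" unfolding K_def by (intro powr_mono) (linarith, simp)
    also have "\<dots> = 2 ^ K" by (simp add: powr_realpow)
    finally have "1 / 2 ^ K \<le> \<epsilon>" using \<epsilon> by (simp add: field_simps)
    then have "(1 / 2 ^ K)\<^sup>2 \<le> \<epsilon>\<^sup>2" by (intro power_mono) auto
    moreover have "(1 / 2 ^ K)\<^sup>2 = (1/4 :: real)^K" by (simp add: power2_eq_square power_divide power_mult_distrib[symmetric])
    ultimately show ?thesis by simp
  qed
  \<comment> \<open>From \<open>2/3 \<le> ln 2\<close> and
    \<open>ln (1 / \<epsilon>) \<le> L + 2\<close> one gets at most
    \<open>3/2 * (L + 2) + 2\<close>, and \<open>1 \<le> L\<close> absorbs the constants.\<close>
  have K2: "real K + 1 \<le> 7 * L"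
  proof -
    have l0: "0 \<le> ln (1 / \<epsilon>)" using \<epsilon> \<epsilon>1 by (intro ln_ge_zero) (simp add: field_simps)
    have "log 2 (1 / \<epsilon>) \<le> 3/2 * ln (1 / \<epsilon>)"
    proof -
      have "ln (1 / \<epsilon>) / ln 2 \<le> ln (1 / \<epsilon>) / (2/3)" using l0 ln2_ge_two_thirds by (intro divide_left_mono) auto
      then show ?thesis by (simp add: log_def)
    qed
    moreover have "real K \<le> log 2 (1 / \<epsilon>) + 1" unfolding K_def using l0 by (simp add: log_def)
    ultimately show ?thesis using lnL L by (simp add: L_def)
  qed
  have ae: "AE x in lborel. x \<in> U \<longrightarrow> wpd U 1 \<psi>0 x = g1 x \<and> wpd U 2 \<psi>0 x = g2 x \<and> wpd U 3 \<psi>0 x = 0"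
    using weak_pd_unique_complex[OF U(1) wpd_works[OF weak_pd_1] weak_pd_1]
      weak_pd_unique_complex[OF U(1) wpd_works[OF weak_pd_2] weak_pd_2]
      weak_pd_unique_complex[OF U(1) wpd_works[OF weak_pd_3] weak_pd_3]
    by eventually_elim auto
  have comps: "Fpot x $ 1 = - x $ 2 / 2" "Fpot x $ 2 = x $ 1 / 2" "Fpot x $ 3 = 0" for x
    by (simp_all add: Fpot_def)
  have "(\<integral>\<^sup>+x\<in>U. ennreal (GL_density U \<kappa> H \<psi>0 Fpot x) \<partial>lborel) \<le> (\<integral>\<^sup>+x. ennreal (400 / l\<^sup>2) * (ennreal (1 / rr x) * indicator U x) \<partial>lborel)"
  proof (rule nn_integral_mono_AE, use ae in eventually_elim)
    fix x
    assume x: "x \<in> U \<longrightarrow> wpd U 1 \<psi>0 x = g1 x \<and> wpd U 2 \<psi>0 x = g2 x \<and> wpd U 3 \<psi>0 x = 0"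
    show "ennreal (GL_density U \<kappa> H \<psi>0 Fpot x) * indicator U x \<le> ennreal (400 / l\<^sup>2) * (ennreal (1 / rr x) * indicator U x)"
    proof (cases "x \<in> U")
      case True
      have "GL_density U \<kappa> H \<psi>0 Fpot x \<le> 400 / (l\<^sup>2 * rr x)"
        using density_bound[of x] x True by (simp add: GL_density_def sum_3 comps H)
      also have "\<dots> = 400 / l\<^sup>2 * (1 / rr x)" by simp
      finally show ?thesis using True rr_bounds(1)[of x]
        by (simp add: ennreal_leI flip: ennreal_mult'')
    qed simp
  qed
  also have "\<dots> = ennreal (400 / l\<^sup>2) * (\<integral>\<^sup>+x\<in>U. ennreal (1 / rr x) \<partial>lborel)"
  proof (rule nn_integral_cmult)
    have [measurable]: "cis \<in> borel_measurable borel" by (intro borel_measurable_continuous_onI continuous_intros)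
    have [measurable]: "U \<in> sets borel" using U(1) by simp
    show "(\<lambda>x. ennreal (1 / rr x) * indicator U x) \<in> borel_measurable lborel"
      unfolding rr_def qq_def fr_def cell_def by measurable
  qed
  also have "\<dots> \<le> ennreal (400 / l\<^sup>2) * ennreal (512 * R^3 * (real K + 1))"
    by (intro mult_left_mono integral_inverse_rr \<epsilon>1 K R U) auto
  also have "\<dots> = ennreal (400 / l\<^sup>2 * (512 * R^3 * (real K + 1)))" by (rule ennreal_mult'[symmetric]) simp
  also have "\<dots> \<le> ennreal (240000 * R^3 * (B * L))"
  proof (rule ennreal_leI)
    have BL: "0 \<le> B * L" using B L by (simp add: L_def)
    have "1 / l\<^sup>2 = B / (2 * pi)" using l by (simp add: field_simps)
    also have "\<dots> \<le> B / 6" using B pi_approx by (intro divide_left_mono) auto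
    finally have "1 / l\<^sup>2 \<le> B / 6" .
    then have "(1 / l\<^sup>2) * (R^3 * (real K + 1)) \<le> (B / 6) * (R^3 * (7 * L))"
      using K2 R0 B by (intro mult_mono) auto
    then have "204800 * ((1 / l\<^sup>2) * (R^3 * (real K + 1))) \<le> 204800 * ((B / 6) * (R^3 * (7 * L)))" by (rule mult_left_mono) simp
    moreover have "400 / l\<^sup>2 * (512 * R^3 * (real K + 1)) = 204800 * ((1 / l\<^sup>2) * (R^3 * (real K + 1)))" by simp
    ultimately have "400 / l\<^sup>2 * (512 * R^3 * (real K + 1)) \<le> 204800 * ((B / 6) * (R^3 * (7 * L)))" by (simp only:)
    also have "\<dots> \<le> 240000 * R^3 * (B * L)"
      using mult_nonneg_nonneg[of "R^3" "B * L"] R0 BL by (simp add: algebra_simps)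
    finally show "400 / l\<^sup>2 * (512 * R^3 * (real K + 1)) \<le> 240000 * R^3 * (B * L)" .
  qed
  finally show ?thesis
    unfolding GL_energy_def field_energy_Fpot L_def by (simp add: nn_integral_completion)
qed

end

section \<open>The lower bound\<close>

text \<open>\<open>Hdiv_F\<close> supplies derivatives in all directions for
  \<open>A - Fpot\<close>; adding the explicit ones of \<open>Fpot\<close> gives those of
  \<open>A\<close>, including the mixed ones in the curl.\<close>

lemma Hdiv_F_weak_pd: "Hdiv_F A \<Longrightarrow> weak_pd UNIV j (comp A k) (wpd UNIV j (comp A k))"
proof -
  assume "Hdiv_F A"
  then obtain g where g: "weak_pd UNIV j (\<lambda>x. A x $ k - Fpot x $ k) g"
    unfolding Hdiv_F_def Hdot1_def by blast
  have "(\<lambda>x. (A x $ k - Fpot x $ k) + comp Fpot k x) = comp A k" by (simp add: comp_def fun_eq_iff)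
  then have "weak_pd UNIV j (comp A k) (\<lambda>x. g x + dF k j)" using weak_pd_add[OF g weak_pd_Fpot[of j k]] by simp
  then show ?thesis by (rule wpd_works)
qed

lemma line_pd_subset: "line_pd U j u g \<Longrightarrow> V \<subseteq> U \<Longrightarrow> line_pd V j u g"
  unfolding line_pd_def by (meson subsetD)

text \<open>The spacing is \<open>s = 1 / \<kappa>\<close> and the coupling
  \<open>q = \<kappa> * H\<close>, so the flux per plaquette is
  \<open>q * s^2 = H / \<kappa>\<close>. Taking out \<open>s^2\<close> turns the lattice weights
  into those of \<open>GL_density\<close>. Passing to the full density adds the nonnegative third
  gradient component, and the flux deviation is controlled by the third component of the
  curl.\<close>

lemma lower_bound_at:
  assumes \<eta>: "0 < \<eta>" "\<eta> \<le> 1/4" and \<kappa>: "0 < \<kappa>" and H: "0 < H"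
    and disc: "\<And>u \<alpha>. (\<Sum>g\<in>{0..int N - 2} \<times> {0..int N - 2}. (ecurl \<alpha> g - H / \<kappa>)\<^sup>2) \<le> (\<eta> * real N * (H / \<kappa>))\<^sup>2 \<Longrightarrow>
      c * (real N)\<^sup>2 * (H / \<kappa>) \<le> lattice_gl.energy u \<alpha> N"
    and c: "0 \<le> c" and N: "0 < N"
    and \<Omega>: "open \<Omega>" and D: "open D" "D \<subseteq> \<Omega>" and K: "compact K" and sep: "\<And>x. x \<in> K \<Longrightarrow> cball x \<delta> \<subseteq> D"
    and small: "(2 * real N + 2) / \<kappa> \<le> \<delta>"
    and \<psi>: "H1 \<Omega> \<psi>" and A: "Hdiv_F A"
    and F: "(\<integral>\<^sup>+x. ennreal ((norm (weak_curl A x - beta))\<^sup>2) \<partial>lebesgue) \<le> ennreal F" "0 \<le> F"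
  shows "ennreal (c * (\<kappa> * H) * (measure lborel K - F / \<eta>\<^sup>2)) \<le> (\<integral>\<^sup>+x\<in>D. ennreal (GL_density \<Omega> \<kappa> H \<psi> A x) \<partial>lebesgue)"
proof -
  have wG: "weak_pd \<Omega> j \<psi> (wpd \<Omega> j \<psi>)" for j
    using \<psi> wpd_works unfolding H1_def by blast
  have lG: "loc_int \<Omega> \<psi>" "loc_int \<Omega> (wpd \<Omega> j \<psi>)" for j using wG by (auto simp: weak_pd_def)
  have wA: "weak_pd UNIV j (comp A k) (wpd UNIV j (comp A k))" for j k by (rule Hdiv_F_weak_pd[OF A])
  have lA: "loc_int UNIV (comp A k)" "loc_int UNIV (wpd UNIV j (comp A k))" for j k using wA by (auto simp: weak_pd_def)
  obtain \<psi>' where \<psi>': "borel_rep \<Omega> \<psi> \<psi>'" using borel_rep_exists_complex[OF \<Omega> lG(1)] by blast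
  obtain G1 where G1: "borel_rep \<Omega> (wpd \<Omega> 1 \<psi>) G1" using borel_rep_exists_complex[OF \<Omega> lG(2)] by blast
  obtain G2 where G2: "borel_rep \<Omega> (wpd \<Omega> 2 \<psi>) G2" using borel_rep_exists_complex[OF \<Omega> lG(2)] by blast
  obtain a1 where a1: "borel_rep UNIV (comp A 1) a1" using borel_rep_exists_real[OF open_UNIV lA(1)] by blast
  obtain a2 where a2: "borel_rep UNIV (comp A 2) a2" using borel_rep_exists_real[OF open_UNIV lA(1)] by blast
  obtain h12 where h12: "borel_rep UNIV (wpd UNIV 2 (comp A 1)) h12" using borel_rep_exists_real[OF open_UNIV lA(2)] by blast
  obtain h21 where h21: "borel_rep UNIV (wpd UNIV 1 (comp A 2)) h21" using borel_rep_exists_real[OF open_UNIV lA(2)] by blast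
  have [measurable]: "\<psi>' \<in> borel_measurable borel" "G1 \<in> borel_measurable borel" "G2 \<in> borel_measurable borel"
    "a1 \<in> borel_measurable borel" "a2 \<in> borel_measurable borel" "h12 \<in> borel_measurable borel" "h21 \<in> borel_measurable borel"
    using \<psi>' G1 G2 a1 a2 h12 h21 by (auto simp: borel_rep_def)
  have [measurable]: "D \<in> sets borel" using D by simp
  have curl: "(\<integral>\<^sup>+x. ennreal ((h21 x - h12 x - 1)\<^sup>2) \<partial>lborel) \<le> ennreal F"
  proof -
    have "AE x in lborel. h12 x = wpd UNIV 2 (comp A 1) x" "AE x in lborel. h21 x = wpd UNIV 1 (comp A 2) x"
      using h12 h21 by (auto simp: borel_rep_def)
    then have "AE x in lborel. ennreal ((h21 x - h12 x - 1)\<^sup>2) \<le> ennreal ((norm (weak_curl A x - beta))\<^sup>2)"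
    proof eventually_elim
      fix x assume h: "h12 x = wpd UNIV 2 (comp A 1) x" "h21 x = wpd UNIV 1 (comp A 2) x"
      have "(weak_curl A x - beta) $ 3 = h21 x - h12 x - 1" by (simp add: weak_curl_def beta_def h)
      then have "\<bar>h21 x - h12 x - 1\<bar> \<le> norm (weak_curl A x - beta)" by (metis component_le_norm_cart)
      then have "\<bar>h21 x - h12 x - 1\<bar>\<^sup>2 \<le> (norm (weak_curl A x - beta))\<^sup>2" by (rule power_mono) simp
      then show "ennreal ((h21 x - h12 x - 1)\<^sup>2) \<le> ennreal ((norm (weak_curl A x - beta))\<^sup>2)" by (intro ennreal_leI) simp
    qed
    then have "(\<integral>\<^sup>+x. ennreal ((h21 x - h12 x - 1)\<^sup>2) \<partial>lborel) \<le> (\<integral>\<^sup>+x. ennreal ((norm (weak_curl A x - beta))\<^sup>2) \<partial>lborel)"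
      by (rule nn_integral_mono_AE)
    then show ?thesis using F(1) by (simp add: nn_integral_completion)
  qed
  define s where "s = 1 / \<kappa>"
  have s: "0 < s" using \<kappa> by (simp add: s_def)
  let ?X = "\<lambda>x. (cmod (G1 x - \<i> * of_real (\<kappa> * H * a1 x) * \<psi>' x))\<^sup>2 + (cmod (G2 x - \<i> * of_real (\<kappa> * H * a2 x) * \<psi>' x))\<^sup>2"
  let ?P = "\<lambda>x. (1 - (cmod (\<psi>' x))\<^sup>2)\<^sup>2"
  have "ennreal (c * (real N)\<^sup>2 * (H / \<kappa>) * (measure lborel K - F / \<eta>\<^sup>2)) \<le>
     ennreal ((real N)\<^sup>2) * (\<integral>\<^sup>+x\<in>D. ennreal (s\<^sup>2 * ?X x + ?P x / 2) \<partial>lborel)"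
  proof (rule averaged_lower_bound[where q = "\<kappa> * H" and \<delta> = \<delta> and ?h12.0 = h12 and ?h21.0 = h21 and b = "H / \<kappa>"])
    show "line_pd D 1 \<psi>' G1" "line_pd D 2 \<psi>' G2"
      using line_pd_subset[OF line_pd_complex[OF \<Omega> wG \<psi>' G1] D(2)] line_pd_subset[OF line_pd_complex[OF \<Omega> wG \<psi>' G2] D(2)] .
    show "line_pd UNIV 1 a2 h21" "line_pd UNIV 2 a1 h12"
      using line_pd_real[OF open_UNIV wA a2 h21] line_pd_real[OF open_UNIV wA a1 h12] .
    show "set_integrable lborel K a1" "set_integrable lborel K a2" "set_integrable lborel K h12" "set_integrable lborel K h21"
      if "compact K" for K
      using that borel_rep_integrable[OF lA(1) a1] borel_rep_integrable[OF lA(1) a2]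
        borel_rep_integrable[OF lA(2) h12] borel_rep_integrable[OF lA(2) h21] by auto
    show "0 \<le> c * (real N)\<^sup>2 * (H / \<kappa>)" "0 < \<kappa> * H" "H / \<kappa> = \<kappa> * H * s\<^sup>2" "(2 * real N + 2) * s \<le> \<delta>"
      using c \<kappa> H small by (auto simp: s_def power2_eq_square)
  qed (use \<eta> disc N s D K sep curl F in auto)
  also have "(\<integral>\<^sup>+x\<in>D. ennreal (s\<^sup>2 * ?X x + ?P x / 2) \<partial>lborel) = (\<integral>\<^sup>+x. ennreal (s\<^sup>2) * (ennreal (?X x + \<kappa>\<^sup>2 / 2 * ?P x) * indicator D x) \<partial>lborel)"
  proof (rule nn_integral_cong)
    fix x
    have "s\<^sup>2 * ?X x + ?P x / 2 = s\<^sup>2 * (?X x + \<kappa>\<^sup>2 / 2 * ?P x)" using \<kappa> by (simp add: s_def field_simps)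
    then show "ennreal (s\<^sup>2 * ?X x + ?P x / 2) * indicator D x = ennreal (s\<^sup>2) * (ennreal (?X x + \<kappa>\<^sup>2 / 2 * ?P x) * indicator D x)"
      by (simp add: ennreal_mult' mult.assoc)
  qed
  also have "\<dots> = ennreal (s\<^sup>2) * (\<integral>\<^sup>+x\<in>D. ennreal (?X x + \<kappa>\<^sup>2 / 2 * ?P x) \<partial>lborel)"
    by (rule nn_integral_cmult) measurable
  also have "(\<integral>\<^sup>+x\<in>D. ennreal (?X x + \<kappa>\<^sup>2 / 2 * ?P x) \<partial>lborel) \<le> (\<integral>\<^sup>+x\<in>D. ennreal (GL_density \<Omega> \<kappa> H \<psi> A x) \<partial>lborel)"
  proof (rule nn_integral_mono_AE)
    have "AE x in lborel. x \<in> \<Omega> \<longrightarrow> \<psi>' x = \<psi> x" "AE x in lborel. x \<in> \<Omega> \<longrightarrow> G1 x = wpd \<Omega> 1 \<psi> x"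
      "AE x in lborel. x \<in> \<Omega> \<longrightarrow> G2 x = wpd \<Omega> 2 \<psi> x" "AE x in lborel. a1 x = A x $ 1" "AE x in lborel. a2 x = A x $ 2"
      using \<psi>' G1 G2 a1 a2 by (auto simp: borel_rep_def comp_def)
    then show "AE x in lborel. ennreal (?X x + \<kappa>\<^sup>2 / 2 * ?P x) * indicator D x \<le> ennreal (GL_density \<Omega> \<kappa> H \<psi> A x) * indicator D x"
    proof eventually_elim
      fix x
      assume h: "x \<in> \<Omega> \<longrightarrow> \<psi>' x = \<psi> x" "x \<in> \<Omega> \<longrightarrow> G1 x = wpd \<Omega> 1 \<psi> x"
      "x \<in> \<Omega> \<longrightarrow> G2 x = wpd \<Omega> 2 \<psi> x" "a1 x = A x $ 1" "a2 x = A x $ 2"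
      show "ennreal (?X x + \<kappa>\<^sup>2 / 2 * ?P x) * indicator D x \<le> ennreal (GL_density \<Omega> \<kappa> H \<psi> A x) * indicator D x"
      proof (cases "x \<in> D")
        case True
        then have "x \<in> \<Omega>" using D by auto
        then have "?X x + \<kappa>\<^sup>2 / 2 * ?P x \<le> GL_density \<Omega> \<kappa> H \<psi> A x"
          using h by (simp add: GL_density_def sum_3)
        then have "ennreal (?X x + \<kappa>\<^sup>2 / 2 * ?P x) \<le> ennreal (GL_density \<Omega> \<kappa> H \<psi> A x)" by (rule ennreal_leI)
        then show ?thesis by (rule mult_right_mono) simp
      qed simp
    qed
  qed
  finally have le: "ennreal (c * (real N)\<^sup>2 * (H / \<kappa>) * (measure lborel K - F / \<eta>\<^sup>2)) \<le>
     ennreal ((real N)\<^sup>2) * (ennreal (s\<^sup>2) * (\<integral>\<^sup>+x\<in>D. ennreal (GL_density \<Omega> \<kappa> H \<psi> A x) \<partial>lborel))" (is "_ \<le> _ * (_ * ?I)")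
    by (simp add: mult_left_mono)
  \<comment> \<open>Dividing by \<open>N^2 * s^2\<close> removes the grid from the inequality and
    leaves the factor \<open>\<kappa> * H\<close>.\<close>
  define a where "a = (real N)\<^sup>2 * s\<^sup>2"
  have a: "0 < a" using N s by (simp add: a_def)
  have "ennreal (1 / a) * ennreal (c * (real N)\<^sup>2 * (H / \<kappa>) * (measure lborel K - F / \<eta>\<^sup>2)) \<le> ennreal (1 / a) * (ennreal ((real N)\<^sup>2) * (ennreal (s\<^sup>2) * ?I))"
    using le by (rule mult_left_mono) simp
  also have "\<dots> = ennreal (1 / a * ((real N)\<^sup>2 * s\<^sup>2)) * ?I"
    using a by (subst ennreal_mult, simp, simp, subst ennreal_mult, simp, simp) (simp only: mult.assoc)
  also have "1 / a * ((real N)\<^sup>2 * s\<^sup>2) = 1" using N s by (simp add: a_def)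
  also have "ennreal (1 / a) * ennreal (c * (real N)\<^sup>2 * (H / \<kappa>) * (measure lborel K - F / \<eta>\<^sup>2)) =
     ennreal (1 / a * (c * (real N)\<^sup>2 * (H / \<kappa>) * (measure lborel K - F / \<eta>\<^sup>2)))"
    using a by (intro ennreal_mult'[symmetric]) simp
  also have "1 / a * (c * (real N)\<^sup>2 * (H / \<kappa>) * (measure lborel K - F / \<eta>\<^sup>2)) = c * (\<kappa> * H) * (measure lborel K - F / \<eta>\<^sup>2)"
    using N \<kappa> by (simp add: a_def s_def power2_eq_square)
  finally show ?thesis by (simp add: nn_integral_completion)
qed

text \<open>Inner regularity gives the compact set; its distance from the complement of
  \<open>D\<close> is the room into which the translated grids must fit.\<close>

lemma inner_compact:
  fixes D :: "R3 set"
  assumes D: "open D" "bounded D" and \<eta>: "0 < \<eta>"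
  obtains K \<delta> where "compact K" "0 < \<delta>" "\<And>x. x \<in> K \<Longrightarrow> cball x \<delta> \<subseteq> D" "measure lebesgue D - \<eta> \<le> measure lborel K"
proof -
  have Dl: "D \<in> lmeasurable" using D by (simp add: lmeasurable_open)
  then obtain K where K: "closed K" "K \<subseteq> D" "(D - K) \<in> lmeasurable" "emeasure lebesgue (D - K) < ennreal \<eta>"
    using sets_lebesgue_inner_closed[of D \<eta>] \<eta> by (metis fmeasurableD)
  have cK: "compact K" using K(1,2) D(2) bounded_subset compact_eq_bounded_closed by blast
  have "measure lebesgue (D - K) = measure lebesgue D - measure lebesgue K"
    using cK K(2) Dl by (intro measurable_measure_Diff) (auto intro: fmeasurableD lmeasurable_compact)
  moreover have "measure lebesgue (D - K) \<le> \<eta>"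
    unfolding measure_def using K(4) \<eta> by (intro enn2real_leI) auto
  moreover have "measure lebesgue K = measure lborel K" using cK by (simp add: borel_compact)
  ultimately have m: "measure lebesgue D - \<eta> \<le> measure lborel K" by linarith
  obtain \<delta> where \<delta>: "0 < \<delta>" "(\<Union>x\<in>K. cball x \<delta>) \<subseteq> D"
    using compact_subset_open_imp_cball_epsilon_subset[OF cK D(1) K(2)] by auto
  then have "cball x \<delta> \<subseteq> D" if "x \<in> K" for x using that by blast
  with cK \<delta>(1) m that show thesis by blast
qed

lemma field_energy_bound:
  assumes B: "0 < \<kappa> * H" and e: "GL_energy \<Omega> \<kappa> H \<psi> A \<le> ennreal (C * ((\<kappa> * H) * L))" and C: "0 \<le> C * L"
  shows "(\<integral>\<^sup>+x. ennreal ((norm (weak_curl A x - beta))\<^sup>2) \<partial>lebesgue) \<le> ennreal (C * L / (\<kappa> * H))"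
proof -
  let ?E = "\<integral>\<^sup>+x. ennreal ((norm (weak_curl A x - beta))\<^sup>2) \<partial>lebesgue"
  define B where "B = \<kappa> * H"
  have Bp: "0 < B" using B by (simp add: B_def)
  have "ennreal (B\<^sup>2) * ?E \<le> GL_energy \<Omega> \<kappa> H \<psi> A"
    unfolding GL_energy_def B_def power_mult_distrib by simp
  also have "\<dots> \<le> ennreal (B\<^sup>2 * (C * L / B))"
  proof -
    have "C * (B * L) = B\<^sup>2 * (C * L / B)" using Bp by (simp add: power2_eq_square)
    then show ?thesis using e unfolding B_def by simp
  qed
  also have "\<dots> = ennreal (B\<^sup>2) * ennreal (C * L / B)" using C Bp by (intro ennreal_mult) auto
  finally have "ennreal (B\<^sup>2) * ?E \<le> ennreal (B\<^sup>2) * ennreal (C * L / B)" .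
  then show ?thesis using Bp unfolding B_def[symmetric] by (subst (asm) ennreal_mult_le_mult_iff) auto
qed

lemma lower_bound_eventually:
  fixes \<Omega> D :: "R3 set" and H :: "real \<Rightarrow> real"
    and \<psi> :: "real \<Rightarrow> R3 \<Rightarrow> complex" and A :: "real \<Rightarrow> R3 \<Rightarrow> R3"
  assumes \<Omega>: "bounded \<Omega>" "open \<Omega>" and D: "D \<subseteq> \<Omega>" "open D"
    and H: "\<And>\<kappa>. \<kappa> > 0 \<Longrightarrow> H \<kappa> > 0"
    and lo: "(\<lambda>\<kappa>. ln \<kappa>) \<in> o[at_top](\<lambda>\<kappa>. \<kappa> * H \<kappa>)"
    and hi: "(\<lambda>\<kappa>. \<kappa> * H \<kappa>) \<in> o[at_top](\<lambda>\<kappa>. \<kappa>\<^sup>2)"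
    and min: "\<And>\<kappa>. \<kappa> > 0 \<Longrightarrow> GL_minimizer \<Omega> \<kappa> (H \<kappa>) (\<psi> \<kappa>) (A \<kappa>)"
    and \<eta>: "0 < \<eta>" "\<eta> \<le> 1/4"
  shows "\<forall>\<^sub>F \<kappa> in at_top. 1 \<le> ln (sqrt (\<kappa> / H \<kappa>)) \<and> 0 < \<kappa> * H \<kappa> \<and>
    ennreal ((1 - \<eta>) ^ 15 * (1 - 4 * \<eta>) * ln (sqrt (\<kappa> / H \<kappa>)) * (\<kappa> * H \<kappa>) * (measure lebesgue D - 2 * \<eta>))
      \<le> (\<integral>\<^sup>+x\<in>D. ennreal (GL_density \<Omega> \<kappa> (H \<kappa>) (\<psi> \<kappa>) (A \<kappa>) x) \<partial>lebesgue)"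
proof -
  obtain R where R: "0 < R" "\<Omega> \<subseteq> cball 0 R" 
  proof -
    obtain b where "0 < b" "\<forall>x\<in>\<Omega>. norm x \<le> b" using \<Omega>(1) by (auto simp: bounded_pos)
    then show thesis by (intro that[of b]) auto
  qed
  obtain b0 where b0: "0 < b0" and disc: "\<And>b N u \<alpha>. 0 < b \<Longrightarrow> b < b0 \<Longrightarrow> N = nat \<lceil>sqrt (1000 / \<eta> ^ 3 * ln (1 / sqrt b)) / sqrt b\<rceil> \<Longrightarrow>
     (\<Sum>g\<in>{0..int N - 2} \<times> {0..int N - 2}. (ecurl \<alpha> g - b)\<^sup>2) \<le> (\<eta> * real N * b)\<^sup>2 \<Longrightarrow>
     (1 - \<eta>) ^ 15 * (1 - 4 * \<eta>) * (real N)\<^sup>2 * b * ln (1 / sqrt b) \<le> lattice_gl.energy u \<alpha> N"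
    using discrete_lower_bound[OF \<eta>] by metis
  obtain K \<delta> where K: "compact K" "0 < \<delta>" "\<And>x. x \<in> K \<Longrightarrow> cball x \<delta> \<subseteq> D" "measure lebesgue D - \<eta> \<le> measure lborel K"
    using inner_compact[OF D(2) bounded_subset[OF \<Omega>(1) D(1)] \<eta>(1)] by blast
  define C where "C = 240000 * R^3"
  \<comment> \<open>The first entry makes \<open>C * L / B\<close> at most \<open>\<eta>^3\<close>,
    so the bad translations have measure at most \<open>\<eta>\<close>; the second makes
    \<open>N / \<kappa>\<close> small against \<open>\<delta>\<close>.\<close>
  define c1 where "c1 = min (\<eta>^3 / C) ((\<delta> / 4)\<^sup>2 * \<eta>^3 / 1000)"
  \<comment> \<open>The first entry gives \<open>b < b0\<close> for the discrete bound, the second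
    gives \<open>1 \<le> L\<close>.\<close>
  define b1 where "b1 = min (b0 / 2) (exp (-2))"
  have C: "0 < C" and c1: "0 < c1" and b1: "0 < b1" using R K(2) \<eta> b0 by (auto simp: C_def c1_def b1_def)
  have ev: "\<forall>\<^sub>F \<kappa>::real in at_top. \<bar>ln \<kappa>\<bar> \<le> c1 * \<bar>\<kappa> * H \<kappa>\<bar>" "\<forall>\<^sub>F \<kappa>::real in at_top. \<bar>ln \<kappa>\<bar> \<le> 1 * \<bar>\<kappa> * H \<kappa>\<bar>"
    "\<forall>\<^sub>F \<kappa>::real in at_top. \<bar>ln \<kappa>\<bar> \<le> (R\<^sup>2 / (2 * pi)) * \<bar>\<kappa> * H \<kappa>\<bar>"
    using landau_o.smallD[OF lo c1] landau_o.smallD[OF lo, of 1] landau_o.smallD[OF lo, of "R\<^sup>2 / (2 * pi)"] R by auto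
  have ev2: "\<forall>\<^sub>F \<kappa>::real in at_top. \<bar>\<kappa> * H \<kappa>\<bar> \<le> b1 * \<bar>\<kappa>\<^sup>2\<bar>"
    using landau_o.smallD[OF hi b1] by simp
  have ev3: "\<forall>\<^sub>F \<kappa>::real in at_top. max (exp 1) (8 / \<delta>) \<le> \<kappa>" by (rule eventually_ge_at_top)
  from ev ev2 ev3 show ?thesis
  proof eventually_elim
    fix \<kappa> :: real
    assume e: "\<bar>ln \<kappa>\<bar> \<le> c1 * \<bar>\<kappa> * H \<kappa>\<bar>" "\<bar>ln \<kappa>\<bar> \<le> 1 * \<bar>\<kappa> * H \<kappa>\<bar>" "\<bar>ln \<kappa>\<bar> \<le> (R\<^sup>2 / (2 * pi)) * \<bar>\<kappa> * H \<kappa>\<bar>"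
      "\<bar>\<kappa> * H \<kappa>\<bar> \<le> b1 * \<bar>\<kappa>\<^sup>2\<bar>" "max (exp 1) (8 / \<delta>) \<le> \<kappa>"
    have \<kappa>1: "exp 1 \<le> \<kappa>" and \<kappa>\<delta>: "8 / \<delta> \<le> \<kappa>" using e(5) by auto
    have \<kappa>: "0 < \<kappa>" using \<kappa>1 exp_gt_zero[of "1::real"] by linarith
    have h: "0 < H \<kappa>" by (rule H[OF \<kappa>])
    define B where "B = \<kappa> * H \<kappa>"
    define b where "b = H \<kappa> / \<kappa>"
    define L where "L = ln (sqrt (\<kappa> / H \<kappa>))"
    have B: "0 < B" and b: "0 < b" using \<kappa> h by (auto simp: B_def b_def)
    have bb: "b = B / \<kappa>\<^sup>2" using \<kappa> by (simp add: b_def B_def power2_eq_square)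
    have bb1: "b \<le> b1" using e(4) B \<kappa> unfolding bb by (simp add: B_def[symmetric] field_simps)
    have bs: "b < b0" "b \<le> exp (-2)" using bb1 b0 by (auto simp: b1_def)
    have L1: "L = ln (1 / sqrt b)" unfolding L_def b_def by (simp add: real_sqrt_divide)
    have L2: "L = ln (\<kappa> / sqrt B)"
    proof -
      have "sqrt (\<kappa> / H \<kappa>) = sqrt (\<kappa>\<^sup>2 / B)" using \<kappa> by (simp add: B_def power2_eq_square)
      also have "\<dots> = \<kappa> / sqrt B" using \<kappa> by (simp add: real_sqrt_divide)
      finally show ?thesis by (simp add: L_def)
    qed
    have Lge: "1 \<le> L"
    proof -
      have "ln b \<le> -2" using ln_mono[OF bs(2) b] by simp
      moreover have "L = - ln b / 2" using b by (simp add: L1 ln_div ln_sqrt)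
      ultimately show ?thesis by simp
    qed
    have lnk: "1 \<le> ln \<kappa>" using \<kappa>1 \<kappa> by (simp add: ln_ge_iff)
    have B1: "1 \<le> B" using e(2) lnk B by (simp add: B_def[symmetric])
    \<comment> \<open>\<open>L\<close> is \<open>ln \<kappa>\<close> minus half of
      \<open>ln B\<close>, so once \<open>1 \<le> B\<close> the hypothesis on
      \<open>ln \<kappa>\<close> controls \<open>L / B\<close>.\<close>
    have Lk: "L \<le> ln \<kappa>"
      using B1 \<kappa> by (simp add: L2 ln_div)
    have LB: "L / B \<le> c1"
    proof -
      have "L \<le> c1 * B" using e(1) Lk lnk B by (simp add: B_def[symmetric])
      then show ?thesis using B by (simp add: field_simps)
    qed
    interpret v: vortex_lattice B \<kappa> by standard (fact B \<kappa>)+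
    \<comment> \<open>The third smallness condition and \<open>1 \<le> ln \<kappa>\<close> give
      \<open>2 * pi / B \<le> R^2\<close>, so a cell is no larger than the ball.\<close>
    have lR: "v.l \<le> R"
    proof -
      have ab: "\<bar>ln \<kappa>\<bar> = ln \<kappa>" "\<bar>\<kappa> * H \<kappa>\<bar> = B" using lnk B by (auto simp: B_def)
      have "1 \<le> (R\<^sup>2 / (2 * pi)) * B" by (rule order_trans[OF lnk e(3)[unfolded ab]])
      then have "2 * pi \<le> R\<^sup>2 * B" by (simp add: pos_le_divide_eq)
      then have "2 * pi / B \<le> R\<^sup>2" using B by (simp add: pos_divide_le_eq)
      then show ?thesis unfolding v.l_def using R(1) by (intro real_le_lsqrt) auto
    qed
    have e1: "v.\<epsilon> \<le> 1"
    proof -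
      have "B \<le> \<kappa>\<^sup>2"
      proof -
        have "b \<le> 1" using bs(2) order_trans[of b "exp (-2)" 1] by simp
        then show ?thesis using \<kappa> by (simp add: bb)
      qed
      also have "\<dots> \<le> \<kappa>\<^sup>2 * (2 * pi)" using mult_left_mono[of 1 "2 * pi" "\<kappa>\<^sup>2"] pi_ge_two by simp
      finally have "1 \<le> \<kappa>\<^sup>2 * (2 * pi / B)" using B by (simp add: field_simps)
      then have "1 \<le> sqrt (\<kappa>\<^sup>2 * (2 * pi / B))" by simp
      also have "\<dots> = \<kappa> * v.l" using \<kappa> unfolding v.l_def real_sqrt_mult by simp
      finally show ?thesis unfolding v.\<epsilon>_def by simp
    qed
    have en: "GL_energy \<Omega> \<kappa> (H \<kappa>) (\<psi> \<kappa>) (A \<kappa>) \<le> ennreal (C * (B * L))"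
    proof -
      have "GL_energy \<Omega> \<kappa> (H \<kappa>) (\<psi> \<kappa>) (A \<kappa>) \<le> GL_energy \<Omega> \<kappa> (H \<kappa>) v.\<psi>0 Fpot"
        using min[OF \<kappa>] v.H1_\<psi>0[OF \<Omega>(1)] Hdiv_F_Fpot unfolding GL_minimizer_def by blast
      also have "\<dots> \<le> ennreal (C * (B * L))"
        unfolding C_def L2 by (rule v.energy_upper[OF \<Omega>(2) R(2) lR e1]) (use Lge L2 B_def in auto)
      finally show ?thesis .
    qed
    have F: "(\<integral>\<^sup>+x. ennreal ((norm (weak_curl (A \<kappa>) x - beta))\<^sup>2) \<partial>lebesgue) \<le> ennreal (C * L / B)"
      using field_energy_bound[of \<kappa> "H \<kappa>" \<Omega> "\<psi> \<kappa>" "A \<kappa>" C L] en B C Lge by (simp add: B_def)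
    define N where "N = nat \<lceil>sqrt (1000 / \<eta> ^ 3 * ln (1 / sqrt b)) / sqrt b\<rceil>"
    let ?x = "sqrt (1000 / \<eta> ^ 3 * L) / sqrt b"
    have x: "0 < ?x" using \<eta> Lge b by simp
    have Nx: "N = nat \<lceil>?x\<rceil>" by (simp add: N_def L1)
    have N: "0 < N" "real N \<le> ?x + 1" unfolding Nx using x by linarith+
    have small: "(2 * real N + 2) / \<kappa> \<le> \<delta>"
    proof -
      have "(2 * real N + 2) / \<kappa> \<le> (2 * ?x + 4) / \<kappa>" using N(2) \<kappa> by (intro divide_right_mono) auto
      also have "\<dots> = 2 * (?x / \<kappa>) + 4 / \<kappa>" by (simp add: add_divide_distrib)
      also have "4 / \<kappa> \<le> \<delta> / 2" using \<kappa>\<delta> \<kappa> K(2) by (simp add: field_simps)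
      also have "?x / \<kappa> \<le> \<delta> / 4"
      proof -
        have "sqrt b * \<kappa> = sqrt B" using \<kappa> by (simp add: bb real_sqrt_divide)
        moreover have "?x / \<kappa> = sqrt (1000 / \<eta> ^ 3 * L) / (sqrt b * \<kappa>)" by simp
        ultimately have "?x / \<kappa> = sqrt (1000 / \<eta> ^ 3 * L / B)" by (simp only: real_sqrt_divide)
        also have "\<dots> \<le> \<delta> / 4"
        proof (rule real_le_lsqrt)
          have "1000 / \<eta> ^ 3 * L / B = 1000 / \<eta>^3 * (L / B)" by simp
          also have "\<dots> \<le> 1000 / \<eta>^3 * ((\<delta> / 4)\<^sup>2 * \<eta>^3 / 1000)"
            using LB \<eta> by (intro mult_left_mono) (auto simp: c1_def)
          also have "\<dots> = (\<delta> / 4)\<^sup>2" using \<eta> by simp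
          finally show "1000 / \<eta> ^ 3 * L / B \<le> (\<delta> / 4)\<^sup>2" .
        qed (use K(2) in simp)
        finally show ?thesis .
      qed
      finally show ?thesis by simp
    qed
    define \<phi> where "\<phi> = (1 - \<eta>) ^ 15 * (1 - 4 * \<eta>)"
    have \<phi>: "0 \<le> \<phi>" using \<eta> by (simp add: \<phi>_def)
    have low: "ennreal (\<phi> * L * (\<kappa> * H \<kappa>) * (measure lborel K - C * L / B / \<eta>\<^sup>2)) \<le> (\<integral>\<^sup>+x\<in>D. ennreal (GL_density \<Omega> \<kappa> (H \<kappa>) (\<psi> \<kappa>) (A \<kappa>) x) \<partial>lebesgue)"
    proof (rule lower_bound_at[OF \<eta> \<kappa> h _ _ N(1) \<Omega>(2) D(2) D(1) K(1) K(3) small _ _ F])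
      fix u :: "int \<times> int \<Rightarrow> complex" and \<alpha>
      assume "(\<Sum>g\<in>{0..int N - 2} \<times> {0..int N - 2}. (ecurl \<alpha> g - H \<kappa> / \<kappa>)\<^sup>2) \<le> (\<eta> * real N * (H \<kappa> / \<kappa>))\<^sup>2"
      from disc[OF b bs(1) N_def, of \<alpha> u] this
      show "\<phi> * L * (real N)\<^sup>2 * (H \<kappa> / \<kappa>) \<le> lattice_gl.energy u \<alpha> N"
        by (simp add: b_def[symmetric] L1 \<phi>_def mult_ac)
    qed (use min[OF \<kappa>] \<phi> Lge C B in \<open>auto simp: GL_minimizer_def\<close>)
    have "C * L / B / \<eta>\<^sup>2 \<le> \<eta>"
    proof -
      have "C * (L / B) \<le> C * (\<eta>^3 / C)" using LB C by (intro mult_left_mono) (auto simp: c1_def)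
      then have "C * L / B \<le> \<eta> * \<eta>\<^sup>2" using C by (simp add: power3_eq_cube power2_eq_square)
      then show ?thesis using \<eta> by (simp only: pos_divide_le_eq zero_less_power)
    qed
    then have "\<phi> * L * (\<kappa> * H \<kappa>) * (measure lebesgue D - 2 * \<eta>) \<le> \<phi> * L * (\<kappa> * H \<kappa>) * (measure lborel K - C * L / B / \<eta>\<^sup>2)"
      using \<phi> Lge B K(4) by (intro mult_left_mono) (auto simp: B_def)
    with low have "ennreal (\<phi> * L * (\<kappa> * H \<kappa>) * (measure lebesgue D - 2 * \<eta>)) \<le> (\<integral>\<^sup>+x\<in>D. ennreal (GL_density \<Omega> \<kappa> (H \<kappa>) (\<psi> \<kappa>) (A \<kappa>) x) \<partial>lebesgue)"
      using ennreal_leI order_trans by blast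
    then show "1 \<le> ln (sqrt (\<kappa> / H \<kappa>)) \<and> 0 < \<kappa> * H \<kappa> \<and>
      ennreal ((1 - \<eta>) ^ 15 * (1 - 4 * \<eta>) * ln (sqrt (\<kappa> / H \<kappa>)) * (\<kappa> * H \<kappa>) * (measure lebesgue D - 2 * \<eta>))
      \<le> (\<integral>\<^sup>+x\<in>D. ennreal (GL_density \<Omega> \<kappa> (H \<kappa>) (\<psi> \<kappa>) (A \<kappa>) x) \<partial>lebesgue)"
      using Lge B by (simp add: \<phi>_def L_def B_def)
  qed
qed

text \<open>The energy may be infinite, so the remainder is built from its truncation at the main term.\<close>

lemma remainder_from_eventually:
  fixes I :: "real \<Rightarrow> ennreal" and X :: "real \<Rightarrow> real"
  assumes m: "0 \<le> m" and X: "\<forall>\<^sub>F \<kappa> in F. 0 \<le> X \<kappa>"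
    and I: "\<And>c. 0 < c \<Longrightarrow> \<forall>\<^sub>F \<kappa> in F. ennreal ((m - c) * X \<kappa>) \<le> I \<kappa>"
  shows "\<exists>r. r \<in> o[F](X) \<and> (\<forall>\<^sub>F \<kappa> in F. ennreal (m * X \<kappa> + r \<kappa>) \<le> I \<kappa>)"
proof (intro exI conjI)
  define J where "J \<kappa> = min (I \<kappa>) (ennreal (m * X \<kappa>))" for \<kappa>
  let ?r = "\<lambda>\<kappa>. enn2real (J \<kappa>) - m * X \<kappa>"
  have fin: "ennreal (enn2real (J \<kappa>)) = J \<kappa>" for \<kappa>
    by (rule ennreal_enn2real) (simp add: J_def min_less_iff_disj)
  show "\<forall>\<^sub>F \<kappa> in F. ennreal (m * X \<kappa> + ?r \<kappa>) \<le> I \<kappa>"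
    by (intro always_eventually allI) (simp add: fin, simp add: J_def)
  show "?r \<in> o[F](X)"
  proof (rule landau_o.smallI)
    fix c :: real assume c: "0 < c"
    from I[OF c] X show "\<forall>\<^sub>F \<kappa> in F. norm (?r \<kappa>) \<le> c * norm (X \<kappa>)"
    proof eventually_elim
      fix \<kappa> assume h: "ennreal ((m - c) * X \<kappa>) \<le> I \<kappa>" "0 \<le> X \<kappa>"
      have "(m - c) * X \<kappa> \<le> m * X \<kappa>" using c h(2) by (intro mult_right_mono) auto
      then have "ennreal ((m - c) * X \<kappa>) \<le> ennreal (enn2real (J \<kappa>))" unfolding fin using h(1) by (simp add: J_def ennreal_leI)
      then have "(m - c) * X \<kappa> \<le> enn2real (J \<kappa>)" by (metis enn2real_nonneg ennreal_le_iff)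
      moreover have "enn2real (J \<kappa>) \<le> m * X \<kappa>" using m h(2) by (intro enn2real_leI) (auto simp: J_def)
      ultimately show "norm (?r \<kappa>) \<le> c * norm (X \<kappa>)" using h(2) by (simp add: algebra_simps)
    qed
  qed
qed

theorem theorem5p1:
  fixes \<Omega> D :: "R3 set" and H :: "real \<Rightarrow> real"
    and \<psi> :: "real \<Rightarrow> R3 \<Rightarrow> complex" and A :: "real \<Rightarrow> R3 \<Rightarrow> R3"
  assumes "bounded \<Omega>" and "smooth_bdry_open \<Omega>"
    and "D \<subseteq> \<Omega>" and "smooth_bdry_open D"
    and "\<And>\<kappa>. \<kappa> > 0 \<Longrightarrow> H \<kappa> > 0"
    and "(\<lambda>\<kappa>. ln \<kappa>) \<in> o[at_top](\<lambda>\<kappa>. \<kappa> * H \<kappa>)"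
    and "(\<lambda>\<kappa>. \<kappa> * H \<kappa>) \<in> o[at_top](\<lambda>\<kappa>. \<kappa>\<^sup>2)"
    and "\<And>\<kappa>. \<kappa> > 0 \<Longrightarrow> GL_minimizer \<Omega> \<kappa> (H \<kappa>) (\<psi> \<kappa>) (A \<kappa>)"
  shows "\<exists>r. r \<in> o[at_top](\<lambda>\<kappa>. \<kappa> * H \<kappa> * ln (sqrt (\<kappa> / H \<kappa>))) \<and>
    (\<forall>\<^sub>F \<kappa> in at_top.
       (\<integral>\<^sup>+x\<in>D. ennreal (GL_density \<Omega> \<kappa> (H \<kappa>) (\<psi> \<kappa>) (A \<kappa>) x) \<partial>lebesgue)
         \<ge> ennreal (measure lebesgue D * \<kappa> * H \<kappa> * ln (sqrt (\<kappa> / H \<kappa>)) + r \<kappa>))"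
proof -
  let ?X = "\<lambda>\<kappa>. \<kappa> * H \<kappa> * ln (sqrt (\<kappa> / H \<kappa>))"
  let ?I = "\<lambda>\<kappa>. \<integral>\<^sup>+x\<in>D. ennreal (GL_density \<Omega> \<kappa> (H \<kappa>) (\<psi> \<kappa>) (A \<kappa>) x) \<partial>lebesgue"
  let ?m = "measure lebesgue D"
  have op: "open \<Omega>" "open D" using assms(2,4) by (auto simp: smooth_bdry_open_def)
  have low: "\<forall>\<^sub>F \<kappa> in at_top. 1 \<le> ln (sqrt (\<kappa> / H \<kappa>)) \<and> 0 < \<kappa> * H \<kappa> \<and>
      ennreal ((1 - \<eta>) ^ 15 * (1 - 4 * \<eta>) * ln (sqrt (\<kappa> / H \<kappa>)) * (\<kappa> * H \<kappa>) * (?m - 2 * \<eta>)) \<le> ?I \<kappa>"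
    if "0 < \<eta>" "\<eta> \<le> 1/4" for \<eta>
    by (rule lower_bound_eventually) (use assms op that in auto)
  have X: "\<forall>\<^sub>F \<kappa> in at_top. 0 \<le> ?X \<kappa>"
    using low[of "1/4", simplified] by eventually_elim (rule mult_nonneg_nonneg; linarith)
  have "\<forall>\<^sub>F \<kappa> in at_top. ennreal ((?m - c) * ?X \<kappa>) \<le> ?I \<kappa>" if c: "0 < c" for c
  proof -
    \<comment> \<open>All losses are continuous in \<open>\<eta>\<close> and vanish at 0, so some
      admissible \<open>\<eta>\<close> keeps them below the prescribed \<open>c\<close>.\<close>
    have "((\<lambda>\<eta>. (1 - \<eta>) ^ 15 * (1 - 4 * \<eta>) * (?m - 2 * \<eta>)) \<longlongrightarrow> (1 - 0) ^ 15 * (1 - 4 * 0) * (?m - 2 * 0)) (at_right 0)"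
      by (intro tendsto_intros)
    then have "\<forall>\<^sub>F \<eta> in at_right 0. ?m - c < (1 - \<eta>) ^ 15 * (1 - 4 * \<eta>) * (?m - 2 * \<eta>)"
      using c by (intro order_tendstoD) auto
    moreover have "\<forall>\<^sub>F \<eta>::real in at_right 0. \<eta> \<in> {0<..<1/4}" by (rule eventually_at_right_real) simp
    ultimately have "\<forall>\<^sub>F \<eta> in at_right 0. ?m - c < (1 - \<eta>) ^ 15 * (1 - 4 * \<eta>) * (?m - 2 * \<eta>) \<and> \<eta> \<in> {0<..<1/4}"
      by (rule eventually_conj)
    then obtain \<eta> where \<eta>: "?m - c < (1 - \<eta>) ^ 15 * (1 - 4 * \<eta>) * (?m - 2 * \<eta>)" "0 < \<eta>" "\<eta> < 1/4"
      using eventually_happens[of _ "at_right (0::real)"] by auto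
    from \<eta> have "\<eta> \<le> 1/4" by simp
    from low[OF \<eta>(2) this] X show ?thesis
    proof eventually_elim
      case (elim \<kappa>)
      have "(?m - c) * ?X \<kappa> \<le> ((1 - \<eta>) ^ 15 * (1 - 4 * \<eta>) * (?m - 2 * \<eta>)) * ?X \<kappa>"
        using \<eta>(1) elim by (intro mult_right_mono) auto
      also have "\<dots> = (1 - \<eta>) ^ 15 * (1 - 4 * \<eta>) * ln (sqrt (\<kappa> / H \<kappa>)) * (\<kappa> * H \<kappa>) * (?m - 2 * \<eta>)" by (simp add: mult_ac)
      finally show ?case using elim ennreal_leI order_trans by blast
    qed
  qed
  from remainder_from_eventually[OF _ X this] show ?thesis by (simp add: mult.assoc)
qed

end
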